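(* Let $E\subset\mathbb{C}$ be a compact set of positive logarithmic capacity, let $\Omega$ be the unbounded component of $\overline{\mathbb{C}}\setminus E$, and let $\mathcal{E}:=\overline{\mathbb{C}}\setminus\Omega$ denote the polynomial convex hull of $E$. Assume there is a closed set $E_0\subset\mathcal{E}$ with the following three properties: (i) $\mathrm{cap}(E_0)>0$; (ii) either $E_0=\mathcal{E}$ or $\mathrm{dist}(E_0,\mathcal{E}\setminus E_0)>0$; (iii) either the interior $\mathrm{int}(E_0)$ of $E_0$ is empty or the boundary of each open component of $\mathrm{int}(E_0)$ contains an NCS point (of that component). Let $V$ be an open set containing $E_0$ such that $\mathrm{dist}(V,\mathcal{E}\setminus E_0)>0$ if $E_0\neq\mathcal{E}$. Then for any asymptotically extremal sequence of monic polynomials $\{P_n\}_{n\in\mathcal{N}}$ for $E$, $$\nu_{P_n}|_{V}\ \stackrel{*}{\longrightarrow}\ \mu_E|_{E_0},\qquad n\to\infty,\ n\in\mathcal{N},$$ where $\mu|_K$ denotes the restriction of a measure $\mu$ to the set $K$.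
   Context: $\mathrm{cap}$ denotes logarithmic capacity. $\mu_E$ is the equilibrium measure of $E$: the Borel probability measure on $E$ minimizing the logarithmic energy $\iint\log\frac{1}{|z-t|}\,d\mu(z)\,d\mu(t)$. For a polynomial $p_n$ of degree $n$, $\nu_{p_n}:=\frac1n\sum_{p_n(z)=0}\delta_z$ is the normalized counting measure of its zeros (counted with multiplicity), where $\delta_z$ is the unit point mass at $z$. Asymptotically extremal: $\mathcal{N}$ denotes an increasing sequence of positive integers. A sequence of monic polynomials $\{P_n\}_{n\in\mathcal{N}}$, with $\deg P_n=n$, is asymptotically extremal on (for) $E$ if $\limsup_{n\to\infty,\,n\in\mathcal{N}}\|P_n\|_E^{1/n}\le\mathrm{cap}(E)$, where $\|\cdot\|_E$ is the uniform norm on $E$. Weak* convergence: $\lambda_n\stackrel{*}{\to}\lambda$ means $\int f\,d\lambda_n\to\int f\,d\lambda$ for every continuous $f$ with compact support in $\mathbb{C}$. NCS point: Let $G$ be a bounded simply connected domain in $\mathbb{C}$, and let $g_G(z,\zeta)$ denote its Green function with pole at $\zeta\in G$. A point $z_0\in\partial G$ is a non-convex type singularity (NCS point) of $G$ if: (i) there exists a closed disk $\overline{D}$ with $z_0$ on its circumference such that $\overline{D}$ is contained in $G$ except for the point $z_0$; and (ii) there exists a line segment $L$ connecting a point $\zeta_0$ in the interior of $\overline{D}$ to $z_0$ such that $\lim_{z\to z_0,\,z\in L}\frac{g_G(z,\zeta_0)}{|z-z_0|}=+\infty$. (Under condition (ii) of the theorem, every component of $\mathrm{int}(E_0)$ is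 simply connected.) *)

theory Defs
  imports "HOL-Probability.Probability" "HOL-Computational_Algebra.Polynomial"
begin

section \<open>Logarithmic energy, capacity, equilibrium measure\<close>

definition log_kernel :: "complex \<Rightarrow> complex \<Rightarrow> ereal" where
  "log_kernel z t = (if z = t then \<infinity> else ereal (ln (1 / cmod (z - t))))"

text \<open>The double integral of the kernel, as positive part minus negative part
  (\<open>e2ennreal\<close> sends negative values to 0). For a finite measure carried by a bounded set
  the negative part is finite, so the difference is meaningful with values in
  \<open>(-\<infinity>, \<infinity>]\<close>; it is used only for such measures.\<close>

definition log_energy :: "complex measure \<Rightarrow> ereal" where
  "log_energy M =
     enn2ereal (\<integral>\<^sup>+ z. (\<integral>\<^sup>+ t. e2ennreal (log_kernel z t) \<partial>M) \<partial>M) -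
     enn2ereal (\<integral>\<^sup>+ z. (\<integral>\<^sup>+ t. e2ennreal (- log_kernel z t) \<partial>M) \<partial>M)"

definition prob_measures_on :: "complex set \<Rightarrow> complex measure set" where
  "prob_measures_on K = {M. sets M = sets borel \<and> prob_space M \<and> emeasure M K = 1}"

definition robin_constant :: "complex set \<Rightarrow> ereal" where
  "robin_constant K = (INF M \<in> prob_measures_on K. log_energy M)"

text \<open>Logarithmic capacity of a compact set. For compact \<open>K\<close> the Robin constant lies in
  \<open>(-\<infinity>, \<infinity>]\<close>; the value \<open>\<infinity>\<close> (in particular \<open>K = {}\<close>) gives capacity 0.\<close>

definition log_capacity :: "complex set \<Rightarrow> real" where
  "log_capacity K =
     (if robin_constant K = \<infinity> then 0 else exp (- real_of_ereal (robin_constant K)))"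

definition is_equilibrium_measure :: "complex set \<Rightarrow> complex measure \<Rightarrow> bool" where
  "is_equilibrium_measure K M \<longleftrightarrow>
     M \<in> prob_measures_on K \<and> (\<forall>M' \<in> prob_measures_on K. log_energy M \<le> log_energy M')"

text \<open>\<open>outside K\<close> is the union of the unbounded components of the complement of \<open>K\<close> in the
  plane. For compact \<open>K\<close> there is exactly one, and adding the point at infinity to it gives the
  component \<open>\<Omega>\<close> of the complement of \<open>K\<close> in the Riemann sphere that contains infinity.\<close>

definition poly_convex_hull :: "complex set \<Rightarrow> complex set" where
  "poly_convex_hull K = - outside K"


section \<open>Green functions and NCS points\<close>

definition harmonic_on :: "(complex \<Rightarrow> real) \<Rightarrow> complex set \<Rightarrow> bool" where
  "harmonic_on u S \<longleftrightarrow> open S \<and>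
     (\<exists>ux uy uxx uxy uyx uyy :: complex \<Rightarrow> real.
        continuous_on S uxx \<and> continuous_on S uxy \<and> continuous_on S uyx \<and> continuous_on S uyy \<and>
        (\<forall>z\<in>S. (u has_derivative (\<lambda>h. ux z * Re h + uy z * Im h)) (at z) \<and>
               (ux has_derivative (\<lambda>h. uxx z * Re h + uxy z * Im h)) (at z) \<and>
               (uy has_derivative (\<lambda>h. uyx z * Re h + uyy z * Im h)) (at z) \<and>
               uxx z + uyy z = 0))"

text \<open>The Green function with pole \<open>\<zeta>\<close> of a bounded domain all of whose boundary points are
  regular, as is the case for every bounded simply connected domain. By the maximum principle
  its values on \<open>G - {\<zeta>}\<close> are determined by these conditions; its value at the pole (\<open>\<infinity>\<close> in the
  usual convention) and its values off \<open>G\<close> are left unspecified.\<close>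

definition is_green_function :: "complex set \<Rightarrow> complex \<Rightarrow> (complex \<Rightarrow> real) \<Rightarrow> bool" where
  "is_green_function G \<zeta> g \<longleftrightarrow>
     \<zeta> \<in> G \<and>
     harmonic_on g (G - {\<zeta>}) \<and>
     (\<exists>h. harmonic_on h G \<and> (\<forall>z \<in> G - {\<zeta>}. h z = g z - ln (1 / cmod (z - \<zeta>)))) \<and>
     (\<forall>w \<in> frontier G. (g \<longlongrightarrow> 0) (at w within G))"

definition ncs_point :: "complex set \<Rightarrow> complex \<Rightarrow> bool" where
  "ncs_point G z0 \<longleftrightarrow> z0 \<in> frontier G \<and>
     (\<exists>c r. r > 0 \<and> z0 \<in> sphere c r \<and> cball c r - {z0} \<subseteq> G \<and>
        (\<exists>\<zeta>0 \<in> ball c r. \<exists>g. is_green_function G \<zeta>0 g \<and>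
           filterlim (\<lambda>z. g z / cmod (z - z0)) at_top (at z0 within closed_segment \<zeta>0 z0)))"


section \<open>Zeros of polynomials and weak* convergence\<close>

text \<open>\<open>order z p\<close> is the multiplicity of \<open>z\<close> as a zero of \<open>p\<close> (0 if \<open>z\<close> is not a zero), so each
  zero carries the mass multiplicity / degree. The image under the identity turns the discrete
  measure, defined on all subsets, into a Borel measure.\<close>

definition zero_measure :: "complex poly \<Rightarrow> complex measure" where
  "zero_measure p =
     distr (density (count_space UNIV) (\<lambda>z. ennreal (real (order z p) / real (degree p))))
       borel (\<lambda>z. z)"

text \<open>The index sequence \<open>n \<in> \<N>\<close> is enumerated by a strictly increasing \<open>N :: nat \<Rightarrow> nat\<close>.\<close>

definition asymptotically_extremal ::
    "complex set \<Rightarrow> (nat \<Rightarrow> nat) \<Rightarrow> (nat \<Rightarrow> complex poly) \<Rightarrow> bool" where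
  "asymptotically_extremal K N P \<longleftrightarrow>
     strict_mono N \<and> (\<forall>k. N k > 0) \<and>
     (\<forall>k. degree (P (N k)) = N k \<and> lead_coeff (P (N k)) = 1) \<and>
     limsup (\<lambda>k. ereal (root (N k) (SUP z\<in>K. cmod (poly (P (N k)) z)))) \<le> ereal (log_capacity K)"

text \<open>The restriction \<open>A \<mapsto> M (A \<inter> K)\<close>, kept as a measure on the whole plane.\<close>

definition measure_restriction :: "complex measure \<Rightarrow> complex set \<Rightarrow> complex measure" where
  "measure_restriction M K = density M (indicator K)"

definition weak_star_conv :: "(nat \<Rightarrow> complex measure) \<Rightarrow> complex measure \<Rightarrow> bool" where
  "weak_star_conv \<mu> M \<longleftrightarrow>
     (\<forall>f :: complex \<Rightarrow> real. continuous_on UNIV f \<longrightarrow> compact (closure {z. f z \<noteq> 0}) \<longrightarrow>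
        (\<lambda>k. integral\<^sup>L (\<mu> k) f) \<longlonglongrightarrow> integral\<^sup>L M f)"

end

theory Submission imports Defs "HOL-Complex_Analysis.Complex_Analysis"
  "HOL-Computational_Algebra.Fundamental_Theorem_Algebra"
begin

text \<open>
  Write \<open>M\<close> for the equilibrium measure, \<open>u = pot M\<close> for its logarithmic potential, \<open>rob\<close> for the
  Robin constant, \<open>H\<close> for the polynomial convex hull of \<open>E\<close> and \<open>Out\<close> for its complement.
  Frostman's theorem gives \<open>u \<le> rob\<close> everywhere, so \<open>g = rob - u\<close> is nonnegative.  For a monic
  polynomial of degree \<open>n\<close> let \<open>q = - ln \<bar>p\<bar> / n\<close>, the potential of the zero counting measure, and
  let \<open>eps = ln \<parallel>p\<parallel> / n + rob\<close>.  Asymptotic extremality says that \<open>eps\<close>, which is never negative,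
  tends to 0.  The whole proof is about the excess \<open>d = q - u + eps\<close>, which is nonnegative by the
  Bernstein-Walsh inequality (\<open>bernstein_walsh\<close>).  Taking Laplacians, convergence \<open>d \<rightarrow> 0\<close> in \<open>L\<^sup>1\<close>
  near a point forces the zero counting measures to converge to \<open>M\<close> there.  It therefore suffices
  to show that the integrals of \<open>d\<close> tend to 0 on the compact subsets of the open set
  \<open>- (H - E0)\<close>, and that few zeros stay away from \<open>H\<close>.

  In the outer domain \<open>d\<close> is superharmonic, and its mean over an annulus surrounding \<open>E\<close> is at
  most \<open>eps\<close>, because there the means of \<open>u\<close> are as if all mass sat at the centre and those of \<open>q\<close>
  are not larger (\<open>excess_annulus\<close>).  A Harnack-type chain of discs (\<open>superharmonic_chain\<close>) carries
  the smallness to every point of \<open>Out\<close>.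

  At a point \<open>w\<close> in the closure of \<open>Out\<close> there are nearby points at which \<open>d\<close> is small.  As \<open>q\<close> is
  superharmonic and \<open>u \<le> rob\<close>, the integral of \<open>d\<close> over a disc about such a point is at most the
  integral of \<open>g\<close> plus a small error (\<open>near_boundary\<close>).

  In a component \<open>G\<close> of the interior of \<open>E0\<close> one has \<open>u = rob\<close>, so \<open>d = q - rob + eps\<close> is
  superharmonic there.  If its integral near some point of \<open>G\<close> failed to tend to 0, then
  for infinitely many indices \<open>d\<close> would be bounded below near the pole of the Green function of
  \<open>G\<close>, hence would dominate a fixed multiple of that Green function (\<open>green_minorant\<close>).  At an NCS
  point \<open>z0\<close> the Green function at distance \<open>\<rho>\<close> on the segment exceeds any multiple of \<open>\<rho>\<close>, so the
  integral of \<open>d\<close> over a disc of radius comparable to \<open>\<rho>\<close> exceeds any multiple of \<open>\<rho>\<^sup>3\<close>.  But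
  \<open>g\<close> is \<open>O(\<rho>)\<close> near \<open>z0\<close>, because \<open>g = 0\<close> on a disc touching \<open>z0\<close> (\<open>disc_green_bound\<close>), and so
  \<open>near_boundary\<close> bounds the same integral by a multiple of \<open>\<rho>\<^sup>3\<close> (\<open>ncs_vanish\<close>).

  The boundary of \<open>H\<close> may have positive area.  Almost everywhere on it \<open>g = 0\<close>, and \<open>g\<close> is upper
  semicontinuous, so \<open>near_boundary\<close> shows that the upper limits of the averages of \<open>d\<close> over discs of
  radius \<open>\<rho>\<close> tend to 0 as \<open>\<rho> \<rightarrow> 0\<close>.  Reverse Fatou in the index and dominated convergence in \<open>\<rho>\<close>
  complete the \<open>L\<^sup>1\<close> statement (\<open>vanish_of_local\<close>).

  That \<open>u = rob\<close> almost everywhere on all of \<open>H\<close>, although \<open>M\<close> only minimizes the energy among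
  measures on \<open>E\<close>, is obtained from the polynomials themselves: integrating \<open>ln \<bar>p\<bar> / n\<close> against a
  measure on \<open>H\<close> with bounded potential gives a lower bound for its energy
  (\<open>hull_energy_minimal\<close>).  Finally, zeros away from \<open>H\<close> carry little mass because the mean of \<open>g\<close>
  over the zeros is at most \<open>eps\<close> (\<open>sum_green_le\<close>), and \<open>g\<close> is bounded below there.
\<close>


section \<open>Rotation invariance of plane Lebesgue measure\<close>

lemma nn_integral_lborel_complex:
  fixes f :: "complex \<Rightarrow> ennreal"
  assumes [measurable]: "f \<in> borel_measurable borel"
  shows "(\<integral>\<^sup>+ z. f z \<partial>lborel) = (\<integral>\<^sup>+ y. (\<integral>\<^sup>+ x. f (Complex x y) \<partial>lborel) \<partial>lborel)"
proof -
  have meas: "(\<lambda>(x,y). Complex x y) \<in> borel_measurable (borel \<Otimes>\<^sub>M borel)"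
    unfolding borel_prod
    by (intro borel_measurable_continuous_onI) (auto simp: case_prod_beta Complex_eq intro!: continuous_intros)
  have "lborel = distr (lborel \<Otimes>\<^sub>M lborel) borel (\<lambda>(x,y). Complex x y)"
  proof (rule lborel_eqI)
    fix l u :: complex
    assume le: "\<And>b. b \<in> Basis \<Longrightarrow> l \<bullet> b \<le> u \<bullet> b"
    have le': "Re l \<le> Re u" "Im l \<le> Im u"
      using le[of 1] le[of \<i>] by (auto simp: Basis_complex_def)
    have vim: "(\<lambda>(x,y). Complex x y) -` box l u = {Re l<..<Re u} \<times> {Im l<..<Im u}"
      by (auto simp: box_def Basis_complex_def)
    have "emeasure (distr (lborel \<Otimes>\<^sub>M lborel) borel (\<lambda>(x,y). Complex x y)) (box l u)
        = emeasure (lborel \<Otimes>\<^sub>M lborel) ({Re l<..<Re u} \<times> {Im l<..<Im u})"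
      using meas by (subst emeasure_distr) (auto simp: vim space_pair_measure measurable_lborel1 cong: measurable_cong_sets)
    also have "\<dots> = ennreal (Re u - Re l) * ennreal (Im u - Im l)"
      using le' by (subst lborel.emeasure_pair_measure_Times) auto
    also have "\<dots> = ennreal (prod ((\<bullet>) (u - l)) Basis)"
      using le' by (simp add: Basis_complex_def ennreal_mult)
    finally show "emeasure (distr (lborel \<Otimes>\<^sub>M lborel) borel (\<lambda>(x,y). Complex x y)) (box l u)
        = ennreal (prod ((\<bullet>) (u - l)) Basis)" .
  qed simp
  then have "(\<integral>\<^sup>+ z. f z \<partial>lborel) = (\<integral>\<^sup>+ z. f z \<partial>distr (lborel \<Otimes>\<^sub>M lborel) borel (\<lambda>(x,y). Complex x y))"
    by simp
  also have "\<dots> = (\<integral>\<^sup>+ p. f (case p of (x,y) \<Rightarrow> Complex x y) \<partial>(lborel \<Otimes>\<^sub>M lborel))"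
    using meas by (subst nn_integral_distr) (auto cong: measurable_cong_sets)
  also have "\<dots> = (\<integral>\<^sup>+ y. (\<integral>\<^sup>+ x. f (Complex x y) \<partial>lborel) \<partial>lborel)"
    using meas by (subst lborel_pair.nn_integral_snd[symmetric]) (auto simp: case_prod_beta cong: measurable_cong_sets)
  finally show ?thesis .
qed

lemma complex_measurable_Complex [measurable]:
  assumes "f \<in> borel_measurable M" "g \<in> borel_measurable M"
  shows "(\<lambda>x. Complex (f x) (g x)) \<in> borel_measurable M"
proof -
  have "(\<lambda>x. of_real (f x) + \<i> * of_real (g x)) \<in> borel_measurable M"
    using assms by (intro borel_measurable_add borel_measurable_times borel_measurable_of_real) auto
  then show ?thesis by (simp add: Complex_eq)
qed

lemma nn_integral_shear_x:
  fixes f :: "complex \<Rightarrow> ennreal"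
  assumes [measurable]: "f \<in> borel_measurable borel"
  shows "(\<integral>\<^sup>+ z. f (Complex (Re z + s * Im z) (Im z)) \<partial>lborel) = (\<integral>\<^sup>+ z. f z \<partial>lborel)"
proof -
  have "(\<integral>\<^sup>+ x. f (Complex (x + s * y) y) \<partial>lborel) = (\<integral>\<^sup>+ x. f (Complex x y) \<partial>lborel)" for y
    using nn_integral_real_affine[of "\<lambda>x. f (Complex x y)" 1 "s * y"] by (simp add: add.commute)
  then show ?thesis
    by (subst (1 2) nn_integral_lborel_complex) auto
qed

lemma nn_integral_shear_y:
  fixes f :: "complex \<Rightarrow> ennreal"
  assumes [measurable]: "f \<in> borel_measurable borel"
  shows "(\<integral>\<^sup>+ z. f (Complex (Re z) (Im z + s * Re z)) \<partial>lborel) = (\<integral>\<^sup>+ z. f z \<partial>lborel)"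
proof -
  have "(\<integral>\<^sup>+ y. f (Complex x (y + s * x)) \<partial>lborel) = (\<integral>\<^sup>+ y. f (Complex x y) \<partial>lborel)" for x
    using nn_integral_real_affine[of "\<lambda>y. f (Complex x y)" 1 "s * x"] by (simp add: add.commute)
  moreover have "(\<integral>\<^sup>+ z. h z \<partial>lborel) = (\<integral>\<^sup>+ x. (\<integral>\<^sup>+ y. h (Complex x y) \<partial>lborel) \<partial>lborel)"
    if [measurable]: "h \<in> borel_measurable borel" for h :: "complex \<Rightarrow> ennreal"
    by (subst nn_integral_lborel_complex) (auto intro!: lborel_pair.Fubini' simp: case_prod_beta)
  ultimately show ?thesis
    by simp
qed

text \<open>
  A rotation is a product of three shears, which preserve area by Fubini; the angle \<open>\<pi>\<close>, where
  this factorization breaks down, is handled as the square of a quarter turn.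
\<close>

lemma nn_integral_rotation:
  fixes f :: "complex \<Rightarrow> ennreal"
  assumes f [measurable]: "f \<in> borel_measurable borel" and c: "cmod c = 1"
  shows "(\<integral>\<^sup>+ z. f (c * z) \<partial>lborel) = (\<integral>\<^sup>+ z. f z \<partial>lborel)"
proof -
  have *: "(\<integral>\<^sup>+ z. h (d * z) \<partial>lborel) = (\<integral>\<^sup>+ z. h z \<partial>lborel)"
    if h [measurable]: "h \<in> borel_measurable borel" and d: "cmod d = 1" "d \<noteq> -1"
    for h :: "complex \<Rightarrow> ennreal" and d
  proof -
    define a where "a = Re d"
    define b where "b = Im d"
    \<comment> \<open>tangent of half the rotation angle, the parameter of the shears\<close>
    define t where "t = b / (1 + a)"
    have ab: "a^2 + b^2 = 1"
      using d(1) by (simp add: a_def b_def cmod_def real_sqrt_eq_1_iff)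
    have "a \<noteq> -1"
      using ab d(2) by (auto simp: a_def b_def complex_eq_iff power2_eq_square)
    then have a: "1 + a \<noteq> 0" by simp
    have t: "t * (1 + a) = b" using a by (simp add: t_def)
    have "t * b * (1 + a) = (1 - a) * (1 + a)"
      using t ab by (simp add: algebra_simps power2_eq_square)
    then have tb: "t * b = 1 - a" using a by simp
    have eq: "d * z = Complex ((Re z + (-t) * Im z) + (-t) * (Im z + b * (Re z + (-t) * Im z)))
                (Im z + b * (Re z + (-t) * Im z))" for z
    proof -
      have 1: "Im z + b * (Re z + (-t) * Im z) = a * Im z + b * Re z"
      proof -
        have "b * (t * Im z) = Im z - a * Im z"
          using tb by (metis left_diff_distrib mult.assoc mult.commute mult_1)
        then show ?thesis by (simp add: algebra_simps)
      qed
      have "t * (a * Im z) + t * Im z = b * Im z"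
        using t by (metis add.commute distrib_left distrib_right mult.assoc mult.commute mult_1)
      moreover have "t * (b * Re z) = Re z - a * Re z"
        using tb by (metis left_diff_distrib mult.assoc mult_1)
      ultimately have 2: "(Re z + (-t) * Im z) + (-t) * (a * Im z + b * Re z) = a * Re z - b * Im z"
        by (simp add: algebra_simps)
      show ?thesis
        unfolding 1 2 by (simp add: complex_eq_iff a_def b_def)
    qed
    have "(\<integral>\<^sup>+ z. h (d * z) \<partial>lborel)
      = (\<integral>\<^sup>+ z. (\<lambda>z. h (Complex (Re z + (-t) * (Im z + b * Re z)) (Im z + b * Re z))) (Complex (Re z + (-t) * Im z) (Im z)) \<partial>lborel)"
      by (simp only: eq complex.sel)
    also have "\<dots> = (\<integral>\<^sup>+ z. h (Complex (Re z + (-t) * (Im z + b * Re z)) (Im z + b * Re z)) \<partial>lborel)"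
      by (rule nn_integral_shear_x) measurable
    also have "\<dots> = (\<integral>\<^sup>+ z. (\<lambda>z. h (Complex (Re z + (-t) * Im z) (Im z))) (Complex (Re z) (Im z + b * Re z)) \<partial>lborel)"
      by simp
    also have "\<dots> = (\<integral>\<^sup>+ z. h (Complex (Re z + (-t) * Im z) (Im z)) \<partial>lborel)"
      by (rule nn_integral_shear_y) measurable
    also have "\<dots> = (\<integral>\<^sup>+ z. h z \<partial>lborel)"
      by (rule nn_integral_shear_x) measurable
    finally show ?thesis .
  qed
  show ?thesis
  proof (cases "c = -1")
    case True
    have "(\<integral>\<^sup>+ z. f (c * z) \<partial>lborel) = (\<integral>\<^sup>+ z. (\<lambda>z. f (\<i> * z)) (\<i> * z) \<partial>lborel)"
      using True by (simp add: mult.assoc[symmetric])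
    also have "\<dots> = (\<integral>\<^sup>+ z. f (\<i> * z) \<partial>lborel)"
      by (rule *) (auto simp: complex_eq_iff)
    also have "\<dots> = (\<integral>\<^sup>+ z. f z \<partial>lborel)"
      by (rule *) (auto simp: complex_eq_iff)
    finally show ?thesis .
  next
    case False
    then show ?thesis using * f c by blast
  qed
qed

abbreviation "unit_pt \<theta> \<equiv> exp (2 * of_real pi * \<i> * of_real \<theta>)"

lemma cmod_unit_pt: "cmod (unit_pt \<theta>) = 1"
  by (simp add: norm_exp_eq_Re)

text \<open>
  Averaging the rotation invariance over all angles replaces an integrand by its circle means.
\<close>

lemma nn_integral_radial_average:
  fixes f :: "complex \<Rightarrow> ennreal"
  assumes f [measurable]: "f \<in> borel_measurable borel" and S [measurable]: "S \<in> sets borel"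
    and rad: "\<And>z c. cmod c = 1 \<Longrightarrow> c * z \<in> S \<longleftrightarrow> z \<in> S"
  shows "(\<integral>\<^sup>+ z\<in>S. f z \<partial>lborel)
       = (\<integral>\<^sup>+ z\<in>S. (\<integral>\<^sup>+ \<theta>\<in>{0..1::real}. f (unit_pt \<theta> * z) \<partial>lborel) \<partial>lborel)"
proof -
  have [measurable]: "(\<lambda>\<theta>::real. unit_pt \<theta>) \<in> borel_measurable borel"
    by (intro borel_measurable_continuous_onI continuous_intros)
  have "(\<integral>\<^sup>+ z\<in>S. f z \<partial>lborel) = (\<integral>\<^sup>+ \<theta>\<in>{0..1::real}. (\<integral>\<^sup>+ z\<in>S. f z \<partial>lborel) \<partial>lborel)"
    by (subst nn_integral_cmult_indicator) auto
  also have "\<dots> = (\<integral>\<^sup>+ \<theta>. (\<integral>\<^sup>+ z. f (unit_pt \<theta> * z) * indicator S z * indicator {0..1} \<theta> \<partial>lborel) \<partial>lborel)"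
  proof (intro nn_integral_cong)
    fix \<theta> :: real
    have "(\<integral>\<^sup>+ z\<in>S. f z \<partial>lborel) = (\<integral>\<^sup>+ z. f (unit_pt \<theta> * z) * indicator S (unit_pt \<theta> * z) \<partial>lborel)"
      by (rule nn_integral_rotation[symmetric]) (auto simp: cmod_unit_pt)
    also have "\<dots> = (\<integral>\<^sup>+ z. f (unit_pt \<theta> * z) * indicator S z \<partial>lborel)"
      by (intro nn_integral_cong) (simp add: indicator_def rad cmod_unit_pt)
    finally show "(\<integral>\<^sup>+ z\<in>S. f z \<partial>lborel) * indicator {0..1} \<theta>
        = (\<integral>\<^sup>+ z. f (unit_pt \<theta> * z) * indicator S z * indicator {0..1} \<theta> \<partial>lborel)"
      by (simp add: nn_integral_multc)
  qed
  also have "\<dots> = (\<integral>\<^sup>+ z. (\<integral>\<^sup>+ \<theta>. f (unit_pt \<theta> * z) * indicator S z * indicator {0..1} \<theta> \<partial>lborel) \<partial>lborel)"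
    by (rule lborel_pair.Fubini'[symmetric]) (simp add: case_prod_beta)
  also have "\<dots> = (\<integral>\<^sup>+ z\<in>S. (\<integral>\<^sup>+ \<theta>\<in>{0..1::real}. f (unit_pt \<theta> * z) \<partial>lborel) \<partial>lborel)"
    by (intro nn_integral_cong) (auto simp: indicator_def)
  finally show ?thesis .
qed

section \<open>Circle means of the logarithmic kernel\<close>

lemma circle_mean_holomorphic:
  assumes "h holomorphic_on cball 0 1"
  shows "((\<lambda>\<theta>::real. h (unit_pt \<theta>)) has_integral h 0) {0..1}"
proof -
  have "((\<lambda>u. h u / (u - 0)) has_contour_integral (2 * of_real pi * \<i> * h 0)) (circlepath 0 1)"
    using assms by (intro Cauchy_integral_circlepath_simple) auto
  then have "((\<lambda>x. h (unit_pt x) / unit_pt x * (2 * of_real pi * \<i> * unit_pt x))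
      has_integral (2 * of_real pi * \<i> * h 0)) {0..1}"
    unfolding has_contour_integral vector_derivative_at[OF has_vector_derivative_circlepath]
    unfolding circlepath by simp
  then have "((\<lambda>x. (2 * of_real pi * \<i>) * h (unit_pt x)) has_integral (2 * of_real pi * \<i> * h 0)) {0..1}"
    by (rule has_integral_eq[rotated]) (simp add: field_simps)
  from has_integral_mult_right[OF this, of "inverse (2 * of_real pi * \<i>)"]
  show ?thesis by (simp add: field_simps)
qed

text \<open>
  Up to the constant \<open>ln \<bar>t\<bar>\<close> the integrand is the real part of \<open>Ln (1 - w s / t)\<close> on the unit
  circle, and \<open>1 - w s / t\<close> stays in the right half plane for \<open>\<bar>w\<bar> \<le> 1\<close>.
\<close>

lemma circle_mean_ln_less:
  assumes "cmod s < cmod t"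
  shows "((\<lambda>\<theta>::real. ln (cmod (unit_pt \<theta> * s - t))) has_integral ln (cmod t)) {0..1}"
proof -
  have t: "t \<noteq> 0" using assms by auto
  have lt: "cmod (w * s / t) < 1" if "cmod w \<le> 1" for w
  proof -
    have "cmod w * cmod s < cmod t" using assms that mult_right_mono[OF that, of "cmod s"] by auto
    then show ?thesis using t by (simp add: norm_mult norm_divide)
  qed
  have rep: "Re (1 - w * s / t) > 0" if "cmod w \<le> 1" for w
    using lt[OF that] complex_Re_le_cmod[of "w * s / t"] by simp
  have nz: "1 - w * s / t \<noteq> 0" if "cmod w \<le> 1" for w
    using rep[OF that] by auto
  define h where "h = (\<lambda>w. Ln (1 - w * s / t))"
  have "h holomorphic_on cball 0 1"
    unfolding h_def using rep t
    by (intro holomorphic_intros) (auto simp: complex_nonpos_Reals_iff dest!: rep)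
  from circle_mean_holomorphic[OF this]
  have "((\<lambda>\<theta>::real. Re (h (unit_pt \<theta>))) has_integral Re (h 0)) {0..1}"
    by (rule has_integral_Re)
  then have "((\<lambda>\<theta>::real. Re (h (unit_pt \<theta>)) + ln (cmod t)) has_integral (0 + ln (cmod t))) {0..1}"
    using has_integral_const_real[of "ln (cmod t)" 0 1] by (intro has_integral_add) (auto simp: h_def)
  moreover have "Re (h (unit_pt \<theta>)) + ln (cmod t) = ln (cmod (unit_pt \<theta> * s - t))" for \<theta>
  proof -
    have "1 - unit_pt \<theta> * s / t \<noteq> 0" by (rule nz) (simp add: cmod_unit_pt)
    then have "Re (h (unit_pt \<theta>)) + ln (cmod t) = ln (cmod (1 - unit_pt \<theta> * s / t) * cmod t)"
      using t unfolding h_def by (simp add: ln_mult)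
    also have "cmod (1 - unit_pt \<theta> * s / t) * cmod t = cmod (t - unit_pt \<theta> * s)"
      using t by (simp add: norm_mult[symmetric] left_diff_distrib)
    finally show ?thesis by (simp add: norm_minus_commute)
  qed
  ultimately show ?thesis by simp
qed

text \<open>
  The case \<open>\<bar>s\<bar> > \<bar>t\<bar>\<close> reduces to the previous one, because conjugation and a rotation exchange
  the roles of \<open>s\<close> and \<open>t\<close>.
\<close>

lemma circle_mean_ln:
  assumes "cmod s \<noteq> cmod t"
  shows "((\<lambda>\<theta>::real. ln (cmod (unit_pt \<theta> * s - t))) has_integral ln (max (cmod s) (cmod t))) {0..1}"
proof (cases "cmod s < cmod t")
  case True
  then show ?thesis using circle_mean_ln_less[OF True] by (simp add: max_def)
next
  case False
  then have lt: "cmod (cnj t) < cmod (cnj s)" using assms by simp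
  have "cmod (unit_pt \<theta> * s - t) = cmod (unit_pt \<theta> * cnj t - cnj s)" for \<theta>
  proof -
    have 1: "unit_pt \<theta> * cnj (unit_pt \<theta>) = 1"
      by (metis cmod_unit_pt complex_norm_square of_real_1 power_one)
    have "cmod (unit_pt \<theta> * s - t) = cmod (unit_pt \<theta> * cnj (unit_pt \<theta> * s - t))"
      by (simp only: norm_mult cmod_unit_pt complex_mod_cnj mult_1)
    also have "unit_pt \<theta> * cnj (unit_pt \<theta> * s - t) = cnj s - unit_pt \<theta> * cnj t"
      using 1 by (simp only: complex_cnj_diff complex_cnj_mult right_diff_distrib mult.assoc[symmetric] mult_1)
    finally show ?thesis by (simp add: norm_minus_commute)
  qed
  then show ?thesis using circle_mean_ln_less[OF lt] False by (simp add: max_def)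
qed

lemma sphere_null: "AE s in lborel. cmod s \<noteq> r"
proof -
  have "sphere (0::complex) r \<in> null_sets lborel"
    using negligible_sphere[of 0 r] by (auto simp: null_sets_completion_iff negligible_iff_null_sets)
  then have "AE s in lborel. s \<notin> sphere (0::complex) r" by (rule AE_not_in)
  then show ?thesis by simp
qed

text \<open>
  The constant \<open>R\<close> makes the integrand nonnegative, so that circle means can be taken under the
  extended integral without integrability considerations.
\<close>

lemma nn_integral_ln_radial:
  assumes S [measurable]: "S \<in> sets borel"
    and rad: "\<And>z c. cmod c = 1 \<Longrightarrow> c * z \<in> S \<longleftrightarrow> z \<in> S"
    and R: "\<And>s. s \<in> S \<Longrightarrow> cmod s + cmod t \<le> R"
  shows "(\<integral>\<^sup>+ s\<in>S. ennreal (ln (R / cmod (s - t))) \<partial>lborel)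
       = (\<integral>\<^sup>+ s\<in>S. ennreal (ln (R / max (cmod s) (cmod t))) \<partial>lborel)"
proof -
  have "(\<integral>\<^sup>+ s\<in>S. ennreal (ln (R / cmod (s - t))) \<partial>lborel)
     = (\<integral>\<^sup>+ s\<in>S. (\<integral>\<^sup>+ \<theta>\<in>{0..1::real}. ennreal (ln (R / cmod (unit_pt \<theta> * s - t))) \<partial>lborel) \<partial>lborel)"
    by (rule nn_integral_radial_average[OF _ S rad]) auto
  also have "\<dots> = (\<integral>\<^sup>+ s\<in>S. ennreal (ln (R / max (cmod s) (cmod t))) \<partial>lborel)"
  proof (rule nn_integral_cong_AE, use sphere_null[of "cmod t"] in eventually_elim)
    fix s :: complex assume ne: "cmod s \<noteq> cmod t"
    show "(\<integral>\<^sup>+ \<theta>\<in>{0..1::real}. ennreal (ln (R / cmod (unit_pt \<theta> * s - t))) \<partial>lborel) * indicator S s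
       = ennreal (ln (R / max (cmod s) (cmod t))) * indicator S s"
    proof (cases "s \<in> S")
      case True
      have mpos: "max (cmod s) (cmod t) > 0" using ne by (auto simp: max_def)
      have Rpos: "R > 0" using R[OF True] ne
        by (smt (verit) norm_ge_zero)
      have pos: "cmod (unit_pt \<theta> * s - t) > 0" for \<theta>
        using ne by (metis cmod_unit_pt mult_1 norm_mult right_minus_eq zero_less_norm_iff)
      have le: "cmod (unit_pt \<theta> * s - t) \<le> R" for \<theta>
        using R[OF True] norm_triangle_ineq4[of "unit_pt \<theta> * s" t] by (simp add: norm_mult cmod_unit_pt)
      have eq: "ln (R / cmod (unit_pt \<theta> * s - t)) = ln R - ln (cmod (unit_pt \<theta> * s - t))" for \<theta>
        using pos[of \<theta>] Rpos by (simp add: ln_div)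
      have "((\<lambda>\<theta>::real. ln R - ln (cmod (unit_pt \<theta> * s - t))) has_integral (ln R - ln (max (cmod s) (cmod t)))) {0..1}"
        using has_integral_diff[OF has_integral_const_real[of "ln R" 0 1] circle_mean_ln[OF ne]] by simp
      then have hi: "((\<lambda>\<theta>::real. ln (R / cmod (unit_pt \<theta> * s - t))) has_integral ln (R / max (cmod s) (cmod t))) {0..1}"
        unfolding eq using Rpos mpos by (simp add: ln_div)
      have "(\<integral>\<^sup>+ \<theta>\<in>{0..1::real}. ennreal (ln (R / cmod (unit_pt \<theta> * s - t))) \<partial>lborel)
          = (\<integral>\<^sup>+ \<theta>. ennreal (indicator {0..1} \<theta> * ln (R / cmod (unit_pt \<theta> * s - t))) \<partial>lborel)"
        by (intro nn_integral_cong) (simp add: indicator_def)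
      also have "\<dots> = ennreal (ln (R / max (cmod s) (cmod t)))"
        by (rule nn_integral_has_integral_lebesgue[OF _ hi]) (use pos le in \<open>auto intro!: ln_ge_zero simp: field_simps\<close>)
      finally show ?thesis using True by simp
    qed simp
  qed
  finally show ?thesis .
qed

section \<open>Disc and annulus means of the logarithmic kernel\<close>

lemma ball_borel [measurable]: "ball (z::complex) r \<in> sets borel" "cball (z::complex) r \<in> sets borel"
  by auto

lemma ln_le_ln_max: "0 < a \<Longrightarrow> ln a \<le> ln (max a b)" "0 < a \<Longrightarrow> ln a \<le> ln (max b a)" for a b :: real
  by (auto simp: max_def)

lemma measure_ball_complex: "r \<ge> 0 \<Longrightarrow> measure lborel (ball (z::complex) r) = pi * r\<^sup>2"
  by (simp add: content_ball unit_ball_vol_2)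

lemma emeasure_ball_complex: "r \<ge> 0 \<Longrightarrow> emeasure lborel (ball (z::complex) r) = ennreal (pi * r\<^sup>2)"
  by (simp add: emeasure_ball unit_ball_vol_2)

lemma emeasure_ball_finite: "emeasure lborel (ball (z::complex) r) < \<infinity>"
  by (cases "r \<ge> 0") (auto simp: emeasure_ball_complex ball_empty)

lemma nn_integral_translate:
  fixes f :: "complex \<Rightarrow> ennreal"
  assumes [measurable]: "f \<in> borel_measurable borel"
  shows "(\<integral>\<^sup>+ s. f (c + s) \<partial>lborel) = (\<integral>\<^sup>+ s. f s \<partial>lborel)"
proof -
  have "(\<integral>\<^sup>+ s. f s \<partial>lborel) = (\<integral>\<^sup>+ s. f s \<partial>distr lborel borel ((+) c))"
    by (simp add: lborel_distr_plus)
  also have "\<dots> = (\<integral>\<^sup>+ s. f (c + s) \<partial>lborel)"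
    by (subst nn_integral_distr) auto
  finally show ?thesis by simp
qed

lemma integral_translate:
  fixes f :: "complex \<Rightarrow> real"
  assumes [measurable]: "f \<in> borel_measurable borel"
  shows "(\<integral> s. f (c + s) \<partial>lborel) = (\<integral> s. f s \<partial>lborel)"
proof -
  have "(\<integral> s. f s \<partial>lborel) = (\<integral> s. f s \<partial>distr lborel borel ((+) c))"
    by (simp add: lborel_distr_plus)
  also have "\<dots> = (\<integral> s. f (c + s) \<partial>lborel)"
    by (subst integral_distr) auto
  finally show ?thesis by simp
qed

text \<open>
  A translation moves the singularity to the point 1, where the circle-mean formula evaluates the
  integral; the resulting bound is uniform in \<open>t\<close>.
\<close>

lemma nn_integral_abs_ln_bounded:
  assumes "\<rho> \<ge> 0" "T \<ge> 0"
  obtains C where "C \<ge> 0"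
    "\<And>t. cmod t \<le> T \<Longrightarrow> (\<integral>\<^sup>+ s\<in>ball 0 \<rho>. ennreal \<bar>ln (cmod (s - t))\<bar> \<partial>lborel) \<le> ennreal C"
proof
  define \<rho>' where "\<rho>' = \<rho> + T + 1"
  define R where "R = \<rho>' + 1"
  have R: "R \<ge> 1" using assms by (simp add: R_def \<rho>'_def)
  define C where "C = (2 * ln R) * (pi * \<rho>'\<^sup>2)"
  show "C \<ge> 0" using R by (simp add: C_def)
  fix t :: complex assume t: "cmod t \<le> T"
  have le: "ennreal \<bar>ln x\<bar> \<le> ennreal (ln (R / x)) + ennreal (ln R)" if "x > 0" "x \<le> R" for x
  proof -
    have "ln x \<le> ln R" using that by simp
    have "ln (R / x) = ln R - ln x" using that R by (simp add: ln_div)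
    moreover have "ln R \<ge> 0" using R by simp
    ultimately have "\<bar>ln x\<bar> \<le> ln (R / x) + ln R" "ln (R/x) \<ge> 0"
      using \<open>ln x \<le> ln R\<close> by auto
    then show ?thesis using \<open>ln R \<ge> 0\<close> by (simp flip: ennreal_plus)
  qed
  have pt: "ennreal \<bar>ln (cmod (s - t))\<bar> * indicator (ball 0 \<rho>) s
      \<le> (\<lambda>s. (ennreal (ln (R / cmod (s - 1))) + ennreal (ln R)) * indicator (ball 0 \<rho>') s) ((1 - t) + s)" for s
  proof (cases "s \<in> ball 0 \<rho> \<and> s \<noteq> t")
    case True
    have "cmod (1 - t + s) \<le> 1 + cmod t + cmod s"
      using norm_triangle_ineq[of "1 - t" s] norm_triangle_ineq4[of 1 t] by simp
    then have "1 - t + s \<in> ball 0 \<rho>'" using True t by (simp add: \<rho>'_def)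
    moreover have "cmod (s - t) \<le> R"
      using True t norm_triangle_ineq4[of s t] by (simp add: R_def \<rho>'_def)
    ultimately show ?thesis using True le[of "cmod (s - t)"] by (simp add: add_diff_eq)
  qed auto
  have "(\<integral>\<^sup>+ s\<in>ball 0 \<rho>. ennreal \<bar>ln (cmod (s - t))\<bar> \<partial>lborel)
     \<le> (\<integral>\<^sup>+ s. (\<lambda>s. (ennreal (ln (R / cmod (s - 1))) + ennreal (ln R)) * indicator (ball 0 \<rho>') s) ((1 - t) + s) \<partial>lborel)"
    by (intro nn_integral_mono pt)
  also have "\<dots> = (\<integral>\<^sup>+ s\<in>ball 0 \<rho>'. (ennreal (ln (R / cmod (s - 1))) + ennreal (ln R)) \<partial>lborel)"
    by (rule nn_integral_translate) measurable
  also have "\<dots> = (\<integral>\<^sup>+ s\<in>ball 0 \<rho>'. ennreal (ln (R / cmod (s - 1))) \<partial>lborel) + (\<integral>\<^sup>+ s\<in>ball (0::complex) \<rho>'. ennreal (ln R) \<partial>lborel)"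
    by (simp add: distrib_right nn_integral_add)
  also have "(\<integral>\<^sup>+ s\<in>ball 0 \<rho>'. ennreal (ln (R / cmod (s - 1))) \<partial>lborel)
      = (\<integral>\<^sup>+ s\<in>ball 0 \<rho>'. ennreal (ln (R / max (cmod s) (cmod 1))) \<partial>lborel)"
    by (rule nn_integral_ln_radial) (auto simp: norm_mult R_def)
  also have "\<dots> \<le> (\<integral>\<^sup>+ s\<in>ball (0::complex) \<rho>'. ennreal (ln R) \<partial>lborel)"
  proof (intro nn_integral_mono mult_right_mono ennreal_leI)
    fix s :: complex
    have "max (cmod s) (cmod 1) \<ge> 1" by simp
    then have "R / max (cmod s) (cmod 1) \<le> R" "R / max (cmod s) (cmod 1) > 0"
      using R by (auto simp: divide_le_eq mult_left_le intro!: divide_pos_pos)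
    then show "ln (R / max (cmod s) (cmod 1)) \<le> ln R" using R by (subst ln_le_cancel_iff) auto
  qed auto
  also have "(\<integral>\<^sup>+ s\<in>ball (0::complex) \<rho>'. ennreal (ln R) \<partial>lborel) + (\<integral>\<^sup>+ s\<in>ball (0::complex) \<rho>'. ennreal (ln R) \<partial>lborel) = ennreal C"
    using R assms by (simp add: nn_integral_cmult_indicator emeasure_ball_complex \<rho>'_def C_def flip: ennreal_mult ennreal_plus)
  finally show "(\<integral>\<^sup>+ s\<in>ball 0 \<rho>. ennreal \<bar>ln (cmod (s - t))\<bar> \<partial>lborel) \<le> ennreal C"
    by (simp add: add_right_mono)
qed

lemma set_integrable_ln:
  assumes S [measurable]: "S \<in> sets borel" and b: "bounded S"
  shows "set_integrable lborel S (\<lambda>s. ln (cmod (s - t)))"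
proof -
  obtain \<rho> where \<rho>: "\<rho> > 0" "S \<subseteq> ball 0 \<rho>"
    using b by (meson bounded_subset_ballD)
  obtain C where C: "\<And>t'. cmod t' \<le> cmod t \<Longrightarrow> (\<integral>\<^sup>+ s\<in>ball 0 \<rho>. ennreal \<bar>ln (cmod (s - t'))\<bar> \<partial>lborel) \<le> ennreal C"
    using nn_integral_abs_ln_bounded[of \<rho> "cmod t"] \<rho> by (metis less_imp_le norm_ge_zero)
  have "set_integrable lborel (ball 0 \<rho>) (\<lambda>s. ln (cmod (s - t)))"
    unfolding set_integrable_def
  proof (rule integrableI_bounded)
    have "(\<integral>\<^sup>+ x. ennreal (norm (indicat_real (ball 0 \<rho>) x *\<^sub>R ln (cmod (x - t)))) \<partial>lborel)
      = (\<integral>\<^sup>+ s\<in>ball 0 \<rho>. ennreal \<bar>ln (cmod (s - t))\<bar> \<partial>lborel)"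
      by (intro nn_integral_cong) (simp add: indicator_def)
    also have "\<dots> < \<infinity>" using C[of t] by (simp add: le_less_trans)
    finally show "(\<integral>\<^sup>+ x. ennreal (norm (indicat_real (ball 0 \<rho>) x *\<^sub>R ln (cmod (x - t)))) \<partial>lborel) < \<infinity>" .
  qed simp
  then show ?thesis using \<rho> S by (auto intro: set_integrable_subset)
qed

lemma set_integral_ln_radial:
  assumes S [measurable]: "S \<in> sets borel" and b: "bounded S"
    and rad: "\<And>z c. cmod c = 1 \<Longrightarrow> c * z \<in> S \<longleftrightarrow> z \<in> S"
  shows "set_integrable lborel S (\<lambda>s. ln (max (cmod s) (cmod t)))"
    and "(LINT s:S|lborel. ln (cmod (s - t))) = (LINT s:S|lborel. ln (max (cmod s) (cmod t)))"
proof -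
  obtain \<rho> where \<rho>: "\<rho> > 0" "S \<subseteq> ball 0 \<rho>"
    using b by (meson bounded_subset_ballD)
  define R where "R = \<rho> + cmod t + 1"
  have R: "R > 0" "\<And>s. s \<in> S \<Longrightarrow> cmod s + cmod t \<le> R"
    using \<rho> by (auto simp: R_def subset_iff add_pos_nonneg intro!: less_imp_le)
  have fin: "emeasure lborel S < \<infinity>"
    using emeasure_bounded_finite[OF b] by simp
  have AE1: "AE s in lborel. cmod s \<noteq> 0" by (rule sphere_null)
  have AE2: "AE s in lborel. s \<noteq> t" by (rule AE_lborel_singleton)
  have L: "ennreal (ln (R / cmod (s - t))) * indicator S s = ennreal (indicator S s * (ln R - ln (cmod (s - t))))"
    if "s \<noteq> t" for s
    using that R by (auto simp: ln_div indicator_def)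
  have Rr: "ennreal (ln (R / max (cmod s) (cmod t))) * indicator S s = ennreal (indicator S s * (ln R - ln (max (cmod s) (cmod t))))"
    if "cmod s \<noteq> 0" for s
  proof -
    have "max (cmod s) (cmod t) > 0" using that by (auto simp: max_def)
    then show ?thesis using R by (auto simp: ln_div indicator_def)
  qed
  have i1: "integrable lborel (\<lambda>s. indicator S s * (ln R - ln (cmod (s - t))))"
  proof -
    have "set_integrable lborel S (\<lambda>s. ln R - ln (cmod (s - t)))"
      using set_integrable_ln[OF S b, of t] fin
      by (intro set_integral_diff) (auto simp: set_integrable_def)
    then show ?thesis by (simp add: set_integrable_def)
  qed
  have nn1: "AE s in lborel. 0 \<le> indicator S s * (ln R - ln (cmod (s - t)))"
    using AE2
  proof eventually_elim
    fix s assume "s \<noteq> t"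
    then show "0 \<le> indicator S s * (ln R - ln (cmod (s - t)))"
      using R(1) R(2)[of s] norm_triangle_ineq4[of s t] by (auto simp: indicator_def)
  qed
  have nn2: "AE s in lborel. 0 \<le> indicator S s * (ln R - ln (max (cmod s) (cmod t)))"
    using AE1
  proof eventually_elim
    fix s :: complex assume "cmod s \<noteq> 0"
    then show "0 \<le> indicator S s * (ln R - ln (max (cmod s) (cmod t)))"
    proof (cases "s \<in> S")
      case True
      then have "max (cmod s) (cmod t) \<le> R" "max (cmod s) (cmod t) > 0"
        using R(2)[of s] \<open>cmod s \<noteq> 0\<close> norm_ge_zero[of s] norm_ge_zero[of t] by linarith+
      then show ?thesis using R(1) True by simp
    qed simp
  qed
  have eq: "(\<integral>\<^sup>+ s. ennreal (indicator S s * (ln R - ln (cmod (s - t)))) \<partial>lborel)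
      = (\<integral>\<^sup>+ s. ennreal (indicator S s * (ln R - ln (max (cmod s) (cmod t)))) \<partial>lborel)"
  proof -
    have "(\<integral>\<^sup>+ s. ennreal (indicator S s * (ln R - ln (cmod (s - t)))) \<partial>lborel)
       = (\<integral>\<^sup>+ s\<in>S. ennreal (ln (R / cmod (s - t))) \<partial>lborel)"
      by (rule nn_integral_cong_AE, use AE2 in eventually_elim) (simp add: L)
    also have "\<dots> = (\<integral>\<^sup>+ s\<in>S. ennreal (ln (R / max (cmod s) (cmod t))) \<partial>lborel)"
      by (rule nn_integral_ln_radial[OF S rad R(2)])
    also have "\<dots> = (\<integral>\<^sup>+ s. ennreal (indicator S s * (ln R - ln (max (cmod s) (cmod t)))) \<partial>lborel)"
      by (rule nn_integral_cong_AE, use AE1 in eventually_elim) (simp add: Rr)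
    finally show ?thesis .
  qed
  have i2: "integrable lborel (\<lambda>s. indicator S s * (ln R - ln (max (cmod s) (cmod t))))"
  proof (rule integrableI_nonneg[OF _ nn2])
    show "(\<integral>\<^sup>+ s. ennreal (indicator S s * (ln R - ln (max (cmod s) (cmod t)))) \<partial>lborel) < \<infinity>"
      unfolding eq[symmetric] using nn_integral_eq_integral[OF i1 nn1] by simp
  qed measurable
  have c: "set_integrable lborel S (\<lambda>s. ln R)" using fin by (auto simp: set_integrable_def)
  have "set_integrable lborel S (\<lambda>s. ln R - (ln R - ln (max (cmod s) (cmod t))))"
    by (rule set_integral_diff(1)[OF c]) (use i2 in \<open>simp add: set_integrable_def\<close>)
  then show i3: "set_integrable lborel S (\<lambda>s. ln (max (cmod s) (cmod t)))" by simp
  have "(\<integral> s. indicator S s * (ln R - ln (cmod (s - t))) \<partial>lborel)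
      = (\<integral> s. indicator S s * (ln R - ln (max (cmod s) (cmod t))) \<partial>lborel)"
    using eq by (simp add: integral_eq_nn_integral[OF _ nn1] integral_eq_nn_integral[OF _ nn2])
  then have "(LINT s:S|lborel. ln R - ln (cmod (s - t))) = (LINT s:S|lborel. ln R - ln (max (cmod s) (cmod t)))"
    by (simp add: set_lebesgue_integral_def)
  then show "(LINT s:S|lborel. ln (cmod (s - t))) = (LINT s:S|lborel. ln (max (cmod s) (cmod t)))"
    using set_integral_diff(2)[OF c set_integrable_ln[OF S b, of t]] set_integral_diff(2)[OF c i3] by simp
qed

lemma set_integral_translate_ball:
  fixes f :: "complex \<Rightarrow> real"
  assumes [measurable]: "f \<in> borel_measurable borel"
  shows "(LINT s:ball z r|lborel. f s) = (LINT s:ball 0 r|lborel. f (z + s))"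
proof -
  have "(\<integral> s. indicator (ball z r) (z + s) * f (z + s) \<partial>lborel) = (\<integral> s. indicator (ball z r) s * f s \<partial>lborel)"
    by (rule integral_translate[of "\<lambda>s. indicator (ball z r) s * f s"]) measurable
  then show ?thesis
    by (simp add: set_lebesgue_integral_def indicator_def dist_norm)
qed

text \<open>
  All mean-value properties of the kernel are read off from this formula, in which the kernel on
  the right is truncated at the distance of the source from the centre.
\<close>

lemma ball_integral_ln:
  "(LINT s:ball z r|lborel. ln (cmod (s - t))) = (LINT s:ball 0 r|lborel. ln (max (cmod s) (cmod (z - t))))"
  "set_integrable lborel (ball 0 r) (\<lambda>s. ln (max (cmod s) (cmod (z - t))))"
proof -
  have "(LINT s:ball z r|lborel. ln (cmod (s - t))) = (LINT s:ball 0 r|lborel. ln (cmod (s - (t - z))))"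
    by (subst set_integral_translate_ball) (auto simp: algebra_simps)
  also have "\<dots> = (LINT s:ball 0 r|lborel. ln (max (cmod s) (cmod (t - z))))"
    by (rule set_integral_ln_radial) (auto simp: norm_mult)
  finally show "(LINT s:ball z r|lborel. ln (cmod (s - t))) = (LINT s:ball 0 r|lborel. ln (max (cmod s) (cmod (z - t))))"
    by (simp add: norm_minus_commute)
  show "set_integrable lborel (ball 0 r) (\<lambda>s. ln (max (cmod s) (cmod (z - t))))"
    by (rule set_integral_ln_radial) (auto simp: norm_mult)
qed

lemma set_integral_const_ball:
  "r \<ge> 0 \<Longrightarrow> (LINT s:ball (z::complex) r|lborel. (c::real)) = pi * r\<^sup>2 * c"
  "set_integrable lborel (ball (z::complex) r) (\<lambda>s. (c::real))"
proof -
  have "integrable lborel (indicat_real (ball z r))"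
    by (intro integrable_real_indicator) (use emeasure_ball_finite in auto)
  then show "set_integrable lborel (ball (z::complex) r) (\<lambda>s. (c::real))"
    by (auto simp: set_integrable_def)
  show "r \<ge> 0 \<Longrightarrow> (LINT s:ball (z::complex) r|lborel. (c::real)) = pi * r\<^sup>2 * c"
    by (auto simp: set_lebesgue_integral_def measure_ball_complex)
qed

lemma ball_mean_ln_eq:
  assumes "0 \<le> r" "r \<le> cmod (z - t)"
  shows "(LINT s:ball z r|lborel. ln (cmod (s - t))) = pi * r\<^sup>2 * ln (cmod (z - t))"
proof -
  have "(LINT s:ball z r|lborel. ln (cmod (s - t))) = (LINT s:ball (0::complex) r|lborel. ln (cmod (z - t)))"
    unfolding ball_integral_ln using assms by (intro set_lebesgue_integral_cong) (auto simp: max_def)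
  then show ?thesis using assms by (simp add: set_integral_const_ball)
qed

lemma ball_mean_ln_ge:
  assumes "0 \<le> r" "z \<noteq> t"
  shows "pi * r\<^sup>2 * ln (cmod (z - t)) \<le> (LINT s:ball z r|lborel. ln (cmod (s - t)))"
proof -
  have "(LINT s:ball (0::complex) r|lborel. ln (cmod (z - t))) \<le> (LINT s:ball z r|lborel. ln (cmod (s - t)))"
    unfolding ball_integral_ln(1) using assms
    by (intro set_integral_mono ball_integral_ln set_integral_const_ball) (auto intro!: ln_le_ln_max)
  then show ?thesis using assms by (simp add: set_integral_const_ball)
qed

lemma set_integrable_const_bounded:
  assumes "S \<in> sets borel" "bounded (S :: complex set)"
  shows "set_integrable lborel S (\<lambda>s. c :: real)"
  using assms emeasure_bounded_finite[OF assms(2)]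
  by (auto simp: set_integrable_def)

definition annulus :: "real \<Rightarrow> real \<Rightarrow> complex set" where
  "annulus a b = {s. a < cmod s \<and> cmod s < b}"

lemma annulus_props: "annulus a b \<in> sets borel" "bounded (annulus a b)"
  "cmod c = 1 \<Longrightarrow> c * z \<in> annulus a b \<longleftrightarrow> z \<in> annulus a b"
proof -
  show "annulus a b \<in> sets borel" unfolding annulus_def by measurable
  have "annulus a b \<subseteq> ball 0 b" by (auto simp: annulus_def)
  then show "bounded (annulus a b)" using bounded_ball bounded_subset by blast
qed (auto simp: annulus_def norm_mult)

text \<open>
  Over an annulus around the origin the kernel behaves as if a source in the inner disc sat at the
  centre, and any other source can only increase the mean. This yields the starting point of the
  convergence in the outer domain.
\<close>

lemma annulus_mean_ln:
  assumes a: "a > 0"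
  shows "(LINT s:annulus a b|lborel. ln (cmod s)) \<le> (LINT s:annulus a b|lborel. ln (cmod (s - t)))"
    and "cmod t \<le> a \<Longrightarrow> (LINT s:annulus a b|lborel. ln (cmod (s - t))) = (LINT s:annulus a b|lborel. ln (cmod s))"
proof -
  have "(LINT s:annulus a b|lborel. ln (cmod s)) \<le> (LINT s:annulus a b|lborel. ln (max (cmod s) (cmod t)))"
    using a set_integrable_ln[OF annulus_props(1,2), of a b 0]
    by (intro set_integral_mono set_integral_ln_radial annulus_props) (auto simp: annulus_def intro!: ln_le_ln_max)
  also have "\<dots> = (LINT s:annulus a b|lborel. ln (cmod (s - t)))"
    by (rule set_integral_ln_radial(2)[symmetric]) (auto simp: annulus_props)
  finally show "(LINT s:annulus a b|lborel. ln (cmod s)) \<le> (LINT s:annulus a b|lborel. ln (cmod (s - t)))" .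
  assume t: "cmod t \<le> a"
  have "(LINT s:annulus a b|lborel. ln (cmod (s - t))) = (LINT s:annulus a b|lborel. ln (max (cmod s) (cmod t)))"
    by (rule set_integral_ln_radial) (auto simp: annulus_props)
  also have "\<dots> = (LINT s:annulus a b|lborel. ln (cmod s))"
    using t annulus_props by (intro set_lebesgue_integral_cong) (auto simp: max_def annulus_def)
  finally show "(LINT s:annulus a b|lborel. ln (cmod (s - t))) = (LINT s:annulus a b|lborel. ln (cmod s))" .
qed

section \<open>A maximum principle and logarithmic potentials\<close>

text \<open>
  Upper semicontinuity makes \<open>v\<close> attain its supremum if it exceeds \<open>M\<close>. Among the maximum points,
  which form a compact set, take one with the largest real part: the right part of a disc about it
  consists of points with smaller values, contradicting the sub-mean value inequality there. The
  boundary condition \<open>bd\<close> is stated by means of compact sets, so that unbounded and irregular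
  domains are covered.
\<close>

lemma submean_max_principle:
  fixes v :: "complex \<Rightarrow> real"
  assumes usc: "\<And>c. open {z\<in>S. v z < c}"
    and sub: "\<And>z. z \<in> S \<Longrightarrow> \<exists>r>0. cball z r \<subseteq> S \<and> set_integrable lborel (ball z r) v
        \<and> pi * r\<^sup>2 * v z \<le> (LINT s:ball z r|lborel. v s)"
    and bd: "\<And>\<epsilon>. \<epsilon> > 0 \<Longrightarrow> \<exists>C. compact C \<and> C \<subseteq> S \<and> (\<forall>z\<in>S-C. v z \<le> M + \<epsilon>)"
    and z0: "z0 \<in> S"
  shows "v z0 \<le> M"
proof (rule ccontr)
  assume "\<not> v z0 \<le> M"
  define \<epsilon> where "\<epsilon> = (v z0 - M) / 2"
  have \<epsilon>: "\<epsilon> > 0" "M + \<epsilon> < v z0" using \<open>\<not> v z0 \<le> M\<close> by (auto simp: \<epsilon>_def field_simps)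
  obtain C where C: "compact C" "C \<subseteq> S" "\<And>z. z \<in> S - C \<Longrightarrow> v z \<le> M + \<epsilon>"
    using bd[OF \<epsilon>(1)] by blast
  define A where "A = (\<lambda>c. {z\<in>C. v z \<ge> c})"
  have A_compact: "compact (A c)" for c
  proof -
    have "A c = C - {z\<in>S. v z < c}" using C(2) by (auto simp: A_def)
    then show ?thesis using C(1) usc by (simp add: compact_diff)
  qed
  have inC: "z \<in> C" if "z \<in> S" "v z \<ge> v z0" for z
    using C(3)[of z] that \<epsilon>(2) by (cases "z \<in> C") auto
  \<comment> \<open>the superlevel sets form a chain of nonempty compact sets, so they have a common point\<close>
  define F where "F = (\<lambda>z. A (v z)) ` {z\<in>S. v z \<ge> v z0}"
  have "\<Inter>F \<noteq> {}"
  proof (rule compact_chain)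
    show "\<And>T. T \<in> F \<Longrightarrow> compact T" by (auto simp: F_def A_compact)
    show "{} \<notin> F" using inC by (fastforce simp: F_def A_def)
    show "T \<subseteq> U \<or> U \<subseteq> T" if TU: "T \<in> F \<and> U \<in> F" for T U
    proof -
      obtain a b where "T = A (v a)" "U = A (v b)" using TU unfolding F_def by blast
      then show ?thesis by (cases "v a \<le> v b") (auto simp: A_def)
    qed
  qed
  then obtain zm where zm: "\<And>T. T \<in> F \<Longrightarrow> zm \<in> T" by blast
  have zmC: "zm \<in> C" using zm[of "A (v z0)"] z0 by (auto simp: F_def A_def)
  have max0: "v z \<le> v zm" if "z \<in> S" "v z \<ge> v z0" for z
    using zm[of "A (v z)"] that by (auto simp: F_def A_def)
  then have zm0: "v z0 \<le> v zm" using z0 by simp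
  have max: "v z \<le> v zm" if "z \<in> S" for z
    using max0[OF that] zm0 by linarith
  \<comment> \<open>a maximum point with the largest real part\<close>
  obtain z1 where z1: "z1 \<in> A (v zm)" "\<And>y. y \<in> A (v zm) \<Longrightarrow> Re y \<le> Re z1"
  proof -
    have "A (v zm) \<noteq> {}" using zmC by (auto simp: A_def)
    then show thesis
      using continuous_attains_sup[OF A_compact, of "v zm" Re] that
        continuous_on_Re[OF continuous_on_id, of "A (v zm)"] by auto
  qed
  have "z1 \<in> S" and v1: "v z1 = v zm" using z1(1) C(2) max[of z1] by (auto simp: A_def)
  then obtain r where r: "r > 0" "cball z1 r \<subseteq> S" "set_integrable lborel (ball z1 r) v"
     "pi * r\<^sup>2 * v z1 \<le> (LINT s:ball z1 r|lborel. v s)"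
    using sub by blast
  define h where "h = (\<lambda>s. indicator (ball z1 r) s * (v z1 - v s))"
  have hi: "integrable lborel h"
    using set_integral_diff(1)[OF set_integral_const_ball(2) r(3)] by (simp add: set_integrable_def h_def)
  have h0: "h s \<ge> 0" for s
    using max[of s] r(2) v1 by (auto simp: h_def indicator_def subset_iff)
  have "integral\<^sup>L lborel h = (LINT s:ball z1 r|lborel. v z1 - v s)"
    by (simp add: h_def set_lebesgue_integral_def)
  also have "\<dots> = pi * r\<^sup>2 * v z1 - (LINT s:ball z1 r|lborel. v s)"
    using r by (subst set_integral_diff(2)) (auto simp: set_integral_const_ball)
  finally have "integral\<^sup>L lborel h \<le> 0" using r(4) by simp
  then have "integral\<^sup>L lborel h = 0" using h0 by (simp add: integral_nonneg_AE antisym)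
  then have "AE s in lborel. h s = 0"
    using integral_nonneg_eq_0_iff_AE[OF hi] h0 by auto
  \<comment> \<open>a smaller disc to the right of \<open>z1\<close>, where \<open>v\<close> is below its maximum\<close>
  moreover have "h s \<noteq> 0" if "s \<in> ball (z1 + of_real (r/2)) (r/2)" for s
  proof -
    have d: "cmod (s - (z1 + of_real (r/2))) < r/2" using that by (simp add: dist_norm norm_minus_commute)
    have "cmod (s - z1) \<le> cmod (s - (z1 + of_real (r/2))) + cmod (of_real (r/2))"
      using norm_triangle_ineq[of "s - (z1 + of_real (r/2))" "of_real (r/2)"] by simp
    then have sb: "s \<in> ball z1 r" using d r(1) by (simp add: dist_norm norm_minus_commute)
    have "\<bar>Re (s - (z1 + of_real (r/2)))\<bar> < r/2"
      using abs_Re_le_cmod d by (rule le_less_trans)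
    then have "- Re (s - (z1 + of_real (r/2))) < r/2" by linarith
    then have "Re s > Re z1" by simp
    then have "s \<notin> A (v zm)" using z1(2)[of s] by auto
    then have "v s < v zm"
      using inC[of s] zm0 sb r(2) by (auto simp: A_def subset_iff not_le) (meson less_imp_le not_less order_trans)
    then show ?thesis using sb v1 by (simp add: h_def)
  qed
  ultimately have "AE s in lborel. s \<notin> ball (z1 + of_real (r/2)) (r/2)"
    by (auto elim!: eventually_mono)
  then have "ball (z1 + of_real (r/2)) (r/2) \<in> null_sets lborel"
    by (subst AE_iff_null_sets) auto
  then have "emeasure lborel (ball (z1 + of_real (r/2)) (r/2)) = 0" by (rule null_setsD1)
  then show False using r(1) by (simp add: emeasure_ball_complex)
qed

definition pot :: "complex measure \<Rightarrow> complex \<Rightarrow> real" where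
  "pot M z = - (\<integral> t. ln (cmod (z - t)) \<partial>M)"

locale compact_prob = prob_space M for M :: "complex measure" +
  fixes K :: "complex set"
  assumes setsM [measurable_cong]: "sets M = sets borel"
    and K_compact: "compact K"
    and M_K: "emeasure M K = 1"
begin

lemma space_M: "space M = UNIV"
  using sets_eq_imp_space_eq[OF setsM] by simp

lemma K_sets [measurable]: "K \<in> sets borel"
  using K_compact by (simp add: compact_imp_closed)

lemma AE_K: "AE t in M. t \<in> K"
proof -
  have "prob K = 1" using M_K by (simp add: measure_def)
  then show ?thesis using AE_prob_1 by blast
qed

lemma K_nonempty: "K \<noteq> {}"
  using M_K by auto

lemma K_radius: obtains R0 where "R0 > 0" "K \<subseteq> ball 0 R0"
  using compact_imp_bounded[OF K_compact] bounded_subset_ballD by metis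

lemma ln_bounds_K:
  assumes "\<delta> > 0" "\<And>t. t \<in> K \<Longrightarrow> \<delta> \<le> cmod (z - t)"  "\<And>t. t \<in> K \<Longrightarrow> cmod (z - t) \<le> B"
  shows "integrable M (\<lambda>t. ln (cmod (z - t)))" "- ln B \<le> pot M z" "pot M z \<le> - ln \<delta>"
proof -
  have bd: "AE t in M. ln \<delta> \<le> ln (cmod (z - t)) \<and> ln (cmod (z - t)) \<le> ln B"
    using AE_K
  proof eventually_elim
    fix t assume t: "t \<in> K"
    then show "ln \<delta> \<le> ln (cmod (z - t)) \<and> ln (cmod (z - t)) \<le> ln B"
      using assms(2)[OF t] assms(3)[OF t] assms(1) by (auto intro!: ln_mono)
  qed
  show i: "integrable M (\<lambda>t. ln (cmod (z - t)))"
  proof (rule integrable_const_bound[where B="max \<bar>ln \<delta>\<bar> \<bar>ln B\<bar>"])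
    show "AE t in M. norm (ln (cmod (z - t))) \<le> max \<bar>ln \<delta>\<bar> \<bar>ln B\<bar>"
      using bd by eventually_elim auto
  qed measurable
  have "(\<integral> t. ln (cmod (z - t)) \<partial>M) \<le> (\<integral> t. ln B \<partial>M)"
    by (rule integral_mono_AE[OF i]) (use bd in auto)
  then show "- ln B \<le> pot M z" by (simp add: pot_def prob_space)
  have "(\<integral> t. ln \<delta> \<partial>M) \<le> (\<integral> t. ln (cmod (z - t)) \<partial>M)"
    by (rule integral_mono_AE[OF _ i]) (use bd in auto)
  then show "pot M z \<le> - ln \<delta>" by (simp add: pot_def prob_space)
qed

lemma dist_K_pos:
  assumes "z \<notin> K"
  obtains \<delta> where "\<delta> > 0" "\<And>t. t \<in> K \<Longrightarrow> \<delta> \<le> cmod (z - t)"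
  using separate_point_closed[OF compact_imp_closed[OF K_compact] assms] by (auto simp: dist_norm)

lemma dist_K_bounded: obtains B where "B > 0" "\<And>t. t \<in> K \<Longrightarrow> cmod (z - t) \<le> B"
proof -
  obtain R0 where "R0 > 0" "K \<subseteq> ball 0 R0" by (rule K_radius)
  then have "cmod (z - t) \<le> cmod z + R0" if "t \<in> K" for t
  proof -
    have "cmod t < R0" using \<open>t \<in> K\<close> \<open>K \<subseteq> ball 0 R0\<close> by auto
    then show "cmod (z - t) \<le> cmod z + R0" using norm_triangle_ineq4[of z t] by linarith
  qed
  moreover have "cmod z + R0 > 0" using \<open>R0 > 0\<close> by (simp add: add_nonneg_pos)
  ultimately show thesis using that by blast
qed

lemma integrable_ln_off:
  assumes "z \<notin> K" shows "integrable M (\<lambda>t. ln (cmod (z - t)))"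
  by (metis assms dist_K_pos dist_K_bounded ln_bounds_K(1))

lemma pot_far:
  assumes "K \<subseteq> ball 0 R0" "R0 < cmod z"
  shows "- ln (cmod z + R0) \<le> pot M z" "pot M z \<le> - ln (cmod z - R0)"
proof -
  have "cmod z - R0 \<le> cmod (z - t)" "cmod (z - t) \<le> cmod z + R0" if "t \<in> K" for t
  proof -
    have "cmod t < R0" using \<open>t \<in> K\<close> assms(1) by auto
    then show "cmod z - R0 \<le> cmod (z - t)" "cmod (z - t) \<le> cmod z + R0"
      using norm_triangle_ineq4[of z t] norm_triangle_ineq2[of z t] by linarith+
  qed
  then show "- ln (cmod z + R0) \<le> pot M z" "pot M z \<le> - ln (cmod z - R0)"
    using ln_bounds_K[of "cmod z - R0" z "cmod z + R0"] assms(2) by auto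
qed

text \<open>
  The logarithm is Lipschitz away from 0, so the potential is continuous off the carrier.
\<close>

lemma pot_lipschitz:
  assumes "\<delta> > 0" "\<And>t. t \<in> K \<Longrightarrow> \<delta> \<le> cmod (z - t)" "\<And>t. t \<in> K \<Longrightarrow> \<delta> \<le> cmod (w - t)"
  shows "\<bar>pot M z - pot M w\<bar> \<le> cmod (z - w) / \<delta>"
proof -
  have le: "ln a - ln b \<le> \<bar>a - b\<bar> / \<delta>" if "\<delta> \<le> a" "\<delta> \<le> b" for a b :: real
  proof -
    have "ln a - ln b = ln (a / b)" using that assms(1) by (simp add: ln_div)
    also have "\<dots> \<le> a / b - 1" using that assms(1) by (intro ln_le_minus_one) auto
    also have "\<dots> = (a - b) / b" using that assms(1) by (simp add: field_simps)
    also have "\<dots> \<le> \<bar>a - b\<bar> / b" using that assms(1) by (intro divide_right_mono) auto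
    also have "\<dots> \<le> \<bar>a - b\<bar> / \<delta>" using that assms(1) by (intro divide_left_mono) auto
    finally show ?thesis .
  qed
  have iz: "integrable M (\<lambda>t. ln (cmod (z - t)))" "integrable M (\<lambda>t. ln (cmod (w - t)))"
    by (metis assms(1,2) dist_K_bounded ln_bounds_K(1)) (metis assms(1,3) dist_K_bounded ln_bounds_K(1))
  have "AE t in M. \<bar>ln (cmod (w - t)) - ln (cmod (z - t))\<bar> \<le> cmod (z - w) / \<delta>"
    using AE_K
  proof eventually_elim
    fix t assume t: "t \<in> K"
    have "\<bar>cmod (w - t) - cmod (z - t)\<bar> \<le> cmod (z - w)"
      using norm_triangle_ineq3[of "w - t" "z - t"] by (simp add: norm_minus_commute)
    then have "\<bar>cmod (w - t) - cmod (z - t)\<bar> / \<delta> \<le> cmod (z - w) / \<delta>"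
      using assms(1) by (intro divide_right_mono) auto
    then show "\<bar>ln (cmod (w - t)) - ln (cmod (z - t))\<bar> \<le> cmod (z - w) / \<delta>"
      using le[OF assms(2)[OF t] assms(3)[OF t]] le[OF assms(3)[OF t] assms(2)[OF t]] by (simp add: abs_minus_commute)
  qed
  then have "(\<integral> t. \<bar>ln (cmod (w - t)) - ln (cmod (z - t))\<bar> \<partial>M) \<le> (\<integral> t. cmod (z - w) / \<delta> \<partial>M)"
    using iz by (intro integral_mono_AE) auto
  then have "(\<integral> t. \<bar>ln (cmod (w - t)) - ln (cmod (z - t))\<bar> \<partial>M) \<le> cmod (z - w) / \<delta>"
    by (simp add: prob_space)
  moreover have "\<bar>\<integral> t. (ln (cmod (w - t)) - ln (cmod (z - t))) \<partial>M\<bar> \<le> (\<integral> t. \<bar>ln (cmod (w - t)) - ln (cmod (z - t))\<bar> \<partial>M)"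
    by (rule integral_abs_bound)
  ultimately show ?thesis
    using iz by (simp add: pot_def)
qed

lemma continuous_pot_off: "continuous_on (-K) (pot M)"
proof (rule continuous_at_imp_continuous_on, rule ballI)
  fix z assume "z \<in> -K"
  then obtain \<delta> where \<delta>: "\<delta> > 0" "\<And>t. t \<in> K \<Longrightarrow> \<delta> \<le> cmod (z - t)" using dist_K_pos by auto
  show "isCont (pot M) z"
    unfolding continuous_at_eps_delta
  proof (intro allI impI)
    fix e :: real assume e: "e > 0"
    define d where "d = min (\<delta>/2) (e * (\<delta>/2))"
    have d: "d > 0" using \<delta> e by (simp add: d_def)
    have "norm (pot M w - pot M z) < e" if "norm (w - z) < d" for w
    proof -
      have "\<delta>/2 \<le> cmod (w - t)" if "t \<in> K" for t
        using \<delta>(2)[OF that] \<open>norm (w - z) < d\<close> norm_triangle_ineq[of "z - w" "w - t"]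
        by (simp add: d_def norm_minus_commute)
      moreover have "\<delta>/2 \<le> cmod (z - t)" if "t \<in> K" for t
        using \<delta>(2)[OF that] \<delta>(1) by linarith
      ultimately have "\<bar>pot M w - pot M z\<bar> \<le> cmod (w - z) / (\<delta>/2)"
        using pot_lipschitz[of "\<delta>/2" w z] \<delta>(1) by simp
      also have "\<dots> < e" using that \<delta>(1) by (simp add: d_def field_simps)
      finally show ?thesis by simp
    qed
    then show "\<exists>d>0. \<forall>x'. dist x' z < d \<longrightarrow> dist (pot M x') (pot M z) < e"
      using d by (auto simp: dist_norm)
  qed
qed

lemma pot_measurable [measurable]: "pot M \<in> borel_measurable borel"
  unfolding pot_def by measurable

text \<open>
  The uniform bound on the integrals of \<open>\<bar>ln\<bar>\<close> makes the kernel integrable for the product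
  measure.
\<close>

lemma pot_Fubini:
  assumes S [measurable]: "S \<in> sets borel" and b: "bounded S"
  shows "set_integrable lborel S (pot M)"
    and "integrable M (\<lambda>t. LINT s:S|lborel. ln (cmod (s - t)))"
    and "(LINT s:S|lborel. pot M s) = - (\<integral> t. (LINT s:S|lborel. ln (cmod (s - t))) \<partial>M)"
proof -
  interpret pair_sigma_finite lborel M
    by (intro pair_sigma_finite.intro) (unfold_locales)
  obtain \<rho> where \<rho>: "\<rho> > 0" "S \<subseteq> ball 0 \<rho>" using b by (meson bounded_subset_ballD)
  obtain R0 where R0: "R0 > 0" "K \<subseteq> ball 0 R0" by (rule K_radius)
  obtain C where C: "C \<ge> 0" "\<And>t. cmod t \<le> R0 \<Longrightarrow> (\<integral>\<^sup>+ s\<in>ball 0 \<rho>. ennreal \<bar>ln (cmod (s - t))\<bar> \<partial>lborel) \<le> ennreal C"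
    using nn_integral_abs_ln_bounded[of \<rho> R0] \<rho> R0 by (metis less_imp_le)
  define F where "F = (\<lambda>s t. indicator S s * ln (cmod (s - t)))"
  have [measurable]: "case_prod F \<in> borel_measurable (lborel \<Otimes>\<^sub>M M)"
    unfolding F_def by measurable
  have int: "integrable (lborel \<Otimes>\<^sub>M M) (case_prod F)"
  proof (rule integrableI_bounded)
    have "(\<integral>\<^sup>+ x. ennreal (norm (case_prod F x)) \<partial>(lborel \<Otimes>\<^sub>M M)) = (\<integral>\<^sup>+ t. (\<integral>\<^sup>+ s. ennreal (norm (F s t)) \<partial>lborel) \<partial>M)"
      by (subst nn_integral_snd[symmetric]) auto
    also have "\<dots> \<le> (\<integral>\<^sup>+ t. ennreal C \<partial>M)"
    proof (rule nn_integral_mono_AE, use AE_K in eventually_elim)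
      fix t assume "t \<in> K"
      have "(\<integral>\<^sup>+ s. ennreal (norm (F s t)) \<partial>lborel) \<le> (\<integral>\<^sup>+ s\<in>ball 0 \<rho>. ennreal \<bar>ln (cmod (s - t))\<bar> \<partial>lborel)"
        using \<rho>(2) by (intro nn_integral_mono) (auto simp: F_def indicator_def)
      also have "\<dots> \<le> ennreal C" using C(2)[of t] \<open>t \<in> K\<close> R0(2) by (auto simp: subset_iff)
      finally show "(\<integral>\<^sup>+ s. ennreal (norm (F s t)) \<partial>lborel) \<le> ennreal C" .
    qed
    also have "\<dots> < \<infinity>" by (simp add: emeasure_space_1)
    finally show "(\<integral>\<^sup>+ x. ennreal (norm (case_prod F x)) \<partial>(lborel \<Otimes>\<^sub>M M)) < \<infinity>" .
  qed measurable
  have eq1: "(\<integral> t. F s t \<partial>M) = - (indicator S s * pot M s)" for s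
    by (simp add: F_def pot_def)
  have eq2: "(\<integral> s. F s t \<partial>lborel) = (LINT s:S|lborel. ln (cmod (s - t)))" for t
    by (simp add: F_def set_lebesgue_integral_def)
  have "integrable lborel (\<lambda>s. - (indicator S s * pot M s))"
    using integrable_fst[OF int] by (simp add: eq1)
  then show "set_integrable lborel S (pot M)" by (simp add: set_integrable_def)
  show "integrable M (\<lambda>t. LINT s:S|lborel. ln (cmod (s - t)))"
    using integrable_snd[OF int] by (simp add: eq2)
  show "(LINT s:S|lborel. pot M s) = - (\<integral> t. (LINT s:S|lborel. ln (cmod (s - t))) \<partial>M)"
    using Fubini_integral[OF int] by (simp add: eq1 eq2 set_lebesgue_integral_def)
qed

lemma pot_ball_eq:
  assumes "r \<ge> 0" "\<And>t. t \<in> K \<Longrightarrow> r \<le> cmod (z - t)"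
  shows "(LINT s:ball z r|lborel. pot M s) = pi * r\<^sup>2 * pot M z"
proof -
  have "(LINT s:ball z r|lborel. pot M s) = - (\<integral> t. (LINT s:ball z r|lborel. ln (cmod (s - t))) \<partial>M)"
    by (rule pot_Fubini) auto
  also have "(\<integral> t. (LINT s:ball z r|lborel. ln (cmod (s - t))) \<partial>M) = (\<integral> t. pi * r\<^sup>2 * ln (cmod (z - t)) \<partial>M)"
  proof (rule integral_cong_AE)
    show "AE t in M. (LINT s:ball z r|lborel. ln (cmod (s - t))) = pi * r\<^sup>2 * ln (cmod (z - t))"
      using AE_K by eventually_elim (use assms in \<open>auto intro!: ball_mean_ln_eq\<close>)
    show "(\<lambda>t. LINT s:ball z r|lborel. ln (cmod (s - t))) \<in> borel_measurable M"
      by (rule borel_measurable_integrable[OF pot_Fubini(2)]) auto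
  qed measurable
  also have "\<dots> = - (pi * r\<^sup>2 * pot M z)" by (simp add: pot_def)
  finally show ?thesis by simp
qed

lemma pot_ball_le:
  assumes "r \<ge> 0" "integrable M (\<lambda>t. ln (cmod (z - t)))" "AE t in M. t \<noteq> z"
  shows "(LINT s:ball z r|lborel. pot M s) \<le> pi * r\<^sup>2 * pot M z"
proof -
  have "(LINT s:ball z r|lborel. pot M s) = - (\<integral> t. (LINT s:ball z r|lborel. ln (cmod (s - t))) \<partial>M)"
    by (rule pot_Fubini) auto
  also have "\<dots> \<le> - (\<integral> t. pi * r\<^sup>2 * ln (cmod (z - t)) \<partial>M)"
    unfolding neg_le_iff_le
  proof (rule integral_mono_AE)
    show "AE t in M. pi * r\<^sup>2 * ln (cmod (z - t)) \<le> (LINT s:ball z r|lborel. ln (cmod (s - t)))"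
      using assms(3) by eventually_elim (use assms(1) in \<open>auto intro!: ball_mean_ln_ge\<close>)
    show "integrable M (\<lambda>t. LINT s:ball z r|lborel. ln (cmod (s - t)))"
      by (rule pot_Fubini) auto
  qed (use assms in auto)
  also have "\<dots> = pi * r\<^sup>2 * pot M z" by (simp add: pot_def)
  finally show ?thesis .
qed

lemma pot_annulus:
  assumes "a > 0" "K \<subseteq> cball 0 a"
  shows "(LINT s:annulus a b|lborel. pot M s) = - (LINT s:annulus a b|lborel. ln (cmod s))"
proof -
  have "(LINT s:annulus a b|lborel. pot M s) = - (\<integral> t. (LINT s:annulus a b|lborel. ln (cmod (s - t))) \<partial>M)"
    by (rule pot_Fubini) (auto simp: annulus_props)
  also have "(\<integral> t. (LINT s:annulus a b|lborel. ln (cmod (s - t))) \<partial>M) = (\<integral> t. (LINT s:annulus a b|lborel. ln (cmod s)) \<partial>M)"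
  proof (rule integral_cong_AE)
    show "AE t in M. (LINT s:annulus a b|lborel. ln (cmod (s - t))) = (LINT s:annulus a b|lborel. ln (cmod s))"
      using AE_K by eventually_elim (use assms in \<open>auto intro!: annulus_mean_ln(2)\<close>)
    show "(\<lambda>t. LINT s:annulus a b|lborel. ln (cmod (s - t))) \<in> borel_measurable M"
      by (rule borel_measurable_integrable[OF pot_Fubini(2)]) (auto simp: annulus_props)
  qed measurable
  finally show ?thesis by (simp add: prob_space)
qed

lemma pot_lower:
  assumes "K \<subseteq> ball 0 R0" "cmod z \<le> T" "integrable M (\<lambda>t. ln (cmod (z - t)))"
  shows "- ln (T + R0 + 1) \<le> pot M z"
proof -
  have "(\<integral> t. ln (cmod (z - t)) \<partial>M) \<le> (\<integral> t. ln (T + R0 + 1) \<partial>M)"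
  proof (rule integral_mono_AE[OF assms(3)])
    show "AE t in M. ln (cmod (z - t)) \<le> ln (T + R0 + 1)"
      using AE_K
    proof eventually_elim
      fix t assume "t \<in> K"
      then have "cmod (z - t) \<le> T + R0 + 1" using assms norm_triangle_ineq4[of z t] by (auto simp: subset_iff)
      moreover have "1 \<le> T + R0 + 1"
        using \<open>t \<in> K\<close> assms(1,2) norm_ge_zero[of z] norm_ge_zero[of t] by (fastforce simp: subset_iff simp del: norm_ge_zero)
      ultimately show "ln (cmod (z - t)) \<le> ln (T + R0 + 1)"
        by (cases "z = t") auto
    qed
  qed auto
  then show ?thesis by (simp add: pot_def prob_space)
qed

end

section \<open>Energy and its first variation\<close>

text \<open>
  The kernel \<open>ln (R / x)\<close> for \<open>0 < x \<le> R\<close>. The value at 0 is set by hand, because \<open>ln (R / 0) = 0\<close>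
  by the conventions for division and logarithm.
\<close>

definition pos_log_kernel :: "real \<Rightarrow> real \<Rightarrow> ennreal" where
  "pos_log_kernel R x = (if x = 0 then \<infinity> else ennreal (ln (R / x)))"

lemma pos_log_kernel_measurable [measurable]: "pos_log_kernel R \<in> borel_measurable borel"
  unfolding pos_log_kernel_def by measurable

definition epot :: "real \<Rightarrow> complex measure \<Rightarrow> complex \<Rightarrow> ennreal" where
  "epot R M z = (\<integral>\<^sup>+ t. pos_log_kernel R (cmod (z - t)) \<partial>M)"

definition energy :: "real \<Rightarrow> complex measure \<Rightarrow> ennreal" where
  "energy R M = (\<integral>\<^sup>+ z. epot R M z \<partial>M)"

lemma epot_measurable:
  assumes "sigma_finite_measure M" "sets M = sets borel"
  shows "epot R M \<in> borel_measurable borel"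
proof -
  interpret sigma_finite_measure M by fact
  note [measurable_cong] = assms(2)
  show ?thesis unfolding epot_def by measurable
qed

lemma prob_measures_onD:
  assumes "M \<in> prob_measures_on K" "compact K"
  shows "compact_prob M K"
  using assms by (auto simp: prob_measures_on_def compact_prob_def compact_prob_axioms_def)

lemma prob_measures_onI:
  assumes "compact_prob M K" shows "M \<in> prob_measures_on K"
  using assms by (auto simp: prob_measures_on_def compact_prob_def compact_prob_axioms_def)

context compact_prob begin

lemma epot_measurable' [measurable]: "epot R M \<in> borel_measurable borel"
  by (rule epot_measurable) (unfold_locales, rule setsM)

text \<open>
  Scaling the kernel by a large \<open>R\<close> makes it nonnegative on the carrier and shifts the energy by
  \<open>ln R\<close>, since the total mass is 1. From here on energies are extended nonnegative integrals.
\<close>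

lemma log_energy_eq:
  assumes R: "R \<ge> 1" "K \<subseteq> ball 0 (R/2)"
  shows "log_energy M = enn2ereal (energy R M) - ereal (ln R)"
proof -
  define p where "p = (\<lambda>z t. e2ennreal (log_kernel z t))"
  define n where "n = (\<lambda>z t. e2ennreal (- log_kernel z t))"
  have [measurable]: "case_prod p \<in> borel_measurable (borel \<Otimes>\<^sub>M borel)"
    unfolding p_def log_kernel_def
  proof -
    have eq: "(\<lambda>(z,t). e2ennreal (if z = t then \<infinity> else ereal (ln (1 / cmod (z - t)))))
      = (\<lambda>x. if cmod (fst x - snd x) = 0 then \<infinity> else ennreal (ln (1 / cmod (fst x - snd x))))"
      by (auto simp: fun_eq_iff e2ennreal_infty)
    show "(\<lambda>(z,t). e2ennreal (if z = t then \<infinity> else ereal (ln (1 / cmod (z - t))))) \<in> borel_measurable (borel \<Otimes>\<^sub>M borel)"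
      unfolding eq by measurable
  qed
  have [measurable]: "case_prod n \<in> borel_measurable (borel \<Otimes>\<^sub>M borel)"
    unfolding n_def log_kernel_def
  proof -
    have eq: "(\<lambda>(z,t). e2ennreal (- (if z = t then \<infinity> else ereal (ln (1 / cmod (z - t))))))
      = (\<lambda>x. if cmod (fst x - snd x) = 0 then 0 else ennreal (- ln (1 / cmod (fst x - snd x))))"
      by (auto simp: fun_eq_iff e2ennreal_neg)
    show "(\<lambda>(z,t). e2ennreal (- (if z = t then \<infinity> else ereal (ln (1 / cmod (z - t)))))) \<in> borel_measurable (borel \<Otimes>\<^sub>M borel)"
      unfolding eq by measurable
  qed
  have pt: "p z t + ennreal (ln R) = pos_log_kernel R (cmod (z - t)) + n z t" "n z t \<le> ennreal (ln R)"
    if "z \<in> K" "t \<in> K" for z t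
  proof -
    have le: "cmod (z - t) \<le> R"
      using that R norm_triangle_ineq4[of z t] by (auto simp: subset_iff) (smt (verit) field_sum_of_halves)
    have "p z t + ennreal (ln R) = pos_log_kernel R (cmod (z - t)) + n z t \<and> n z t \<le> ennreal (ln R)"
    proof (cases "z = t")
      case True
      then show ?thesis by (auto simp: p_def n_def log_kernel_def pos_log_kernel_def e2ennreal_infty e2ennreal_neg)
    next
      case False
      define y where "y = ln (1 / cmod (z - t))"
      have lR: "ln (R / cmod (z - t)) = ln R + y"
        using False R by (simp add: y_def ln_div)
      have nn: "ln R + y \<ge> 0" unfolding lR[symmetric] using False le R by (intro ln_ge_zero) (auto simp: field_simps)
      have "ln R \<ge> 0" using R by simp
      have "ennreal y + ennreal (ln R) = ennreal (ln R + y) + ennreal (- y)"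
      proof (cases "y \<ge> 0")
        case True
        then show ?thesis using \<open>ln R \<ge> 0\<close> by (simp add: ennreal_neg add.commute flip: ennreal_plus)
      next
        case False
        then show ?thesis using nn by (simp add: ennreal_neg flip: ennreal_plus)
      qed
      moreover have "ennreal (- y) \<le> ennreal (ln R)" using nn by (intro ennreal_leI) auto
      ultimately show ?thesis using False by (simp add: p_def n_def log_kernel_def pos_log_kernel_def lR flip: y_def)
    qed
    then show "p z t + ennreal (ln R) = pos_log_kernel R (cmod (z - t)) + n z t" "n z t \<le> ennreal (ln R)" by auto
  qed
  define P where "P = (\<integral>\<^sup>+ z. (\<integral>\<^sup>+ t. p z t \<partial>M) \<partial>M)"
  define Nn where "Nn = (\<integral>\<^sup>+ z. (\<integral>\<^sup>+ t. n z t \<partial>M) \<partial>M)"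
  have "P + ennreal (ln R) = (\<integral>\<^sup>+ z. (\<integral>\<^sup>+ t. p z t + ennreal (ln R) \<partial>M) \<partial>M)"
    by (simp add: P_def nn_integral_add emeasure_space_1)
  also have "\<dots> = (\<integral>\<^sup>+ z. (\<integral>\<^sup>+ t. pos_log_kernel R (cmod (z - t)) + n z t \<partial>M) \<partial>M)"
  proof (rule nn_integral_cong_AE, use AE_K in eventually_elim)
    fix z assume z: "z \<in> K"
    show "(\<integral>\<^sup>+ t. p z t + ennreal (ln R) \<partial>M) = (\<integral>\<^sup>+ t. pos_log_kernel R (cmod (z - t)) + n z t \<partial>M)"
      by (rule nn_integral_cong_AE, use AE_K in eventually_elim) (rule pt(1)[OF z])
  qed
  also have "\<dots> = energy R M + Nn"
    by (simp add: nn_integral_add energy_def epot_def Nn_def)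
  finally have eq: "P + ennreal (ln R) = energy R M + Nn" .
  have "Nn \<le> (\<integral>\<^sup>+ z. (\<integral>\<^sup>+ t. ennreal (ln R) \<partial>M) \<partial>M)"
    unfolding Nn_def
  proof (rule nn_integral_mono_AE, use AE_K in eventually_elim)
    fix z assume z: "z \<in> K"
    show "(\<integral>\<^sup>+ t. n z t \<partial>M) \<le> (\<integral>\<^sup>+ t. ennreal (ln R) \<partial>M)"
      by (rule nn_integral_mono_AE, use AE_K in eventually_elim) (rule pt(2)[OF z])
  qed
  then have "Nn \<le> ennreal (ln R)" by (simp add: emeasure_space_1)
  then have "Nn < \<infinity>" by (simp add: le_less_trans)
  then obtain nr where nr: "Nn = ennreal nr" "nr \<ge> 0" by (cases Nn) auto
  have lR: "ln R \<ge> 0" using R by simp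
  have "enn2ereal P - enn2ereal Nn = enn2ereal (energy R M) - ereal (ln R)"
  proof (cases P)
    case (real a)
    then have "energy R M < \<infinity>" using eq by (cases "energy R M") (auto simp: nr lR simp flip: ennreal_plus)
    then obtain e where e: "energy R M = ennreal e" "e \<ge> 0" by (cases "energy R M") auto
    have "a + ln R = e + nr" using eq real nr e lR by (simp flip: ennreal_plus)
    then show ?thesis using real nr e lR by (simp add: enn2ereal_ennreal)
  next
    case top
    then have "energy R M = top" using eq nr by (cases "energy R M") (auto simp flip: ennreal_plus)
    then show ?thesis using top nr by simp
  qed
  then show ?thesis
    by (simp add: log_energy_def P_def Nn_def p_def n_def)
qed

end

text \<open>
  Compare \<open>M\<close> with the measure obtained by removing the fraction \<open>t\<close> of its mass from the set \<open>A\<close>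
  where the potential exceeds \<open>W + \<eta>\<close> and renormalizing. Expanding the quadratic form, the energy
  drops by at least \<open>2 t \<eta> M(A)\<close> to first order, and the total drop is limited by \<open>\<epsilon>\<close> because \<open>W\<close>
  bounds all energies from below. The slack \<open>\<epsilon>\<close> makes the lemma applicable to measures whose
  energy is merely close to an infimum.
\<close>

lemma energy_variation:
  assumes M: "compact_prob M K"
    and W: "W \<ge> 0" and min: "\<And>T. T \<in> prob_measures_on K \<Longrightarrow> ennreal W \<le> energy R T"
    and en: "energy R M \<le> ennreal (W + \<epsilon>)" "\<epsilon> \<ge> 0"
    and t: "0 < t" "t < 1" and \<eta>: "\<eta> \<ge> 0"
  shows "2 * t * \<eta> * measure M {z. ennreal (W + \<eta>) < epot R M z} \<le> \<epsilon> + t\<^sup>2 * (W + \<epsilon>)"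
proof -
  interpret compact_prob M K by fact
  define A where "A = {z. ennreal (W + \<eta>) < epot R M z}"
  have [measurable]: "A \<in> sets borel" unfolding A_def by measurable
  have AM: "A \<in> sets M" using setsM by simp
  define \<alpha> where "\<alpha> = measure M A"
  have \<alpha>: "0 \<le> \<alpha>" "\<alpha> \<le> 1" by (auto simp: \<alpha>_def)
  define q where "q = (\<lambda>z t. pos_log_kernel R (cmod (z - t)))"
  have [measurable]: "case_prod q \<in> borel_measurable (borel \<Otimes>\<^sub>M borel)" unfolding q_def by measurable
  have qsym: "q z w = q w z" for z w by (simp add: q_def norm_minus_commute)
  define a where "a = (\<lambda>z. t * indicat_real A z)"
  have [measurable]: "a \<in> borel_measurable borel" unfolding a_def by measurable
  have a01: "0 \<le> a z" "a z < 1" for z using t by (auto simp: a_def indicator_def)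
  define m where "m = 1 - t * \<alpha>"
  have "t * \<alpha> \<le> t * 1" using t \<alpha> by (intro mult_left_mono) auto
  then have m: "m > 0" unfolding m_def using t by linarith
  \<comment> \<open>the competitor: a fraction \<open>t\<close> of the mass on \<open>A\<close> is removed\<close>
  define T where "T = density M (\<lambda>z. ennreal ((1 - a z) / m))"
  have inta: "(\<integral>\<^sup>+ z. ennreal ((1 - a z) / m) \<partial>M) = 1"
  proof -
    have iA: "integrable M (indicat_real A)"
      using AM by (intro integrable_real_indicator) (auto simp: emeasure_eq_measure)
    have "(\<integral> z. (1 - a z) \<partial>M) = 1 - t * \<alpha>"
      using AM iA prob_space by (simp add: a_def \<alpha>_def space_M)
    moreover have ia: "integrable M (\<lambda>z. (1 - a z))"
      using iA by (auto simp: a_def)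
    ultimately have "(\<integral> z. (1 - a z) / m \<partial>M) = 1" using m by (simp add: m_def)
    moreover have "(\<integral>\<^sup>+ z. ennreal ((1 - a z) / m) \<partial>M) = ennreal (\<integral> z. (1 - a z) / m \<partial>M)"
      using ia m a01 by (intro nn_integral_eq_integral) (auto intro!: divide_nonneg_pos simp: less_imp_le)
    ultimately show ?thesis by simp
  qed
  have "T \<in> prob_measures_on K"
  proof (rule prob_measures_onI)
    have "emeasure T (space T) = 1" unfolding T_def using inta by (simp add: emeasure_density)
    then have p: "prob_space T" by (rule prob_spaceI)
    moreover have "emeasure T K = 1"
    proof -
      have "AE z in T. z \<in> K" unfolding T_def using AE_K by (subst AE_density) auto
      moreover have "K \<in> sets T" using setsM K_sets by (simp add: T_def)
      ultimately show ?thesis using p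
        by (simp add: prob_space.emeasure_eq_1_AE)
    qed
    ultimately show "compact_prob T K"
      using setsM K_compact by (auto simp: compact_prob_def compact_prob_axioms_def T_def)
  qed
  then have le: "ennreal W \<le> energy R T" by (rule min)
  define X where "X = (\<integral>\<^sup>+ z. (\<integral>\<^sup>+ w. ennreal ((1 - a z) * (1 - a w)) * q z w \<partial>M) \<partial>M)"
  have enT: "energy R T = ennreal (1 / m\<^sup>2) * X"
  proof -
    have "energy R T = (\<integral>\<^sup>+ z. ennreal ((1 - a z) / m) * (\<integral>\<^sup>+ w. ennreal ((1 - a w) / m) * q z w \<partial>M) \<partial>M)"
      unfolding energy_def epot_def T_def q_def
      by (simp add: nn_integral_density)
    also have "\<dots> = (\<integral>\<^sup>+ z. (\<integral>\<^sup>+ w. ennreal (1 / m\<^sup>2) * (ennreal ((1 - a z) * (1 - a w)) * q z w) \<partial>M) \<partial>M)"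
    proof (intro nn_integral_cong)
      fix z
      have "ennreal ((1 - a z) / m) * (ennreal ((1 - a w) / m) * q z w) = ennreal (1 / m\<^sup>2) * (ennreal ((1 - a z) * (1 - a w)) * q z w)" for w
        using a01[of z] a01[of w] m by (simp add: mult.assoc[symmetric] power2_eq_square flip: ennreal_mult)
      then show "ennreal ((1 - a z) / m) * (\<integral>\<^sup>+ w. ennreal ((1 - a w) / m) * q z w \<partial>M)
         = (\<integral>\<^sup>+ w. ennreal (1 / m\<^sup>2) * (ennreal ((1 - a z) * (1 - a w)) * q z w) \<partial>M)"
        by (simp add: nn_integral_cmult[symmetric])
    qed
    also have "\<dots> = ennreal (1 / m\<^sup>2) * X"
      by (simp add: X_def nn_integral_cmult)
    finally show ?thesis .
  qed
  define I where "I = energy R M"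
  have I_eq: "I = (\<integral>\<^sup>+ z. (\<integral>\<^sup>+ w. q z w \<partial>M) \<partial>M)" by (simp add: I_def energy_def epot_def q_def)
  define IA where "IA = (\<integral>\<^sup>+ z. indicator A z * epot R M z \<partial>M)"
  define IAA where "IAA = (\<integral>\<^sup>+ z. (\<integral>\<^sup>+ w. (indicator A z * indicator A w) * q z w \<partial>M) \<partial>M)"
  have IA1: "(\<integral>\<^sup>+ z. (\<integral>\<^sup>+ w. indicator A z * q z w \<partial>M) \<partial>M) = IA"
    by (simp add: IA_def epot_def q_def nn_integral_cmult)
  interpret pp: pair_sigma_finite M M by unfold_locales
  have IA2: "(\<integral>\<^sup>+ z. (\<integral>\<^sup>+ w. indicator A w * q z w \<partial>M) \<partial>M) = IA"
  proof -
    have "(\<integral>\<^sup>+ z. (\<integral>\<^sup>+ w. indicator A w * q z w \<partial>M) \<partial>M) = (\<integral>\<^sup>+ w. (\<integral>\<^sup>+ z. indicator A w * q z w \<partial>M) \<partial>M)"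
      by (rule pp.Fubini') measurable
    also have "\<dots> = IA" using qsym by (simp add: IA1[symmetric])
    finally show ?thesis .
  qed
  \<comment> \<open>the expansion of the quadratic form, rearranged so that no infinite quantity is subtracted\<close>
  have key: "X + ennreal (2 * t) * IA = I + ennreal (t\<^sup>2) * IAA"
  proof -
    have "X + ennreal (2 * t) * IA = X + (ennreal t * IA + ennreal t * IA)"
      using t by (simp flip: distrib_right ennreal_plus)
    also have "\<dots> = (\<integral>\<^sup>+ z. (\<integral>\<^sup>+ w. ennreal ((1 - a z) * (1 - a w)) * q z w
          + (ennreal t * (indicator A z * q z w) + ennreal t * (indicator A w * q z w)) \<partial>M) \<partial>M)"
      unfolding X_def
      by (subst (1) IA1[symmetric], subst IA2[symmetric]) (simp add: nn_integral_add nn_integral_cmult)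
    also have "\<dots> = (\<integral>\<^sup>+ z. (\<integral>\<^sup>+ w. q z w + ennreal (t\<^sup>2) * ((indicator A z * indicator A w) * q z w) \<partial>M) \<partial>M)"
    proof (intro nn_integral_cong)
      fix z w
      have "ennreal ((1 - a z) * (1 - a w)) + (ennreal (a z) + ennreal (a w)) = 1 + ennreal (a z * a w)"
      proof -
        have nn: "0 \<le> (1 - a z) * (1 - a w)" "0 \<le> a z * a w"
          using a01[of z] a01[of w] by auto
        have "ennreal ((1 - a z) * (1 - a w)) + (ennreal (a z) + ennreal (a w))
            = ennreal ((1 - a z) * (1 - a w) + (a z + a w))"
          using a01[of z] a01[of w] nn(1) by (simp only: ennreal_plus add_nonneg_nonneg)
        also have "(1 - a z) * (1 - a w) + (a z + a w) = 1 + a z * a w"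
          by (simp add: algebra_simps)
        also have "ennreal (1 + a z * a w) = 1 + ennreal (a z * a w)"
          using nn(2) by (simp add: ennreal_plus)
        finally show ?thesis .
      qed
      moreover have "ennreal (a z) = ennreal t * indicator A z" for z
        by (simp add: a_def indicator_def)
      moreover have "ennreal (a z * a w) = ennreal (t\<^sup>2) * (indicator A z * indicator A w)"
        by (simp add: a_def indicator_def power2_eq_square)
      ultimately have *: "ennreal ((1 - a z) * (1 - a w)) + (ennreal t * indicator A z + ennreal t * indicator A w) = 1 + ennreal (t\<^sup>2) * (indicator A z * indicator A w)"
        by simp
      show "ennreal ((1 - a z) * (1 - a w)) * q z w
          + (ennreal t * (indicator A z * q z w) + ennreal t * (indicator A w * q z w))
         = q z w + ennreal (t\<^sup>2) * ((indicator A z * indicator A w) * q z w)"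
        using arg_cong[OF *, of "\<lambda>x. x * q z w"] by (simp only: distrib_right mult.assoc mult_1)
    qed
    also have "\<dots> = I + ennreal (t\<^sup>2) * IAA"
      by (simp add: I_eq IAA_def nn_integral_add nn_integral_cmult)
    finally show ?thesis .
  qed
  have "IAA \<le> I" unfolding IAA_def I_eq
    by (intro nn_integral_mono) (auto simp: indicator_def)
  have "IA \<le> I" unfolding IA_def I_def energy_def
    by (intro nn_integral_mono) (auto simp: indicator_def)
  have "ennreal ((W + \<eta>) * \<alpha>) \<le> IA"
  proof -
    have "ennreal ((W + \<eta>) * \<alpha>) = (\<integral>\<^sup>+ z. ennreal (W + \<eta>) * indicator A z \<partial>M)"
      using AM W \<eta> \<alpha> by (simp add: nn_integral_cmult_indicator emeasure_eq_measure \<alpha>_def ennreal_mult)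
    also have "\<dots> \<le> IA" unfolding IA_def
      by (intro nn_integral_mono) (auto simp: indicator_def A_def)
    finally show ?thesis .
  qed
  have Ifin: "I < \<infinity>" using en by (simp add: I_def le_less_trans)
  obtain i where i: "I = ennreal i" "i \<ge> 0" using Ifin by (cases I) auto
  obtain ia where ia: "IA = ennreal ia" "ia \<ge> 0" using Ifin \<open>IA \<le> I\<close> by (cases IA) auto
  obtain iaa where iaa: "IAA = ennreal iaa" "iaa \<ge> 0" using Ifin \<open>IAA \<le> I\<close> by (cases IAA) auto
  have "X < \<infinity>"
  proof -
    have "X \<le> I + ennreal (t\<^sup>2) * IAA" unfolding key[symmetric] by simp
    also have "\<dots> = ennreal (i + t\<^sup>2 * iaa)" using i iaa by (simp add: ennreal_mult)
    finally show ?thesis by (simp add: le_less_trans)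
  qed
  then obtain x where x: "X = ennreal x" "x \<ge> 0" by (cases X) auto
  have k: "x + 2 * t * ia = i + t\<^sup>2 * iaa"
    using key t x ia i iaa by (simp add: ennreal_mult[symmetric] flip: ennreal_plus)
  have "W \<le> 1 / m\<^sup>2 * x"
    using le x m by (simp add: enT ennreal_mult[symmetric])
  then have w: "m\<^sup>2 * W \<le> x" using m by (simp add: field_simps)
  have i': "i \<le> W + \<epsilon>"
    using en W unfolding I_def[symmetric] i(1) by (subst (asm) ennreal_le_iff) auto
  have "iaa \<le> i" using \<open>IAA \<le> I\<close> i iaa by simp
  then have "t\<^sup>2 * iaa \<le> t\<^sup>2 * (W + \<epsilon>)" using i' by (intro mult_left_mono) auto
  moreover have "(W + \<eta>) * \<alpha> \<le> ia" using \<open>ennreal ((W + \<eta>) * \<alpha>) \<le> IA\<close> ia by simp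
  then have "2 * t * ((W + \<eta>) * \<alpha>) \<le> 2 * t * ia" using t by (intro mult_left_mono) auto
  moreover have "m\<^sup>2 * W = W - 2 * t * (W * \<alpha>) + (t * \<alpha>)\<^sup>2 * W"
    by (simp add: m_def power2_eq_square algebra_simps)
  moreover have "(t * \<alpha>)\<^sup>2 * W \<ge> 0" using W by simp
  ultimately have "2 * t * ((W + \<eta>) * \<alpha>) - 2 * t * (W * \<alpha>) \<le> \<epsilon> + t\<^sup>2 * (W + \<epsilon>)"
    using k w i' by linarith
  then show ?thesis unfolding A_def[symmetric] \<alpha>_def[symmetric]
    by (simp add: algebra_simps)
qed

section \<open>The maximum principle for potentials\<close>

lemma pos_log_kernel_tendsto:
  assumes R: "R > 0" and x: "x \<longlonglongrightarrow> l" and nn: "\<And>n. x n \<ge> 0"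
  shows "(\<lambda>n. pos_log_kernel R (x n)) \<longlonglongrightarrow> pos_log_kernel R l"
proof (cases "l = 0")
  case False
  have "l \<ge> 0" by (rule LIMSEQ_le_const[OF x]) (use nn in auto)
  then have l: "l > 0" using False by simp
  have "\<forall>\<^sub>F n in sequentially. x n > 0"
    using order_tendstoD(1)[OF x l] .
  have lim: "(\<lambda>n. ennreal (ln (R / x n))) \<longlonglongrightarrow> ennreal (ln (R / l))"
    using l R by (intro tendsto_ennrealI tendsto_intros x) auto
  have ev: "\<forall>\<^sub>F n in sequentially. ennreal (ln (R / x n)) = pos_log_kernel R (x n)"
    using \<open>\<forall>\<^sub>F n in sequentially. x n > 0\<close> by eventually_elim (simp add: pos_log_kernel_def)
  have "(\<lambda>n. pos_log_kernel R (x n)) \<longlonglongrightarrow> ennreal (ln (R / l))"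
    by (rule Lim_transform_eventually[OF lim ev])
  then show ?thesis using False by (simp add: pos_log_kernel_def)
next
  case True
  have "(\<lambda>n. pos_log_kernel R (x n)) \<longlonglongrightarrow> top"
    unfolding tendsto_top_iff_ennreal
  proof (intro allI impI)
    fix b :: real assume b: "b \<ge> 0"
    have "\<forall>\<^sub>F n in sequentially. x n < R / exp (b + 1)"
      using order_tendstoD(2)[OF x] R True by simp
    then show "\<forall>\<^sub>F n in sequentially. ennreal b < pos_log_kernel R (x n)"
    proof eventually_elim
      case (elim n)
      show ?case
      proof (cases "x n = 0")
        case False
        then have xp: "x n > 0" using nn[of n] by simp
        then have "exp (b + 1) < R / x n" using elim R by (simp add: field_simps)
        then have "ln (exp (b + 1)) < ln (R / x n)" using R xp by (subst ln_less_cancel_iff) auto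
        then have "b < ln (R / x n)" by simp
        then show ?thesis using False b by (simp add: pos_log_kernel_def ennreal_less_iff)
      qed (simp add: pos_log_kernel_def)
    qed
  qed
  then show ?thesis using True by (simp add: pos_log_kernel_def)
qed

context compact_prob begin

text \<open>
  Lower semicontinuity of the potential, by Fatou.
\<close>

lemma epot_le_closed:
  assumes R: "R > 0"
  shows "closed {z. epot R M z \<le> c}"
  unfolding closed_sequential_limits
proof (intro allI impI, elim conjE)
  fix x :: "nat \<Rightarrow> complex" and l
  assume x: "\<forall>n. x n \<in> {z. epot R M z \<le> c}" "x \<longlonglongrightarrow> l"
  have "epot R M l = (\<integral>\<^sup>+ t. liminf (\<lambda>n. pos_log_kernel R (cmod (x n - t))) \<partial>M)"
    unfolding epot_def
  proof (intro nn_integral_cong)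
    fix t
    have "(\<lambda>n. pos_log_kernel R (cmod (x n - t))) \<longlonglongrightarrow> pos_log_kernel R (cmod (l - t))"
      by (rule pos_log_kernel_tendsto[OF R]) (auto intro!: tendsto_intros x)
    then show "pos_log_kernel R (cmod (l - t)) = liminf (\<lambda>n. pos_log_kernel R (cmod (x n - t)))"
      by (simp add: lim_imp_Liminf)
  qed
  also have "\<dots> \<le> liminf (\<lambda>n. epot R M (x n))"
    unfolding epot_def by (rule nn_integral_liminf) measurable
  also have "\<dots> \<le> liminf (\<lambda>n. c)"
    by (rule Liminf_mono) (use x in auto)
  also have "\<dots> = c" by (simp add: Liminf_const)
  finally show "l \<in> {z. epot R M z \<le> c}" by simp
qed

lemma in_radius:
  assumes "K \<subseteq> ball 0 (R/2)" "z \<in> ball 0 (R/2)" "t \<in> K"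
  shows "cmod (z - t) < R"
proof -
  have "cmod t < R/2" "cmod z < R/2" using assms by auto
  then show ?thesis using norm_triangle_ineq4[of z t] by linarith
qed

lemma epot_finiteD:
  assumes R: "R > 0" "K \<subseteq> ball 0 (R/2)" and z: "z \<in> ball 0 (R/2)"
    and le: "epot R M z \<le> ennreal c" "c \<ge> 0"
  shows "integrable M (\<lambda>t. ln (cmod (z - t)))" "AE t in M. t \<noteq> z" "pot M z \<le> c - ln R"
proof -
  have "(\<integral>\<^sup>+ t. pos_log_kernel R (cmod (z - t)) \<partial>M) \<noteq> \<infinity>"
    using le unfolding epot_def by (auto simp: top_unique)
  then have "AE t in M. pos_log_kernel R (cmod (z - t)) \<noteq> \<infinity>"
    by (intro nn_integral_noteq_infinite) auto
  then show ne: "AE t in M. t \<noteq> z"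
    by eventually_elim (auto simp: pos_log_kernel_def)
  define f where "f = (\<lambda>t. ln R - ln (cmod (z - t)))"
  have AEf: "AE t in M. pos_log_kernel R (cmod (z - t)) = ennreal (f t) \<and> 0 \<le> f t"
    using ne AE_K
  proof eventually_elim
    fix t assume t: "t \<noteq> z" "t \<in> K"
    have "cmod (z - t) < R" by (rule in_radius[OF R(2) z t(2)])
    moreover have "cmod (z - t) > 0" using t by simp
    ultimately show "pos_log_kernel R (cmod (z - t)) = ennreal (f t) \<and> 0 \<le> f t"
      using R t by (auto simp: pos_log_kernel_def f_def ln_div)
  qed
  have eq: "epot R M z = (\<integral>\<^sup>+ t. ennreal (f t) \<partial>M)"
    unfolding epot_def by (rule nn_integral_cong_AE) (use AEf in auto)
  have [measurable]: "f \<in> borel_measurable M" unfolding f_def by measurable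
  have "(\<integral>\<^sup>+ t. ennreal (f t) \<partial>M) < \<infinity>"
    using le_less_trans[OF le(1) ennreal_less_top] unfolding eq by simp
  then have fi: "integrable M f"
    using AEf by (intro integrableI_nonneg) auto
  then have "integrable M (\<lambda>t. ln R - f t)" by auto
  then show i: "integrable M (\<lambda>t. ln (cmod (z - t)))" by (simp add: f_def)
  have "ennreal (integral\<^sup>L M f) \<le> ennreal c"
    using nn_integral_eq_integral[OF fi] AEf le eq by simp
  then have "integral\<^sup>L M f \<le> c" using le(2) by (subst (asm) ennreal_le_iff) auto
  moreover have "integral\<^sup>L M f = ln R + pot M z"
    using i prob_space by (simp add: f_def pot_def)
  ultimately show "pot M z \<le> c - ln R" by simp
qed

lemma epot_eq_pot:
  assumes R: "R > 0" "K \<subseteq> ball 0 (R/2)" and z: "z \<in> ball 0 (R/2)"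
    and i: "integrable M (\<lambda>t. ln (cmod (z - t)))" "AE t in M. t \<noteq> z"
  shows "epot R M z = ennreal (pot M z + ln R)"
proof -
  define f where "f = (\<lambda>t. ln R - ln (cmod (z - t)))"
  have AEf: "AE t in M. pos_log_kernel R (cmod (z - t)) = ennreal (f t) \<and> 0 \<le> f t"
    using i(2) AE_K
  proof eventually_elim
    fix t assume t: "t \<noteq> z" "t \<in> K"
    have "cmod (z - t) < R" by (rule in_radius[OF R(2) z t(2)])
    moreover have "cmod (z - t) > 0" using t by simp
    ultimately show "pos_log_kernel R (cmod (z - t)) = ennreal (f t) \<and> 0 \<le> f t"
      using R t by (auto simp: pos_log_kernel_def f_def ln_div)
  qed
  have fi: "integrable M f" using i(1) by (simp add: f_def)
  have "epot R M z = (\<integral>\<^sup>+ t. ennreal (f t) \<partial>M)"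
    unfolding epot_def by (rule nn_integral_cong_AE) (use AEf in auto)
  also have "\<dots> = ennreal (integral\<^sup>L M f)"
    by (rule nn_integral_eq_integral[OF fi]) (use AEf in auto)
  also have "integral\<^sup>L M f = pot M z + ln R"
    using i prob_space by (simp add: f_def pot_def)
  finally show ?thesis .
qed

text \<open>
  Continuity from above along shrinking discs.
\<close>

lemma measure_small_ball:
  assumes "AE t in M. t \<noteq> z" "e > 0"
  obtains r where "r > 0" "measure M (ball z r) < e"
proof -
  have "(\<lambda>n. measure M (ball z (1 / real (Suc n)))) \<longlonglongrightarrow> measure M (\<Inter>n. ball z (1 / real (Suc n)))"
  proof (rule finite_Lim_measure_decseq)
    show "decseq (\<lambda>n. ball z (1 / real (Suc n)))"
      by (intro decseq_SucI subset_ball frac_le) auto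
  qed (auto simp: setsM)
  also have "(\<Inter>n. ball z (1 / real (Suc n))) = {z}"
  proof -
    have "x = z" if "\<And>n. dist z x < 1 / real (Suc n)" for x
    proof (rule ccontr)
      assume "x \<noteq> z"
      then obtain n where "1 / real (Suc n) < dist z x" using nat_approx_posE[of "dist z x"] by auto
      then show False using \<open>\<And>n. dist z x < 1 / real (Suc n)\<close>[of n] by simp
    qed
    then show ?thesis by auto
  qed
  also have "measure M {z} = 0"
  proof -
    have "{z} \<in> null_sets M" using assms(1) setsM by (subst AE_iff_null_sets) auto
    then show ?thesis by (simp add: measure_eq_0_null_sets)
  qed
  finally have "(\<lambda>n. measure M (ball z (1 / real (Suc n)))) \<longlonglongrightarrow> 0" .
  from order_tendstoD(2)[OF this assms(2)] obtain n where "measure M (ball z (1 / real (Suc n))) < e"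
    unfolding eventually_sequentially by blast
  then show thesis using that[of "1 / real (Suc n)"] by simp
qed

text \<open>
  Off the carrier \<open>K\<close> the potential has the mean value property, so by the maximum principle it
  suffices to control it near \<open>K\<close> and at infinity. Near \<open>K\<close> compare \<open>w\<close> with its closest point \<open>\<xi>\<close>
  in \<open>K\<close>: since \<open>\<bar>\<xi> - t\<bar> \<le> 2 \<bar>w - t\<bar>\<close> for all \<open>t\<close> in \<open>K\<close>, masses near \<open>w\<close> contribute at most
  \<open>ln 2\<close> times the mass of a small disc, which is small as there are no atoms, and the other
  masses contribute little because \<open>w\<close> and \<open>\<xi>\<close> are close.
\<close>

theorem maria_frostman:
  assumes R: "R > 0" "K \<subseteq> ball 0 (R/2)"
    and le: "\<And>z. z \<in> K \<Longrightarrow> epot R M z \<le> ennreal c" "c \<ge> 0"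
  shows "integrable M (\<lambda>t. ln (cmod (z - t)))" "AE t in M. t \<noteq> z" "pot M z \<le> c - ln R"
proof -
  have inK: "integrable M (\<lambda>t. ln (cmod (z - t)))" "AE t in M. t \<noteq> z" "pot M z \<le> c - ln R" if "z \<in> K" for z
    using epot_finiteD[OF R _ le(1)[OF that] le(2)] that R(2) by auto
  have offK: "integrable M (\<lambda>t. ln (cmod (z - t)))" "AE t in M. t \<noteq> z" if "z \<notin> K" for z
    using integrable_ln_off[OF that] AE_K that by (auto elim: eventually_mono)
  show "integrable M (\<lambda>t. ln (cmod (z - t)))" "AE t in M. t \<noteq> z"
    using inK offK by (cases "z \<in> K"; blast)+
  define m where "m = c - ln R"
  have near: "\<exists>\<delta>>0. \<forall>w\<in>ball \<zeta> \<delta> - K. pot M w < m + \<epsilon>" if \<zeta>: "\<zeta> \<in> K" and \<epsilon>: "\<epsilon> > 0" for \<zeta> \<epsilon>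
  proof -
    obtain r where r: "r > 0" "measure M (ball \<zeta> r) < \<epsilon>/4"
      using measure_small_ball[OF inK(2)[OF \<zeta>], of "\<epsilon>/4"] \<epsilon> by auto
    define \<delta> where "\<delta> = min (r/2) (r * \<epsilon> / 8)"
    have \<delta>: "\<delta> > 0" "\<delta> \<le> r/2" "\<delta> \<le> r * \<epsilon> / 8" using r \<epsilon> by (auto simp: \<delta>_def)
    define \<kappa> where "\<kappa> = \<delta> / (r - \<delta>)"
    have rd: "r - \<delta> > 0" using \<delta> r by linarith
    have \<kappa>0: "\<kappa> \<ge> 0" using \<delta> rd by (simp add: \<kappa>_def)
    have "\<kappa> \<le> (r * \<epsilon> / 8) / (r / 2)"
      unfolding \<kappa>_def using \<delta> r rd by (intro frac_le) auto
    then have \<kappa>: "\<kappa> \<le> \<epsilon> / 4" using r by (simp add: field_simps)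
    have "pot M w < m + \<epsilon>" if w: "w \<in> ball \<zeta> \<delta> - K" for w
    proof -
      obtain \<xi> where \<xi>: "\<xi> \<in> K" "\<And>t. t \<in> K \<Longrightarrow> dist w \<xi> \<le> dist w t"
        using distance_attains_inf[OF compact_imp_closed[OF K_compact] K_nonempty, of w] by blast
      have d: "cmod (w - \<xi>) < \<delta>"
        using \<xi>(2)[OF \<zeta>] w by (auto simp: dist_norm norm_minus_commute)
      have bound: "ln (cmod (\<xi> - t)) - ln (cmod (w - t)) \<le> ln 2 * indicator (ball \<zeta> r) t + \<kappa>"
        if t: "t \<in> K" "t \<noteq> \<xi>" for t
      proof -
        have wt: "cmod (w - t) > 0" "cmod (\<xi> - t) > 0" using t w by auto
        have eq: "ln (cmod (\<xi> - t)) - ln (cmod (w - t)) = ln (cmod (\<xi> - t) / cmod (w - t))"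
          using wt by (simp add: ln_div)
        have tri: "cmod (\<xi> - t) \<le> cmod (w - \<xi>) + cmod (w - t)"
          using norm_triangle_ineq[of "\<xi> - w" "w - t"] by (simp add: norm_minus_commute)
        show ?thesis
        proof (cases "t \<in> ball \<zeta> r")
          case True
          have "cmod (w - \<xi>) \<le> cmod (w - t)" using \<xi>(2)[OF t(1)] by (simp add: dist_norm)
          then have "cmod (\<xi> - t) / cmod (w - t) \<le> 2" using tri wt by (simp add: divide_le_eq)
          then have "ln (cmod (\<xi> - t) / cmod (w - t)) \<le> ln 2" using wt by (intro ln_mono) auto
          then show ?thesis using True \<kappa>0 eq by simp
        next
          case False
          have "r \<le> cmod (\<zeta> - t)" using False by (simp add: dist_norm)
          also have "\<dots> \<le> cmod (\<zeta> - w) + cmod (w - t)"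
            using norm_triangle_ineq[of "\<zeta> - w" "w - t"] by simp
          finally have rt: "r - \<delta> \<le> cmod (w - t)" using w by (simp add: dist_norm)
          have "ln (cmod (\<xi> - t) / cmod (w - t)) \<le> cmod (\<xi> - t) / cmod (w - t) - 1"
            using wt by (intro ln_le_minus_one) auto
          also have "\<dots> = (cmod (\<xi> - t) - cmod (w - t)) / cmod (w - t)" using wt by (simp add: diff_divide_distrib)
          also have "\<dots> \<le> \<delta> / cmod (w - t)" using tri d wt by (intro divide_right_mono) auto
          also have "\<dots> \<le> \<kappa>" unfolding \<kappa>_def using rt rd \<delta> wt by (intro divide_left_mono) auto
          finally show ?thesis using False eq by simp
        qed
      qed
      have i1: "integrable M (\<lambda>t. ln (cmod (\<xi> - t)))" by (rule inK(1)[OF \<xi>(1)])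
      have i2: "integrable M (\<lambda>t. ln (cmod (w - t)))" using w by (intro offK) auto
      have ib: "integrable M (indicat_real (ball \<zeta> r))"
        using setsM by (intro integrable_real_indicator) (auto simp: emeasure_eq_measure)
      have "(\<integral> t. ln (cmod (\<xi> - t)) - ln (cmod (w - t)) \<partial>M) \<le> (\<integral> t. ln 2 * indicator (ball \<zeta> r) t + \<kappa> \<partial>M)"
      proof (rule integral_mono_AE)
        show "AE t in M. ln (cmod (\<xi> - t)) - ln (cmod (w - t)) \<le> ln 2 * indicator (ball \<zeta> r) t + \<kappa>"
          using AE_K inK(2)[OF \<xi>(1)] by eventually_elim (rule bound)
      qed (use i1 i2 ib in auto)
      also have "\<dots> = ln 2 * measure M (ball \<zeta> r) + \<kappa>"
        using ib prob_space by (simp add: space_M)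
      also have "\<dots> < \<epsilon>"
      proof -
        have "ln 2 * measure M (ball \<zeta> r) \<le> 1 * measure M (ball \<zeta> r)"
          using ln_2_less_1 by (intro mult_right_mono) auto
        then show ?thesis using r \<kappa> \<epsilon> by linarith
      qed
      finally have "pot M w - pot M \<xi> < \<epsilon>" using i1 i2 by (simp add: pot_def)
      then show ?thesis using inK(3)[OF \<xi>(1)] by (simp add: m_def)
    qed
    then show ?thesis using \<delta> by blast
  qed
  obtain R0 where R0: "R0 > 0" "K \<subseteq> ball 0 R0" by (rule K_radius)
  have opK: "open (-K)" using K_compact by (simp add: compact_imp_closed open_Compl)
  have usc: "open {z\<in>-K. pot M z < b}" for b
    using continuous_open_preimage[OF continuous_pot_off opK, of "{..<b}"]
    by (simp add: vimage_def Int_def)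
  have "pot M z \<le> m" if "z \<in> -K" for z
  proof (rule submean_max_principle[OF usc _ _ that])
    fix z assume z: "z \<in> -K"
    then obtain \<delta> where \<delta>: "\<delta> > 0" "\<And>t. t \<in> K \<Longrightarrow> \<delta> \<le> cmod (z - t)" using dist_K_pos by auto
    have "\<delta>/2 \<le> cmod (z - t)" if "t \<in> K" for t using \<delta>(1) \<delta>(2)[OF that] by linarith
    then have "pi * (\<delta>/2)\<^sup>2 * pot M z \<le> (LINT s:ball z (\<delta>/2)|lborel. pot M s)"
      using pot_ball_eq[of "\<delta>/2" z] \<delta>(1) by simp
    moreover have "cball z (\<delta>/2) \<subseteq> -K"
    proof
      fix x assume "x \<in> cball z (\<delta>/2)"
      then have "cmod (z - x) < \<delta>" using \<delta>(1) by (simp add: dist_norm)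
      then show "x \<in> -K" using \<delta>(2)[of x] by auto
    qed
    moreover have "set_integrable lborel (ball z (\<delta>/2)) (pot M)" by (rule pot_Fubini) auto
    ultimately show "\<exists>r>0. cball z r \<subseteq> -K \<and> set_integrable lborel (ball z r) (pot M) \<and> pi * r\<^sup>2 * pot M z \<le> (LINT s:ball z r|lborel. pot M s)"
      using \<delta>(1) by (intro exI[of _ "\<delta>/2"]) auto
  next
    fix \<epsilon> :: real assume \<epsilon>: "\<epsilon> > 0"
    obtain d where d: "\<And>\<zeta>. \<zeta> \<in> K \<Longrightarrow> d \<zeta> > 0" "\<And>\<zeta> w. \<zeta> \<in> K \<Longrightarrow> w \<in> ball \<zeta> (d \<zeta>) - K \<Longrightarrow> pot M w < m + \<epsilon>"
    proof -
      have "\<forall>\<zeta>\<in>K. \<exists>\<delta>>0. \<forall>w\<in>ball \<zeta> \<delta> - K. pot M w < m + \<epsilon>"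
        using near[OF _ \<epsilon>] by blast
      from bchoice[OF this] show thesis using that by blast
    qed
    define C where "C = {z\<in>-K. pot M z \<ge> m + \<epsilon>}"
    have "- C = {z\<in>-K. pot M z < m + \<epsilon>} \<union> (\<Union>\<zeta>\<in>K. ball \<zeta> (d \<zeta>))"
    proof (intro equalityI subsetI)
      fix x assume "x \<in> - C"
      then show "x \<in> {z\<in>-K. pot M z < m + \<epsilon>} \<union> (\<Union>\<zeta>\<in>K. ball \<zeta> (d \<zeta>))"
        using d(1)[of x] by (cases "x \<in> K") (auto simp: C_def intro!: bexI[of _ x])
    next
      fix x assume "x \<in> {z\<in>-K. pot M z < m + \<epsilon>} \<union> (\<Union>\<zeta>\<in>K. ball \<zeta> (d \<zeta>))"
      then show "x \<in> - C"
      proof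
        assume "x \<in> (\<Union>\<zeta>\<in>K. ball \<zeta> (d \<zeta>))"
        then obtain \<zeta> where z: "\<zeta> \<in> K" "x \<in> ball \<zeta> (d \<zeta>)" by blast
        show ?thesis using d(2)[OF z(1), of x] z(2) by (cases "x \<in> K") (auto simp: C_def)
      qed (auto simp: C_def)
    qed
    then have "open (- C)" using usc by auto
    then have "closed C" by (simp add: closed_def)
    moreover have "bounded C"
    proof (rule boundedI)
      fix x assume x: "x \<in> C"
      show "cmod x \<le> R0 + exp (- (m + \<epsilon>))"
      proof (rule ccontr)
        assume "\<not> ?thesis"
        then have gt: "exp (- (m + \<epsilon>)) < cmod x - R0" by simp
        have "0 < cmod x - R0"
          by (rule order.strict_trans[OF _ gt]) simp
        then have "R0 < cmod x" by simp
        then have "pot M x \<le> - ln (cmod x - R0)"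
          using R0 by (intro pot_far(2))
        moreover have "ln (exp (- (m + \<epsilon>))) < ln (cmod x - R0)"
          using gt \<open>R0 < cmod x\<close> by (subst ln_less_cancel_iff) auto
        ultimately show False using x by (simp add: C_def)
      qed
    qed
    ultimately have "compact C" by (simp add: compact_eq_bounded_closed)
    then show "\<exists>C. compact C \<and> C \<subseteq> - K \<and> (\<forall>z\<in>- K - C. pot M z \<le> m + \<epsilon>)"
      by (intro exI[of _ C]) (auto simp: C_def)
  qed
  then show "pot M z \<le> c - ln R"
    using inK(3) by (cases "z \<in> K") (auto simp: m_def)
qed

end

section \<open>Frostman's theorem\<close>

text \<open>
  For a minimizer, letting \<open>t\<close> be small in the first variation shows that the potential is at most
  \<open>W\<close> almost everywhere with respect to \<open>M\<close>. By semicontinuity this holds on a compact carrier,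
  and the maximum principle extends it to the plane.
\<close>

lemma frostman_upper:
  assumes M: "M \<in> prob_measures_on K" and K: "compact K"
    and R: "R > 0" "K \<subseteq> ball 0 (R/2)"
    and min: "\<And>T. T \<in> prob_measures_on K \<Longrightarrow> energy R M \<le> energy R T"
    and W: "energy R M = ennreal W" "W \<ge> 0"
  shows "integrable M (\<lambda>t. ln (cmod (z - t)))" "AE t in M. t \<noteq> z" "pot M z \<le> W - ln R"
proof -
  interpret compact_prob M K by (rule prob_measures_onD[OF M K])
  have null: "measure M {z. ennreal (W + \<eta>) < epot R M z} = 0" if \<eta>: "\<eta> > 0" for \<eta>
  proof (rule ccontr)
    define \<alpha> where "\<alpha> = measure M {z. ennreal (W + \<eta>) < epot R M z}"
    assume "\<not> ?thesis"
    then have \<alpha>: "\<alpha> > 0" unfolding \<alpha>_def by (simp add: zero_less_measure_iff)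
    \<comment> \<open>small enough for the quadratic term of the variation to lose against the linear one\<close>
    define t where "t = min (1/2) (\<eta> * \<alpha> / (W + 1))"
    have t: "0 < t" "t < 1" "t \<le> \<eta> * \<alpha> / (W + 1)" using \<alpha> \<eta> W by (auto simp: t_def)
    have "2 * t * \<eta> * \<alpha> \<le> 0 + t\<^sup>2 * (W + 0)"
      unfolding \<alpha>_def
      by (rule energy_variation[OF compact_prob_axioms W(2)]) (use min W t \<eta> in auto)
    then have "2 * (\<eta> * \<alpha>) \<le> t * W"
      using t(1) by (simp add: power2_eq_square mult.assoc)
    also have "\<dots> \<le> \<eta> * \<alpha> / (W + 1) * W" using t W by (intro mult_right_mono) auto
    also have "\<dots> = \<eta> * \<alpha> * (W / (W + 1))" by simp
    also have "\<dots> \<le> \<eta> * \<alpha> * 1" using \<alpha> \<eta> W by (intro mult_left_mono) auto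
    finally show False using \<alpha> \<eta> by (simp add: mult_less_0_iff not_le[symmetric])
  qed
  have "AE z in M. \<forall>n. epot R M z \<le> ennreal (W + 1 / real (Suc n))"
    unfolding AE_all_countable
  proof
    fix n
    have "{z. ennreal (W + 1 / real (Suc n)) < epot R M z} \<in> sets M" unfolding setsM by measurable
    then have "{z. ennreal (W + 1 / real (Suc n)) < epot R M z} \<in> null_sets M"
      using null[of "1 / real (Suc n)"] by (auto simp: null_sets_def emeasure_eq_measure)
    then show "AE z in M. epot R M z \<le> ennreal (W + 1 / real (Suc n))"
      by (rule AE_I') (auto simp: not_le)
  qed
  then have AEW: "AE z in M. epot R M z \<le> ennreal W"
  proof eventually_elim
    fix z assume *: "\<forall>n. epot R M z \<le> ennreal (W + 1 / real (Suc n))"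
    have "(\<lambda>n. ennreal (W + 1 / real (Suc n))) \<longlonglongrightarrow> ennreal (W + 0)"
      by (intro tendsto_ennrealI tendsto_intros LIMSEQ_Suc[OF lim_1_over_n, simplified])
         (simp add: LIMSEQ_inverse_real_of_nat flip: inverse_eq_divide del: of_nat_Suc)
    then show "epot R M z \<le> ennreal W"
      using * by (intro LIMSEQ_le_const) auto
  qed
  \<comment> \<open>a compact carrier on which the bound holds at every point\<close>
  define K' where "K' = K \<inter> {z. epot R M z \<le> ennreal W}"
  have cK': "compact K'" unfolding K'_def
    by (intro compact_Int_closed K_compact epot_le_closed R)
  have "AE z in M. z \<in> K'" using AEW AE_K by eventually_elim (simp add: K'_def)
  then have "emeasure M K' = 1"
    using cK' setsM by (subst emeasure_eq_1_AE) (auto simp: compact_imp_closed)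
  then interpret M': compact_prob M K'
    using setsM cK' by unfold_locales auto
  have le: "\<And>z. z \<in> K' \<Longrightarrow> epot R M z \<le> ennreal W" by (simp add: K'_def)
  have sub: "K' \<subseteq> ball 0 (R/2)" using R by (auto simp: K'_def)
  show "integrable M (\<lambda>t. ln (cmod (z - t)))" "AE t in M. t \<noteq> z" "pot M z \<le> W - ln R"
    using M'.maria_frostman[OF R(1) sub le W(2)] by auto
qed

lemma restrict_prob:
  assumes M: "compact_prob M K" and K': "compact K'" "K' \<subseteq> K" and m: "measure M K' > 0"
  defines "T \<equiv> density M (\<lambda>z. ennreal (1 / measure M K') * indicator K' z)"
  shows "compact_prob T K'" and "epot R T z \<le> ennreal (1 / measure M K') * epot R M z"
proof -
  interpret compact_prob M K by fact
  have [measurable]: "K' \<in> sets borel" using K' by (simp add: compact_imp_closed)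
  have em: "emeasure T A = ennreal (1 / measure M K') * emeasure M (A \<inter> K')" if "A \<in> sets borel" for A
  proof -
    have "emeasure T A = (\<integral>\<^sup>+ z. ennreal (1 / measure M K') * indicator (A \<inter> K') z \<partial>M)"
      using that setsM unfolding T_def by (subst emeasure_density) (auto intro!: nn_integral_cong simp: indicator_def)
    also have "\<dots> = ennreal (1 / measure M K') * emeasure M (A \<inter> K')"
      using that setsM by (subst nn_integral_cmult_indicator) auto
    finally show ?thesis .
  qed
  have one: "ennreal (1 / measure M K') * emeasure M K' = 1"
    using m by (simp add: emeasure_eq_measure flip: ennreal_mult)
  have "emeasure T UNIV = 1" "emeasure T K' = 1"
    using em[of UNIV] em[of K'] one by auto
  moreover have "space T = UNIV" by (simp add: T_def space_M)
  ultimately show "compact_prob T K'"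
    using K' setsM by (auto simp: compact_prob_def compact_prob_axioms_def T_def intro!: prob_spaceI)
  have "epot R T z = (\<integral>\<^sup>+ t. (ennreal (1 / measure M K') * indicator K' t) * pos_log_kernel R (cmod (z - t)) \<partial>M)"
    unfolding epot_def T_def by (rule nn_integral_density) measurable
  also have "\<dots> \<le> (\<integral>\<^sup>+ t. ennreal (1 / measure M K') * pos_log_kernel R (cmod (z - t)) \<partial>M)"
    by (intro nn_integral_mono) (auto simp: indicator_def)
  also have "\<dots> = ennreal (1 / measure M K') * epot R M z"
    unfolding epot_def by (rule nn_integral_cmult) measurable
  finally show "epot R T z \<le> ennreal (1 / measure M K') * epot R M z" .
qed

text \<open>
  A lower bound on the suprema of potentials is a lower bound on energies. If the infimum \<open>W0\<close> of
  the energies were below \<open>W\<close>, take a near-minimizer \<open>L\<close>: by the first variation its potential is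
  at most \<open>W0 + \<delta>\<close> off a set of mass at most \<open>\<delta>\<close>, so normalizing the restriction of \<open>L\<close> to the
  remaining compact set gives a measure whose potential is bounded by a number below \<open>W\<close>. Working
  with near-minimizers replaces the weak compactness argument for the existence of a minimizer.
\<close>

lemma energy_lower_bound:
  assumes H: "compact H" and R: "R > 0" "H \<subseteq> ball 0 (R/2)"
    and W: "W \<ge> 0"
    and sup: "\<And>T K c. \<lbrakk>compact_prob T K; K \<subseteq> H; \<And>z. integrable T (\<lambda>t. ln (cmod (z - t)));
        \<And>z. AE t in T. t \<noteq> z; \<And>z. pot T z \<le> c - ln R\<rbrakk> \<Longrightarrow> W \<le> c"
    and T: "T \<in> prob_measures_on H"
  shows "ennreal W \<le> energy R T"
proof (rule ccontr)
  assume "\<not> ennreal W \<le> energy R T"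
  define W0' where "W0' = (INF T \<in> prob_measures_on H. energy R T)"
  have lt: "W0' < ennreal W"
    unfolding W0'_def using \<open>\<not> ennreal W \<le> energy R T\<close> T
    by (meson INF_lower le_less_trans not_le)
  then obtain W0 where W0: "W0' = ennreal W0" "W0 \<ge> 0" by (cases W0') auto
  have W0W: "W0 < W" using lt W0 by (simp add: ennreal_less_iff)
  have min: "ennreal W0 \<le> energy R T" if "T \<in> prob_measures_on H" for T
    unfolding W0(1)[symmetric] W0'_def using that by (rule INF_lower)
  define \<delta> where "\<delta> = min (1/4) ((W - W0) / (2 * (W + 1)))"
  have "(W - W0) / (2 * (W + 1)) > 0" using W0W W by (intro divide_pos_pos) auto
  then have \<delta>: "0 < \<delta>" "\<delta> \<le> 1/4" "\<delta> \<le> (W - W0) / (2 * (W + 1))"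
    unfolding \<delta>_def by (simp_all only: min_less_iff_conj min.cobounded1 min.cobounded2) auto
  define t where "t = min (1/2) (2 * \<delta>\<^sup>2 / (W0 + 2))"
  have t: "0 < t" "t < 1" "t \<le> 2 * \<delta>\<^sup>2 / (W0 + 2)" using \<delta> W0 by (auto simp: t_def)
  \<comment> \<open>the admissible error of the near-minimizer must be of second order in \<open>t\<close>\<close>
  define \<epsilon> where "\<epsilon> = t\<^sup>2"
  have t2: "t\<^sup>2 \<le> 1" using t by (simp add: power_le_one)
  have \<epsilon>: "\<epsilon> > 0" "\<epsilon> \<le> 1" using t t2 by (auto simp: \<epsilon>_def)
  have "W0' < ennreal (W0 + \<epsilon>)" using W0 \<epsilon> by (simp add: ennreal_less_iff)
  then obtain L where L: "L \<in> prob_measures_on H" "energy R L < ennreal (W0 + \<epsilon>)"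
    unfolding W0'_def by (auto simp: INF_less_iff)
  interpret L: compact_prob L H by (rule prob_measures_onD[OF L(1) H])
  define A where "A = {z. ennreal (W0 + \<delta>) < epot R L z}"
  have [measurable]: "A \<in> sets borel" unfolding A_def by measurable
  have "2 * t * \<delta> * measure L A \<le> \<epsilon> + t\<^sup>2 * (W0 + \<epsilon>)"
    unfolding A_def
    by (rule energy_variation[OF L.compact_prob_axioms W0(2) min]) (use L \<epsilon> t \<delta> in auto)
  also have "\<dots> \<le> t\<^sup>2 * (W0 + 2)" using \<epsilon>(2) t by (simp add: \<epsilon>_def algebra_simps)
  finally have "2 * \<delta> * measure L A \<le> t * (W0 + 2)"
    using t by (simp add: power2_eq_square mult.assoc)
  also have "\<dots> \<le> 2 * \<delta>\<^sup>2" using t(3) W0 by (simp add: field_simps)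
  finally have \<alpha>: "measure L A \<le> \<delta>" using \<delta> by (simp add: power2_eq_square)
  define K' where "K' = H \<inter> {z. epot R L z \<le> ennreal (W0 + \<delta>)}"
  have cK': "compact K'" unfolding K'_def
    by (intro compact_Int_closed H L.epot_le_closed R)
  have "1 - \<delta> \<le> measure L K'"
  proof -
    have "measure L K' = measure L (UNIV - A)"
    proof (rule measure_eq_AE)
      show "AE x in L. (x \<in> K') = (x \<in> UNIV - A)"
        using L.AE_K by eventually_elim (auto simp: K'_def A_def)
    qed (use cK' L.setsM in \<open>auto simp: compact_imp_closed\<close>)
    also have "\<dots> = 1 - measure L A"
      using L.prob_compl[of A] L.setsM by (simp add: L.space_M)
    finally show ?thesis using \<alpha> by simp
  qed
  then have m: "measure L K' \<ge> 3/4" "1 - \<delta> \<le> measure L K'" using \<delta> by auto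
  define T' where "T' = density L (\<lambda>z. ennreal (1 / measure L K') * indicator K' z)"
  define c where "c = 1 / measure L K' * (W0 + \<delta>)"
  have c0: "c \<ge> 0" using m W0 \<delta> by (auto simp: c_def)
  interpret T': compact_prob T' K'
    unfolding T'_def by (rule restrict_prob(1)[OF L.compact_prob_axioms cK']) (use m in \<open>auto simp: K'_def\<close>)
  have le: "epot R T' z \<le> ennreal c" if "z \<in> K'" for z
  proof -
    have "epot R T' z \<le> ennreal (1 / measure L K') * epot R L z"
      unfolding T'_def by (rule restrict_prob(2)[OF L.compact_prob_axioms cK']) (use m in \<open>auto simp: K'_def\<close>)
    also have "\<dots> \<le> ennreal (1 / measure L K') * ennreal (W0 + \<delta>)"
      using that by (intro mult_left_mono) (auto simp: K'_def)
    also have "\<dots> = ennreal c" unfolding c_def using m W0 \<delta> by (intro ennreal_mult[symmetric]) auto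
    finally show ?thesis .
  qed
  have sub: "K' \<subseteq> ball 0 (R/2)" using R by (auto simp: K'_def)
  note mf = T'.maria_frostman[OF R(1) sub le c0]
  have "W \<le> c"
    by (rule sup[OF T'.compact_prob_axioms]) (use mf in \<open>auto simp: K'_def\<close>)
  then have "W * measure L K' \<le> W0 + \<delta>" using m by (simp add: c_def field_simps)
  moreover have "W * (1 - \<delta>) \<le> W * measure L K'" using m W by (intro mult_left_mono) auto
  ultimately have "W - W0 \<le> \<delta> * (W + 1)" by (simp add: algebra_simps)
  also have "\<dots> \<le> (W - W0) / (2 * (W + 1)) * (W + 1)" using \<delta> W by (intro mult_right_mono) auto
  also have "\<dots> = (W - W0) / 2" using W by (simp add: field_simps)
  finally show False using W0W by simp
qed

text \<open>
  The convex combination \<open>(1 - t) M + t T\<close> is built as a mixture over a Bernoulli variable.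
\<close>

lemma mixture_energy:
  assumes M: "M \<in> prob_measures_on K" and T: "T \<in> prob_measures_on K" and K: "compact K"
    and t: "0 \<le> t" "t \<le> 1"
  obtains L where "L \<in> prob_measures_on K"
    "energy R L = ennreal ((1-t)\<^sup>2) * energy R M + ennreal (2 * t * (1-t)) * (\<integral>\<^sup>+ z. epot R M z \<partial>T) + ennreal (t\<^sup>2) * energy R T"
proof -
  interpret M: compact_prob M K by (rule prob_measures_onD[OF M K])
  interpret T: compact_prob T K by (rule prob_measures_onD[OF T K])
  define \<kappa> where "\<kappa> = (\<lambda>b. if b then T else M)"
  define L where "L = measure_pmf (bernoulli_pmf t) \<bind> \<kappa>"
  have \<kappa>: "\<kappa> \<in> measure_pmf (bernoulli_pmf t) \<rightarrow>\<^sub>M prob_algebra borel"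
    using M.prob_space_axioms T.prob_space_axioms M.setsM T.setsM
    by (auto simp: \<kappa>_def space_prob_algebra)
  then have \<kappa>s: "\<kappa> \<in> measure_pmf (bernoulli_pmf t) \<rightarrow>\<^sub>M subprob_algebra borel"
    by (rule measurable_prob_algebraD)
  have nn: "(\<integral>\<^sup>+ z. f z \<partial>L) = ennreal t * (\<integral>\<^sup>+ z. f z \<partial>T) + ennreal (1 - t) * (\<integral>\<^sup>+ z. f z \<partial>M)"
    if "f \<in> borel_measurable borel" for f
    unfolding L_def using t
    unfolding nn_integral_bind[OF that \<kappa>s] by (simp add: \<kappa>_def mult.commute)
  have setsL: "sets L = sets borel"
    unfolding L_def by (rule sets_bind_measurable[OF \<kappa>s]) simp
  have "emeasure L A = ennreal t * emeasure T A + ennreal (1 - t) * emeasure M A" if "A \<in> sets borel" for A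
    using nn[of "indicator A"] that setsL M.setsM T.setsM by simp
  from this[of UNIV] this[of K] have em: "emeasure L UNIV = 1" "emeasure L K = 1"
    using M.emeasure_space_1 T.emeasure_space_1 M.M_K T.M_K t
    by (auto simp: M.space_M T.space_M simp flip: ennreal_plus)
  moreover have "space L = UNIV" using sets_eq_imp_space_eq[OF setsL] by simp
  ultimately have Lp: "prob_space L" by (intro prob_spaceI) simp
  have LK: "L \<in> prob_measures_on K"
    using Lp em setsL by (auto simp: prob_measures_on_def)
  have epL: "epot R L z = ennreal t * epot R T z + ennreal (1 - t) * epot R M z" for z
    unfolding epot_def by (rule nn) measurable
  have [measurable]: "epot R L \<in> borel_measurable borel"
    unfolding epL[abs_def] by measurable
  have [measurable_cong]: "sets T = sets borel" "sets M = sets borel" by (fact T.setsM M.setsM)+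
  interpret pp: pair_sigma_finite T M by unfold_locales
  have sym: "(\<integral>\<^sup>+ z. epot R T z \<partial>M) = (\<integral>\<^sup>+ z. epot R M z \<partial>T)"
  proof -
    have "(\<integral>\<^sup>+ z. epot R T z \<partial>M) = (\<integral>\<^sup>+ z. (\<integral>\<^sup>+ t. pos_log_kernel R (cmod (t - z)) \<partial>T) \<partial>M)"
      by (simp add: epot_def norm_minus_commute)
    also have "\<dots> = (\<integral>\<^sup>+ t. (\<integral>\<^sup>+ z. pos_log_kernel R (cmod (t - z)) \<partial>M) \<partial>T)"
      by (rule pp.Fubini') measurable
    finally show ?thesis by (simp add: epot_def)
  qed
  have "energy R L = ennreal t * (\<integral>\<^sup>+ z. epot R L z \<partial>T) + ennreal (1 - t) * (\<integral>\<^sup>+ z. epot R L z \<partial>M)"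
    unfolding energy_def by (rule nn) measurable
  also have "\<dots> = ennreal t * (ennreal t * energy R T + ennreal (1 - t) * (\<integral>\<^sup>+ z. epot R M z \<partial>T))
      + ennreal (1 - t) * (ennreal t * (\<integral>\<^sup>+ z. epot R M z \<partial>T) + ennreal (1 - t) * energy R M)"
    unfolding epL by (simp add: nn_integral_add nn_integral_cmult energy_def sym)
  also have "\<dots> = ennreal ((1-t)\<^sup>2) * energy R M + ennreal (2 * t * (1-t)) * (\<integral>\<^sup>+ z. epot R M z \<partial>T) + ennreal (t\<^sup>2) * energy R T"
  proof -
    have "ennreal (2 * t * (1-t)) = ennreal t * ennreal (1 - t) + ennreal (1 - t) * ennreal t"
      using t by (simp flip: ennreal_mult ennreal_plus)
    then show ?thesis using t
      by (simp add: distrib_left distrib_right power2_eq_square ennreal_mult ac_simps)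
  qed
  finally show thesis using that LK by blast
qed

text \<open>
  If the potential were below \<open>W - ln R - \<delta>\<close> on a part \<open>F\<close> of \<open>H\<close> with positive area, the
  normalized area measure \<open>T\<close> on \<open>F\<close>, which has finite energy, could be mixed into \<open>M\<close>: the energy
  of \<open>(1 - t) M + t T\<close> changes to first order by at most \<open>- 2 t \<delta>\<close>, contradicting minimality.
\<close>

lemma frostman_ae:
  assumes M: "M \<in> prob_measures_on H" and H: "compact H"
    and R: "R \<ge> 1" "H \<subseteq> ball 0 (R/2)"
    and min: "\<And>T. T \<in> prob_measures_on H \<Longrightarrow> energy R M \<le> energy R T"
    and W: "energy R M = ennreal W" "W \<ge> 0"
  shows "AE z in lborel. z \<in> H \<longrightarrow> pot M z = W - ln R"
proof -
  interpret compact_prob M H by (rule prob_measures_onD[OF M H])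
  have R0: "R > 0" using R by simp
  have fu: "integrable M (\<lambda>t. ln (cmod (z - t)))" "AE t in M. t \<noteq> z" "pot M z \<le> W - ln R" for z
    by (rule frostman_upper[OF M H R0 R(2) _ W]; rule min; assumption)+
  have "AE z in lborel. z \<in> H \<longrightarrow> \<not> pot M z \<le> W - ln R - \<delta>" if \<delta>: "\<delta> > 0" for \<delta>
  proof (rule ccontr)
    define F where "F = {z\<in>H. pot M z \<le> W - ln R - \<delta>}"
    have F_eq: "F = H \<inter> {z. pot M z \<le> W - ln R - \<delta>}" by (auto simp: F_def)
    have FH: "F \<subseteq> H" by (auto simp: F_def)
    have [measurable]: "H \<in> sets borel" by (rule K_sets)
    have [measurable]: "F \<in> sets borel" unfolding F_eq by measurable
    assume "\<not> (AE z in lborel. z \<in> H \<longrightarrow> \<not> pot M z \<le> W - ln R - \<delta>)"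
    then have nz: "emeasure lborel F \<noteq> 0"
    proof (rule contrapos_nn)
      assume "emeasure lborel F = 0"
      then have "AE z in lborel. z \<notin> F" by (intro AE_not_in) (auto simp: null_sets_def)
      then show "AE z in lborel. z \<in> H \<longrightarrow> \<not> pot M z \<le> W - ln R - \<delta>"
        by eventually_elim (simp add: F_def)
    qed
    have bF: "bounded F" using FH H compact_imp_bounded bounded_subset by blast
    define a where "a = measure lborel F"
    have ema: "emeasure lborel F = ennreal a"
      using emeasure_bounded_finite[OF bF] by (simp add: a_def emeasure_eq_ennreal_measure)
    have a: "a > 0" using nz ema by (cases "a > 0") (auto simp: ennreal_neg not_less)
    define T where "T = density lborel (\<lambda>z. ennreal (1/a) * indicator F z)"
    have emT: "emeasure T A = ennreal (1/a) * emeasure lborel (A \<inter> F)" if "A \<in> sets borel" for A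
    proof -
      have "emeasure T A = (\<integral>\<^sup>+ z. ennreal (1/a) * indicator (A \<inter> F) z \<partial>lborel)"
        using that unfolding T_def by (subst emeasure_density) (auto intro!: nn_integral_cong simp: indicator_def)
      then show ?thesis using that by (subst (asm) nn_integral_cmult_indicator) auto
    qed
    have one: "ennreal (1/a) * emeasure lborel F = 1" using a by (simp add: ema flip: ennreal_mult)
    have "emeasure T UNIV = 1" "emeasure T H = 1"
      using emT[of UNIV] emT[of H] one FH by (auto simp: Int_absorb1)
    then have TH: "T \<in> prob_measures_on H"
      by (auto simp: prob_measures_on_def T_def intro!: prob_spaceI)
    interpret T: compact_prob T H by (rule prob_measures_onD[OF TH H])
    have nnT: "(\<integral>\<^sup>+ z. f z \<partial>T) = (\<integral>\<^sup>+ z. ennreal (1/a) * indicator F z * f z \<partial>lborel)" if "f \<in> borel_measurable borel" for f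
      unfolding T_def using that by (subst nn_integral_density) auto
    obtain C where C: "C \<ge> 0" "\<And>t. cmod t \<le> R/2 \<Longrightarrow> (\<integral>\<^sup>+ s\<in>ball 0 (R/2). ennreal \<bar>ln (cmod (s - t))\<bar> \<partial>lborel) \<le> ennreal C"
      by (rule nn_integral_abs_ln_bounded[of "R/2" "R/2"]) (use R0 in auto)
    define C' where "C' = 1/a * (C + ln R * (pi * (R/2)\<^sup>2))"
    have lR: "ln R \<ge> 0" using R by simp
    have epT: "epot R T z \<le> ennreal C'" if z: "z \<in> H" for z
    proof -
      have "epot R T z = (\<integral>\<^sup>+ t. ennreal (1/a) * indicator F t * pos_log_kernel R (cmod (z - t)) \<partial>lborel)"
        unfolding epot_def by (rule nnT) measurable
      also have "\<dots> \<le> (\<integral>\<^sup>+ t. ennreal (1/a) * (ennreal \<bar>ln (cmod (t - z))\<bar> * indicator (ball 0 (R/2)) t + ennreal (ln R) * indicator (ball 0 (R/2)) t) \<partial>lborel)"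
      proof (rule nn_integral_mono_AE, use AE_lborel_singleton[of z] in eventually_elim)
        fix t assume t: "t \<noteq> z"
        show "ennreal (1/a) * indicator F t * pos_log_kernel R (cmod (z - t)) \<le> ennreal (1/a) * (ennreal \<bar>ln (cmod (t - z))\<bar> * indicator (ball 0 (R/2)) t + ennreal (ln R) * indicator (ball 0 (R/2)) t)"
        proof (cases "t \<in> F")
          case True
          then have tb: "t \<in> ball 0 (R/2)" using FH R by auto
          have "pos_log_kernel R (cmod (z - t)) = ennreal (ln R - ln (cmod (t - z)))"
            using t R0 by (simp add: pos_log_kernel_def ln_div norm_minus_commute)
          also have "\<dots> \<le> ennreal (\<bar>ln (cmod (t - z))\<bar> + ln R)" by (intro ennreal_leI) auto
          also have "\<dots> = ennreal \<bar>ln (cmod (t - z))\<bar> + ennreal (ln R)" using lR by simp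
          finally show ?thesis using True tb by (auto intro!: mult_left_mono)
        qed simp
      qed
      also have "\<dots> = ennreal (1/a) * ((\<integral>\<^sup>+ t\<in>ball 0 (R/2). ennreal \<bar>ln (cmod (t - z))\<bar> \<partial>lborel) + ennreal (ln R) * emeasure lborel (ball (0::complex) (R/2)))"
        by (simp add: nn_integral_cmult nn_integral_add nn_integral_cmult_indicator)
      also have "\<dots> \<le> ennreal (1/a) * (ennreal C + ennreal (ln R) * ennreal (pi * (R/2)\<^sup>2))"
        using C(2)[of z] z R R0 by (intro mult_left_mono add_mono) (auto simp: emeasure_ball_complex)
      also have "\<dots> = ennreal C'"
        using C a lR R0 by (simp add: C'_def flip: ennreal_mult ennreal_plus)
      finally show ?thesis .
    qed
    have "energy R T \<le> (\<integral>\<^sup>+ z. ennreal C' \<partial>T)"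
      unfolding energy_def by (rule nn_integral_mono_AE, use T.AE_K in eventually_elim) (rule epT)
    then have "energy R T \<le> ennreal C'" by (simp add: T.emeasure_space_1)
    then obtain J where J: "energy R T = ennreal J" "J \<ge> 0"
      by (cases "energy R T") (auto simp: top_unique)
    have AEF: "AE z in T. z \<in> F"
      unfolding T_def by (subst AE_density) (auto simp: indicator_def)
    have W\<delta>: "W - \<delta> \<ge> 0"
    proof -
      have "F \<noteq> {}" using nz by auto
      then obtain z where z: "z \<in> F" by blast
      have zb: "z \<in> ball 0 (R/2)" using z FH R by auto
      have "- ln R \<le> pot M z"
      proof -
        have "(\<integral> t. ln (cmod (z - t)) \<partial>M) \<le> (\<integral> t. ln R \<partial>M)"
        proof (rule integral_mono_AE[OF fu(1)])
          show "AE t in M. ln (cmod (z - t)) \<le> ln R"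
            using AE_K fu(2)[of z]
          proof eventually_elim
            fix t assume t: "t \<in> H" "t \<noteq> z"
            have "cmod (z - t) < R" by (rule in_radius[OF R(2) zb t(1)])
            then show "ln (cmod (z - t)) \<le> ln R" using t by (intro ln_mono) auto
          qed
        qed auto
        then show ?thesis using prob_space by (simp add: pot_def space_M)
      qed
      then show ?thesis using z by (simp add: F_def)
    qed
    have mut: "(\<integral>\<^sup>+ z. epot R M z \<partial>T) \<le> ennreal (W - \<delta>)"
    proof -
      have "(\<integral>\<^sup>+ z. epot R M z \<partial>T) \<le> (\<integral>\<^sup>+ z. ennreal (W - \<delta>) \<partial>T)"
      proof (rule nn_integral_mono_AE, use AEF in eventually_elim)
        fix z assume z: "z \<in> F"
        have zb: "z \<in> ball 0 (R/2)" using z FH R by auto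
        have "epot R M z = ennreal (pot M z + ln R)"
          by (rule epot_eq_pot[OF R0 R(2) zb fu(1,2)])
        also have "\<dots> \<le> ennreal (W - \<delta>)" using z by (intro ennreal_leI) (auto simp: F_def)
        finally show "epot R M z \<le> ennreal (W - \<delta>)" .
      qed
      then show ?thesis by (simp add: T.emeasure_space_1)
    qed
    define t where "t = min (1/2) (\<delta> / (2 * (J + 1)))"
    have "\<delta> / (2 * (J + 1)) > 0" using \<delta> J by (intro divide_pos_pos) auto
    then have t: "0 < t" "t \<le> 1/2" "t \<le> \<delta> / (2 * (J + 1))"
      unfolding t_def by (simp_all only: min_less_iff_conj min.cobounded1 min.cobounded2) auto
    obtain L where L: "L \<in> prob_measures_on H"
      "energy R L = ennreal ((1-t)\<^sup>2) * energy R M + ennreal (2 * t * (1-t)) * (\<integral>\<^sup>+ z. epot R M z \<partial>T) + ennreal (t\<^sup>2) * energy R T"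
      using mixture_energy[OF M TH H, of t R] t by auto
    have "ennreal W \<le> energy R L" using min[OF L(1)] W by simp
    also have "\<dots> \<le> ennreal ((1-t)\<^sup>2) * ennreal W + ennreal (2 * t * (1-t)) * ennreal (W - \<delta>) + ennreal (t\<^sup>2) * ennreal J"
      unfolding L(2) W J using mut by (intro add_mono mult_left_mono) auto
    also have "\<dots> = ennreal ((1-t)\<^sup>2 * W + 2 * t * (1-t) * (W - \<delta>) + t\<^sup>2 * J)"
    proof -
      have "0 \<le> 2 * t * (1 - t)" using t by auto
      moreover have "0 \<le> 2 * t * (1 - t) * (W - \<delta>)" using t W\<delta> by (intro mult_nonneg_nonneg) auto
      ultimately show ?thesis using t W W\<delta> J by (simp add: ennreal_mult[symmetric] ennreal_plus[symmetric] del: ennreal_plus)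
    qed
    finally have "W \<le> (1-t)\<^sup>2 * W + 2 * t * (1-t) * (W - \<delta>) + t\<^sup>2 * J"
      using t W W\<delta> J by (subst (asm) ennreal_le_iff) (auto intro!: add_nonneg_nonneg mult_nonneg_nonneg)
    then have "2 * t * (1-t) * \<delta> + t\<^sup>2 * W \<le> t\<^sup>2 * J"
      by (simp add: power2_eq_square algebra_simps)
    moreover have "t\<^sup>2 * W \<ge> 0" using W by simp
    ultimately have "t * (2 * (1-t) * \<delta>) \<le> t * (t * J)"
      by (simp add: power2_eq_square mult.assoc mult.left_commute)
    then have "2 * (1-t) * \<delta> \<le> t * J" using t(1) by simp
    moreover have "\<delta> \<le> 2 * (1-t) * \<delta>" using t \<delta> by simp
    moreover have "t * J \<le> \<delta> / (2 * (J + 1)) * J" using t J by (intro mult_right_mono) auto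
    moreover have "\<delta> / (2 * (J + 1)) * J = \<delta> / 2 * (J / (J + 1))" by simp
    moreover have "\<delta> / 2 * (J / (J + 1)) \<le> \<delta> / 2 * 1" using J \<delta> by (intro mult_left_mono) auto
    ultimately show False using \<delta> by linarith
  qed
  then have "AE z in lborel. \<forall>n. z \<in> H \<longrightarrow> \<not> pot M z \<le> W - ln R - 1 / real (Suc n)"
    unfolding AE_all_countable by simp
  then show ?thesis
  proof (eventually_elim, intro impI antisym fu(3))
    fix z assume *: "\<forall>n. z \<in> H \<longrightarrow> \<not> pot M z \<le> W - ln R - 1 / real (Suc n)" and z: "z \<in> H"
    show "W - ln R \<le> pot M z"
    proof (rule ccontr)
      assume "\<not> ?thesis"
      then obtain n where "1 / real (Suc n) < W - ln R - pot M z"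
        using nat_approx_posE[of "W - ln R - pot M z"] by auto
      then show False using * z by (auto simp: not_le dest!: spec[of _ n])
    qed
  qed
qed

section \<open>Mean values of harmonic functions\<close>

text \<open>
  Schwarz, by the classical argument: the second difference of \<open>u\<close> over a small square equals
  \<open>h\<^sup>2\<close> times each mixed derivative at some point of the square.
\<close>

lemma mixed_derivatives_commute:
  fixes u ux uy uxx uxy uyx uyy :: "complex \<Rightarrow> real"
  assumes S: "open S" "z \<in> S"
    and cont: "continuous_on S uxy" "continuous_on S uyx"
    and d: "\<And>z. z \<in> S \<Longrightarrow> (u has_derivative (\<lambda>h. ux z * Re h + uy z * Im h)) (at z)"
      "\<And>z. z \<in> S \<Longrightarrow> (ux has_derivative (\<lambda>h. uxx z * Re h + uxy z * Im h)) (at z)"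
      "\<And>z. z \<in> S \<Longrightarrow> (uy has_derivative (\<lambda>h. uyx z * Re h + uyy z * Im h)) (at z)"
  shows "uxy z = uyx z"
proof (rule ccontr)
  have lineX: "((\<lambda>x. f (Complex x y)) has_real_derivative a) (at x)"
    if "(f has_derivative (\<lambda>h. a * Re h + b * Im h)) (at (Complex x y))" for f a b x y
  proof -
    have "((\<lambda>x. Complex x y) has_derivative (\<lambda>h. of_real h)) (at x)"
      unfolding Complex_eq by (auto intro!: derivative_eq_intros)
    from has_derivative_compose[OF this that] show ?thesis
      by (simp add: has_field_derivative_def)
  qed
  have lineY: "((\<lambda>y. f (Complex x y)) has_real_derivative b) (at y)"
    if "(f has_derivative (\<lambda>h. a * Re h + b * Im h)) (at (Complex x y))" for f a b x y
  proof -
    have "((\<lambda>y. Complex x y) has_derivative (\<lambda>h. \<i> * of_real h)) (at y)"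
      unfolding Complex_eq by (auto intro!: derivative_eq_intros)
    from has_derivative_compose[OF this that] show ?thesis
      by (simp add: has_field_derivative_def)
  qed
  assume ne: "uxy z \<noteq> uyx z"
  define e where "e = \<bar>uxy z - uyx z\<bar> / 2"
  have e: "e > 0" using ne by (simp add: e_def)
  obtain d0 where d0: "d0 > 0" "ball z d0 \<subseteq> S" using S openE by blast
  have "isCont uxy z" "isCont uyx z"
    using cont S continuous_on_eq_continuous_at by blast+
  then obtain d1 d2 where d12: "d1 > 0" "\<And>w. dist w z < d1 \<Longrightarrow> dist (uxy w) (uxy z) < e"
     "d2 > 0" "\<And>w. dist w z < d2 \<Longrightarrow> dist (uyx w) (uyx z) < e"
    using e unfolding continuous_at_eps_delta by metis
  define h where "h = min d0 (min d1 d2) / 3"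
  have h: "h > 0" "3 * h \<le> d0" "3 * h \<le> d1" "3 * h \<le> d2" using d0 d12 by (auto simp: h_def)
  define x where "x = Re z"
  define y where "y = Im z"
  have near: "dist (Complex s t) z < 3 * h" if "x \<le> s" "s \<le> x + h" "y \<le> t" "t \<le> y + h" for s t
  proof -
    have "dist (Complex s t) z \<le> \<bar>s - x\<bar> + \<bar>t - y\<bar>"
      using cmod_le[of "Complex s t - z"] by (simp add: dist_norm x_def y_def)
    also have "\<dots> < 3 * h" using that h by auto
    finally show ?thesis .
  qed
  have inS: "Complex s t \<in> S" if "x \<le> s" "s \<le> x + h" "y \<le> t" "t \<le> y + h" for s t
    using near[OF that] d0 h by (auto simp: dist_commute subset_iff)
  define D where "D = u (Complex (x+h) (y+h)) - u (Complex (x+h) y) - u (Complex x (y+h)) + u (Complex x y)"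
  obtain s t where st: "x < s" "s < x + h" "y < t" "t < y + h" "D = h * (h * uxy (Complex s t))"
  proof -
    have "\<exists>s>x. s < x + h \<and> (u (Complex (x+h) (y+h)) - u (Complex (x+h) y)) - (u (Complex x (y+h)) - u (Complex x y))
        = (x + h - x) * (ux (Complex s (y+h)) - ux (Complex s y))"
    proof (rule MVT2)
      fix s assume "x \<le> s" "s \<le> x + h"
      then show "DERIV (\<lambda>s. u (Complex s (y+h)) - u (Complex s y)) s :> ux (Complex s (y+h)) - ux (Complex s y)"
        using h by (intro DERIV_diff lineX[OF d(1)] inS) auto
    qed (use h in auto)
    then obtain s where s: "x < s" "s < x + h" "D = h * (ux (Complex s (y+h)) - ux (Complex s y))"
      by (auto simp: D_def)
    have "\<exists>t>y. t < y + h \<and> ux (Complex s (y+h)) - ux (Complex s y) = (y + h - y) * uxy (Complex s t)"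
    proof (rule MVT2)
      fix t assume "y \<le> t" "t \<le> y + h"
      then show "DERIV (\<lambda>t. ux (Complex s t)) t :> uxy (Complex s t)"
        using h s by (intro lineY[OF d(2)] inS) auto
    qed (use h in auto)
    then show thesis using s that by auto
  qed
  obtain s' t' where st': "x < s'" "s' < x + h" "y < t'" "t' < y + h" "D = h * (h * uyx (Complex s' t'))"
  proof -
    have "\<exists>t>y. t < y + h \<and> (u (Complex (x+h) (y+h)) - u (Complex x (y+h))) - (u (Complex (x+h) y) - u (Complex x y))
        = (y + h - y) * (uy (Complex (x+h) t) - uy (Complex x t))"
    proof (rule MVT2)
      fix t assume "y \<le> t" "t \<le> y + h"
      then show "DERIV (\<lambda>t. u (Complex (x+h) t) - u (Complex x t)) t :> uy (Complex (x+h) t) - uy (Complex x t)"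
        using h by (intro DERIV_diff lineY[OF d(1)] inS) auto
    qed (use h in auto)
    then obtain t where t: "y < t" "t < y + h" "D = h * (uy (Complex (x+h) t) - uy (Complex x t))"
      by (auto simp: D_def)
    have "\<exists>s>x. s < x + h \<and> uy (Complex (x+h) t) - uy (Complex x t) = (x + h - x) * uyx (Complex s t)"
    proof (rule MVT2)
      fix s assume "x \<le> s" "s \<le> x + h"
      then show "DERIV (\<lambda>s. uy (Complex s t)) s :> uyx (Complex s t)"
        using h t by (intro lineX[OF d(3)] inS) auto
    qed (use h in auto)
    then show thesis using t that by auto
  qed
  have "uxy (Complex s t) = uyx (Complex s' t')" using st(5) st'(5) h by simp
  moreover have "dist (uxy (Complex s t)) (uxy z) < e" using st h near[of s t] by (intro d12) auto
  moreover have "dist (uyx (Complex s' t')) (uyx z) < e" using st' h near[of s' t'] by (intro d12) auto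
  moreover have "\<bar>uxy z - uyx z\<bar> \<le> \<bar>a - uxy z\<bar> + \<bar>a - uyx z\<bar>" for a by arith
  ultimately show False unfolding dist_real_def e_def by (metis add_strict_mono field_sum_of_halves not_less)
qed

lemma harmonic_on_imp_continuous:
  assumes "harmonic_on u S" shows "continuous_on S u"
  using assms unfolding harmonic_on_def
  by (metis continuous_at_imp_continuous_on has_derivative_continuous)

text \<open>
  The function \<open>u\<^sub>x - \<i> u\<^sub>y\<close> satisfies the Cauchy-Riemann equations, and the real part of a
  primitive differs from \<open>u\<close> by a constant.
\<close>

lemma harmonic_local_holomorphic:
  assumes h: "harmonic_on u S" and B: "ball z R \<subseteq> S"
  obtains F where "F holomorphic_on ball z R" "\<And>w. w \<in> ball z R \<Longrightarrow> Re (F w) = u w"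
proof -
  obtain ux uy uxx uxy uyx uyy :: "complex \<Rightarrow> real" where
    S: "open S" and cont: "continuous_on S uxy" "continuous_on S uyx"
    and d: "\<And>z. z \<in> S \<Longrightarrow> (u has_derivative (\<lambda>h. ux z * Re h + uy z * Im h)) (at z)"
      "\<And>z. z \<in> S \<Longrightarrow> (ux has_derivative (\<lambda>h. uxx z * Re h + uxy z * Im h)) (at z)"
      "\<And>z. z \<in> S \<Longrightarrow> (uy has_derivative (\<lambda>h. uyx z * Re h + uyy z * Im h)) (at z)"
      "\<And>z. z \<in> S \<Longrightarrow> uxx z + uyy z = 0"
    using h unfolding harmonic_on_def by blast
  \<comment> \<open>the derivative of the holomorphic function to be found\<close>
  define f where "f = (\<lambda>w. of_real (ux w) - \<i> * of_real (uy w))"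
  have fd: "(f has_field_derivative (of_real (uxx w) - \<i> * of_real (uxy w))) (at w)" if w: "w \<in> S" for w
  proof -
    have sym: "uxy w = uyx w" by (rule mixed_derivatives_commute[OF S w cont d(1-3)])
    have "(f has_derivative (\<lambda>h. of_real (uxx w * Re h + uxy w * Im h) - \<i> * of_real (uyx w * Re h + uyy w * Im h))) (at w)"
      unfolding f_def by (intro has_derivative_diff has_derivative_of_real has_derivative_mult_right d w)
    also have "(\<lambda>h. of_real (uxx w * Re h + uxy w * Im h) - \<i> * of_real (uyx w * Re h + uyy w * Im h))
       = (\<lambda>h. (of_real (uxx w) - \<i> * of_real (uxy w)) * h)"
      using d(4)[OF w] sym by (auto simp: fun_eq_iff complex_eq_iff algebra_simps add_eq_0_iff2)
    finally show ?thesis by (simp add: has_field_derivative_def)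
  qed
  have "f holomorphic_on ball z R"
    using fd B by (meson S field_differentiable_def holomorphic_onI field_differentiable_at_within subsetD)
  then obtain F0 where F0: "\<And>w. w \<in> ball z R \<Longrightarrow> (F0 has_field_derivative f w) (at w)"
    using holomorphic_convex_primitive'[of "ball z R" f] by (metis at_within_open convex_ball open_ball)
  have der: "((\<lambda>w. Re (F0 w) - u w) has_derivative (\<lambda>h. 0)) (at w within ball z R)" if w: "w \<in> ball z R" for w
  proof -
    have "(F0 has_derivative (\<lambda>h. f w * h)) (at w)" using F0[OF w] by (simp add: has_field_derivative_def)
    then have "((\<lambda>w. Re (F0 w)) has_derivative (\<lambda>h. Re (f w * h))) (at w)"
      by (rule has_derivative_Re)
    then have "((\<lambda>w. Re (F0 w) - u w) has_derivative (\<lambda>h. Re (f w * h) - (ux w * Re h + uy w * Im h))) (at w)"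
      by (rule has_derivative_diff) (use d w B in auto)
    also have "(\<lambda>h. Re (f w * h) - (ux w * Re h + uy w * Im h)) = (\<lambda>h. 0)"
      by (auto simp: f_def fun_eq_iff)
    finally show ?thesis by (rule has_derivative_at_withinI)
  qed
  obtain c where c: "\<And>w. w \<in> ball z R \<Longrightarrow> Re (F0 w) - u w = c"
    using has_derivative_zero_constant[OF convex_ball der] by blast
  show thesis
  proof (rule that[of "\<lambda>w. F0 w - of_real c"])
    show "(\<lambda>w. F0 w - of_real c) holomorphic_on ball z R"
      using F0 by (intro holomorphic_intros) (meson field_differentiable_def holomorphic_onI field_differentiable_at_within)
    show "Re (F0 w - of_real c) = u w" if "w \<in> ball z R" for w using c[OF that] by simp
  qed
qed

text \<open>
  Circle means of the holomorphic function with real part \<open>u\<close>, averaged over the disc.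
\<close>

theorem harmonic_ball_mean:
  assumes h: "harmonic_on u S" and B: "cball z r \<subseteq> S" and r: "r > 0"
  shows "set_integrable lborel (ball z r) u" "(LINT s:ball z r|lborel. u s) = pi * r\<^sup>2 * u z"
proof -
  have S: "open S" using h by (simp add: harmonic_on_def)
  have contS: "continuous_on S u" by (rule harmonic_on_imp_continuous[OF h])
  obtain R where R: "R > r" "ball z R \<subseteq> S"
  proof -
    obtain e where e: "e > 0" "\<And>x y. x \<in> cball z r \<Longrightarrow> y \<in> -S \<Longrightarrow> e \<le> dist x y"
    proof -
      have "\<exists>e>0. \<forall>x\<in>cball z r. \<forall>y\<in>-S. e \<le> dist x y"
        using B S by (intro separate_compact_closed) (auto simp: closed_Compl)
      then show thesis using that by blast
    qed
    have "ball z (r + e) \<subseteq> S"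
    proof
      fix y assume y: "y \<in> ball z (r + e)"
      show "y \<in> S"
      proof (rule ccontr)
        assume ny: "y \<notin> S"
        then have d: "dist z y > r" using B by (auto simp: subset_iff not_le)
        define x where "x = z + of_real (r / dist z y) * (y - z)"
        have "dist z x = r"
        proof -
          have "x - z = of_real (r / dist z y) * (y - z)" by (simp add: x_def)
          then have "dist z x = \<bar>r / dist z y\<bar> * dist z y"
            by (metis dist_commute dist_norm norm_mult norm_of_real)
          moreover have "dist z y > 0" using d r by linarith
          ultimately show ?thesis using r by (simp only: abs_of_pos divide_pos_pos) simp
        qed
        moreover have "dist x y = dist z y - r"
        proof -
          have "y - x = of_real (1 - r / dist z y) * (y - z)" by (simp add: x_def algebra_simps)
          then have "dist x y = \<bar>1 - r / dist z y\<bar> * dist z y"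
            by (metis dist_commute dist_norm norm_mult norm_of_real)
          also have "\<dots> = dist z y - r"
          proof -
            have "dist z y > 0" using d r by linarith
            then have "r / dist z y < 1" using d by (simp only: divide_less_eq_1_pos)
            then have "\<bar>1 - r / dist z y\<bar> * dist z y = (1 - r / dist z y) * dist z y" by simp
            also have "\<dots> = dist z y - r" using \<open>dist z y > 0\<close> by (simp only: left_diff_distrib) simp
            finally show ?thesis .
          qed
          finally show ?thesis .
        qed
        ultimately show False using e(2)[of x y] ny y by simp
      qed
    qed
    then show thesis by (intro that[of "r + e"]) (use e in auto)
  qed
  obtain F where F: "F holomorphic_on ball z R" "\<And>w. w \<in> ball z R \<Longrightarrow> Re (F w) = u w"
    using harmonic_local_holomorphic[OF h R(2)] by blast
  have circ: "((\<lambda>\<theta>::real. u (z + unit_pt \<theta> * s)) has_integral u z) {0..1}" if s: "s \<in> ball 0 r" for s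
  proof -
    have in_ball: "z + w * s \<in> ball z R" if "w \<in> cball 0 1" for w
    proof -
      have "cmod (w * s) \<le> 1 * cmod s" using that unfolding norm_mult by (intro mult_right_mono) auto
      then show ?thesis using s R by (simp add: dist_norm)
    qed
    have "(\<lambda>w. F (z + w * s)) holomorphic_on cball 0 1"
      by (rule holomorphic_on_compose_gen[of "\<lambda>w. z + w * s" _ F, unfolded o_def])
         (use F in_ball in \<open>auto intro!: holomorphic_intros\<close>)
    from has_integral_Re[OF circle_mean_holomorphic[OF this]]
    have "((\<lambda>\<theta>::real. Re (F (z + unit_pt \<theta> * s))) has_integral Re (F z)) {0..1}" by simp
    moreover have "Re (F (z + unit_pt \<theta> * s)) = u (z + unit_pt \<theta> * s)" for \<theta>
      by (rule F(2)[OF in_ball]) (simp add: cmod_unit_pt)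
    moreover have "Re (F z) = u z" by (rule F(2)) (use r R in auto)
    ultimately show ?thesis by simp
  qed
  have contB: "continuous_on (cball z r) u" using contS B continuous_on_subset by blast
  have "compact (u ` cball z r)" by (intro compact_continuous_image contB compact_cball)
  then have "bounded (u ` cball z r)" by (rule compact_imp_bounded)
  then obtain b where b: "\<And>w. w \<in> cball z r \<Longrightarrow> \<bar>u w\<bar> \<le> b"
    unfolding bounded_iff real_norm_def by blast
  have b0: "b \<ge> 0" using b[of z] r by auto
  have "set_integrable lborel (cball z r) u"
    unfolding set_integrable_def by (rule borel_integrable_compact[OF compact_cball contB])
  then show int: "set_integrable lborel (ball z r) u"
    by (rule set_integrable_subset) auto
  define f where "f = (\<lambda>s. indicator (ball z r) (z + s) * (u (z + s) + b))"
  have [measurable]: "(\<lambda>s. indicator (ball z r) s * (u s + b)) \<in> borel_measurable borel"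
  proof -
    have "continuous_on (ball z r) (\<lambda>s. u s + b)"
      using contB by (intro continuous_intros) (auto intro: continuous_on_subset)
    then show ?thesis
      using borel_measurable_continuous_on_indicator[of "ball z r" "\<lambda>s. u s + b"] by simp
  qed
  have [measurable]: "f \<in> borel_measurable borel"
    unfolding f_def by (rule measurable_compose[of "\<lambda>s. z + s" _ borel "\<lambda>s. indicator (ball z r) s * (u s + b)"]) auto
  have nnf: "f s \<ge> 0" for s using b[of "z + s"] by (auto simp: f_def indicator_def)
  have "(\<integral>\<^sup>+ s\<in>ball 0 r. ennreal (f s) \<partial>lborel) = (\<integral>\<^sup>+ s\<in>ball 0 r. (\<integral>\<^sup>+ \<theta>\<in>{0..1::real}. ennreal (f (unit_pt \<theta> * s)) \<partial>lborel) \<partial>lborel)"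
    by (rule nn_integral_radial_average) (auto simp: norm_mult)
  also have "\<dots> = (\<integral>\<^sup>+ s\<in>ball (0::complex) r. ennreal (u z + b) \<partial>lborel)"
  proof (intro nn_integral_cong)
    fix s :: complex
    show "(\<integral>\<^sup>+ \<theta>\<in>{0..1::real}. ennreal (f (unit_pt \<theta> * s)) \<partial>lborel) * indicator (ball 0 r) s = ennreal (u z + b) * indicator (ball 0 r) s"
    proof (cases "s \<in> ball 0 r")
      case True
      have feq: "f (unit_pt \<theta> * s) = u (z + unit_pt \<theta> * s) + b" for \<theta>
        using True by (simp add: f_def dist_norm norm_mult cmod_unit_pt)
      have hi: "((\<lambda>\<theta>. f (unit_pt \<theta> * s)) has_integral (u z + b)) {0..1}"
        unfolding feq using has_integral_add[OF circ[OF True] has_integral_const_real[of b 0 1]] by simp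
      have "(\<integral>\<^sup>+ \<theta>\<in>{0..1::real}. ennreal (f (unit_pt \<theta> * s)) \<partial>lborel)
         = (\<integral>\<^sup>+ \<theta>. ennreal (indicator {0..1} \<theta> * f (unit_pt \<theta> * s)) \<partial>lborel)"
        by (intro nn_integral_cong) (simp add: indicator_def)
      also have "\<dots> = ennreal (u z + b)"
        by (rule nn_integral_has_integral_lebesgue[OF nnf hi])
      finally show ?thesis by simp
    qed simp
  qed
  also have "\<dots> = ennreal (pi * r\<^sup>2 * (u z + b))"
    using r b[of z] by (simp add: nn_integral_cmult_indicator emeasure_ball_complex mult.commute flip: ennreal_mult)
  finally have eq: "(\<integral>\<^sup>+ s\<in>ball 0 r. ennreal (f s) \<partial>lborel) = ennreal (pi * r\<^sup>2 * (u z + b))" .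
  have "(LINT s:ball z r|lborel. u s + b) = (\<integral> s. indicator (ball z r) s * (u s + b) \<partial>lborel)"
    by (simp add: set_lebesgue_integral_def)
  also have "\<dots> = (\<integral> s. f s \<partial>lborel)"
    unfolding f_def by (rule integral_translate[symmetric]) measurable
  also have "\<dots> = enn2real (\<integral>\<^sup>+ s. ennreal (f s) \<partial>lborel)"
    by (rule integral_eq_nn_integral) (use nnf in auto)
  also have "(\<integral>\<^sup>+ s. ennreal (f s) \<partial>lborel) = (\<integral>\<^sup>+ s\<in>ball 0 r. ennreal (f s) \<partial>lborel)"
    by (intro nn_integral_cong) (auto simp: f_def indicator_def dist_norm)
  also have "enn2real \<dots> = pi * r\<^sup>2 * (u z + b)"
    unfolding eq using b[of z] r by (intro enn2real_ennreal mult_nonneg_nonneg) auto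
  finally have "(LINT s:ball z r|lborel. u s + b) = pi * r\<^sup>2 * (u z + b)" .
  moreover have "(LINT s:ball z r|lborel. u s + b) = (LINT s:ball z r|lborel. u s) + pi * r\<^sup>2 * b"
    using set_integral_add(2)[OF int set_integral_const_ball(2)] set_integral_const_ball(1) r by simp
  ultimately show "(LINT s:ball z r|lborel. u s) = pi * r\<^sup>2 * u z"
    by (simp add: algebra_simps)
qed

section \<open>A Harnack-type chain inequality\<close>

text \<open>
  Superharmonicity in the weak form in which it is used: measurability and the super-mean value
  inequality over discs. The value \<open>\<infinity>\<close> is allowed, as at the zeros of a polynomial.
\<close>

definition superharmonic_ball :: "complex set \<Rightarrow> (complex \<Rightarrow> ennreal) \<Rightarrow> bool" where
  "superharmonic_ball G e \<longleftrightarrow> e \<in> borel_measurable borel \<and>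
     (\<forall>z r. r > 0 \<longrightarrow> cball z r \<subseteq> G \<longrightarrow> (\<integral>\<^sup>+ s\<in>ball z r. e s \<partial>lborel) \<le> ennreal (pi * r\<^sup>2) * e z)"

lemma superharmonic_ballD:
  assumes "superharmonic_ball G e" "r > 0" "cball z r \<subseteq> G"
  shows "(\<integral>\<^sup>+ s\<in>ball z r. e s \<partial>lborel) \<le> ennreal (pi * r\<^sup>2) * e z"
  using assms unfolding superharmonic_ball_def by blast

text \<open>
  If every value near \<open>a\<close> controls \<open>J\<close>, so does every value near \<open>a'\<close>: discs of radius \<open>3 t\<close> about
  points near \<open>a'\<close> contain a fixed disc about \<open>a\<close>.
\<close>

lemma superharmonic_chain_step:
  assumes t: "t > 0" "cball a' (4 * t) \<subseteq> G" and a: "a \<in> ball a' t"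
    and s: "s > 0" and C: "C > 0"
    and le: "\<And>z. z \<in> ball a s \<Longrightarrow> J \<le> ennreal C * e z"
    and e: "superharmonic_ball G e" and z: "z \<in> ball a' t"
  shows "J \<le> ennreal (C * 9 * t\<^sup>2 / (min s t)\<^sup>2) * e z"
proof -
  define s1 where "s1 = min s t"
  have s1: "s1 > 0" "s1 \<le> s" "s1 \<le> t" using s t by (auto simp: s1_def)
  have em[measurable]: "e \<in> borel_measurable borel" using e by (simp add: superharmonic_ball_def)
  have sub: "ball a s1 \<subseteq> ball z (3 * t)"
  proof
    fix x assume x: "x \<in> ball a s1"
    have "dist z x \<le> dist z a' + dist a' a + dist a x"
      using dist_triangle[of z x a'] dist_triangle[of a' x a] by linarith
    then show "x \<in> ball z (3 * t)" using x a z s1 by (auto simp: dist_commute)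
  qed
  have "cball z (3 * t) \<subseteq> G"
  proof
    fix x assume "x \<in> cball z (3 * t)"
    then have "dist a' x \<le> 4 * t" using z dist_triangle[of a' x z] by auto
    then show "x \<in> G" using t by auto
  qed
  then have sm: "(\<integral>\<^sup>+ x\<in>ball z (3 * t). e x \<partial>lborel) \<le> ennreal (pi * (3 * t)\<^sup>2) * e z"
    by (intro superharmonic_ballD[OF e]) (use t in auto)
  have "J * ennreal (pi * s1\<^sup>2) = (\<integral>\<^sup>+ x\<in>ball a s1. J \<partial>lborel)"
    using s1 by (simp add: nn_integral_cmult_indicator emeasure_ball_complex)
  also have "\<dots> \<le> (\<integral>\<^sup>+ x\<in>ball a s1. ennreal C * e x \<partial>lborel)"
    using le s1 by (intro nn_integral_mono) (auto simp: indicator_def)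
  also have "\<dots> = ennreal C * (\<integral>\<^sup>+ x\<in>ball a s1. e x \<partial>lborel)"
    by (simp add: nn_integral_cmult mult.assoc)
  also have "\<dots> \<le> ennreal C * (\<integral>\<^sup>+ x\<in>ball z (3 * t). e x \<partial>lborel)"
    using sub by (intro mult_left_mono nn_integral_mono) (auto simp: indicator_def)
  also have "\<dots> \<le> ennreal C * (ennreal (pi * (3 * t)\<^sup>2) * e z)"
    by (intro mult_left_mono sm) auto
  finally have le2: "J * ennreal (pi * s1\<^sup>2) \<le> ennreal C * (ennreal (pi * (3 * t)\<^sup>2) * e z)" .
  have "J = ennreal (1 / (pi * s1\<^sup>2)) * (J * ennreal (pi * s1\<^sup>2))"
  proof -
    have "ennreal (1 / (pi * s1\<^sup>2)) * ennreal (pi * s1\<^sup>2) = 1"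
      using s1 by (simp flip: ennreal_mult)
    then show ?thesis by (metis mult.assoc mult.commute mult_1)
  qed
  also have "\<dots> \<le> ennreal (1 / (pi * s1\<^sup>2)) * (ennreal C * (ennreal (pi * (3 * t)\<^sup>2) * e z))"
    by (intro mult_left_mono le2) auto
  also have "\<dots> = ennreal (1 / (pi * s1\<^sup>2) * (C * (pi * (3 * t)\<^sup>2))) * e z"
  proof -
    have "ennreal x * (ennreal y * (ennreal w * e z)) = ennreal (x * (y * w)) * e z"
      if "x \<ge> 0" "y \<ge> 0" "w \<ge> 0" for x y w
      using that by (simp only: ennreal_mult mult_nonneg_nonneg mult.assoc)
    then show ?thesis using C by simp
  qed
  also have "1 / (pi * s1\<^sup>2) * (C * (pi * (3 * t)\<^sup>2)) = C * 9 * t\<^sup>2 / s1\<^sup>2"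
    by (simp add: power_mult_distrib)
  finally show ?thesis by (simp add: s1_def)
qed

text \<open>
  The constants depend on the domain and the two points only, not on the superharmonic function.
  The set of points \<open>a\<close> for which such constants exist contains \<open>b\<close>, is open, and is closed in \<open>G\<close>
  by the chain step, so it is all of the connected set \<open>G\<close>.
\<close>

lemma superharmonic_chain:
  assumes G: "open G" "connected G" and a: "a \<in> G" and b: "b \<in> G"
  obtains s r C where "s > 0" "r > 0" "C > 0" "cball b r \<subseteq> G"
    "\<And>e z. superharmonic_ball G e \<Longrightarrow> z \<in> ball a s \<Longrightarrow> (\<integral>\<^sup>+ x\<in>ball b r. e x \<partial>lborel) \<le> ennreal C * e z"
proof -
  have room: "\<exists>t>0. cball x (4 * t) \<subseteq> G" if x: "x \<in> G" for x
  proof -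
    obtain d where "d > 0" "cball x d \<subseteq> G" using G(1) x open_contains_cball by blast
    then show ?thesis by (intro exI[of _ "d/4"]) auto
  qed
  obtain r where r: "r > 0" "cball b (4 * r) \<subseteq> G" using room[OF b] by blast
  define P where "P = (\<lambda>a s C. s > 0 \<and> C > (0::real) \<and> (\<forall>e z. superharmonic_ball G e \<longrightarrow> z \<in> ball a s \<longrightarrow>
      (\<integral>\<^sup>+ x\<in>ball b r. e x \<partial>lborel) \<le> ennreal C * e z))"
  define A where "A = {a\<in>G. \<exists>s C. P a s C}"
  have bA: "b \<in> A"
  proof -
    have "(\<integral>\<^sup>+ x\<in>ball b r. e x \<partial>lborel) \<le> ennreal (pi * (2 * r)\<^sup>2) * e z"
      if e: "superharmonic_ball G e" and z: "z \<in> ball b r" for e z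
    proof -
      have [measurable]: "e \<in> borel_measurable borel" using e by (simp add: superharmonic_ball_def)
      have sub: "ball b r \<subseteq> ball z (2 * r)"
      proof
        fix x assume "x \<in> ball b r"
        then show "x \<in> ball z (2 * r)" using z dist_triangle[of z x b] by (auto simp: dist_commute)
      qed
      have "cball z (2 * r) \<subseteq> G"
      proof
        fix x assume "x \<in> cball z (2 * r)"
        then have "dist b x \<le> 4 * r" using z dist_triangle[of b x z] r by auto
        then show "x \<in> G" using r by auto
      qed
      have "(\<integral>\<^sup>+ x\<in>ball b r. e x \<partial>lborel) \<le> (\<integral>\<^sup>+ x\<in>ball z (2 * r). e x \<partial>lborel)"
        using sub by (intro nn_integral_mono) (auto simp: indicator_def)
      also have "\<dots> \<le> ennreal (pi * (2 * r)\<^sup>2) * e z"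
        by (rule superharmonic_ballD[OF e]) (use r \<open>cball z (2 * r) \<subseteq> G\<close> in auto)
      finally show ?thesis .
    qed
    then have "P b r (pi * (2 * r)\<^sup>2)" using r by (auto simp: P_def)
    then show ?thesis using b by (auto simp: A_def)
  qed
  have step: "a' \<in> A" if t: "t > 0" "cball a' (4 * t) \<subseteq> G" and x: "x \<in> A" "x \<in> ball a' t" for a' t x
  proof -
    obtain s C where sC: "P x s C" using x by (auto simp: A_def)
    have "P a' t (C * 9 * t\<^sup>2 / (min s t)\<^sup>2)"
      unfolding P_def
    proof (intro conjI allI impI)
      show "C * 9 * t\<^sup>2 / (min s t)\<^sup>2 > 0" using sC t by (auto simp: P_def)
      show "(\<integral>\<^sup>+ x\<in>ball b r. e x \<partial>lborel) \<le> ennreal (C * 9 * t\<^sup>2 / (min s t)\<^sup>2) * e z"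
        if "superharmonic_ball G e" "z \<in> ball a' t" for e z
        by (rule superharmonic_chain_step[OF t x(2) _ _ _ that]) (use sC that in \<open>auto simp: P_def\<close>)
    qed (use t in auto)
    moreover have "a' \<in> G" using t by auto
    ultimately show ?thesis by (auto simp: A_def)
  qed
  have oA: "open A"
  proof (rule openI)
    fix x assume x: "x \<in> A"
    then obtain s C where sC: "P x s C" by (auto simp: A_def)
    obtain t where t: "t > 0" "cball x (4 * t) \<subseteq> G" using room x by (auto simp: A_def)
    have "y \<in> A" if y: "y \<in> ball x (min s t)" for y
    proof -
      have "ball y (s - dist x y) \<subseteq> ball x s"
      proof
        fix w assume "w \<in> ball y (s - dist x y)"
        then show "w \<in> ball x s" using dist_triangle[of x w y] by auto
      qed
      then have "P y (s - dist x y) C" using sC y unfolding P_def by auto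
      moreover have "y \<in> G" using y t by auto
      ultimately show ?thesis by (auto simp: A_def)
    qed
    then show "\<exists>e>0. ball x e \<subseteq> A" using sC t by (intro exI[of _ "min s t"]) (auto simp: P_def)
  qed
  have oB: "open (G - A)"
  proof (rule openI)
    fix x assume x: "x \<in> G - A"
    then obtain t where t: "t > 0" "cball x (4 * t) \<subseteq> G" using room by auto
    have "ball x t \<subseteq> G - A"
    proof
      fix y assume y: "y \<in> ball x t"
      then have "y \<in> G" using t by (auto simp: subset_iff)
      moreover have "y \<notin> A" using step[OF t _ y] x by auto
      ultimately show "y \<in> G - A" by simp
    qed
    then show "\<exists>e>0. ball x e \<subseteq> G - A" using t by auto
  qed
  have "A \<inter> G = {} \<or> (G - A) \<inter> G = {}"
    by (rule connectedD[OF G(2) oA oB]) auto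
  then have "a \<in> A" using bA b a by auto
  then obtain s C where sC: "P a s C" by (auto simp: A_def)
  have "cball b r \<subseteq> cball b (4 * r)" using r by (intro subset_cball) auto
  then show thesis using that[of s r C] sC r by (auto simp: P_def)
qed

section \<open>Monic polynomials as potentials of their zeros\<close>

locale monic_poly =
  fixes p :: "complex poly"
  assumes monic: "lead_coeff p = 1" and deg: "degree p > 0"
begin

definition zeros :: "complex set" where "zeros = {x. poly p x = 0}"

definition wt :: "complex \<Rightarrow> real" where "wt x = real (order x p) / real (degree p)"

text \<open>
  Minus the potential of the zero counting measure, equal to \<open>ln \<bar>p\<bar> / degree p\<close> off the zeros. At
  a zero the corresponding term is \<open>ln 0 = 0\<close>, so the values there have no meaning.
\<close>

definition Lp :: "complex \<Rightarrow> real" where "Lp z = (\<Sum>x\<in>zeros. wt x * ln (cmod (z - x)))"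

lemma p_nz: "p \<noteq> 0" using deg by auto

lemma finite_zeros: "finite zeros"
  unfolding zeros_def using p_nz by (rule poly_roots_finite)

lemma wt_nonneg: "wt x \<ge> 0" by (simp add: wt_def)

lemma decompose: "p = (\<Prod>x\<in>zeros. [:-x, 1:] ^ order x p)"
  using complex_poly_decompose[of p] monic by (simp add: zeros_def)

lemma sum_wt: "(\<Sum>x\<in>zeros. wt x) = 1"
proof -
  have "degree (\<Prod>x\<in>zeros. [:-x, 1:] ^ order x p) = (\<Sum>x\<in>zeros. degree ([:-x, 1:] ^ order x p))"
    by (rule degree_prod_sum_eq) auto
  also have "\<dots> = (\<Sum>x\<in>zeros. order x p)"
    by (simp add: degree_power_eq)
  finally have "degree p = (\<Sum>x\<in>zeros. order x p)" using decompose by simp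
  then have "real (degree p) = (\<Sum>x\<in>zeros. real (order x p))" by simp
  then show ?thesis using deg by (simp add: wt_def flip: sum_divide_distrib)
qed

lemma ln_poly_eq:
  assumes "z \<notin> zeros"
  shows "ln (cmod (poly p z)) = real (degree p) * Lp z"
proof -
  have nz: "z - x \<noteq> 0" if "x \<in> zeros" for x using that assms by auto
  have "poly p z = (\<Prod>x\<in>zeros. (z - x) ^ order x p)"
    by (subst decompose) (simp add: poly_prod poly_power)
  then have "cmod (poly p z) = (\<Prod>x\<in>zeros. cmod (z - x) ^ order x p)"
    by (simp add: prod_norm norm_power flip: prod_norm)
  then have "ln (cmod (poly p z)) = (\<Sum>x\<in>zeros. ln (cmod (z - x) ^ order x p))"
    using nz by (simp add: ln_prod finite_zeros)
  also have "\<dots> = (\<Sum>x\<in>zeros. real (order x p) * ln (cmod (z - x)))"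
    by (intro sum.cong refl) (simp add: ln_realpow)
  also have "\<dots> = real (degree p) * Lp z"
    using deg by (simp add: Lp_def wt_def sum_distrib_left)
  finally show ?thesis .
qed

lemma Lp_measurable [measurable]: "Lp \<in> borel_measurable borel"
  unfolding Lp_def by measurable

lemma AE_not_zero: "AE z in lborel. z \<notin> zeros"
proof -
  have "zeros \<in> null_sets lborel"
    using finite_zeros by (rule finite_imp_null_set_lborel)
  then show ?thesis by (rule AE_not_in)
qed

lemma set_integrable_Lp:
  assumes "S \<in> sets borel" "bounded S"
  shows "set_integrable lborel S Lp"
proof -
  have "set_integrable lborel S (\<lambda>z. wt x * ln (cmod (z - x)))" for x
    using set_integrable_ln[OF assms, of x] by (rule set_integrable_mult_right)
  then have "integrable lborel (\<lambda>z. \<Sum>x\<in>zeros. indicator S z *\<^sub>R (wt x * ln (cmod (z - x))))"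
    by (intro Bochner_Integration.integrable_sum) (simp add: set_integrable_def)
  then show ?thesis
    by (simp add: set_integrable_def Lp_def sum_distrib_left)
qed

lemma set_integral_Lp:
  assumes "S \<in> sets borel" "bounded S"
  shows "(LINT z:S|lborel. Lp z) = (\<Sum>x\<in>zeros. wt x * (LINT z:S|lborel. ln (cmod (z - x))))"
proof -
  have i: "integrable lborel (\<lambda>z. wt x * (indicator S z * ln (cmod (z - x))))" for x
    using set_integrable_ln[OF assms, of x] by (intro integrable_mult_right) (simp add: set_integrable_def)
  have "(LINT z:S|lborel. Lp z) = (\<integral> z. (\<Sum>x\<in>zeros. wt x * (indicator S z * ln (cmod (z - x)))) \<partial>lborel)"
    by (simp add: set_lebesgue_integral_def Lp_def sum_distrib_left mult_ac)
  also have "\<dots> = (\<Sum>x\<in>zeros. (\<integral> z. wt x * (indicator S z * ln (cmod (z - x))) \<partial>lborel))"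
    using i by (rule Bochner_Integration.integral_sum)
  finally show ?thesis by (simp add: set_lebesgue_integral_def)
qed

lemma Lp_ball_ge:
  assumes "z \<notin> zeros" "r \<ge> 0"
  shows "pi * r\<^sup>2 * Lp z \<le> (LINT s:ball z r|lborel. Lp s)"
proof -
  have "pi * r\<^sup>2 * Lp z = (\<Sum>x\<in>zeros. wt x * (pi * r\<^sup>2 * ln (cmod (z - x))))"
    by (simp add: Lp_def sum_distrib_left mult_ac)
  also have "\<dots> \<le> (\<Sum>x\<in>zeros. wt x * (LINT s:ball z r|lborel. ln (cmod (s - x))))"
    using assms by (intro sum_mono mult_left_mono ball_mean_ln_ge wt_nonneg) auto
  also have "\<dots> = (LINT s:ball z r|lborel. Lp s)"
    by (rule set_integral_Lp[symmetric]) auto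
  finally show ?thesis .
qed

lemma Lp_annulus_ge:
  assumes "a > 0"
  shows "(LINT s:annulus a b|lborel. ln (cmod s)) \<le> (LINT s:annulus a b|lborel. Lp s)"
proof -
  have "(LINT s:annulus a b|lborel. ln (cmod s)) = (\<Sum>x\<in>zeros. wt x * (LINT s:annulus a b|lborel. ln (cmod s)))"
    by (simp add: sum_wt flip: sum_distrib_right)
  also have "\<dots> \<le> (\<Sum>x\<in>zeros. wt x * (LINT s:annulus a b|lborel. ln (cmod (s - x))))"
    using assms by (intro sum_mono mult_left_mono annulus_mean_ln wt_nonneg)
  also have "\<dots> = (LINT s:annulus a b|lborel. Lp s)"
    by (rule set_integral_Lp[symmetric]) (auto simp: annulus_props)
  finally show ?thesis .
qed

lemma continuous_Lp: "continuous_on (- zeros) Lp"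
  unfolding Lp_def by (intro continuous_intros) auto

lemma integral_Lp:
  assumes "\<And>z. integrable M (\<lambda>t. ln (cmod (z - t)))"
  shows "integrable M Lp" "(\<integral> t. Lp t \<partial>M) = - (\<Sum>x\<in>zeros. wt x * pot M x)"
proof -
  have i: "integrable M (\<lambda>t. wt x * ln (cmod (t - x)))" for x
    using assms[of x] by (simp add: norm_minus_commute)
  then show "integrable M Lp" unfolding Lp_def by (intro Bochner_Integration.integrable_sum)
  have "(\<integral> t. Lp t \<partial>M) = (\<Sum>x\<in>zeros. \<integral> t. wt x * ln (cmod (t - x)) \<partial>M)"
    unfolding Lp_def using i by (rule Bochner_Integration.integral_sum)
  also have "\<dots> = - (\<Sum>x\<in>zeros. wt x * pot M x)"
    by (simp add: pot_def norm_minus_commute sum_negf)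
  finally show "(\<integral> t. Lp t \<partial>M) = - (\<Sum>x\<in>zeros. wt x * pot M x)" .
qed

text \<open>
  All statements about zero counting measures are reduced to finite weighted sums over the zeros.
\<close>

lemma integral_zero_measure:
  fixes f :: "complex \<Rightarrow> real"
  assumes [measurable]: "f \<in> borel_measurable borel" and [measurable]: "V \<in> sets borel"
  shows "integral\<^sup>L (measure_restriction (zero_measure p) V) f = (\<Sum>x\<in>zeros. wt x * (indicator V x * f x))"
proof -
  define D where "D = density (count_space UNIV) (\<lambda>z. ennreal (wt z))"
  have zm: "zero_measure p = distr D borel (\<lambda>z. z)"
    by (simp add: zero_measure_def D_def wt_def)
  have setsz: "sets (zero_measure p) = sets borel" by (simp add: zm)
  note [measurable_cong] = setsz
  have "integral\<^sup>L (measure_restriction (zero_measure p) V) f = (\<integral> x. indicator V x *\<^sub>R f x \<partial>zero_measure p)"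
    unfolding measure_restriction_def ennreal_indicator[symmetric]
    by (rule integral_density) auto
  also have "\<dots> = (\<integral> x. indicator V x *\<^sub>R f x \<partial>D)"
    unfolding zm by (rule integral_distr) (auto simp: D_def)
  also have "\<dots> = (\<integral> x. wt x *\<^sub>R (indicator V x *\<^sub>R f x) \<partial>count_space UNIV)"
    unfolding D_def by (rule integral_density) (auto simp: wt_nonneg)
  also have "\<dots> = (\<Sum>x\<in>zeros. wt x * (indicator V x * f x))"
  proof -
    have sub: "{a. wt a *\<^sub>R (indicator V a *\<^sub>R f a) \<noteq> 0} \<subseteq> zeros"
      using p_nz by (auto simp: wt_def zeros_def order_root)
    then have "finite {a \<in> UNIV. wt a *\<^sub>R (indicator V a *\<^sub>R f a) \<noteq> 0}"
      using finite_zeros finite_subset by auto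
    from lebesgue_integral_count_space_finite_support[OF this] show ?thesis
      using sub by (auto intro!: sum.mono_neutral_left finite_zeros)
  qed
  finally show ?thesis .
qed

end

section \<open>The Bernstein-Walsh inequality and the excess potential\<close>

text \<open>
  The properties of an equilibrium measure that the arguments below use; \<open>rob\<close> stands for the
  Robin constant.
\<close>

locale frostman_measure = compact_prob M E for M E +
  fixes rob :: real
  assumes int_ln: "\<And>z. integrable M (\<lambda>t. ln (cmod (z - t)))"
    and no_atom: "\<And>z. AE t in M. t \<noteq> z"
    and pot_le: "\<And>z. pot M z \<le> rob"
begin

definition Out :: "complex set" where "Out = outside E"
definition H :: "complex set" where "H = poly_convex_hull E"

lemma E_closed: "closed E" using K_compact by (rule compact_imp_closed)
lemma open_Out: "open Out" unfolding Out_def by (rule open_outside[OF E_closed])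
lemma connected_Out: "connected Out"
  unfolding Out_def by (rule connected_outside) (auto simp: compact_imp_bounded K_compact)
lemma H_eq: "H = - Out" by (simp add: H_def poly_convex_hull_def Out_def)
lemma Out_E: "Out \<inter> E = {}" unfolding Out_def by (rule outside_no_overlap)
lemma E_sub_H: "E \<subseteq> H" using Out_E H_eq by auto
lemma closed_H: "closed H" using open_Out H_eq by (simp add: closed_def)
lemma bounded_H: "bounded H"
  using cobounded_outside[OF compact_imp_bounded[OF K_compact]] H_eq Out_def by simp
lemma compact_H: "compact H" using closed_H bounded_H by (simp add: compact_eq_bounded_closed)
lemma frontier_H: "frontier H \<subseteq> E"
  using frontier_outside_subset[OF E_closed] by (simp add: H_eq Out_def frontier_complement)

text \<open>
  For the equilibrium measure and the Robin constant this is, in the outer domain, the Green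
  function with pole at infinity.
\<close>

definition g :: "complex \<Rightarrow> real" where "g z = rob - pot M z"

lemma g_nonneg: "g z \<ge> 0" using pot_le[of z] by (simp add: g_def)

lemma g_measurable [measurable]: "g \<in> borel_measurable borel"
  unfolding g_def by measurable

lemma set_integrable_g: "S \<in> sets borel \<Longrightarrow> bounded S \<Longrightarrow> set_integrable lborel S g"
  unfolding g_def
  by (intro set_integral_diff pot_Fubini)
     (auto simp: set_integrable_def intro!: integrable_real_indicator emeasure_bounded_finite[simplified])

lemma nn_integral_g:
  assumes "S \<in> sets borel" "bounded S"
  shows "(\<integral>\<^sup>+ s\<in>S. ennreal (g s) \<partial>lborel) = ennreal (LINT s:S|lborel. g s)"
proof -
  have "(\<integral>\<^sup>+ s\<in>S. ennreal (g s) \<partial>lborel) = (\<integral>\<^sup>+ s. ennreal (indicator S s *\<^sub>R g s) \<partial>lborel)"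
    by (intro nn_integral_cong) (simp add: indicator_def)
  also have "\<dots> = ennreal (LINT s:S|lborel. g s)"
    unfolding set_lebesgue_integral_def using set_integrable_g[OF assms] g_nonneg
    by (intro nn_integral_eq_integral) (auto simp: set_integrable_def)
  finally show ?thesis .
qed

end

locale frostman_poly = frostman_measure M E rob + monic_poly p for M E rob p
begin

definition nrm :: real where "nrm = (SUP z\<in>E. cmod (poly p z))"

text \<open>
  The amount by which the \<open>n\<close>-th root of the norm exceeds the capacity, on a logarithmic scale.
\<close>

definition eps :: real where "eps = ln nrm / real (degree p) + rob"

lemma bdd_poly: "bdd_above ((\<lambda>z. cmod (poly p z)) ` E)"
  by (intro bounded_imp_bdd_above compact_imp_bounded compact_continuous_image K_compact continuous_intros)

lemma le_nrm_E: "z \<in> E \<Longrightarrow> cmod (poly p z) \<le> nrm"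
  unfolding nrm_def by (rule cSUP_upper[OF _ bdd_poly])

lemma AE_not_zeros: "AE t in M. t \<notin> zeros"
proof -
  have "AE t in M. \<forall>x\<in>zeros. t \<noteq> x"
    using no_atom by (simp add: AE_finite_all finite_zeros)
  then show ?thesis by eventually_elim auto
qed

lemma nrm_pos: "nrm > 0"
proof -
  have "AE t in M. t \<in> E \<and> t \<notin> zeros" using AE_K AE_not_zeros by eventually_elim simp
  then have "\<exists>t. t \<in> E \<and> t \<notin> zeros"
    by (rule eventually_happens'[rotated]) (simp add: ae_filter_eq_bot_iff emeasure_space_1)
  then obtain t where "t \<in> E" "t \<notin> zeros" by blast
  then show ?thesis using le_nrm_E[of t] by (auto simp: zeros_def intro: less_le_trans[rotated])
qed

lemma le_nrm_H:
  assumes "z \<in> H" shows "cmod (poly p z) \<le> nrm"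
proof (rule maximum_modulus_frontier[of "poly p" H])
  show "cmod (poly p w) \<le> nrm" if "w \<in> frontier H" for w
    using that frontier_H le_nrm_E by auto
qed (use assms bounded_H in \<open>auto intro!: holomorphic_intros continuous_intros\<close>)

lemma Lp_le_H:
  assumes "z \<in> H" "z \<notin> zeros"
  shows "Lp z \<le> ln nrm / real (degree p)"
proof -
  have "ln (cmod (poly p z)) \<le> ln nrm"
    using le_nrm_H[OF assms(1)] assms(2) by (intro ln_mono) (auto simp: zeros_def)
  then show ?thesis using deg ln_poly_eq[OF assms(2)] by (simp add: field_simps)
qed

text \<open>
  Integrate \<open>ln \<bar>p\<bar> / n \<le> ln \<parallel>p\<parallel> / n\<close>, valid on the hull by the maximum modulus principle, against
  \<open>L\<close> and exchange the order of integration.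
\<close>

lemma nrm_lower:
  assumes L: "compact_prob L K" "K \<subseteq> H" and i: "\<And>z. integrable L (\<lambda>t. ln (cmod (z - t)))"
    and na: "\<And>z. AE t in L. t \<noteq> z" and c: "\<And>z. pot L z \<le> c"
  shows "- c \<le> ln nrm / real (degree p)"
    and "- (\<Sum>x\<in>zeros. wt x * pot L x) \<le> ln nrm / real (degree p)"
proof -
  interpret L: compact_prob L K by fact
  have "AE t in L. \<forall>x\<in>zeros. t \<noteq> x"
    using na by (simp add: AE_finite_all finite_zeros)
  then have "AE t in L. Lp t \<le> ln nrm / real (degree p)"
    using L.AE_K by eventually_elim (use L(2) in \<open>auto intro!: Lp_le_H\<close>)
  then have "(\<integral> t. Lp t \<partial>L) \<le> (\<integral> t. ln nrm / real (degree p) \<partial>L)"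
    using integral_Lp[OF i] by (intro integral_mono_AE) auto
  also have "\<dots> = ln nrm / real (degree p)" using L.prob_space by simp
  finally show 1: "- (\<Sum>x\<in>zeros. wt x * pot L x) \<le> ln nrm / real (degree p)"
    using integral_Lp[OF i] by simp
  have "(\<Sum>x\<in>zeros. wt x * pot L x) \<le> (\<Sum>x\<in>zeros. wt x * c)"
    by (intro sum_mono mult_left_mono c wt_nonneg)
  also have "\<dots> = c" by (simp add: sum_wt flip: sum_distrib_right)
  finally show "- c \<le> ln nrm / real (degree p)" using 1 by simp
qed

text \<open>
  The mean of \<open>g\<close> over the zeros is controlled by the norm of the polynomial: apply the preceding
  bound to the equilibrium measure itself.
\<close>

lemma sum_green_le: "(\<Sum>x\<in>zeros. wt x * g x) \<le> eps"
proof -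
  have "(\<Sum>x\<in>zeros. wt x * g x) = rob - (\<Sum>x\<in>zeros. wt x * pot M x)"
    by (simp add: g_def right_diff_distrib sum_subtractf sum_wt flip: sum_distrib_right)
  also have "\<dots> \<le> eps"
    using nrm_lower(2)[OF compact_prob_axioms E_sub_H int_ln no_atom pot_le] by (simp add: eps_def)
  finally show ?thesis .
qed

lemma eps_nonneg: "eps \<ge> 0"
proof -
  have "0 \<le> (\<Sum>x\<in>zeros. wt x * g x)" by (intro sum_nonneg mult_nonneg_nonneg wt_nonneg g_nonneg)
  then show ?thesis using sum_green_le by linarith
qed

lemma hull_bound: "z \<in> H \<Longrightarrow> z \<notin> zeros \<Longrightarrow> 0 \<le> - Lp z - rob + eps"
  using Lp_le_H[of z] by (simp add: eps_def)

text \<open>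
  In the outer domain \<open>Lp + u\<close> is subharmonic off the zeros, its limit at infinity is 0, and near
  the boundary, where \<open>\<bar>p\<bar>\<close> is at most slightly larger than its norm, it is at most slightly
  larger than \<open>eps\<close>. The maximum principle applies.
\<close>

lemma bernstein_walsh:
  assumes z: "z \<notin> zeros" shows "0 \<le> - Lp z - pot M z + eps"
proof (cases "z \<in> H")
  case True
  then show ?thesis using hull_bound[OF True z] pot_le[of z] by simp
next
  case False
  define n where "n = real (degree p)"
  have n: "n > 0" using deg by (simp add: n_def)
  define v where "v = (\<lambda>z. Lp z + pot M z)"
  define S where "S = Out - zeros"
  have oS: "open S" unfolding S_def using open_Out finite_zeros by (simp add: open_Diff finite_imp_closed)
  have SE: "S \<subseteq> - E" using Out_E by (auto simp: S_def)
  have cv: "continuous_on (- E - zeros) v"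
    unfolding v_def by (intro continuous_on_add continuous_on_subset[OF continuous_Lp] continuous_on_subset[OF continuous_pot_off]) auto
  have cvS: "continuous_on S v" by (rule continuous_on_subset[OF cv]) (use SE in \<open>auto simp: S_def\<close>)
  have zS: "z \<in> S" using False z by (simp add: S_def H_eq)
  have "v z \<le> eps"
  proof (rule submean_max_principle[OF _ _ _ zS])
    show "open {z\<in>S. v z < c}" for c
      using continuous_open_preimage[OF cvS oS, of "{..<c}"] by (simp add: vimage_def Int_def)
  next
    fix z assume zS: "z \<in> S"
    then obtain r where r: "r > 0" "cball z r \<subseteq> S" using oS open_contains_cball by blast
    have rE: "r \<le> cmod (z - t)" if "t \<in> E" for t
    proof (rule ccontr)
      assume "\<not> ?thesis"
      then have "t \<in> S" using r by (auto simp: dist_norm subset_iff)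
      then show False using that SE by auto
    qed
    have i: "set_integrable lborel (ball z r) Lp" "set_integrable lborel (ball z r) (pot M)"
      by (auto intro!: set_integrable_Lp pot_Fubini)
    have "pi * r\<^sup>2 * v z = pi * r\<^sup>2 * Lp z + pi * r\<^sup>2 * pot M z" by (simp add: v_def algebra_simps)
    also have "\<dots> \<le> (LINT s:ball z r|lborel. Lp s) + (LINT s:ball z r|lborel. pot M s)"
      using Lp_ball_ge[of z r] pot_ball_eq[of r z] rE r zS by (simp add: S_def)
    also have "\<dots> = (LINT s:ball z r|lborel. v s)"
      unfolding v_def using set_integral_add(2)[OF i] by simp
    finally have "pi * r\<^sup>2 * v z \<le> (LINT s:ball z r|lborel. v s)" .
    moreover have "set_integrable lborel (ball z r) v"
      unfolding v_def by (rule set_integral_add(1)[OF i])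
    ultimately show "\<exists>r>0. cball z r \<subseteq> S \<and> set_integrable lborel (ball z r) v \<and> pi * r\<^sup>2 * v z \<le> (LINT s:ball z r|lborel. v s)"
      using r by blast
  next
    fix \<epsilon> :: real assume \<epsilon>: "\<epsilon> > 0"
    \<comment> \<open>Where \<open>\<bar>p\<bar>\<close> is slightly larger than its norm one is automatically in the outer domain and
      away from the zeros, so closed bounded subsets of \<open>T\<close> are compact in \<open>S\<close>.\<close>
    define T where "T = {z. nrm * exp (n * \<epsilon>) \<le> cmod (poly p z)}"
    have clT: "closed T" unfolding T_def
      by (intro closed_Collect_le continuous_intros)
    have big: "nrm < nrm * exp (n * \<epsilon>)" using nrm_pos n \<epsilon> by simp
    have T: "T \<subseteq> S"
    proof
      fix x assume x: "x \<in> T"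
      then have gt: "nrm < cmod (poly p x)" using big by (simp add: T_def)
      then have "x \<notin> H" using le_nrm_H[of x] by auto
      moreover have "x \<notin> zeros" using gt nrm_pos by (auto simp: zeros_def)
      ultimately show "x \<in> S" by (simp add: S_def H_eq)
    qed
    define C where "C = {z\<in>T. eps + \<epsilon> \<le> v z}"
    have "closed C"
    proof -
      have "closed (T \<inter> v -` {eps + \<epsilon>..})"
        by (intro continuous_closed_preimage continuous_on_subset[OF cvS T] clT) auto
      then show ?thesis by (simp add: C_def Int_def vimage_def)
    qed
    obtain R0 where R0: "R0 > 0" "E \<subseteq> ball 0 R0" by (rule K_radius)
    obtain \<rho> where \<rho>: "\<rho> > 0" "zeros \<subseteq> ball 0 \<rho>"
      using finite_imp_bounded[OF finite_zeros] bounded_subset_ballD by metis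
    \<comment> \<open>beyond this radius \<open>\<bar>x\<bar> + \<rho> < (\<bar>x\<bar> - R0) exp \<epsilon>\<close>, hence \<open>v x < \<epsilon>\<close>\<close>
    define B where "B = max (R0 + 1) ((\<rho> + R0 * exp \<epsilon>) / (exp \<epsilon> - 1) + 1)"
    have e1: "exp \<epsilon> > 1" using \<epsilon> by simp
    have "bounded C"
    proof (rule boundedI)
      fix x assume x: "x \<in> C"
      show "cmod x \<le> B"
      proof (rule ccontr)
        assume "\<not> ?thesis"
        then have gt: "cmod x > R0 + 1" "cmod x > (\<rho> + R0 * exp \<epsilon>) / (exp \<epsilon> - 1)" by (auto simp: B_def)
        have xz: "x \<notin> zeros" using x T by (auto simp: C_def S_def)
        have "Lp x \<le> (\<Sum>y\<in>zeros. wt y * ln (cmod x + \<rho>))"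
          unfolding Lp_def
        proof (intro sum_mono mult_left_mono wt_nonneg ln_mono)
          fix y assume y: "y \<in> zeros"
          show "cmod (x - y) \<le> cmod x + \<rho>"
          proof -
            have "cmod y < \<rho>" using y \<rho> by auto
            then show ?thesis using norm_triangle_ineq4[of x y] by linarith
          qed
          show "0 < cmod (x - y)" using y xz by auto
        qed
        also have "\<dots> = ln (cmod x + \<rho>)" by (simp add: sum_wt flip: sum_distrib_right)
        finally have 1: "Lp x \<le> ln (cmod x + \<rho>)" .
        have 2: "pot M x \<le> - ln (cmod x - R0)"
          using R0 gt by (intro pot_far(2)) auto
        have "cmod x + \<rho> < (cmod x - R0) * exp \<epsilon>"
          using gt(2) e1 by (simp add: divide_less_eq algebra_simps)
        then have "ln (cmod x + \<rho>) < ln ((cmod x - R0) * exp \<epsilon>)"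
          using gt R0 \<rho> by (subst ln_less_cancel_iff) (auto intro!: add_nonneg_pos)
        also have "\<dots> = ln (cmod x - R0) + \<epsilon>" using gt by (simp add: ln_mult)
        finally have "v x < \<epsilon>" using 1 2 by (simp add: v_def)
        then show False using x eps_nonneg by (simp add: C_def)
      qed
    qed
    with \<open>closed C\<close> have "compact C" by (simp add: compact_eq_bounded_closed)
    moreover have "v x \<le> eps + \<epsilon>" if x: "x \<in> S - C" for x
    proof (cases "x \<in> T")
      case True then show ?thesis using x by (auto simp: C_def)
    next
      case False
      have xz: "x \<notin> zeros" using x by (simp add: S_def)
      then have pz: "cmod (poly p x) > 0" by (simp add: zeros_def)
      have "ln (cmod (poly p x)) \<le> ln (nrm * exp (n * \<epsilon>))"
        using False pz by (intro ln_mono) (auto simp: T_def)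
      also have "\<dots> = ln nrm + n * \<epsilon>" using nrm_pos by (simp add: ln_mult)
      finally have "n * Lp x \<le> ln nrm + n * \<epsilon>" using ln_poly_eq[OF xz] by (simp add: n_def)
      then have "Lp x \<le> ln nrm / n + \<epsilon>" using n by (simp add: field_simps)
      then show ?thesis using pot_le[of x] by (simp add: v_def eps_def n_def)
    qed
    ultimately show "\<exists>C. compact C \<and> C \<subseteq> S \<and> (\<forall>z\<in>S - C. v z \<le> eps + \<epsilon>)"
      using T by (intro exI[of _ C]) (auto simp: C_def)
  qed
  then show ?thesis by (simp add: v_def)
qed

text \<open>
  The potential of the zeros minus the potential of \<open>M\<close>, shifted by \<open>eps\<close> to be nonnegative. The
  value \<open>\<infinity>\<close> at the zeros makes it superharmonic there as well.
\<close>

definition excess :: "complex \<Rightarrow> ennreal" where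
  "excess z = (if z \<in> zeros then \<infinity> else ennreal (- Lp z - pot M z + eps))"

text \<open>
  The excess with \<open>pot M\<close> replaced by its upper bound \<open>rob\<close>. For the equilibrium measure the two
  agree almost everywhere on the hull; this one satisfies the super-mean value inequality at every
  point of an open subset of the hull.
\<close>

definition hull_excess :: "complex \<Rightarrow> ennreal" where
  "hull_excess z = (if z \<in> zeros then \<infinity> else ennreal (- Lp z - rob + eps))"

lemma zeros_borel [measurable]: "zeros \<in> sets borel"
  using finite_zeros by (simp add: finite_imp_closed)

lemma excess_measurable [measurable]: "excess \<in> borel_measurable borel"
  unfolding excess_def by measurable

lemma hull_excess_measurable [measurable]: "hull_excess \<in> borel_measurable borel"
  unfolding hull_excess_def by measurable

lemma hull_excess_le_excess: "hull_excess z \<le> excess z"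
  using pot_le[of z] by (auto simp: hull_excess_def excess_def intro!: ennreal_leI)

lemma excess_eq_hull_excess: "pot M z = rob \<Longrightarrow> excess z = hull_excess z"
  by (simp add: hull_excess_def excess_def)

lemma minus_Lp:
  assumes "S \<in> sets borel" "bounded S"
  shows "set_integrable lborel S (\<lambda>s. - Lp s)" "(LINT s:S|lborel. - Lp s) = - (LINT s:S|lborel. Lp s)"
  using set_integrable_Lp[OF assms] by (simp_all add: set_integrable_def set_lebesgue_integral_def)

lemma nn_integral_excess:
  assumes S [measurable]: "S \<in> sets borel" and b: "bounded S"
  shows "(\<integral>\<^sup>+ s\<in>S. excess s \<partial>lborel) = ennreal (LINT s:S|lborel. - Lp s - pot M s + eps)"
    and "set_integrable lborel S (\<lambda>s. - Lp s - pot M s + eps)"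
proof -
  show i: "set_integrable lborel S (\<lambda>s. - Lp s - pot M s + eps)"
    by (intro set_integral_add set_integral_diff minus_Lp[OF S b] pot_Fubini[OF S b]
        set_integrable_const_bounded[OF S b])
  have "(\<integral>\<^sup>+ s\<in>S. excess s \<partial>lborel) = (\<integral>\<^sup>+ s. ennreal (indicator S s *\<^sub>R (- Lp s - pot M s + eps)) \<partial>lborel)"
    by (rule nn_integral_cong_AE, use AE_not_zero in eventually_elim) (simp add: excess_def indicator_def)
  also have "\<dots> = ennreal (LINT s:S|lborel. - Lp s - pot M s + eps)"
    unfolding set_lebesgue_integral_def
    by (rule nn_integral_eq_integral[OF i[unfolded set_integrable_def]], use AE_not_zero in eventually_elim)
       (use bernstein_walsh in \<open>auto simp: indicator_def\<close>)
  finally show "(\<integral>\<^sup>+ s\<in>S. excess s \<partial>lborel) = ennreal (LINT s:S|lborel. - Lp s - pot M s + eps)" .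
qed

lemma nn_integral_hull_excess:
  assumes S [measurable]: "S \<in> sets borel" and b: "bounded S" and H: "S \<subseteq> H"
  shows "(\<integral>\<^sup>+ s\<in>S. hull_excess s \<partial>lborel) = ennreal (LINT s:S|lborel. - Lp s - rob + eps)"
    and "set_integrable lborel S (\<lambda>s. - Lp s - rob + eps)"
proof -
  show i: "set_integrable lborel S (\<lambda>s. - Lp s - rob + eps)"
    by (intro set_integral_add set_integral_diff minus_Lp[OF S b]
        set_integrable_const_bounded[OF S b])
  have "(\<integral>\<^sup>+ s\<in>S. hull_excess s \<partial>lborel) = (\<integral>\<^sup>+ s. ennreal (indicator S s *\<^sub>R (- Lp s - rob + eps)) \<partial>lborel)"
    by (rule nn_integral_cong_AE, use AE_not_zero in eventually_elim) (simp add: hull_excess_def indicator_def)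
  also have "\<dots> = ennreal (LINT s:S|lborel. - Lp s - rob + eps)"
    unfolding set_lebesgue_integral_def
    by (rule nn_integral_eq_integral[OF i[unfolded set_integrable_def]], use AE_not_zero in eventually_elim)
       (use hull_bound H in \<open>auto simp: indicator_def\<close>)
  finally show "(\<integral>\<^sup>+ s\<in>S. hull_excess s \<partial>lborel) = ennreal (LINT s:S|lborel. - Lp s - rob + eps)" .
qed

text \<open>
  The potential of the zeros is superharmonic and \<open>u = rob - g\<close>, so over a disc about a point of
  small excess only the integral of \<open>g\<close> remains.
\<close>

lemma excess_ball_le_green:
  assumes r: "r > 0" and \<eta>: "excess z \<le> ennreal \<eta>" "\<eta> \<ge> 0"
  shows "(\<integral>\<^sup>+ s\<in>ball z r. excess s \<partial>lborel) \<le> ennreal (pi * r\<^sup>2 * \<eta>) + (\<integral>\<^sup>+ s\<in>ball z r. ennreal (g s) \<partial>lborel)"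
proof -
  have z: "z \<notin> zeros" using \<eta> by (auto simp: excess_def top_unique)
  have dz: "- Lp z - pot M z + eps \<le> \<eta>"
    using \<eta> z bernstein_walsh[OF z] by (simp add: excess_def)
  have iL: "set_integrable lborel (ball z r) (\<lambda>s. - Lp s)"
    and iP: "set_integrable lborel (ball z r) (pot M)"
    by (auto intro!: minus_Lp pot_Fubini)
  have "(LINT s:ball z r|lborel. - Lp s - pot M s + eps)
      = - (LINT s:ball z r|lborel. Lp s) - (LINT s:ball z r|lborel. pot M s) + pi * r\<^sup>2 * eps"
    using set_integral_add(2)[OF set_integral_diff(1)[OF iL iP] set_integral_const_ball(2)]
      set_integral_diff(2)[OF iL iP] set_integral_const_ball(1) r
    by (simp add: minus_Lp)
  also have "\<dots> \<le> - (pi * r\<^sup>2 * Lp z) - (LINT s:ball z r|lborel. pot M s) + pi * r\<^sup>2 * eps"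
    using Lp_ball_ge[OF z, of r] r by simp
  also have "\<dots> \<le> pi * r\<^sup>2 * (\<eta> + rob) - (LINT s:ball z r|lborel. pot M s)"
  proof -
    have "pi * r\<^sup>2 * (- Lp z + eps) \<le> pi * r\<^sup>2 * (\<eta> + rob)"
      using dz pot_le[of z] r by (intro mult_left_mono) auto
    then show ?thesis by (simp add: algebra_simps)
  qed
  also have "\<dots> = pi * r\<^sup>2 * \<eta> + (LINT s:ball z r|lborel. g s)"
    unfolding g_def using set_integral_diff(2)[OF set_integral_const_ball(2) iP] set_integral_const_ball(1) r
    by (simp add: algebra_simps)
  finally have le: "(LINT s:ball z r|lborel. - Lp s - pot M s + eps) \<le> pi * r\<^sup>2 * \<eta> + (LINT s:ball z r|lborel. g s)" .
  have "(\<integral>\<^sup>+ s\<in>ball z r. ennreal (g s) \<partial>lborel) = ennreal (LINT s:ball z r|lborel. g s)"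
    by (rule nn_integral_g) auto
  moreover have "0 \<le> (LINT s:ball z r|lborel. g s)"
    unfolding set_lebesgue_integral_def by (intro integral_nonneg_AE) (auto simp: g_nonneg)
  ultimately show ?thesis
    using le \<eta> by (simp add: nn_integral_excess ennreal_leI flip: ennreal_plus)
qed

text \<open>
  In the outer domain \<open>u\<close> has the mean value property, so the excess inherits superharmonicity
  from the potential of the zeros.
\<close>

lemma superharmonic_excess: "superharmonic_ball Out excess"
  unfolding superharmonic_ball_def
proof (intro conjI allI impI)
  fix z r assume r: "(r::real) > 0" "cball z r \<subseteq> Out"
  show "(\<integral>\<^sup>+ s\<in>ball z r. excess s \<partial>lborel) \<le> ennreal (pi * r\<^sup>2) * excess z"
  proof (cases "z \<in> zeros")
    case True
    then show ?thesis using r by (simp add: excess_def ennreal_mult_top)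
  next
    case False
    have rE: "r \<le> cmod (z - t)" if "t \<in> E" for t
    proof (rule ccontr)
      assume "\<not> ?thesis"
      then have "t \<in> Out" using r by (auto simp: dist_norm subset_iff)
      then show False using that Out_E by auto
    qed
    have iL: "set_integrable lborel (ball z r) (\<lambda>s. - Lp s)"
      and iP: "set_integrable lborel (ball z r) (pot M)"
      by (auto intro!: minus_Lp pot_Fubini)
    have "(LINT s:ball z r|lborel. - Lp s - pot M s + eps)
        = - (LINT s:ball z r|lborel. Lp s) - (LINT s:ball z r|lborel. pot M s) + pi * r\<^sup>2 * eps"
      using set_integral_add(2)[OF set_integral_diff(1)[OF iL iP] set_integral_const_ball(2)]
        set_integral_diff(2)[OF iL iP] set_integral_const_ball(1) r
      by (simp add: minus_Lp)
    also have "\<dots> \<le> pi * r\<^sup>2 * (- Lp z - pot M z + eps)"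
      using Lp_ball_ge[OF False, of r] pot_ball_eq[of r z] rE r by (simp add: algebra_simps)
    finally have le: "(LINT s:ball z r|lborel. - Lp s - pot M s + eps) \<le> pi * r\<^sup>2 * (- Lp z - pot M z + eps)" .
    have "excess z = ennreal (- Lp z - pot M z + eps)" using False by (simp add: excess_def)
    then show ?thesis using le bernstein_walsh[OF False] nn_integral_excess(1)[of "ball z r"]
      by (simp add: ennreal_leI flip: ennreal_mult)
  qed
qed measurable

lemma superharmonic_hull_excess:
  assumes "G \<subseteq> H" shows "superharmonic_ball G hull_excess"
  unfolding superharmonic_ball_def
proof (intro conjI allI impI)
  fix z r assume r: "(r::real) > 0" "cball z r \<subseteq> G"
  have "ball z r \<subseteq> cball z r" "z \<in> cball z r" using r by auto
  then have sub: "ball z r \<subseteq> H" "z \<in> H" using r(2) assms by blast+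
  show "(\<integral>\<^sup>+ s\<in>ball z r. hull_excess s \<partial>lborel) \<le> ennreal (pi * r\<^sup>2) * hull_excess z"
  proof (cases "z \<in> zeros")
    case True
    then show ?thesis using r by (simp add: hull_excess_def ennreal_mult_top)
  next
    case False
    have iL: "set_integrable lborel (ball z r) (\<lambda>s. - Lp s)"
      by (auto intro!: minus_Lp)
    have "(LINT s:ball z r|lborel. - Lp s - rob + eps) = - (LINT s:ball z r|lborel. Lp s) + pi * r\<^sup>2 * (eps - rob)"
      using set_integral_add(2)[OF iL set_integral_const_ball(2), of "eps - rob"] set_integral_const_ball(1) r
      by (simp add: minus_Lp algebra_simps)
    also have "\<dots> \<le> pi * r\<^sup>2 * (- Lp z - rob + eps)"
      using Lp_ball_ge[OF False, of r] r by (simp add: algebra_simps)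
    finally have le: "(LINT s:ball z r|lborel. - Lp s - rob + eps) \<le> pi * r\<^sup>2 * (- Lp z - rob + eps)" .
    have "hull_excess z = ennreal (- Lp z - rob + eps)" using False by (simp add: hull_excess_def)
    then show ?thesis using le hull_bound[OF sub(2) False] nn_integral_hull_excess(1)[of "ball z r"] sub(1)
      by (simp add: ennreal_leI flip: ennreal_mult)
  qed
qed measurable

text \<open>
  Around the origin the annulus means of \<open>u\<close> are those of a unit mass at the centre, and the means
  of the potential of the zeros are not larger; so only \<open>eps\<close> is left.
\<close>

lemma excess_annulus:
  assumes a: "a > 0" "E \<subseteq> cball 0 a"
  shows "(\<integral>\<^sup>+ s\<in>annulus a b. excess s \<partial>lborel) \<le> ennreal (eps * measure lborel (annulus a b))"
proof -
  have iL: "set_integrable lborel (annulus a b) (\<lambda>s. - Lp s)"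
    and iP: "set_integrable lborel (annulus a b) (pot M)"
    by (auto intro!: minus_Lp pot_Fubini simp: annulus_props)
  have iC: "set_integrable lborel (annulus a b) (\<lambda>s. eps)"
    by (rule set_integrable_const_bounded) (auto simp: annulus_props)
  have "(LINT s:annulus a b|lborel. - Lp s - pot M s + eps)
      = - (LINT s:annulus a b|lborel. Lp s) - (LINT s:annulus a b|lborel. pot M s) + eps * measure lborel (annulus a b)"
    using set_integral_add(2)[OF set_integral_diff(1)[OF iL iP] iC] set_integral_diff(2)[OF iL iP]
      set_integrable_Lp[of "annulus a b"]
    by (simp add: minus_Lp annulus_props set_lebesgue_integral_def[of _ _ "\<lambda>s. eps"] mult.commute)
  also have "\<dots> \<le> eps * measure lborel (annulus a b)"
    using Lp_annulus_ge[OF a(1), of b] pot_annulus[OF a, of b] by simp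
  finally show ?thesis
    by (simp add: nn_integral_excess annulus_props ennreal_leI)
qed

end

section \<open>Convergence of the excess in the outer domain and at its boundary\<close>

context frostman_measure begin

lemma Out_nonempty: "Out \<noteq> {}"
  using bounded_H not_bounded_UNIV[where 'a=complex] by (auto simp: H_eq)

lemma far_in_Out:
  assumes "E \<subseteq> ball 0 R0" "R0 \<le> cmod z" shows "z \<in> Out"
  using outside_subset_convex[OF convex_ball assms(1)] assms(2) by (auto simp: Out_def)

lemma g_upper:
  assumes "E \<subseteq> ball 0 R0" "cmod z \<le> T"
  shows "g z \<le> rob + ln (T + R0 + 1)"
  using pot_lower[OF assms int_ln] by (simp add: g_def)

text \<open>
  Upper semicontinuity of \<open>g\<close> is lower semicontinuity of the potential.
\<close>

lemma g_usc: assumes "g w < \<eta>" shows "\<exists>\<delta>>0. \<forall>z\<in>ball w \<delta>. g z < \<eta>"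
proof -
  obtain R0 where R0: "R0 > 0" "E \<subseteq> ball 0 R0" by (rule K_radius)
  define R where "R = max (max 1 (2 * R0)) (max (2 * (cmod w + 1)) (exp (\<eta> - rob)))"
  have R: "R \<ge> 1" "R0 \<le> R/2" "cmod w < R/2" "exp (\<eta> - rob) \<le> R" by (auto simp: R_def)
  have R': "R > 0" "E \<subseteq> ball 0 (R/2)" using R R0 by auto
  have "ln (exp (\<eta> - rob)) \<le> ln R" using R(4) by (intro ln_mono) auto
  then have c: "rob - \<eta> + ln R \<ge> 0" by simp
  have ep: "epot R M z = ennreal (pot M z + ln R)" if "z \<in> ball 0 (R/2)" for z
    by (rule epot_eq_pot[OF R' that int_ln no_atom])
  have iff: "g z < \<eta> \<longleftrightarrow> \<not> epot R M z \<le> ennreal (rob - \<eta> + ln R)" if "z \<in> ball 0 (R/2)" for z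
    unfolding ep[OF that] ennreal_le_iff[OF c] by (auto simp: g_def)
  define U where "U = ball 0 (R/2) - {z. epot R M z \<le> ennreal (rob - \<eta> + ln R)}"
  have "open U" unfolding U_def by (intro open_Diff epot_le_closed R') auto
  moreover have "w \<in> U" using assms iff[of w] R by (auto simp: U_def)
  ultimately obtain \<delta> where "\<delta> > 0" "ball w \<delta> \<subseteq> U" using openE by blast
  then show ?thesis using iff by (intro exI[of _ \<delta>]) (auto simp: U_def)
qed

end

lemma ennreal_tendsto_0_cmult:
  assumes "f \<longlonglongrightarrow> 0" shows "(\<lambda>k. ennreal (c * f k)) \<longlonglongrightarrow> 0"
proof -
  have "(\<lambda>k. ennreal (c * f k)) \<longlonglongrightarrow> ennreal (c * 0)"
    by (intro tendsto_ennrealI tendsto_intros assms)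
  then show ?thesis by simp
qed

text \<open>
  A sequence of polynomials which is asymptotically extremal for \<open>E\<close>, enumerated by \<open>k\<close>. That the
  potential equals \<open>rob\<close> almost everywhere on the hull is an assumption here, and is itself
  derived from such a sequence in \<open>hull_energy_minimal\<close>.
\<close>

locale frostman_seq = frostman_measure M E rob for M E rob +
  fixes p :: "nat \<Rightarrow> complex poly"
  assumes mp: "\<And>k. monic_poly (p k)"
    and eps_lim: "(\<lambda>k. frostman_poly.eps E rob (p k)) \<longlonglongrightarrow> 0"
    and pot_hull: "AE z in lborel. z \<in> H \<longrightarrow> pot M z = rob"
begin

sublocale P: frostman_poly M E rob "p k" for k
  using mp[of k] by (simp add: frostman_poly_def frostman_measure_axioms)

text \<open>
  Convergence of the excess to 0 in \<open>L\<^sup>1(S)\<close>.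
\<close>

definition vanish :: "complex set \<Rightarrow> bool" where
  "vanish S \<longleftrightarrow> (\<lambda>k. \<integral>\<^sup>+ s\<in>S. P.excess k s \<partial>lborel) \<longlonglongrightarrow> 0"

lemma vanishI_le:
  assumes "\<And>k. (\<integral>\<^sup>+ s\<in>S. P.excess k s \<partial>lborel) \<le> f k" "f \<longlonglongrightarrow> 0"
  shows "vanish S"
  unfolding vanish_def
  by (rule tendsto_sandwich[OF _ _ tendsto_const assms(2)]) (auto simp: assms(1))

lemma vanish_mono:
  assumes "vanish T" "S \<subseteq> T" shows "vanish S"
proof (rule vanishI_le)
  show "(\<integral>\<^sup>+ s\<in>S. P.excess k s \<partial>lborel) \<le> (\<integral>\<^sup>+ s\<in>T. P.excess k s \<partial>lborel)" for k
    using assms(2) by (intro nn_integral_mono) (auto simp: indicator_def)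
qed (use assms(1) in \<open>simp add: vanish_def\<close>)

lemma vanish_Un:
  assumes "vanish S" "vanish T" "S \<in> sets borel" "T \<in> sets borel"
  shows "vanish (S \<union> T)"
proof (rule vanishI_le)
  have [measurable]: "S \<in> sets borel" "T \<in> sets borel" by fact+
  show "(\<integral>\<^sup>+ s\<in>S \<union> T. P.excess k s \<partial>lborel) \<le> (\<integral>\<^sup>+ s\<in>S. P.excess k s \<partial>lborel) + (\<integral>\<^sup>+ s\<in>T. P.excess k s \<partial>lborel)" for k
  proof -
    have "(\<integral>\<^sup>+ s\<in>S \<union> T. P.excess k s \<partial>lborel) \<le> (\<integral>\<^sup>+ s. P.excess k s * indicator S s + P.excess k s * indicator T s \<partial>lborel)"
      by (intro nn_integral_mono) (auto simp: indicator_def)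
    also have "\<dots> = (\<integral>\<^sup>+ s\<in>S. P.excess k s \<partial>lborel) + (\<integral>\<^sup>+ s\<in>T. P.excess k s \<partial>lborel)"
      by (intro nn_integral_add) measurable
    finally show ?thesis .
  qed
  show "(\<lambda>k. (\<integral>\<^sup>+ s\<in>S. P.excess k s \<partial>lborel) + (\<integral>\<^sup>+ s\<in>T. P.excess k s \<partial>lborel)) \<longlonglongrightarrow> 0"
    using tendsto_add[OF assms(1,2)[unfolded vanish_def]] by simp
qed

lemma vanish_finite_UN:
  assumes "finite I" "\<And>i. i \<in> I \<Longrightarrow> vanish (S i)" "\<And>i. i \<in> I \<Longrightarrow> S i \<in> sets borel"
  shows "vanish (\<Union>i\<in>I. S i)"
  using assms
proof (induction I)
  case empty then show ?case by (simp add: vanish_def)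
next
  case (insert i I)
  then show ?case by (auto intro!: vanish_Un sets.finite_UN)
qed

lemma vanish_compact:
  assumes "compact X" "\<And>w. w \<in> X \<Longrightarrow> \<exists>r>0. vanish (ball w r)"
  shows "vanish X"
proof -
  obtain r where r: "\<And>w. w \<in> X \<Longrightarrow> r w > 0 \<and> vanish (ball w (r w))"
  proof -
    have "\<forall>w\<in>X. \<exists>r. r > 0 \<and> vanish (ball w r)" using assms(2) by blast
    from bchoice[OF this] show thesis using that by blast
  qed
  have cov: "X \<subseteq> (\<Union>w\<in>X. ball w (r w))" using r by force
  obtain D where D: "D \<subseteq> X" "finite D" "X \<subseteq> (\<Union>w\<in>D. ball w (r w))"
    by (rule compactE_image[OF assms(1) _ cov]) auto
  have "vanish (\<Union>w\<in>D. ball w (r w))"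
    using D r by (intro vanish_finite_UN) auto
  then show ?thesis using D(3) by (rule vanish_mono)
qed

text \<open>
  Start from the annulus around \<open>E\<close>, where the integral of the excess is at most a multiple of
  \<open>eps\<close>, and follow a chain of discs.
\<close>

lemma vanish_Out:
  assumes w: "w \<in> Out" shows "\<exists>r>0. vanish (ball w r)"
proof -
  obtain R0 where R0: "R0 > 0" "E \<subseteq> ball 0 R0" by (rule K_radius)
  define a where "a = complex_of_real (R0 + 1)"
  have na: "cmod a = R0 + 1" using R0 unfolding a_def norm_of_real by simp
  have aO: "a \<in> Out" by (rule far_in_Out[OF R0(2)]) (simp add: na)
  obtain s r C where c: "s > 0" "r > 0" "C > 0" "cball w r \<subseteq> Out"
    and chain: "\<And>e z. superharmonic_ball Out e \<Longrightarrow> z \<in> ball a s \<Longrightarrow> (\<integral>\<^sup>+ x\<in>ball w r. e x \<partial>lborel) \<le> ennreal C * e z"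
    by (rule superharmonic_chain[OF open_Out connected_Out aO w], rule that, assumption+)
  define t where "t = min s 1"
  have t: "t > 0" "t \<le> s" "t \<le> 1" using c by (auto simp: t_def)
  have sub: "ball a t \<subseteq> annulus R0 (R0 + 2)"
  proof
    fix x assume "x \<in> ball a t"
    then have "cmod (a - x) < 1" using t by (simp add: dist_norm)
    moreover have "\<bar>cmod a - cmod x\<bar> \<le> cmod (a - x)" by (rule norm_triangle_ineq3)
    ultimately have "R0 < cmod x" "cmod x < R0 + 2" using na by linarith+
    then show "x \<in> annulus R0 (R0 + 2)" by (simp add: annulus_def)
  qed
  define A where "A = measure lborel (annulus R0 (R0 + 2))"
  have "vanish (ball w r)"
  proof (rule vanishI_le)
    fix k
    \<comment> \<open>every value of the excess near \<open>a\<close> bounds \<open>J\<close>, hence so does its mean near \<open>a\<close>\<close>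
    define J where "J = (\<integral>\<^sup>+ x\<in>ball w r. P.excess k x \<partial>lborel)"
    have "J * ennreal (pi * t\<^sup>2) = (\<integral>\<^sup>+ x\<in>ball a t. J \<partial>lborel)"
      using t by (simp add: nn_integral_cmult_indicator emeasure_ball_complex)
    also have "\<dots> \<le> (\<integral>\<^sup>+ x. ennreal C * (P.excess k x * indicator (annulus R0 (R0 + 2)) x) \<partial>lborel)"
    proof (intro nn_integral_mono)
      fix x
      show "J * indicator (ball a t) x \<le> ennreal C * (P.excess k x * indicator (annulus R0 (R0 + 2)) x)"
      proof (cases "x \<in> ball a t")
        case True
        then have "x \<in> ball a s" "x \<in> annulus R0 (R0 + 2)" using t sub by auto
        then show ?thesis using chain[OF P.superharmonic_excess[of k], of x] True unfolding J_def by simp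
      qed simp
    qed
    also have "\<dots> = ennreal C * (\<integral>\<^sup>+ x\<in>annulus R0 (R0 + 2). P.excess k x \<partial>lborel)"
      using annulus_props(1)[of R0 "R0 + 2"] by (intro nn_integral_cmult) simp
    also have "\<dots> \<le> ennreal C * ennreal (P.eps k * A)"
      unfolding A_def using R0 by (intro mult_left_mono P.excess_annulus) auto
    finally have le: "J * ennreal (pi * t\<^sup>2) \<le> ennreal C * ennreal (P.eps k * A)" .
    have "J = ennreal (1 / (pi * t\<^sup>2)) * (J * ennreal (pi * t\<^sup>2))"
    proof -
      have "ennreal (1 / (pi * t\<^sup>2)) * ennreal (pi * t\<^sup>2) = 1" using t by (simp flip: ennreal_mult)
      then have "J = J * (ennreal (1 / (pi * t\<^sup>2)) * ennreal (pi * t\<^sup>2))" by (simp only: mult_1_right)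
      then show ?thesis by (simp only: mult.left_commute)
    qed
    also have "\<dots> \<le> ennreal (1 / (pi * t\<^sup>2)) * (ennreal C * ennreal (P.eps k * A))"
      by (intro mult_left_mono le) auto
    also have "\<dots> = ennreal (1 / (pi * t\<^sup>2) * (C * (P.eps k * A)))"
    proof -
      have "0 \<le> P.eps k * A" using P.eps_nonneg[of k] by (simp add: A_def)
      then show ?thesis using c by (subst ennreal_mult[symmetric], simp, simp, subst ennreal_mult[symmetric], simp, simp, simp)
    qed
    also have "1 / (pi * t\<^sup>2) * (C * (P.eps k * A)) = (1 / (pi * t\<^sup>2) * C * A) * P.eps k" by simp
    finally show "(\<integral>\<^sup>+ x\<in>ball w r. P.excess k x \<partial>lborel) \<le> ennreal ((1 / (pi * t\<^sup>2) * C * A) * P.eps k)"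
      by (simp add: J_def)
  qed (rule ennreal_tendsto_0_cmult[OF eps_lim])
  then show ?thesis using c by blast
qed

text \<open>
  Every point of the closure is close to a disc in the outer domain on which the integral of the
  excess tends to 0, so the excess cannot stay above \<open>\<eta>\<close> throughout that disc.
\<close>

lemma small_value_near:
  assumes w: "w \<in> closure Out" and r: "r > 0" and \<eta>: "\<eta> > 0"
  shows "\<forall>\<^sub>F k in sequentially. \<exists>z\<in>ball w r. P.excess k z \<le> ennreal \<eta>"
proof -
  obtain w' where w': "w' \<in> Out" "dist w' w < r/2"
    using w r by (metis closure_approachable half_gt_zero)
  obtain r' where r': "r' > 0" "vanish (ball w' r')" using vanish_Out[OF w'(1)] by blast
  define t where "t = min r' (r/2)"
  have t: "t > 0" "t \<le> r'" "t \<le> r/2" using r r' by (auto simp: t_def)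
  have "vanish (ball w' t)" by (rule vanish_mono[OF r'(2)]) (use t in auto)
  then have "\<forall>\<^sub>F k in sequentially. (\<integral>\<^sup>+ s\<in>ball w' t. P.excess k s \<partial>lborel) < ennreal (pi * t\<^sup>2 * \<eta>)"
    unfolding vanish_def using t \<eta> by (intro order_tendstoD(2)) auto
  then show ?thesis
  proof eventually_elim
    case (elim k)
    show ?case
    proof (rule ccontr)
      assume no: "\<not> ?thesis"
      have big: "ennreal \<eta> \<le> P.excess k z" if "z \<in> ball w' t" for z
      proof -
        have "dist w z < r" using that t w'(2) dist_triangle[of w z w'] by (simp add: dist_commute)
        then show ?thesis using no by (auto simp: not_le less_imp_le)
      qed
      have "ennreal (pi * t\<^sup>2 * \<eta>) = (\<integral>\<^sup>+ s\<in>ball w' t. ennreal \<eta> \<partial>lborel)"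
        using t \<eta> by (simp add: nn_integral_cmult_indicator emeasure_ball_complex mult.commute flip: ennreal_mult)
      also have "\<dots> \<le> (\<integral>\<^sup>+ s\<in>ball w' t. P.excess k s \<partial>lborel)"
        using big by (intro nn_integral_mono) (auto simp: indicator_def)
      finally show False using elim by simp
    qed
  qed
qed

text \<open>
  Centre the disc at a nearby point of small excess instead of \<open>w\<close>. The slightly larger radius on
  the right absorbs this shift.
\<close>

lemma near_boundary:
  assumes w: "w \<in> closure Out" and \<rho>: "0 < \<rho>" "\<rho> < \<rho>'" and \<eta>: "\<eta> > 0"
  shows "\<forall>\<^sub>F k in sequentially. (\<integral>\<^sup>+ s\<in>ball w \<rho>. P.excess k s \<partial>lborel)
      \<le> (\<integral>\<^sup>+ s\<in>ball w \<rho>'. ennreal (g s) \<partial>lborel) + ennreal \<eta>"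
proof -
  define r where "r = (\<rho>' - \<rho>) / 2"
  have r: "r > 0" using \<rho> by (simp add: r_def)
  have "2 * r = \<rho>' - \<rho>" unfolding r_def by (simp only: times_divide_eq_right nonzero_mult_div_cancel_left zero_neq_numeral[symmetric] not_False_eq_True)
  then have r2: "\<rho>' = \<rho> + 2 * r" by simp
  define \<eta>' where "\<eta>' = \<eta> / (pi * (\<rho> + r)\<^sup>2)"
  have pr: "pi * (\<rho> + r)\<^sup>2 > 0" using \<rho> r by simp
  have \<eta>': "\<eta>' > 0" using \<eta> pr by (simp add: \<eta>'_def)
  show ?thesis using small_value_near[OF w r \<eta>']
  proof eventually_elim
    case (elim k)
    then obtain z where z: "z \<in> ball w r" "P.excess k z \<le> ennreal \<eta>'" by blast
    have sub1: "ball w \<rho> \<subseteq> ball z (\<rho> + r)"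
    proof
      fix x assume "x \<in> ball w \<rho>"
      then show "x \<in> ball z (\<rho> + r)" using z(1) dist_triangle[of z x w] by (simp add: dist_commute)
    qed
    have sub2: "ball z (\<rho> + r) \<subseteq> ball w \<rho>'"
    proof
      fix x assume "x \<in> ball z (\<rho> + r)"
      then show "x \<in> ball w \<rho>'" using z(1) dist_triangle[of w x z] r2 by (simp add: dist_commute)
    qed
    have "(\<integral>\<^sup>+ s\<in>ball w \<rho>. P.excess k s \<partial>lborel) \<le> (\<integral>\<^sup>+ s\<in>ball z (\<rho> + r). P.excess k s \<partial>lborel)"
      using sub1 by (intro nn_integral_mono) (auto simp: indicator_def)
    also have "\<dots> \<le> ennreal (pi * (\<rho> + r)\<^sup>2 * \<eta>') + (\<integral>\<^sup>+ s\<in>ball z (\<rho> + r). ennreal (g s) \<partial>lborel)"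
      by (rule P.excess_ball_le_green) (use \<rho> r z(2) \<eta>' in auto)
    also have "pi * (\<rho> + r)\<^sup>2 * \<eta>' = \<eta>" unfolding \<eta>'_def using pr by (metis less_irrefl nonzero_mult_div_cancel_left times_divide_eq_right)
    also have "(\<integral>\<^sup>+ s\<in>ball z (\<rho> + r). ennreal (g s) \<partial>lborel) \<le> (\<integral>\<^sup>+ s\<in>ball w \<rho>'. ennreal (g s) \<partial>lborel)"
      using sub2 by (intro nn_integral_mono) (auto simp: indicator_def)
    finally show ?case by (simp add: add.commute add_left_mono)
  qed
qed

end

section \<open>Convergence across the boundary of the hull\<close>

lemma ennreal_tendsto_0I:
  fixes f :: "nat \<Rightarrow> ennreal"
  assumes "\<And>e::real. e > 0 \<Longrightarrow> \<forall>\<^sub>F j in sequentially. f j \<le> ennreal e"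
  shows "f \<longlonglongrightarrow> 0"
proof (rule order_tendstoI)
  fix a :: ennreal assume "0 < a"
  then obtain b where b: "0 < b" "b < a" using dense by blast
  then obtain e where e: "b = ennreal e" by (cases b) auto
  then have "e > 0" using b by (simp add: ennreal_less_zero_iff)
  from assms[OF this] show "\<forall>\<^sub>F j in sequentially. f j < a"
    by eventually_elim (use b e in auto)
qed auto

text \<open>
  Each point of \<open>X\<close> lies in all discs of radius \<open>\<rho>\<close> whose centres are within \<open>\<rho>\<close> of it, and all
  these centres belong to \<open>X1\<close>; exchange the integrals.
\<close>

lemma nn_integral_le_average:
  assumes X [measurable]: "X \<in> sets borel" and X1 [measurable]: "X1 \<in> sets borel" and \<rho>: "\<rho> > 0"
    and sub: "\<And>x. x \<in> X \<Longrightarrow> ball x \<rho> \<subseteq> X1" and f [measurable]: "f \<in> borel_measurable borel"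
  shows "(\<integral>\<^sup>+ s\<in>X. f s \<partial>lborel) \<le> (\<integral>\<^sup>+ w\<in>X1. (ennreal (1 / (pi * \<rho>\<^sup>2)) * (\<integral>\<^sup>+ s\<in>ball (w::complex) \<rho>. f s \<partial>lborel)) \<partial>lborel)"
proof -
  define a where "a = ennreal (1 / (pi * \<rho>\<^sup>2))"
  define h where "h = (\<lambda>w s. a * (f s * indicator (ball w \<rho>) s) * indicator X1 w)"
  have ball_sym: "indicator (ball w \<rho>) s = (indicator (ball s \<rho>) w :: ennreal)" for w s :: complex
    by (simp add: indicator_def dist_commute)
  have ind_eq: "indicator (ball w \<rho>) s = (if cmod (w - s) < \<rho> then 1 else 0 :: ennreal)" for w s :: complex
    by (simp add: indicator_def dist_norm)
  have [measurable]: "case_prod h \<in> borel_measurable (borel \<Otimes>\<^sub>M borel)"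
    unfolding h_def ind_eq by measurable
  have one: "a * ennreal (pi * \<rho>\<^sup>2) = 1" using \<rho> by (simp add: a_def flip: ennreal_mult)
  have "(\<integral>\<^sup>+ s\<in>X. f s \<partial>lborel) \<le> (\<integral>\<^sup>+ s. (\<integral>\<^sup>+ w. h w s \<partial>lborel) \<partial>lborel)"
  proof (intro nn_integral_mono)
    fix s
    show "f s * indicator X s \<le> (\<integral>\<^sup>+ w. h w s \<partial>lborel)"
    proof (cases "s \<in> X")
      case True
      have "f s = a * f s * emeasure lborel (ball s \<rho>)"
      proof -
        have "f s = f s * (a * ennreal (pi * \<rho>\<^sup>2))" unfolding one by simp
        then show ?thesis using \<rho> by (simp add: emeasure_ball_complex mult_ac)
      qed
      also have "\<dots> = (\<integral>\<^sup>+ w. a * f s * indicator (ball s \<rho>) w \<partial>lborel)"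
        by (subst nn_integral_cmult_indicator) auto
      also have "\<dots> \<le> (\<integral>\<^sup>+ w. h w s \<partial>lborel)"
      proof (intro nn_integral_mono)
        fix w
        show "a * f s * indicator (ball s \<rho>) w \<le> h w s"
        proof (cases "w \<in> ball s \<rho>")
          case w: True
          then have "w \<in> X1" using sub[OF True] by blast
          then show ?thesis using w by (simp add: h_def dist_commute)
        qed simp
      qed
      finally show ?thesis using True by simp
    qed simp
  qed
  also have "\<dots> = (\<integral>\<^sup>+ w. (\<integral>\<^sup>+ s. h w s \<partial>lborel) \<partial>lborel)"
    by (rule lborel_pair.Fubini') measurable
  also have "\<dots> = (\<integral>\<^sup>+ w\<in>X1. (a * (\<integral>\<^sup>+ s\<in>ball w \<rho>. f s \<partial>lborel)) \<partial>lborel)"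
    unfolding h_def by (simp add: nn_integral_multc nn_integral_cmult)
  finally show ?thesis by (simp add: a_def)
qed

lemma average_measurable [measurable]:
  "f \<in> borel_measurable borel \<Longrightarrow> (\<lambda>w::complex. \<integral>\<^sup>+ s\<in>ball w \<rho>. f s \<partial>lborel) \<in> borel_measurable borel"
proof -
  assume [measurable]: "f \<in> borel_measurable borel"
  have ind_eq: "indicator (ball w \<rho>) s = (if cmod (w - s) < \<rho> then 1 else 0 :: ennreal)" for w s :: complex
    by (simp add: indicator_def dist_norm)
  show ?thesis unfolding ind_eq by measurable
qed

context frostman_seq begin

text \<open>
  What remains after the local statements are the boundary points of the hull, possibly a set of
  positive area. The integral over \<open>X\<close> is at most the integral of the averages over discs of
  radius \<open>\<rho>\<close>. By \<open>near_boundary\<close> their upper limits \<open>Hl\<close> in \<open>k\<close> are bounded uniformly, and they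
  tend to 0 as \<open>\<rho> \<rightarrow> 0\<close> almost everywhere: at boundary points with \<open>g = 0\<close> by upper semicontinuity
  of \<open>g\<close>, elsewhere by the local statements. Reverse Fatou in \<open>k\<close> and dominated convergence in \<open>\<rho>\<close>
  conclude.
\<close>

theorem vanish_of_local:
  assumes X: "compact X" and O: "open O'" "X \<subseteq> O'"
    and loc: "\<And>w. w \<in> O' \<Longrightarrow> w \<notin> closure Out \<Longrightarrow> \<exists>r>0. vanish (ball w r)"
  shows "vanish X"
proof (cases "X = {}")
  case True
  then show ?thesis by (simp add: vanish_def)
next
  case False
  define avg where "avg = (\<lambda>\<rho> k w. ennreal (1 / (pi * \<rho>\<^sup>2)) * (\<integral>\<^sup>+ s\<in>ball w \<rho>. P.excess k s \<partial>lborel))"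
  have [measurable]: "avg \<rho> k \<in> borel_measurable borel" for \<rho> k
    unfolding avg_def by measurable
  obtain R0 where R0: "R0 > 0" "E \<subseteq> ball 0 R0" by (rule K_radius)
  obtain b0 where b0: "b0 > 0" "\<And>x y. x \<in> X \<Longrightarrow> y \<notin> O' \<Longrightarrow> b0 \<le> dist x y"
  proof -
    have "\<exists>d>0. \<forall>x\<in>X. \<forall>y\<in>-O'. d \<le> dist x y"
      using O by (intro separate_compact_closed X) (auto simp: closed_Compl)
    then show thesis using that by blast
  qed
  define \<rho>0 where "\<rho>0 = min 1 (b0 / 8)"
  have \<rho>0: "\<rho>0 > 0" "\<rho>0 \<le> 1" "8 * \<rho>0 \<le> b0" using b0 by (auto simp: \<rho>0_def)
  define X1 where "X1 = {x + y | x y. x \<in> X \<and> y \<in> cball 0 \<rho>0}"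
  have cX1: "compact X1" unfolding X1_def by (intro compact_sums X compact_cball)
  have [measurable]: "X \<in> sets borel" "X1 \<in> sets borel" using X cX1 by (auto simp: compact_imp_closed)
  have X1I: "w \<in> X1" if "x \<in> X" "dist x w \<le> \<rho>0" for x w
    unfolding X1_def using that
    by (intro CollectI, rule_tac x=x in exI, rule_tac x="w - x" in exI) (auto simp: dist_norm norm_minus_commute)
  have X1D: "\<exists>x\<in>X. dist x w \<le> \<rho>0" if "w \<in> X1" for w
  proof -
    obtain x y where xy: "w = x + y" "x \<in> X" "cmod y \<le> \<rho>0" using \<open>w \<in> X1\<close> unfolding X1_def by auto
    then show ?thesis by (intro bexI[of _ x]) (auto simp: dist_norm)
  qed
  have inO: "z \<in> O'" if wz: "w \<in> X1" "dist w z < 6 * \<rho>0" for w z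
  proof (rule ccontr)
    assume "z \<notin> O'"
    obtain x where x: "x \<in> X" "dist x w \<le> \<rho>0" using X1D[OF wz(1)] by blast
    have "b0 \<le> dist x z" by (rule b0(2)[OF x(1) \<open>z \<notin> O'\<close>])
    also have "\<dots> \<le> dist x w + dist w z" by (rule dist_triangle)
    finally show False using x(2) wz(2) \<rho>0 by linarith
  qed
  obtain T where T: "T > 0" "X1 \<subseteq> ball 0 T" using compact_imp_bounded[OF cX1] bounded_subset_ballD by metis
  define G where "G = rob + ln (T + 8 + R0 + 1)"
  have gG: "g z \<le> G" if "w \<in> X1" "dist w z < 8" for w z
  proof -
    have "cmod w < T" using that T by auto
    moreover have "cmod z \<le> cmod w + dist w z" using norm_triangle_ineq[of w "z - w"] by (simp add: dist_norm norm_minus_commute)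
    ultimately have "cmod z \<le> T + 8" using that by linarith
    then show ?thesis unfolding G_def by (rule g_upper[OF R0(2)])
  qed
  have G0: "G \<ge> 0"
  proof -
    obtain x where "x \<in> X" using False by blast
    then have "x \<in> X1" using X1I[of x x] \<rho>0(1) by simp
    then show ?thesis using gG[of x x] g_nonneg[of x] by simp
  qed
  \<comment> \<open>the upper limits in the index of the averages over discs of radius \<open>\<rho>\<close>\<close>
  define Hl where "Hl = (\<lambda>\<rho> w. limsup (\<lambda>k. avg \<rho> k w))"
  have [measurable]: "Hl \<rho> \<in> borel_measurable borel" for \<rho>
    unfolding Hl_def by measurable
  have Hl_vanish: "Hl \<rho> w = 0" if "vanish (ball w \<rho>)" for \<rho> w
  proof -
    have "(\<lambda>k. avg \<rho> k w) \<longlonglongrightarrow> ennreal (1 / (pi * \<rho>\<^sup>2)) * 0"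
      unfolding avg_def using that unfolding vanish_def by (intro ennreal_tendsto_cmult) auto
    then show ?thesis unfolding Hl_def by (simp add: lim_imp_Limsup)
  qed
  \<comment> \<open>The boundary estimate in terms of averages: the disc about \<open>w\<close> is enlarged to one about a
    point \<open>w'\<close> of the closure of \<open>Out\<close>, which costs the factor \<open>(m + 1)\<^sup>2\<close> in area.\<close>
  have Hl_bd: "Hl \<rho> w \<le> ennreal (c * (m + 1) ^ 2)"
    if w': "w' \<in> closure Out" and \<rho>: "0 < \<rho>" and d: "dist w w' \<le> (m - 1) * \<rho>" and m: "m \<ge> 1"
     and gc: "\<And>z. dist w' z < (m + 1) * \<rho> \<Longrightarrow> g z \<le> c" and c: "c > 0" for \<rho> w w' c m
  proof -
    have sub: "ball w \<rho> \<subseteq> ball w' (m * \<rho>)"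
    proof
      fix x assume "x \<in> ball w \<rho>"
      then have "dist w' x < (m - 1) * \<rho> + \<rho>" using d dist_triangle[of w' x w] by (simp add: dist_commute)
      then show "x \<in> ball w' (m * \<rho>)" by (simp add: algebra_simps)
    qed
    have le: "Hl \<rho> w \<le> ennreal (c * (m + 1)\<^sup>2) + ennreal e" if e: "e > 0" for e
    proof -
      have "\<forall>\<^sub>F k in sequentially. (\<integral>\<^sup>+ s\<in>ball w' (m * \<rho>). P.excess k s \<partial>lborel)
         \<le> (\<integral>\<^sup>+ s\<in>ball w' ((m + 1) * \<rho>). ennreal (g s) \<partial>lborel) + ennreal (pi * \<rho>\<^sup>2 * e)"
        using m \<rho> e by (intro near_boundary[OF w']) auto
      then have "\<forall>\<^sub>F k in sequentially. avg \<rho> k w \<le> ennreal (c * (m + 1)\<^sup>2) + ennreal e"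
      proof eventually_elim
        case (elim k)
        have "(\<integral>\<^sup>+ s\<in>ball w \<rho>. P.excess k s \<partial>lborel) \<le> (\<integral>\<^sup>+ s\<in>ball w' (m * \<rho>). P.excess k s \<partial>lborel)"
          using sub by (intro nn_integral_mono) (auto simp: indicator_def)
        also note elim
        also have "(\<integral>\<^sup>+ s\<in>ball w' ((m + 1) * \<rho>). ennreal (g s) \<partial>lborel) \<le> (\<integral>\<^sup>+ s\<in>ball w' ((m + 1) * \<rho>). ennreal c \<partial>lborel)"
          using gc by (intro nn_integral_mono) (auto simp: indicator_def intro!: ennreal_leI)
        also have "\<dots> = ennreal (c * (pi * ((m + 1) * \<rho>)\<^sup>2))"
          using c m \<rho> by (simp add: nn_integral_cmult_indicator emeasure_ball_complex flip: ennreal_mult)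
        finally have "(\<integral>\<^sup>+ s\<in>ball w \<rho>. P.excess k s \<partial>lborel) \<le> ennreal (c * (pi * ((m + 1) * \<rho>)\<^sup>2) + pi * \<rho>\<^sup>2 * e)"
          using c e by (simp add: add_right_mono flip: ennreal_plus)
        then have "avg \<rho> k w \<le> ennreal (1 / (pi * \<rho>\<^sup>2)) * ennreal (c * (pi * ((m + 1) * \<rho>)\<^sup>2) + pi * \<rho>\<^sup>2 * e)"
          unfolding avg_def by (intro mult_left_mono) auto
        also have "\<dots> = ennreal (1 / (pi * \<rho>\<^sup>2) * (c * (pi * ((m + 1) * \<rho>)\<^sup>2) + pi * \<rho>\<^sup>2 * e))"
          using c e by (intro ennreal_mult[symmetric]) auto
        also have "1 / (pi * \<rho>\<^sup>2) * (c * (pi * ((m + 1) * \<rho>)\<^sup>2) + pi * \<rho>\<^sup>2 * e) = c * (m + 1)\<^sup>2 + e"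
        proof -
          have "c * (pi * ((m + 1) * \<rho>)\<^sup>2) + pi * \<rho>\<^sup>2 * e = (pi * \<rho>\<^sup>2) * (c * (m + 1)\<^sup>2 + e)"
            unfolding power_mult_distrib by (simp add: distrib_left mult_ac)
          moreover have "pi * \<rho>\<^sup>2 \<noteq> 0" using \<rho> by simp
          ultimately show ?thesis by (metis nonzero_mult_div_cancel_left mult.left_neutral times_divide_eq_left)
        qed
        finally show ?case using c e by simp
      qed
      then show ?thesis unfolding Hl_def by (rule Limsup_bounded)
    qed
    show ?thesis
      by (rule ennreal_le_epsilon) (use le in auto)
  qed
  define Cb where "Cb = (G + 1) * 36"
  have bound: "Hl \<rho> w \<le> ennreal Cb" if w: "w \<in> X1" and \<rho>: "0 < \<rho>" "\<rho> \<le> \<rho>0" for \<rho> w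
  \<comment> \<open>either a boundary point is close, or the disc lies where the local statement applies
    throughout\<close>
  proof (cases "\<exists>w'\<in>closure Out. dist w w' \<le> 2 * \<rho>")
    case True
    then obtain w' where w': "w' \<in> closure Out" "dist w w' \<le> 2 * \<rho>" by blast
    have "Hl \<rho> w \<le> ennreal ((G + 1) * (3 + 1)\<^sup>2)"
    proof (rule Hl_bd[OF w'(1) \<rho>(1)])
      fix z assume "dist w' z < (3 + 1) * \<rho>"
      then have "dist w' z < 4 * \<rho>" by simp
      then have "dist w z < 8" using w'(2) dist_triangle[of w z w'] \<rho> \<rho>0 by linarith
      then show "g z \<le> G + 1" using gG[OF w, of z] by simp
    qed (use w' G0 in auto)
    also have "\<dots> \<le> ennreal Cb" unfolding Cb_def using G0 by (intro ennreal_leI) auto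
    finally show ?thesis .
  next
    case no: False
    have "vanish (cball w \<rho>)"
    proof (rule vanish_compact[OF compact_cball])
      fix z assume z: "z \<in> cball w \<rho>"
      have "z \<in> O'" using z w \<rho> \<rho>0 by (intro inO[of w]) auto
      moreover have "z \<notin> closure Out" using no z \<rho> by auto
      ultimately show "\<exists>r>0. vanish (ball z r)" by (rule loc)
    qed
    then have "vanish (ball w \<rho>)" by (rule vanish_mono) auto
    then show ?thesis by (simp add: Hl_vanish)
  qed
  define \<rho> where "\<rho> = (\<lambda>j::nat. \<rho>0 / real (Suc j))"
  have \<rho>: "0 < \<rho> j" "\<rho> j \<le> \<rho>0" for j using \<rho>0 by (auto simp: \<rho>_def field_simps)
  have \<rho>_lim: "\<rho> \<longlonglongrightarrow> 0"
    unfolding \<rho>_def using LIMSEQ_Suc[OF lim_const_over_n[of \<rho>0]] by simp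
  have ptw: "AE w in lborel. w \<in> X1 \<longrightarrow> (\<lambda>j. Hl (\<rho> j) w) \<longlonglongrightarrow> 0"
    using pot_hull
  proof eventually_elim
    fix w assume hull: "w \<in> H \<longrightarrow> pot M w = rob"
    show "w \<in> X1 \<longrightarrow> (\<lambda>j. Hl (\<rho> j) w) \<longlonglongrightarrow> 0"
    proof
      assume w: "w \<in> X1"
      show "(\<lambda>j. Hl (\<rho> j) w) \<longlonglongrightarrow> 0"
      proof (cases "w \<in> closure Out \<and> w \<notin> Out")
        case True
        then have "w \<in> H" by (simp add: H_eq)
        then have g0: "g w = 0" using hull by (simp add: g_def)
        show ?thesis
        proof (rule ennreal_tendsto_0I)
          fix e :: real assume e: "e > 0"
          obtain \<delta> where \<delta>: "\<delta> > 0" "\<And>z. z \<in> ball w \<delta> \<Longrightarrow> g z < e/4"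
            using g_usc[of w "e/4"] g0 e by auto
          have "\<forall>\<^sub>F j in sequentially. \<rho> j < \<delta>/2" by (rule order_tendstoD(2)[OF \<rho>_lim]) (use \<delta> in simp)
          then show "\<forall>\<^sub>F j in sequentially. Hl (\<rho> j) w \<le> ennreal e"
          proof eventually_elim
            case (elim j)
            have "Hl (\<rho> j) w \<le> ennreal (e/4 * (1 + 1)\<^sup>2)"
            proof (rule Hl_bd[of w])
              fix z assume "dist w z < (1 + 1) * \<rho> j"
              then show "g z \<le> e/4" using \<delta>(2)[of z] elim by (simp add: less_imp_le)
            qed (use True \<rho> e in auto)
            then show ?case by simp
          qed
        qed
      next
        case False
        have "w \<in> O'" using w \<rho>0 by (intro inO[of w]) auto
        then obtain r where r: "r > 0" "vanish (ball w r)"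
          using False loc[of w] vanish_Out[of w] by blast
        have "\<forall>\<^sub>F j in sequentially. \<rho> j < r" using order_tendstoD(2)[OF \<rho>_lim] r by simp
        then have "\<forall>\<^sub>F j in sequentially. Hl (\<rho> j) w = 0"
        proof eventually_elim
          case (elim j)
          have "vanish (ball w (\<rho> j))" by (rule vanish_mono[OF r(2)]) (use elim in auto)
          then show ?case by (rule Hl_vanish)
        qed
        then show ?thesis by (rule tendsto_eventually)
      qed
    qed
  qed
  have int_lim: "(\<lambda>j. \<integral>\<^sup>+ w\<in>X1. Hl (\<rho> j) w \<partial>lborel) \<longlonglongrightarrow> (\<integral>\<^sup>+ w. (0::ennreal) \<partial>(lborel :: complex measure))"
  proof (rule nn_integral_dominated_convergence[where w="\<lambda>w. ennreal Cb * indicator X1 w"])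
    show "AE w in lborel. Hl (\<rho> j) w * indicator X1 w \<le> ennreal Cb * indicator X1 w" for j
      using bound \<rho> by (auto simp: indicator_def)
    have "(\<integral>\<^sup>+ w. ennreal Cb * indicator X1 w \<partial>lborel) = ennreal Cb * emeasure lborel X1"
      by (rule nn_integral_cmult_indicator) simp
    also have "\<dots> < \<infinity>" using emeasure_bounded_finite[OF compact_imp_bounded[OF cX1]]
      by (simp add: ennreal_mult_less_top)
    finally show "(\<integral>\<^sup>+ w. ennreal Cb * indicator X1 w \<partial>lborel) < \<infinity>" .
    show "AE w in lborel. (\<lambda>j. Hl (\<rho> j) w * indicator X1 w) \<longlonglongrightarrow> 0"
      using ptw by eventually_elim (auto simp: indicator_def)
  qed measurable
  have fatou: "limsup (\<lambda>k. \<integral>\<^sup>+ s\<in>X. P.excess k s \<partial>lborel) \<le> (\<integral>\<^sup>+ w\<in>X1. Hl (\<rho> j) w \<partial>lborel)" for j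
  proof -
    define r where "r = \<rho> j"
    have r: "0 < r" "r \<le> \<rho>0" using \<rho> by (auto simp: r_def)
    obtain w0 where w0: "w0 \<in> closure Out" using Out_nonempty closure_subset by blast
    define L where "L = cmod w0 + T + 2"
    have L: "L > 0" using T by (simp add: L_def add_nonneg_pos)
    have bigs: "ball w r \<subseteq> ball w0 L" if "w \<in> X1" for w
    proof
      fix x assume x: "x \<in> ball w r"
      have "cmod w < T" using that T by auto
      moreover have "dist w0 x \<le> dist w0 0 + dist 0 w + dist w x"
        using dist_triangle[of w0 x 0] dist_triangle[of 0 x w] by linarith
      ultimately show "x \<in> ball w0 L" using x r \<rho>0 by (simp add: L_def)
    qed
    \<comment> \<open>A dominating constant for the averages, from the boundary estimate on one large disc; it is
      available from an index \<open>k0\<close> on.\<close>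
    define B where "B = ennreal (1 / (pi * r\<^sup>2)) * ((\<integral>\<^sup>+ s\<in>ball w0 (L + 1). ennreal (g s) \<partial>lborel) + 1)"
    have Bfin: "B < \<infinity>"
      unfolding B_def by (simp add: nn_integral_g ennreal_mult_less_top)
    have "\<forall>\<^sub>F k in sequentially. (\<integral>\<^sup>+ s\<in>ball w0 L. P.excess k s \<partial>lborel) \<le> (\<integral>\<^sup>+ s\<in>ball w0 (L + 1). ennreal (g s) \<partial>lborel) + ennreal 1"
      using L by (intro near_boundary[OF w0]) auto
    then obtain k0 where k0: "\<And>k. k \<ge> k0 \<Longrightarrow> (\<integral>\<^sup>+ s\<in>ball w0 L. P.excess k s \<partial>lborel) \<le> (\<integral>\<^sup>+ s\<in>ball w0 (L + 1). ennreal (g s) \<partial>lborel) + 1"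
      unfolding eventually_sequentially by auto
    have avgB: "avg r k w \<le> B" if "k \<ge> k0" "w \<in> X1" for k w
    proof -
      have "(\<integral>\<^sup>+ s\<in>ball w r. P.excess k s \<partial>lborel) \<le> (\<integral>\<^sup>+ s\<in>ball w0 L. P.excess k s \<partial>lborel)"
        using bigs[OF that(2)] by (intro nn_integral_mono) (auto simp: indicator_def)
      also note k0[OF that(1)]
      finally show ?thesis unfolding avg_def B_def by (intro mult_left_mono) auto
    qed
    have "limsup (\<lambda>k. \<integral>\<^sup>+ s\<in>X. P.excess k s \<partial>lborel) = limsup (\<lambda>k. \<integral>\<^sup>+ s\<in>X. P.excess (k + k0) s \<partial>lborel)"
      by (rule limsup_shift_k[symmetric])
    also have "\<dots> \<le> limsup (\<lambda>k. \<integral>\<^sup>+ w\<in>X1. avg r (k + k0) w \<partial>lborel)"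
    proof (rule Limsup_mono, rule always_eventually, rule allI)
      fix k
      show "(\<integral>\<^sup>+ s\<in>X. P.excess (k + k0) s \<partial>lborel) \<le> (\<integral>\<^sup>+ w\<in>X1. avg r (k + k0) w \<partial>lborel)"
        unfolding avg_def
      proof (rule nn_integral_le_average)
        show "ball x r \<subseteq> X1" if "x \<in> X" for x
          using X1I[OF that] r by auto
      qed (use r in auto)
    qed
    also have "\<dots> \<le> (\<integral>\<^sup>+ w. limsup (\<lambda>k. avg r (k + k0) w * indicator X1 w) \<partial>lborel)"
    proof (rule nn_integral_limsup[where w="\<lambda>w. B * indicator X1 w"])
      show "AE w in lborel. avg r (k + k0) w * indicator X1 w \<le> B * indicator X1 w" for k
        using avgB[of "k + k0"] by (auto simp: indicator_def)
      have "(\<integral>\<^sup>+ w. B * indicator X1 w \<partial>lborel) = B * emeasure lborel X1"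
        by (rule nn_integral_cmult_indicator) simp
      also have "\<dots> < \<infinity>" using emeasure_bounded_finite[OF compact_imp_bounded[OF cX1]] Bfin
        by (simp add: ennreal_mult_less_top)
      finally show "(\<integral>\<^sup>+ w. B * indicator X1 w \<partial>lborel) < \<infinity>" .
    qed measurable
    also have "\<dots> = (\<integral>\<^sup>+ w\<in>X1. Hl r w \<partial>lborel)"
    proof (intro nn_integral_cong)
      fix w
      have "limsup (\<lambda>k. avg r (k + k0) w) = Hl r w"
        unfolding Hl_def by (rule limsup_shift_k)
      then show "limsup (\<lambda>k. avg r (k + k0) w * indicator X1 w) = Hl r w * indicator X1 w"
        by (cases "w \<in> X1") (auto simp: Limsup_const)
    qed
    finally show ?thesis by (simp add: r_def)
  qed
  have "limsup (\<lambda>k. \<integral>\<^sup>+ s\<in>X. P.excess k s \<partial>lborel) \<le> 0"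
    by (rule LIMSEQ_le_const[OF int_lim[simplified]]) (use fatou in auto)
  then have "limsup (\<lambda>k. \<integral>\<^sup>+ s\<in>X. P.excess k s \<partial>lborel) = 0" by simp
  then show ?thesis unfolding vanish_def by (rule tendsto_0_if_Limsup_eq_0_ennreal)
qed

end

section \<open>Convergence inside a component with an NCS point\<close>

lemma nn_integral_ge_integral:
  assumes i: "set_integrable lborel S f" and S [measurable]: "S \<in> sets borel"
    and le: "\<And>x. x \<in> S \<Longrightarrow> ennreal (f x) \<le> F x"
  shows "ennreal (LINT x:S|lborel. f x) \<le> (\<integral>\<^sup>+ x\<in>S. F x \<partial>(lborel :: complex measure))"
proof -
  define h where "h = (\<lambda>x. indicator S x * f x)"
  have hi: "integrable lborel h" using i by (simp add: h_def set_integrable_def)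
  have hm: "integrable lborel (\<lambda>x. max 0 (h x))" using hi by (intro integrable_max) auto
  have "(LINT x:S|lborel. f x) \<le> (\<integral>x. max 0 (h x) \<partial>lborel)"
    using hi hm by (auto simp: h_def set_lebesgue_integral_def intro!: integral_mono)
  then have "ennreal (LINT x:S|lborel. f x) \<le> ennreal (\<integral>x. max 0 (h x) \<partial>lborel)"
    by (rule ennreal_leI)
  also have "\<dots> = (\<integral>\<^sup>+ x. ennreal (max 0 (h x)) \<partial>lborel)"
    by (rule nn_integral_eq_integral[symmetric, OF hm]) auto
  also have "\<dots> \<le> (\<integral>\<^sup>+ x\<in>S. F x \<partial>lborel)"
  proof (intro nn_integral_mono)
    fix x
    show "ennreal (max 0 (h x)) \<le> F x * indicator S x"
      using le[of x] by (cases "x \<in> S") (auto simp: h_def max_def ennreal_neg)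
  qed
  finally show ?thesis .
qed

context frostman_poly begin

text \<open>
  The maximum principle for \<open>c \<gamma> - hull_excess\<close> in \<open>G\<close> minus a disc about the pole and minus the
  zeros. At the boundary of \<open>G\<close> the Green function tends to 0 while the excess is nonnegative,
  near the pole the inequality is assumed on a collar, and at a zero of the polynomial the excess
  is infinite.
\<close>

lemma green_minorant:
  assumes G: "open G" "G \<subseteq> H" and gr: "harmonic_on \<gamma> (G - {\<zeta>})"
    and bdry: "\<And>w. w \<in> frontier G \<Longrightarrow> (\<gamma> \<longlongrightarrow> 0) (at w within G)"
    and eta: "0 < \<eta>" "\<eta> < \<eta>'" and c: "c > 0"
    and collar: "\<And>z. z \<in> G \<Longrightarrow> \<eta> \<le> cmod (z - \<zeta>) \<Longrightarrow> cmod (z - \<zeta>) \<le> \<eta>' \<Longrightarrow> ennreal (c * \<gamma> z) \<le> hull_excess z"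
    and z: "z \<in> G" "\<eta> < cmod (z - \<zeta>)"
  shows "ennreal (c * \<gamma> z) \<le> hull_excess z"
proof (cases "z \<in> zeros")
  case True
  then show ?thesis by (simp add: hull_excess_def)
next
  case znz: False
  define v where "v = (\<lambda>z. c * \<gamma> z + Lp z + rob - eps)"
  define S where "S = G - cball \<zeta> \<eta> - zeros"
  have oS: "open S" unfolding S_def using G finite_zeros by (intro open_Diff) (auto simp: finite_imp_closed)
  have zS: "z \<in> S" using z znz by (auto simp: S_def dist_norm norm_minus_commute)
  have SG: "S \<subseteq> G - {\<zeta>}" using eta by (auto simp: S_def)
  have contg: "continuous_on (G - {\<zeta>}) \<gamma>" by (rule harmonic_on_imp_continuous[OF gr])
  have contv: "continuous_on (G - {\<zeta>} - zeros) v"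
    unfolding v_def
    by (intro continuous_intros continuous_on_subset[OF contg] continuous_on_subset[OF continuous_Lp]) auto
  have cvS: "continuous_on S v" by (rule continuous_on_subset[OF contv]) (use SG in \<open>auto simp: S_def\<close>)
  have hull_excess_v: "v x \<le> 0" if "x \<in> G" "x \<notin> zeros" "ennreal (c * \<gamma> x) \<le> hull_excess x" for x
  proof -
    have "0 \<le> - Lp x - rob + eps" using that G by (intro hull_bound) auto
    then have "c * \<gamma> x \<le> - Lp x - rob + eps" using that by (simp add: hull_excess_def ennreal_le_iff)
    then show ?thesis by (simp add: v_def)
  qed
  have "v z \<le> 0"
  proof (rule submean_max_principle[OF _ _ _ zS])
    show "open {z\<in>S. v z < b}" for b
      using continuous_open_preimage[OF cvS oS, of "{..<b}"] by (simp add: vimage_def Int_def)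
  next
    fix x assume xS: "x \<in> S"
    then obtain r where r: "r > 0" "cball x r \<subseteq> S" using oS open_contains_cball by blast
    have "cball x r \<subseteq> G - {\<zeta>}" using r SG by blast
    note hm = harmonic_ball_mean[OF gr this r(1)]
    have iL: "set_integrable lborel (ball x r) Lp" by (rule set_integrable_Lp) auto
    have ig: "set_integrable lborel (ball x r) (\<lambda>s. c * \<gamma> s)" by (rule set_integrable_mult_right) (rule hm(1))
    have i1: "set_integrable lborel (ball x r) (\<lambda>s. c * \<gamma> s + Lp s)" by (rule set_integral_add(1)[OF ig iL])
    have ic: "set_integrable lborel (ball x r) (\<lambda>s. rob - eps)" by (rule set_integral_const_ball(2))
    have veq: "v = (\<lambda>s. (c * \<gamma> s + Lp s) + (rob - eps))" by (auto simp: v_def)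
    have iv: "set_integrable lborel (ball x r) v" unfolding veq by (rule set_integral_add(1)[OF i1 ic])
    have "(LINT s:ball x r|lborel. v s) = c * (pi * r\<^sup>2 * \<gamma> x) + (LINT s:ball x r|lborel. Lp s) + pi * r\<^sup>2 * (rob - eps)"
      unfolding veq using set_integral_add(2)[OF i1 ic] set_integral_add(2)[OF ig iL] hm(2) set_integral_const_ball(1) r
      by simp
    moreover have "pi * r\<^sup>2 * Lp x \<le> (LINT s:ball x r|lborel. Lp s)"
      using xS r by (intro Lp_ball_ge) (auto simp: S_def)
    moreover have "pi * r\<^sup>2 * v x = c * (pi * r\<^sup>2 * \<gamma> x) + pi * r\<^sup>2 * Lp x + pi * r\<^sup>2 * (rob - eps)"
      by (simp add: v_def algebra_simps)
    ultimately have "pi * r\<^sup>2 * v x \<le> (LINT s:ball x r|lborel. v s)" by linarith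
    then show "\<exists>r>0. cball x r \<subseteq> S \<and> set_integrable lborel (ball x r) v \<and> pi * r\<^sup>2 * v x \<le> (LINT s:ball x r|lborel. v s)"
      using r iv by blast
  next
    fix \<epsilon> :: real assume \<epsilon>: "\<epsilon> > 0"
    define C where "C = {x\<in>S. \<eta>' \<le> cmod (x - \<zeta>) \<and> \<epsilon> \<le> v x}"
    have "closed C"
      unfolding closed_sequential_limits
    proof (intro allI impI, elim conjE)
      fix x l assume xC: "\<forall>n. x n \<in> C" and lim: "x \<longlonglongrightarrow> l"
      have xp: "x n \<in> G" "x n \<notin> zeros" "\<eta>' \<le> cmod (x n - \<zeta>)" "\<epsilon> \<le> v (x n)" for n
        using xC by (auto simp: C_def S_def)
      have "(\<lambda>n. cmod (x n - \<zeta>)) \<longlonglongrightarrow> cmod (l - \<zeta>)" by (intro tendsto_intros lim)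
      then have l\<zeta>: "\<eta>' \<le> cmod (l - \<zeta>)" by (rule LIMSEQ_le_const) (use xp in auto)
      \<comment> \<open>along \<open>C\<close> the Green function stays away from 0, which excludes limit points on the
        boundary of \<open>G\<close>\<close>
      have big: "\<epsilon> \<le> c * \<gamma> (x n)" for n
      proof -
        have "0 \<le> - Lp (x n) - rob + eps" using xp G by (intro hull_bound) auto
        then show ?thesis using xp(4)[of n] by (simp add: v_def)
      qed
      have lG: "l \<in> G"
      proof (rule ccontr)
        assume nl: "l \<notin> G"
        have "l \<in> closure G" using xp(1) lim closure_sequential by blast
        then have "l \<in> frontier G" using nl G(1) by (simp add: frontier_def interior_open)
        then have "(\<gamma> \<longlongrightarrow> 0) (at l within G)" by (rule bdry)
        moreover have "filterlim x (at l within G) sequentially"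
          using lim xp(1) nl by (auto simp: filterlim_at intro!: always_eventually)
        ultimately have "(\<lambda>n. \<gamma> (x n)) \<longlonglongrightarrow> 0" by (rule filterlim_compose)
        then have "(\<lambda>n. c * \<gamma> (x n)) \<longlonglongrightarrow> c * 0" by (intro tendsto_intros)
        then have "\<epsilon> \<le> c * 0" by (rule LIMSEQ_le_const) (use big in auto)
        then show False using \<epsilon> by simp
      qed
      have l\<zeta>': "l \<noteq> \<zeta>" using l\<zeta> eta by auto
      have lnz: "l \<notin> zeros"
      proof
        \<comment> \<open>limit points at a zero are excluded because \<open>Lp\<close> tends to \<open>- \<infinity>\<close> there\<close>
        assume lz: "l \<in> zeros"
        have "isCont \<gamma> l"
        proof -
          have "open (G - {\<zeta>})" using G(1) by auto
          then show ?thesis using contg lG l\<zeta>' by (simp add: continuous_on_eq_continuous_at)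
        qed
        then have g1: "(\<lambda>n. \<gamma> (x n)) \<longlonglongrightarrow> \<gamma> l" using lim isCont_tendsto_compose by blast
        define b where "b = real (degree p) * (\<epsilon> - rob + eps)"
        have le: "b - real (degree p) * (c * \<gamma> (x n)) \<le> ln (cmod (poly p (x n)))" for n
        proof -
          have "\<epsilon> - rob + eps - c * \<gamma> (x n) \<le> Lp (x n)" using xp(4)[of n] by (simp add: v_def)
          then have "real (degree p) * (\<epsilon> - rob + eps - c * \<gamma> (x n)) \<le> real (degree p) * Lp (x n)"
            by (intro mult_left_mono) auto
          then show ?thesis using ln_poly_eq[OF xp(2)[of n]] by (simp add: b_def algebra_simps)
        qed
        have le2: "exp (b - real (degree p) * (c * \<gamma> (x n))) \<le> cmod (poly p (x n))" for n
        proof -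
          have "cmod (poly p (x n)) > 0" using xp(2)[of n] by (simp add: zeros_def)
          then show ?thesis using le[of n] by (metis exp_le_cancel_iff exp_ln)
        qed
        have l1: "(\<lambda>n. exp (b - real (degree p) * (c * \<gamma> (x n)))) \<longlonglongrightarrow> exp (b - real (degree p) * (c * \<gamma> l))"
          by (intro tendsto_intros g1)
        have l2: "(\<lambda>n. cmod (poly p (x n))) \<longlonglongrightarrow> cmod (poly p l)"
          by (intro tendsto_intros lim)
        have "exp (b - real (degree p) * (c * \<gamma> l)) \<le> cmod (poly p l)"
          by (rule LIMSEQ_le[OF l1 l2]) (use le2 in auto)
        moreover have "exp (b - real (degree p) * (c * \<gamma> l)) > 0" by simp
        moreover have "cmod (poly p l) = 0" using lz by (simp add: zeros_def)
        ultimately show False by linarith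
      qed
      have lS: "l \<in> S" using lG lnz l\<zeta> eta by (auto simp: S_def dist_norm norm_minus_commute)
      have "isCont v l" using cvS oS lS by (simp add: continuous_on_eq_continuous_at)
      then have "(\<lambda>n. v (x n)) \<longlonglongrightarrow> v l" using lim isCont_tendsto_compose by blast
      then have "\<epsilon> \<le> v l" by (rule LIMSEQ_le_const) (use xp in auto)
      then show "l \<in> C" using lS l\<zeta> by (simp add: C_def)
    qed
    moreover have "bounded C"
      using bounded_H by (rule bounded_subset) (use G in \<open>auto simp: C_def S_def\<close>)
    ultimately have "compact C" by (simp add: compact_eq_bounded_closed)
    moreover have "v x \<le> 0 + \<epsilon>" if x: "x \<in> S - C" for x
    proof (cases "\<eta>' \<le> cmod (x - \<zeta>)")
      case True
      then show ?thesis using x by (auto simp: C_def)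
    next
      case False
      have xx: "x \<in> G" "x \<notin> zeros" "\<eta> \<le> cmod (x - \<zeta>)" using x by (auto simp: S_def dist_norm norm_minus_commute)
      have "v x \<le> 0" by (rule hull_excess_v[OF xx(1,2) collar]) (use xx False in auto)
      then show ?thesis using \<epsilon> by simp
    qed
    ultimately show "\<exists>C. compact C \<and> C \<subseteq> S \<and> (\<forall>z\<in>S - C. v z \<le> 0 + \<epsilon>)"
      by (intro exI[of _ C]) (auto simp: C_def)
  qed
  then have "c * \<gamma> z \<le> - Lp z - rob + eps" by (simp add: v_def)
  then show ?thesis using znz by (simp add: hull_excess_def ennreal_leI)
qed

end

context frostman_seq begin

text \<open>
  Almost everywhere equality becomes equality everywhere on an open set, because the potential
  dominates its disc means.
\<close>

lemma g_zero_interior: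
  assumes "open G" "G \<subseteq> H" "z \<in> G" shows "g z = 0"
proof -
  obtain r where r: "r > 0" "ball z r \<subseteq> G" using assms openE by blast
  have "(LINT s:ball z r|lborel. pot M s) = (LINT s:ball z r|lborel. rob)"
    unfolding set_lebesgue_integral_def
    by (rule integral_cong_AE)
       (use pot_hull r assms in \<open>auto simp: indicator_def elim!: eventually_mono\<close>)
  also have "\<dots> = pi * r\<^sup>2 * rob" using r by (simp add: set_integral_const_ball)
  finally have "pi * r\<^sup>2 * rob \<le> pi * r\<^sup>2 * pot M z"
    using pot_ball_le[of r z] r int_ln no_atom by simp
  then have "rob \<le> pot M z" using r by (simp add: mult_le_cancel_left)
  then show ?thesis using g_nonneg[of z] by (simp add: g_def)
qed

text \<open>
  Here \<open>g\<close> is subharmonic and vanishes on the closed disc except possibly at \<open>z0\<close>. On the annulus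
  between radii \<open>r1 < r\<close> and \<open>3 r\<close> it is dominated by a multiple of \<open>ln (\<bar>z - c\<bar> / r1)\<close>, which is
  harmonic, nonnegative and at least \<open>B0\<close> for \<open>\<bar>z - c\<bar> \<ge> 2 r\<close>. Using a radius \<open>r1 < r\<close> keeps \<open>z0\<close>
  in the interior of the annulus, where the maximum principle needs no boundary value; then
  \<open>r1 \<rightarrow> r\<close>.
\<close>

lemma disc_green_bound:
  assumes G: "open G" "G \<subseteq> H" and r: "r > 0" and z0: "z0 \<in> sphere c r" and D: "cball c r - {z0} \<subseteq> G"
  obtains B where "B \<ge> 0" "\<And>z. r \<le> cmod (z - c) \<Longrightarrow> cmod (z - c) < 3 * r \<Longrightarrow> g z \<le> B * (cmod (z - c) - r)"
proof -
  obtain R0 where R0: "R0 > 0" "E \<subseteq> ball 0 R0" by (rule K_radius)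
  define B0 where "B0 = \<bar>rob + ln (cmod c + 3 * r + R0 + 1)\<bar>"
  have B0: "g z \<le> B0" if "cmod (z - c) \<le> 3 * r" for z
  proof -
    have "cmod z \<le> cmod c + 3 * r" using that norm_triangle_ineq[of "z - c" c] by simp
    then show ?thesis using g_upper[OF R0(2)] unfolding B0_def by (smt (verit))
  qed
  \<comment> \<open>so that \<open>b ln (\<bar>z - c\<bar> / r1)\<close> reaches \<open>B0\<close> at \<open>\<bar>z - c\<bar> = 2 r1\<close>\<close>
  define b where "b = B0 / ln 2"
  have b0: "b \<ge> 0" by (simp add: b_def B0_def)
  have main: "g z \<le> b * ln (cmod (z - c) / r1)"
    if r1: "0 < r1" "r1 < r" and z: "r \<le> cmod (z - c)" "cmod (z - c) < 3 * r" for r1 z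
  proof -
    define S where "S = ball c (3 * r) - cball c r1"
    define h where "h = (\<lambda>z. b * (ln (cmod (z - c)) - ln r1))"
    define v where "v = (\<lambda>z. g z - h z)"
    have oS: "open S" by (simp add: S_def open_Diff)
    have zS: "z \<in> S" using z r1 by (simp add: S_def dist_norm norm_minus_commute)
    have gr1: "r1 < cmod (x - c)" if "x \<in> S" for x using that by (simp add: S_def dist_norm norm_minus_commute)
    have ch: "continuous_on S h" unfolding h_def using gr1 r1 by (intro continuous_intros) force
    have "v z \<le> 0"
    proof (rule submean_max_principle[OF _ _ _ zS])
      show "open {z\<in>S. v z < a}" for a
      proof (rule openI)
        fix x assume x: "x \<in> {z\<in>S. v z < a}"
        define e where "e = (a - v x) / 2"
        have e: "e > 0" using x by (simp add: e_def)
        obtain d1 where d1: "d1 > 0" "\<And>y. y \<in> ball x d1 \<Longrightarrow> g y < g x + e"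
          using g_usc[of x "g x + e"] e by auto
        have "isCont h x" using ch oS x by (simp add: continuous_on_eq_continuous_at)
        then obtain d2 where d2: "d2 > 0" "\<And>y. dist y x < d2 \<Longrightarrow> dist (h y) (h x) < e"
          using e unfolding continuous_at_eps_delta by blast
        obtain d3 where d3: "d3 > 0" "ball x d3 \<subseteq> S" using oS x openE by blast
        have "y \<in> {z\<in>S. v z < a}" if y: "y \<in> ball x (min d1 (min d2 d3))" for y
        proof -
          have "g y < g x + e" using d1(2)[of y] y by simp
          moreover have "h x - e < h y" using d2(2)[of y] y by (simp add: dist_commute dist_real_def)
          ultimately have "v y < a" using e unfolding v_def e_def by (simp add: field_simps)
          then show ?thesis using d3(2) y by auto
        qed
        then show "\<exists>e>0. ball x e \<subseteq> {z\<in>S. v z < a}"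
          using d1 d2 d3 by (intro exI[of _ "min d1 (min d2 d3)"]) auto
      qed
    next
      fix x assume x: "x \<in> S"
      then obtain s where s: "s > 0" "cball x s \<subseteq> S" using oS open_contains_cball by blast
      have sc: "s \<le> cmod (x - c)"
      proof (rule ccontr)
        assume "\<not> ?thesis"
        then have "c \<in> cball x s" by (simp add: dist_norm)
        then show False using s(2) gr1[of c] r1 by auto
      qed
      have ig: "set_integrable lborel (ball x s) g" by (rule set_integrable_g) auto
      have il: "set_integrable lborel (ball x s) (\<lambda>y. ln (cmod (y - c)))" by (rule set_integrable_ln) auto
      have ic: "set_integrable lborel (ball x s) (\<lambda>y. ln r1)" by (rule set_integral_const_ball(2))
      have ih: "set_integrable lborel (ball x s) h"
        unfolding h_def by (intro set_integrable_mult_right set_integral_diff il ic)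
      have iv: "set_integrable lborel (ball x s) v" unfolding v_def by (rule set_integral_diff(1)[OF ig ih])
      have "(LINT y:ball x s|lborel. h y) = b * (pi * s\<^sup>2 * ln (cmod (x - c)) - pi * s\<^sup>2 * ln r1)"
        unfolding h_def using set_integral_diff(2)[OF il ic] ball_mean_ln_eq[of s x c] sc s set_integral_const_ball(1)[of s x "ln r1"]
        by simp
      then have hh: "(LINT y:ball x s|lborel. h y) = pi * s\<^sup>2 * h x" by (simp add: h_def algebra_simps)
      have ip: "set_integrable lborel (ball x s) (pot M)" by (rule pot_Fubini) auto
      have "(LINT y:ball x s|lborel. g y) = pi * s\<^sup>2 * rob - (LINT y:ball x s|lborel. pot M y)"
        unfolding g_def using set_integral_diff(2)[OF set_integral_const_ball(2) ip] set_integral_const_ball(1) s by simp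
      then have gg: "pi * s\<^sup>2 * g x \<le> (LINT y:ball x s|lborel. g y)"
        using pot_ball_le[of s x] s int_ln no_atom by (simp add: g_def algebra_simps)
      have "(LINT y:ball x s|lborel. v y) = (LINT y:ball x s|lborel. g y) - pi * s\<^sup>2 * h x"
        unfolding v_def using set_integral_diff(2)[OF ig ih] hh by simp
      then have "pi * s\<^sup>2 * v x \<le> (LINT y:ball x s|lborel. v y)" using gg by (simp add: v_def algebra_simps)
      then show "\<exists>r>0. cball x r \<subseteq> S \<and> set_integrable lborel (ball x r) v \<and> pi * r\<^sup>2 * v x \<le> (LINT s:ball x r|lborel. v s)"
        using s iv by blast
    next
      fix \<epsilon> :: real assume \<epsilon>: "\<epsilon> > 0"
      define C where "C = cball c (2 * r) - ball c r"
      have "compact C" by (simp add: C_def compact_diff)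
      moreover have "C \<subseteq> S" using r r1 by (auto simp: C_def S_def)
      moreover have "v x \<le> 0 + \<epsilon>" if x: "x \<in> S - C" for x
      proof (cases "cmod (x - c) < r")
        case True
        then have "x \<in> cball c r - {z0}" using z0 by (auto simp: dist_norm norm_minus_commute)
        then have "g x = 0" using g_zero_interior[OF G] D by auto
        moreover have "h x \<ge> 0"
        proof -
          have "r1 < cmod (x - c)" using x by (intro gr1) auto
          then have "ln r1 \<le> ln (cmod (x - c))" using r1 by (intro ln_mono) auto
          then show ?thesis using b0 by (simp add: h_def)
        qed
        ultimately show ?thesis using \<epsilon> by (simp add: v_def)
      next
        case False
        then have x2: "2 * r < cmod (x - c)" "cmod (x - c) < 3 * r" using x by (auto simp: C_def S_def dist_norm norm_minus_commute)
        have "ln 2 + ln r1 = ln (2 * r1)" using r1 by (simp add: ln_mult)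
        also have "\<dots> \<le> ln (cmod (x - c))" using x2 r1 by (intro ln_mono) auto
        finally have "b * ln 2 \<le> h x" unfolding h_def using b0 by (intro mult_left_mono) auto
        moreover have "b * ln 2 = B0" by (simp add: b_def)
        moreover have "g x \<le> B0" using x2 by (intro B0) auto
        ultimately show ?thesis using \<epsilon> by (simp add: v_def)
      qed
      ultimately show "\<exists>C. compact C \<and> C \<subseteq> S \<and> (\<forall>z\<in>S - C. v z \<le> 0 + \<epsilon>)" by blast
    qed
    moreover have "cmod (z - c) > 0" using z r by linarith
    ultimately show ?thesis using r1 by (simp add: v_def h_def ln_div)
  qed
  show thesis
  proof (rule that[of "b / r"])
    show "b / r \<ge> 0" using b0 r by simp
    fix z assume z: "r \<le> cmod (z - c)" "cmod (z - c) < 3 * r"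
    have zp: "cmod (z - c) > 0" using z r by linarith
    have lim: "((\<lambda>r1. b * ln (cmod (z - c) / r1)) \<longlongrightarrow> b * ln (cmod (z - c) / r)) (at_left r)"
      using r zp by (intro tendsto_intros) auto
    have "g z \<le> b * ln (cmod (z - c) / r)"
    proof (rule tendsto_lowerbound[OF lim])
      have "\<forall>\<^sub>F r1 in at_left r. r1 \<in> {0<..<r}" by (rule eventually_at_left_field[THEN iffD2]) (use r in auto)
      then show "\<forall>\<^sub>F r1 in at_left r. g z \<le> b * ln (cmod (z - c) / r1)"
        by eventually_elim (rule main; use z in auto)
    qed simp
    also have "\<dots> \<le> b * (cmod (z - c) / r - 1)"
      using zp r b0 by (intro mult_left_mono ln_le_minus_one) auto
    also have "\<dots> = b / r * (cmod (z - c) - r)" using r by (simp add: field_simps)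
    finally show "g z \<le> b / r * (cmod (z - c) - r)" .
  qed
qed

text \<open>
  If the excess does not vanish near \<open>w\<close>, the chain inequality bounds it below near the pole \<open>\<zeta>\<close>
  for infinitely many \<open>k\<close>, so it dominates a multiple of the Green function. Its integral over a
  disc of radius \<open>\<kappa> \<rho>\<close> about the point \<open>z1\<close> of the segment at distance \<open>\<rho>\<close> from \<open>z0\<close> is then at
  least \<open>\<pi> (27 B + 2) \<rho>\<^sup>3\<close>, since \<open>\<gamma> z1 / \<rho>\<close> is as large as desired. On the other hand \<open>g \<le> 3 B \<rho>\<close>
  within distance \<open>3 \<rho>\<close> of \<open>z0\<close>, except possibly at \<open>z0\<close> itself, so the boundary estimate limits
  the integral to \<open>\<pi> (27 B + 1) \<rho>\<^sup>3\<close> for all large \<open>k\<close>.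
\<close>

theorem ncs_vanish:
  assumes G: "open G" "connected G" "G \<subseteq> H" and ncs: "ncs_point G z0"
    and z0c: "z0 \<in> closure Out" and w: "w \<in> G"
  shows "\<exists>r>0. vanish (ball w r)"
proof -
  obtain c r \<zeta> \<gamma> where r: "r > 0" and z0: "z0 \<in> sphere c r" and D: "cball c r - {z0} \<subseteq> G"
    and \<zeta>: "\<zeta> \<in> ball c r" and green: "is_green_function G \<zeta> \<gamma>"
    and lim: "filterlim (\<lambda>z. \<gamma> z / cmod (z - z0)) at_top (at z0 within closed_segment \<zeta> z0)"
    using ncs unfolding ncs_point_def by blast
  have \<zeta>G: "\<zeta> \<in> G" and gr: "harmonic_on \<gamma> (G - {\<zeta>})"
    and bdry: "\<And>w. w \<in> frontier G \<Longrightarrow> (\<gamma> \<longlongrightarrow> 0) (at w within G)"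
    using green unfolding is_green_function_def by blast+
  obtain s rw C where ch: "s > 0" "rw > 0" "C > 0" "cball w rw \<subseteq> G"
    and chain: "\<And>e z. superharmonic_ball G e \<Longrightarrow> z \<in> ball \<zeta> s \<Longrightarrow> (\<integral>\<^sup>+ x\<in>ball w rw. e x \<partial>lborel) \<le> ennreal C * e z"
    by (rule superharmonic_chain[OF G(1,2) \<zeta>G w], rule that, assumption+)
  obtain B where B: "B \<ge> 0" "\<And>z. r \<le> cmod (z - c) \<Longrightarrow> cmod (z - c) < 3 * r \<Longrightarrow> g z \<le> B * (cmod (z - c) - r)"
    using disc_green_bound[OF G(1,3) r z0 D] by metis
  have nz0: "cmod (z0 - c) = r" using z0 by (simp add: dist_norm norm_minus_commute)
  define \<sigma> where "\<sigma> = r - cmod (\<zeta> - c)"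
  have \<sigma>: "\<sigma> > 0" using \<zeta> by (simp add: \<sigma>_def dist_norm norm_minus_commute)
  define d0 where "d0 = cmod (\<zeta> - z0)"
  have \<sigma>d0: "\<sigma> \<le> d0"
    using norm_triangle_ineq2[of "z0 - c" "\<zeta> - c"] nz0 by (simp add: \<sigma>_def d0_def norm_minus_commute)
  then have d0: "d0 > 0" using \<sigma> by linarith
  \<comment> \<open>The opening of a cone about the segment that stays in the disc: at distance \<open>\<rho>\<close> from \<open>z0\<close> the
    segment is at depth at least \<open>2 \<kappa> \<rho>\<close>.\<close>
  define \<kappa> where "\<kappa> = \<sigma> / (2 * d0)"
  have \<kappa>: "\<kappa> > 0" "\<kappa> \<le> 1/2" using \<sigma> d0 \<sigma>d0 by (auto simp: \<kappa>_def field_simps)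
  obtain dG where dG: "dG > 0" "cball \<zeta> dG \<subseteq> G" using G(1) \<zeta>G open_contains_cball by blast
  define \<eta>' where "\<eta>' = min (s / 2) (min (d0 / 4) dG)"
  have \<eta>': "\<eta>' > 0" "\<eta>' \<le> s / 2" "\<eta>' \<le> d0 / 4" "\<eta>' \<le> dG" using ch d0 dG by (auto simp: \<eta>'_def)
  define \<eta> where "\<eta> = \<eta>' / 2"
  have \<eta>: "0 < \<eta>" "\<eta> < \<eta>'" using \<eta>' by (auto simp: \<eta>_def)
  define An where "An = cball \<zeta> \<eta>' - ball \<zeta> \<eta>"
  have AnG: "An \<subseteq> G - {\<zeta>}"
  proof
    fix x assume x: "x \<in> An"
    then have "x \<in> cball \<zeta> dG" "x \<noteq> \<zeta>" using \<eta> \<eta>' by (auto simp: An_def)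
    then show "x \<in> G - {\<zeta>}" using dG by auto
  qed
  have "compact (\<gamma> ` An)"
    unfolding An_def
    by (intro compact_continuous_image continuous_on_subset[OF harmonic_on_imp_continuous[OF gr]] compact_diff)
       (use AnG in \<open>auto simp: An_def\<close>)
  then obtain m0 where m0: "\<And>x. x \<in> An \<Longrightarrow> \<bar>\<gamma> x\<bar> \<le> m0"
  proof -
    have "bounded (\<gamma> ` An)" using \<open>compact (\<gamma> ` An)\<close> by (rule compact_imp_bounded)
    then show thesis using that unfolding bounded_iff real_norm_def by blast
  qed
  define m where "m = max 1 m0"
  have m: "m > 0" "\<And>x. x \<in> An \<Longrightarrow> \<gamma> x \<le> m"
    using abs_le_D1[OF m0] by (auto simp: m_def le_max_iff_disj)
  have "vanish (ball w rw)"
    unfolding vanish_def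
  proof (rule ennreal_tendsto_0I, rule ccontr)
    fix e :: real assume e: "e > 0"
    assume "\<not> (\<forall>\<^sub>F k in sequentially. (\<integral>\<^sup>+ x\<in>ball w rw. P.excess k x \<partial>lborel) \<le> ennreal e)"
    then have freq: "\<exists>\<^sub>F k in sequentially. \<not> (\<integral>\<^sup>+ x\<in>ball w rw. P.excess k x \<partial>lborel) \<le> ennreal e"
      by (simp add: frequently_def)
    define c1 where "c1 = e / C"
    have c1: "c1 > 0" using e ch by (simp add: c1_def)
    define c2 where "c2 = c1 / m"
    have c2: "c2 > 0" using c1 m by (simp add: c2_def)
    \<comment> \<open>the slope of the Green function that contradicts the upper bound\<close>
    define K where "K = (27 * B + 2) / (c2 * \<kappa>\<^sup>2)"
    have "\<forall>\<^sub>F z in at z0 within closed_segment \<zeta> z0. K \<le> \<gamma> z / cmod (z - z0)"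
      using lim by (simp add: filterlim_at_top)
    then obtain d where d: "d > 0" "\<And>z. z \<in> closed_segment \<zeta> z0 \<Longrightarrow> z \<noteq> z0 \<Longrightarrow> dist z z0 < d \<Longrightarrow> K \<le> \<gamma> z / cmod (z - z0)"
      unfolding eventually_at by blast
    define \<rho> where "\<rho> = min (d / 2) (min (d0 / 8) (r / 8))"
    have \<rho>: "\<rho> > 0" "\<rho> \<le> d / 2" "\<rho> \<le> d0 / 8" "\<rho> \<le> r / 8" using d d0 r by (auto simp: \<rho>_def)
    define t where "t = \<rho> / d0"
    have t: "0 < t" "t \<le> 1" "t * d0 = \<rho>" using \<rho> d0 by (auto simp: t_def)
    \<comment> \<open>the point of the segment at distance \<open>\<rho>\<close> from \<open>z0\<close>\<close>
    define z1 where "z1 = z0 + of_real t * (\<zeta> - z0)"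
    have z1z0: "cmod (z1 - z0) = \<rho>" using t by (simp add: z1_def norm_mult d0_def)
    have z1seg: "z1 \<in> closed_segment \<zeta> z0"
    proof -
      have "z1 = (1 - t) *\<^sub>R z0 + t *\<^sub>R \<zeta>" by (simp add: z1_def scaleR_conv_of_real algebra_simps)
      then have "z1 \<in> closed_segment z0 \<zeta>" unfolding in_segment using t by (intro exI[of _ t]) auto
      then show ?thesis by (simp add: closed_segment_commute)
    qed
    have Kz1: "K * \<rho> \<le> \<gamma> z1"
    proof -
      have "K \<le> \<gamma> z1 / cmod (z1 - z0)"
        using z1z0 \<rho> d(1) by (intro d(2) z1seg) (auto simp: dist_norm)
      then show ?thesis using z1z0 \<rho> by (simp add: field_simps)
    qed
    have z1c: "cmod (z1 - c) \<le> r - t * \<sigma>"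
    proof -
      have "z1 - c = of_real (1 - t) * (z0 - c) + of_real t * (\<zeta> - c)" by (simp add: z1_def algebra_simps)
      then have "cmod (z1 - c) \<le> cmod (of_real (1 - t) * (z0 - c)) + cmod (of_real t * (\<zeta> - c))"
        using norm_triangle_ineq by metis
      also have "\<dots> = (1 - t) * r + t * cmod (\<zeta> - c)" unfolding norm_mult norm_of_real using t nz0 by simp
      also have "\<dots> = r - t * \<sigma>" by (simp add: \<sigma>_def algebra_simps)
      finally show ?thesis .
    qed
    have \<kappa>\<rho>: "\<kappa> * \<rho> = t * \<sigma> / 2" by (simp add: \<kappa>_def t_def mult.commute)
    have \<kappa>\<rho>2: "\<kappa> * \<rho> \<le> \<rho> / 2" using mult_right_mono[OF \<kappa>(2), of \<rho>] \<rho> by simp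
    have t\<sigma>: "t * \<sigma> > 0" using t \<sigma> by simp
    have inG: "x \<in> G" "\<eta> < cmod (x - \<zeta>)" if x: "x \<in> cball z1 (\<kappa> * \<rho>)" for x
    proof -
      have xz1: "cmod (x - z1) \<le> \<kappa> * \<rho>" using x by (simp add: dist_norm norm_minus_commute)
      have "cmod (x - c) \<le> cmod (x - z1) + cmod (z1 - c)" using norm_triangle_ineq[of "x - z1" "z1 - c"] by simp
      then have "cmod (x - c) < r" using xz1 z1c \<kappa>\<rho> t\<sigma> by linarith
      then have "x \<in> cball c r - {z0}" using nz0 by (auto simp: dist_norm norm_minus_commute)
      then show "x \<in> G" using D by blast
      have "d0 \<le> cmod (x - \<zeta>) + cmod (x - z1) + cmod (z1 - z0)"
        using norm_triangle_ineq[of "\<zeta> - x" "x - z0"] norm_triangle_ineq[of "x - z1" "z1 - z0"]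
        by (simp add: d0_def norm_minus_commute)
      then show "\<eta> < cmod (x - \<zeta>)" using xz1 z1z0 \<kappa>\<rho>2 \<rho> \<eta> \<eta>' by linarith
    qed
    have \<kappa>\<rho>0: "\<kappa> * \<rho> > 0" using \<kappa> \<rho> by simp
    have cb: "cball z1 (\<kappa> * \<rho>) \<subseteq> G - {\<zeta>}" using inG \<eta> by force
    have hm: "set_integrable lborel (ball z1 (\<kappa> * \<rho>)) \<gamma>"
       "(LINT x:ball z1 (\<kappa> * \<rho>)|lborel. \<gamma> x) = pi * (\<kappa> * \<rho>)\<^sup>2 * \<gamma> z1"
      by (rule harmonic_ball_mean[OF gr cb \<kappa>\<rho>0])+
    have lower: "ennreal (pi * (27 * B + 2) * \<rho> ^ 3) \<le> (\<integral>\<^sup>+ x\<in>ball z0 (2 * \<rho>). P.excess k x \<partial>lborel)"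
      if k: "\<not> (\<integral>\<^sup>+ x\<in>ball w rw. P.excess k x \<partial>lborel) \<le> ennreal e" for k
    proof -
      have "(\<integral>\<^sup>+ x\<in>ball w rw. P.excess k x \<partial>lborel) = (\<integral>\<^sup>+ x\<in>ball w rw. P.hull_excess k x \<partial>lborel)"
      proof (rule nn_integral_cong_AE, use pot_hull in eventually_elim)
        fix x assume hx: "x \<in> H \<longrightarrow> pot M x = rob"
        show "P.excess k x * indicator (ball w rw) x = P.hull_excess k x * indicator (ball w rw) x"
        proof (cases "x \<in> ball w rw")
          case True
          then have "x \<in> H" using ch(4) G(3) by (meson ball_subset_cball subsetD)
          then show ?thesis using hx P.excess_eq_hull_excess[of x k] by simp
        qed simp
      qed
      then have gt: "ennreal e < (\<integral>\<^sup>+ x\<in>ball w rw. P.hull_excess k x \<partial>lborel)" using k by (simp add: not_le)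
      have sup: "superharmonic_ball G (P.hull_excess k)" by (rule P.superharmonic_hull_excess[OF G(3)])
      have hull_excess_big: "ennreal c1 \<le> P.hull_excess k x" if "x \<in> ball \<zeta> s" for x
      proof -
        have "ennreal e \<le> ennreal C * P.hull_excess k x"
          using less_imp_le[OF gt] chain[OF sup that] by (rule order_trans)
        then have "ennreal (1 / C) * ennreal e \<le> ennreal (1 / C) * (ennreal C * P.hull_excess k x)"
          by (rule mult_left_mono) auto
        also have "\<dots> = P.hull_excess k x" using ch(3) by (simp add: mult.assoc[symmetric] flip: ennreal_mult)
        also have "ennreal (1 / C) * ennreal e = ennreal c1" using ch(3) e by (simp add: c1_def flip: ennreal_mult)
        finally show ?thesis .
      qed
      have minor: "ennreal (c2 * \<gamma> x) \<le> P.hull_excess k x" if x: "x \<in> ball z1 (\<kappa> * \<rho>)" for x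
      proof (rule P.green_minorant[OF G(1,3) gr bdry \<eta> c2])
        fix y assume y: "y \<in> G" "\<eta> \<le> cmod (y - \<zeta>)" "cmod (y - \<zeta>) \<le> \<eta>'"
        then have "y \<in> An" by (simp add: An_def dist_norm norm_minus_commute)
        then have "c2 * \<gamma> y \<le> c2 * m" using c2 m(2) by (intro mult_left_mono) auto
        also have "c2 * m = c1" using m by (simp add: c2_def)
        finally have "ennreal (c2 * \<gamma> y) \<le> ennreal c1" by (rule ennreal_leI)
        also have "\<dots> \<le> P.hull_excess k y" using y \<eta>' ch(1) by (intro hull_excess_big) (simp add: dist_norm norm_minus_commute)
        finally show "ennreal (c2 * \<gamma> y) \<le> P.hull_excess k y" .
      qed (use inG[of x] x in auto)
      have i1: "ennreal (LINT x:ball z1 (\<kappa> * \<rho>)|lborel. c2 * \<gamma> x) \<le> (\<integral>\<^sup>+ x\<in>ball z1 (\<kappa> * \<rho>). P.hull_excess k x \<partial>lborel)"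
        by (rule nn_integral_ge_integral[OF set_integrable_mult_right[OF hm(1)] _ minor]) auto
      have i2: "(LINT x:ball z1 (\<kappa> * \<rho>)|lborel. c2 * \<gamma> x) = c2 * (pi * (\<kappa> * \<rho>)\<^sup>2 * \<gamma> z1)"
        using hm(2) by simp
      have i3: "pi * (27 * B + 2) * \<rho> ^ 3 \<le> c2 * (pi * (\<kappa> * \<rho>)\<^sup>2 * \<gamma> z1)"
      proof -
        have "c2 * \<kappa>\<^sup>2 \<noteq> 0" using c2 \<kappa> by simp
        then have "K * (c2 * \<kappa>\<^sup>2) = 27 * B + 2" by (simp add: K_def)
        then have "pi * (27 * B + 2) * \<rho> ^ 3 = (c2 * pi * (\<kappa> * \<rho>)\<^sup>2) * (K * \<rho>)"
          by (simp add: power_mult_distrib power2_eq_square power3_eq_cube mult_ac)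
        also have "\<dots> \<le> (c2 * pi * (\<kappa> * \<rho>)\<^sup>2) * \<gamma> z1" using Kz1 c2 by (intro mult_left_mono) auto
        finally show ?thesis by (simp add: mult_ac)
      qed
      have "ennreal (pi * (27 * B + 2) * \<rho> ^ 3) \<le> (\<integral>\<^sup>+ x\<in>ball z1 (\<kappa> * \<rho>). P.hull_excess k x \<partial>lborel)"
        by (rule order_trans[OF ennreal_leI[OF i3] i1[unfolded i2]])
      also have "\<dots> \<le> (\<integral>\<^sup>+ x\<in>ball z0 (2 * \<rho>). P.excess k x \<partial>lborel)"
      proof (intro nn_integral_mono)
        fix x
        show "P.hull_excess k x * indicator (ball z1 (\<kappa> * \<rho>)) x \<le> P.excess k x * indicator (ball z0 (2 * \<rho>)) x"
        proof (cases "x \<in> ball z1 (\<kappa> * \<rho>)")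
          case True
          have "dist z0 x \<le> dist z0 z1 + dist z1 x" by (rule dist_triangle)
          moreover have "dist z0 z1 = \<rho>" using z1z0 by (simp add: dist_norm norm_minus_commute)
          moreover have "dist z1 x < \<kappa> * \<rho>" using True by simp
          ultimately have "dist z0 x < 2 * \<rho>" using \<kappa>\<rho>2 \<rho>(1) by linarith
          then have "x \<in> ball z0 (2 * \<rho>)" by simp
          then show ?thesis using True P.hull_excess_le_excess by simp
        qed simp
      qed
      finally show ?thesis .
    qed
    have gsmall: "g x \<le> B * (3 * \<rho>)" if x: "x \<in> ball z0 (3 * \<rho>)" "x \<noteq> z0" for x
    proof (cases "r \<le> cmod (x - c)")
      case True
      have "cmod (x - c) \<le> cmod (x - z0) + r" using norm_triangle_ineq[of "x - z0" "z0 - c"] nz0 by simp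
      moreover have "cmod (x - z0) < 3 * \<rho>" using x by (simp add: dist_norm norm_minus_commute)
      ultimately have xx: "cmod (x - c) - r \<le> 3 * \<rho>" "cmod (x - c) < 3 * r" using \<rho> r by linarith+
      have "g x \<le> B * (cmod (x - c) - r)" by (rule B(2)[OF True xx(2)])
      also have "\<dots> \<le> B * (3 * \<rho>)" using xx B by (intro mult_left_mono) auto
      finally show ?thesis .
    next
      case False
      then have "x \<in> cball c r - {z0}" using x by (auto simp: dist_norm norm_minus_commute)
      then have "g x = 0" using D g_zero_interior[OF G(1,3)] by blast
      then show ?thesis using B \<rho> by simp
    qed
    have upper: "(\<integral>\<^sup>+ x\<in>ball z0 (3 * \<rho>). ennreal (g x) \<partial>lborel) \<le> ennreal (pi * (27 * B) * \<rho> ^ 3)"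
    proof -
      have "(\<integral>\<^sup>+ x\<in>ball z0 (3 * \<rho>). ennreal (g x) \<partial>lborel) \<le> (\<integral>\<^sup>+ x\<in>ball z0 (3 * \<rho>). ennreal (B * (3 * \<rho>)) \<partial>lborel)"
        by (rule nn_integral_mono_AE, use AE_lborel_singleton[of z0] in eventually_elim)
           (use gsmall in \<open>auto simp: indicator_def intro!: ennreal_leI\<close>)
      also have "\<dots> = ennreal (B * (3 * \<rho>)) * ennreal (pi * (3 * \<rho>)\<^sup>2)"
        using \<rho> by (subst nn_integral_cmult_indicator) (simp_all only: emeasure_ball_complex mult_nonneg_nonneg less_imp_le ball_borel sets_lborel zero_le_numeral)
      also have "\<dots> = ennreal (B * (3 * \<rho>) * (pi * (3 * \<rho>)\<^sup>2))" using B \<rho> by (intro ennreal_mult[symmetric]) auto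
      also have "B * (3 * \<rho>) * (pi * (3 * \<rho>)\<^sup>2) = pi * (27 * B) * \<rho> ^ 3"
        by (simp add: power2_eq_square power3_eq_cube)
      finally show ?thesis .
    qed
    have ev: "\<forall>\<^sub>F k in sequentially. (\<integral>\<^sup>+ s\<in>ball z0 (2 * \<rho>). P.excess k s \<partial>lborel)
        \<le> (\<integral>\<^sup>+ s\<in>ball z0 (3 * \<rho>). ennreal (g s) \<partial>lborel) + ennreal (pi * \<rho> ^ 3)"
      using \<rho> by (intro near_boundary[OF z0c]) auto
    obtain k where k: "\<not> (\<integral>\<^sup>+ x\<in>ball w rw. P.excess k x \<partial>lborel) \<le> ennreal e"
       "(\<integral>\<^sup>+ s\<in>ball z0 (2 * \<rho>). P.excess k s \<partial>lborel)
        \<le> (\<integral>\<^sup>+ s\<in>ball z0 (3 * \<rho>). ennreal (g s) \<partial>lborel) + ennreal (pi * \<rho> ^ 3)"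
    proof (rule ccontr)
      assume "\<not> thesis"
      then have no: "\<And>k. (\<integral>\<^sup>+ s\<in>ball z0 (2 * \<rho>). P.excess k s \<partial>lborel)
        \<le> (\<integral>\<^sup>+ s\<in>ball z0 (3 * \<rho>). ennreal (g s) \<partial>lborel) + ennreal (pi * \<rho> ^ 3)
         \<Longrightarrow> (\<integral>\<^sup>+ x\<in>ball w rw. P.excess k x \<partial>lborel) \<le> ennreal e" using that by blast
      have "\<forall>\<^sub>F k in sequentially. (\<integral>\<^sup>+ x\<in>ball w rw. P.excess k x \<partial>lborel) \<le> ennreal e"
        using ev by eventually_elim (rule no)
      then show False using freq by (simp add: frequently_def)
    qed
    have "ennreal (pi * (27 * B + 2) * \<rho> ^ 3) \<le> ennreal (pi * (27 * B) * \<rho> ^ 3) + ennreal (pi * \<rho> ^ 3)"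
      using lower[OF k(1)] k(2) add_right_mono[OF upper] by (meson order_trans)
    also have "\<dots> = ennreal (pi * (27 * B) * \<rho> ^ 3 + pi * \<rho> ^ 3)" using B \<rho> by (intro ennreal_plus[symmetric]) auto
    finally have "pi * (27 * B + 2) * \<rho> ^ 3 \<le> pi * (27 * B) * \<rho> ^ 3 + pi * \<rho> ^ 3"
      using B \<rho> by (subst (asm) ennreal_le_iff) auto
    moreover have "pi * (27 * B + 2) * \<rho> ^ 3 = pi * (27 * B) * \<rho> ^ 3 + pi * \<rho> ^ 3 + pi * \<rho> ^ 3"
      by (simp add: distrib_left distrib_right)
    moreover have "pi * \<rho> ^ 3 > 0" using \<rho>(1) by simp
    ultimately show False by linarith
  qed
  then show ?thesis using ch(2) by blast
qed

end

section \<open>A mollifier from disc means of the logarithm\<close>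

text \<open>
  The mean of \<open>s \<mapsto> ln \<bar>s - t\<bar>\<close> over a disc of radius \<open>a\<close> about \<open>z + t\<close>.
\<close>

definition log_ball_mean :: "real \<Rightarrow> complex \<Rightarrow> real" where
  "log_ball_mean a z = (LINT s:ball 0 a|lborel. ln (max (cmod s) (cmod z))) / (pi * a\<^sup>2)"

lemma ball_mean_log_ball_mean:
  "a > 0 \<Longrightarrow> (LINT s:ball w a|lborel. ln (cmod (s - t))) = pi * a\<^sup>2 * log_ball_mean a (w - t)"
  by (simp add: ball_integral_ln(1) log_ball_mean_def)

lemma integral_scale:
  fixes f :: "complex \<Rightarrow> real"
  assumes [measurable]: "f \<in> borel_measurable borel" and a: "a > 0"
  shows "(\<integral> s. f s \<partial>lborel) = a\<^sup>2 * (\<integral> s. f (a *\<^sub>R s) \<partial>lborel)"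
proof -
  have "lborel = density (distr lborel borel (\<lambda>x::complex. 0 + a *\<^sub>R x)) (\<lambda>_. ennreal (\<bar>a\<bar> ^ DIM(complex)))"
    by (rule lborel_affine) (use a in auto)
  then have "(\<integral> s. f s \<partial>lborel) = (\<integral> s. f s \<partial>density (distr lborel borel (\<lambda>x. 0 + a *\<^sub>R x)) (\<lambda>_. ennreal (\<bar>a\<bar> ^ DIM(complex))))"
    by simp
  also have "\<dots> = (\<integral> s. (\<bar>a\<bar> ^ DIM(complex)) *\<^sub>R f s \<partial>distr lborel borel (\<lambda>x. 0 + a *\<^sub>R x))"
    by (rule integral_density) auto
  also have "\<dots> = (\<integral> s. (\<bar>a\<bar> ^ DIM(complex)) *\<^sub>R f (0 + a *\<^sub>R s) \<partial>lborel)"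
    by (rule integral_distr) auto
  also have "\<dots> = a\<^sup>2 * (\<integral> s. f (a *\<^sub>R s) \<partial>lborel)"
    by simp
  finally show ?thesis .
qed

text \<open>
  Rescaling to the unit disc puts the kernels for radii \<open>a\<close> and \<open>2 a\<close> over the same domain, so
  they can be compared pointwise.
\<close>

lemma log_ball_mean_unit:
  assumes a: "a > 0"
  shows "log_ball_mean a z = (LINT s:ball 0 1|lborel. ln (max (a * cmod s) (cmod z))) / pi"
    and "set_integrable lborel (ball 0 1) (\<lambda>s. ln (max (a * cmod s) (cmod z)))"
proof -
  define f where "f = (\<lambda>s::complex. indicator (ball 0 a) s * ln (max (cmod s) (cmod z)))"
  have [measurable]: "f \<in> borel_measurable borel" unfolding f_def by measurable
  have feq: "f (a *\<^sub>R s) = indicator (ball 0 1) s * ln (max (a * cmod s) (cmod z))" for s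
    using a by (simp add: f_def indicator_def)
  have "(\<integral> s. f s \<partial>lborel) = a\<^sup>2 * (\<integral> s. f (a *\<^sub>R s) \<partial>lborel)"
    by (rule integral_scale) (use a in auto)
  then show "log_ball_mean a z = (LINT s:ball 0 1|lborel. ln (max (a * cmod s) (cmod z))) / pi"
    using a unfolding feq by (simp add: log_ball_mean_def set_lebesgue_integral_def f_def)
  have eq: "ln (max (a * cmod s) (cmod z)) = ln a + ln (max (cmod s) (cmod (z / of_real a)))" if "s \<noteq> 0" for s
  proof -
    have "max (a * cmod s) (cmod z) = a * max (cmod s) (cmod (z / of_real a))"
      using a by (simp add: norm_divide max_mult_distrib_left)
    moreover have "max (cmod s) (cmod (z / of_real a)) > 0" using that by (simp add: less_max_iff_disj)
    ultimately show ?thesis using a by (simp add: ln_mult)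
  qed
  have "set_integrable lborel (ball 0 1) (\<lambda>s. ln (max (cmod s) (cmod (z / of_real a - 0))))"
    by (rule ball_integral_ln(2))
  then have i: "set_integrable lborel (ball 0 1) (\<lambda>s. ln a + ln (max (cmod s) (cmod (z / of_real a))))"
    by (intro set_integral_add set_integral_const_ball) simp
  have "AE s in lborel. s \<noteq> (0::complex)" by (rule AE_lborel_singleton)
  then have "AE s in lborel. indicat_real (ball 0 1) s *\<^sub>R (ln a + ln (max (cmod s) (cmod (z / of_real a))))
     = indicat_real (ball 0 1) s *\<^sub>R ln (max (a * cmod s) (cmod z))"
    by eventually_elim (simp add: eq)
  then show "set_integrable lborel (ball 0 1) (\<lambda>s. ln (max (a * cmod s) (cmod z)))"
    using i unfolding set_integrable_def by (subst integrable_cong_AE[symmetric]) auto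
qed

text \<open>
  The two means agree where \<open>\<bar>z\<bar> \<ge> 2 a\<close>, so the difference has compact support; it is nonnegative
  and serves as an unnormalized mollifier. Convolving with it amounts to integrating a
  distributional Laplacian by parts, without derivatives.
\<close>

definition bump :: "real \<Rightarrow> complex \<Rightarrow> real" where
  "bump a z = log_ball_mean (2 * a) z - log_ball_mean a z"

lemma log_ball_mean_measurable [measurable]: "log_ball_mean a \<in> borel_measurable borel"
proof -
  have "(\<lambda>z. \<integral> s. indicator (ball 0 a) s * ln (max (cmod s) (cmod z)) \<partial>lborel) \<in> borel_measurable borel"
    by (intro lborel.borel_measurable_lebesgue_integral) measurable
  then show ?thesis unfolding log_ball_mean_def[abs_def] set_lebesgue_integral_def by simp
qed

lemma bump_measurable [measurable]: "bump a \<in> borel_measurable borel"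
  unfolding bump_def by measurable

lemma bump_unit:
  assumes a: "a > 0"
  shows "bump a z = (LINT s:ball 0 1|lborel. ln (max (2 * a * cmod s) (cmod z)) - ln (max (a * cmod s) (cmod z))) / pi"
  and "set_integrable lborel (ball 0 1) (\<lambda>s. ln (max (2 * a * cmod s) (cmod z)) - ln (max (a * cmod s) (cmod z)))"
proof -
  note k1 = log_ball_mean_unit[of a z] note k2 = log_ball_mean_unit[of "2 * a" z]
  show "bump a z = (LINT s:ball 0 1|lborel. ln (max (2 * a * cmod s) (cmod z)) - ln (max (a * cmod s) (cmod z))) / pi"
    using k1 k2 a by (simp add: bump_def diff_divide_distrib set_integral_diff(2))
  show "set_integrable lborel (ball 0 1) (\<lambda>s. ln (max (2 * a * cmod s) (cmod z)) - ln (max (a * cmod s) (cmod z)))"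
    using k1 k2 a by (intro set_integral_diff) auto
qed

lemma bump_integrand:
  fixes x y :: real
  assumes a: "a > 0" and that: "x \<ge> 0" "y \<ge> 0"
  shows "0 \<le> ln (max (2 * a * x) y) - ln (max (a * x) y)" "ln (max (2 * a * x) y) - ln (max (a * x) y) \<le> ln 2"
proof -
  have "0 \<le> ln (max (2 * a * x) y) - ln (max (a * x) y) \<and> ln (max (2 * a * x) y) - ln (max (a * x) y) \<le> ln 2"
  proof (cases "max (a * x) y = 0")
    case True
    have "a * x \<le> max (a * x) y" "y \<le> max (a * x) y" by simp_all
    then have "a * x \<le> 0" "y = 0" using True that(2) by simp_all
    moreover have "a * x \<ge> 0" using a that(1) by simp
    ultimately have "x = 0" "y = 0" using a by auto
    then show ?thesis by simp
  next
    case False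
    have "max (a * x) y \<ge> 0" using that(2) by (simp add: le_max_iff_disj)
    then have pos: "max (a * x) y > 0" using False by linarith
    have ax: "0 \<le> a * x" using a that by simp
    have le1: "max (a * x) y \<le> max (2 * a * x) y" using ax by (intro max.mono) auto
    have le2: "max (2 * a * x) y \<le> 2 * max (a * x) y" using that by (auto simp: max_def)
    have "ln (max (a * x) y) \<le> ln (max (2 * a * x) y)" using le1 pos by (intro ln_mono)
    moreover have "ln (max (2 * a * x) y) \<le> ln (2 * max (a * x) y)" using le1 le2 pos by (intro ln_mono) auto
    moreover have "ln (2 * max (a * x) y) = ln 2 + ln (max (a * x) y)" using pos by (simp add: ln_mult)
    ultimately show ?thesis by linarith
  qed
  then show "0 \<le> ln (max (2 * a * x) y) - ln (max (a * x) y)" "ln (max (2 * a * x) y) - ln (max (a * x) y) \<le> ln 2" by auto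
qed

lemma bump_bounds:
  assumes a: "a > 0" shows "0 \<le> bump a z" "bump a z \<le> ln 2"
proof -
  have "0 \<le> (LINT s:ball 0 1|lborel. ln (max (2 * a * cmod s) (cmod z)) - ln (max (a * cmod s) (cmod z)))"
    unfolding set_lebesgue_integral_def
    by (intro integral_nonneg_AE) (auto intro!: mult_nonneg_nonneg bump_integrand[OF a])
  then show "0 \<le> bump a z" using bump_unit(1)[OF a] by simp
  have "(LINT s:ball 0 1|lborel. ln (max (2 * a * cmod s) (cmod z)) - ln (max (a * cmod s) (cmod z))) \<le> (LINT s:ball (0::complex) 1|lborel. ln 2)"
    by (intro set_integral_mono bump_unit(2)[OF a] set_integral_const_ball) (auto intro!: bump_integrand[OF a])
  also have "\<dots> = pi * ln 2" by (simp add: set_integral_const_ball)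
  finally show "bump a z \<le> ln 2" unfolding bump_unit(1)[OF a] by (simp add: field_simps)
qed

lemma bump_support:
  assumes a: "a > 0" and z: "2 * a \<le> cmod z" shows "bump a z = 0"
proof -
  have "(LINT s:ball 0 1|lborel. ln (max (2 * a * cmod s) (cmod z)) - ln (max (a * cmod s) (cmod z))) = (LINT s:ball (0::complex) 1|lborel. (0::real))"
  proof (rule set_lebesgue_integral_cong)
    show "\<forall>x. x \<in> ball 0 1 \<longrightarrow> ln (max (2 * a * cmod x) (cmod z)) - ln (max (a * cmod x) (cmod z)) = 0"
    proof (intro allI impI)
      fix x :: complex assume "x \<in> ball 0 1"
      then have "cmod x \<le> 1" by simp
      then have ax: "a * cmod x \<le> a" using mult_left_mono[of "cmod x" 1 a] a by simp
      have "2 * a * cmod x \<le> cmod z" "a * cmod x \<le> cmod z" using ax z a by linarith+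
      then have "max (2 * a * cmod x) (cmod z) = cmod z" "max (a * cmod x) (cmod z) = cmod z"
        by (simp_all only: max_absorb2)
      then show "ln (max (2 * a * cmod x) (cmod z)) - ln (max (a * cmod x) (cmod z)) = 0" by simp
    qed
  qed simp
  then show ?thesis unfolding bump_unit(1)[OF a] by simp
qed

lemma bump_lower:
  assumes a: "a > 0" and z: "cmod z \<le> a / 2" shows "ln 2 / 2 \<le> bump a z"
proof -
  have i0: "set_integrable lborel (ball (0::complex) 1) (\<lambda>s. ln 2 - ln 2 * indicat_real (ball 0 (1/2)) s)"
  proof -
    have "integrable lborel (\<lambda>s::complex. ln 2 * indicat_real (ball 0 1) s - ln 2 * indicat_real (ball 0 (1/2)) s)"
      by (intro Bochner_Integration.integrable_diff integrable_mult_right integrable_real_indicator)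
         (use emeasure_ball_finite in auto)
    moreover have "(\<lambda>s::complex. ln 2 * indicat_real (ball 0 1) s - ln 2 * indicat_real (ball 0 (1/2)) s)
        = (\<lambda>s. indicat_real (ball 0 1) s *\<^sub>R (ln 2 - ln 2 * indicat_real (ball 0 (1/2)) s))"
      by (auto simp: fun_eq_iff indicator_def)
    ultimately show ?thesis unfolding set_integrable_def by simp
  qed
  have "(LINT s:ball (0::complex) 1|lborel. ln 2 - ln 2 * indicat_real (ball 0 (1/2)) s) = pi * (3/4) * ln 2"
  proof -
    have "(LINT s:ball (0::complex) 1|lborel. ln 2 - ln 2 * indicat_real (ball 0 (1/2)) s)
        = (\<integral> s. ln 2 * indicat_real (ball 0 1) s - ln 2 * indicat_real (ball (0::complex) (1/2)) s \<partial>lborel)"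
      unfolding set_lebesgue_integral_def by (intro Bochner_Integration.integral_cong) (auto simp: indicator_def)
    also have "\<dots> = ln 2 * measure lborel (ball (0::complex) 1) - ln 2 * measure lborel (ball (0::complex) (1/2))"
      by (subst Bochner_Integration.integral_diff)
         (use emeasure_ball_finite in \<open>auto intro!: integrable_mult_right integrable_real_indicator\<close>)
    also have "\<dots> = pi * (3/4) * ln 2" by (simp add: measure_ball_complex power2_eq_square)
    finally show ?thesis .
  qed
  moreover have "(LINT s:ball (0::complex) 1|lborel. ln 2 - ln 2 * indicat_real (ball 0 (1/2)) s)
     \<le> (LINT s:ball 0 1|lborel. ln (max (2 * a * cmod s) (cmod z)) - ln (max (a * cmod s) (cmod z)))"
  proof (rule set_integral_mono[OF i0 bump_unit(2)[OF a]])
    fix s :: complex assume "s \<in> ball 0 1"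
    show "ln 2 - ln 2 * indicat_real (ball 0 (1/2)) s \<le> ln (max (2 * a * cmod s) (cmod z)) - ln (max (a * cmod s) (cmod z))"
    proof (cases "s \<in> ball 0 (1/2)")
      case True
      then show ?thesis using bump_integrand(1)[OF a, of "cmod s" "cmod z"] by simp
    next
      case False
      then have s: "1/2 \<le> cmod s" by simp
      have h: "a / 2 \<le> a * cmod s" using mult_left_mono[OF s, of a] a by simp
      have h1: "cmod z \<le> a * cmod s" using h z by linarith
      have h2: "cmod z \<le> 2 * (a * cmod s)" using h z a by linarith
      have pos: "a * cmod s > 0" using h a by linarith
      have "ln (max (2 * a * cmod s) (cmod z)) = ln (2 * (a * cmod s))"
        using max_absorb1[OF h2] by (simp only: mult.assoc)
      also have "\<dots> = ln 2 + ln (a * cmod s)" using pos by (intro ln_mult_pos) auto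
      finally show ?thesis using False max_absorb1[OF h1] by simp
    qed
  qed
  ultimately have "pi * (3/4) * ln 2 \<le> pi * bump a z" unfolding bump_unit(1)[OF a] by simp
  then have "3/4 * ln 2 \<le> bump a z" using pi_gt_zero by (simp only: mult.assoc mult_le_cancel_left_pos)
  moreover have "ln 2 / 2 \<le> 3/4 * ln (2::real)" by simp
  ultimately show ?thesis by linarith
qed

lemma bump_integral:
  assumes a: "a > 0"
  shows "integrable lborel (bump a)" "(\<integral> z. bump a z \<partial>lborel) > 0"
proof -
  show i: "integrable lborel (bump a)"
  proof (rule Bochner_Integration.integrable_bound)
    show "integrable lborel (\<lambda>z::complex. ln 2 * indicat_real (ball 0 (2 * a)) z)"
      using emeasure_ball_finite by (intro integrable_mult_right integrable_real_indicator) auto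
    show "AE z in lborel. norm (bump a z) \<le> norm (ln 2 * indicat_real (ball 0 (2 * a)) z)"
      using bump_bounds[OF a] bump_support[OF a] by (auto simp: indicator_def)
  qed measurable
  have "0 < ln 2 / 2 * (pi * (a/2)\<^sup>2)" using a by simp
  also have "\<dots> = (\<integral> z. ln 2 / 2 * indicat_real (ball (0::complex) (a/2)) z \<partial>lborel)"
    using a by (simp add: measure_ball_complex)
  also have "\<dots> \<le> (\<integral> z. bump a z \<partial>lborel)"
  proof (rule integral_mono[OF _ i])
    show "integrable lborel (\<lambda>z::complex. ln 2 / 2 * indicat_real (ball 0 (a/2)) z)"
      using emeasure_ball_finite by (intro integrable_mult_right integrable_real_indicator) auto
    show "ln 2 / 2 * indicat_real (ball 0 (a/2)) z \<le> bump a z" for z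
      using bump_bounds[OF a, of z] bump_lower[OF a, of z] by (auto simp: indicator_def)
  qed
  finally show "(\<integral> z. bump a z \<partial>lborel) > 0" .
qed

context frostman_poly begin

text \<open>
  A disc mean of the excess compares the zeros with \<open>M\<close>, tested against one fixed continuous
  kernel.
\<close>

lemma ball_mean_difference:
  assumes a: "a > 0"
  shows "(LINT s:ball w a|lborel. - Lp s - pot M s + eps)
       = pi * a\<^sup>2 * ((\<integral> t. log_ball_mean a (w - t) \<partial>M) - (\<Sum>x\<in>zeros. wt x * log_ball_mean a (w - x)) + eps)"
    and "integrable M (\<lambda>t. log_ball_mean a (w - t))"
proof -
  have iM: "integrable M (\<lambda>t. LINT s:ball w a|lborel. ln (cmod (s - t)))" by (rule pot_Fubini) auto
  then have "integrable M (\<lambda>t. (1 / (pi * a\<^sup>2)) * (pi * a\<^sup>2 * log_ball_mean a (w - t)))"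
    using a by (intro integrable_mult_right) (simp add: ball_mean_log_ball_mean)
  then show "integrable M (\<lambda>t. log_ball_mean a (w - t))" using a by simp
  have iL: "set_integrable lborel (ball w a) (\<lambda>s. - Lp s)" by (rule minus_Lp) auto
  have iP: "set_integrable lborel (ball w a) (pot M)" by (rule pot_Fubini) auto
  have L: "(LINT s:ball w a|lborel. Lp s) = (\<Sum>x\<in>zeros. wt x * (pi * a\<^sup>2 * log_ball_mean a (w - x)))"
    using a by (simp add: set_integral_Lp ball_mean_log_ball_mean)
  have P: "(LINT s:ball w a|lborel. pot M s) = - (\<integral> t. pi * a\<^sup>2 * log_ball_mean a (w - t) \<partial>M)"
    using a pot_Fubini(3)[of "ball w a"] by (simp add: ball_mean_log_ball_mean)
  have "(LINT s:ball w a|lborel. - Lp s - pot M s + eps)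
      = - (LINT s:ball w a|lborel. Lp s) - (LINT s:ball w a|lborel. pot M s) + pi * a\<^sup>2 * eps"
    using set_integral_add(2)[OF set_integral_diff(1)[OF iL iP] set_integral_const_ball(2)]
      set_integral_diff(2)[OF iL iP] set_integral_const_ball(1) a
    by (simp add: minus_Lp)
  also have "\<dots> = pi * a\<^sup>2 * ((\<integral> t. log_ball_mean a (w - t) \<partial>M) - (\<Sum>x\<in>zeros. wt x * log_ball_mean a (w - x)) + eps)"
    unfolding L P by (simp add: right_diff_distrib distrib_left sum_distrib_left mult_ac)
  finally show "(LINT s:ball w a|lborel. - Lp s - pot M s + eps)
       = pi * a\<^sup>2 * ((\<integral> t. log_ball_mean a (w - t) \<partial>M) - (\<Sum>x\<in>zeros. wt x * log_ball_mean a (w - x)) + eps)" .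
qed

end

section \<open>From excess to zeros\<close>

lemma compact_support_uniformly_continuous:
  fixes f :: "complex \<Rightarrow> real"
  assumes c: "continuous_on UNIV f" and T: "\<And>z. T \<le> cmod z \<Longrightarrow> f z = 0" and e: "e > 0"
  obtains d where "d > 0" "\<And>x y. dist x y < d \<Longrightarrow> \<bar>f x - f y\<bar> < e"
proof -
  have uc: "uniformly_continuous_on (cball 0 (T + 1)) f"
    by (rule compact_uniformly_continuous[OF continuous_on_subset[OF c]]) auto
  obtain d where d: "d > 0" "\<And>x y. x \<in> cball 0 (T + 1) \<Longrightarrow> y \<in> cball 0 (T + 1) \<Longrightarrow> dist y x < d \<Longrightarrow> dist (f y) (f x) < e"
  proof -
    have "\<exists>d>0. \<forall>x\<in>cball 0 (T + 1). \<forall>y\<in>cball 0 (T + 1). dist y x < d \<longrightarrow> dist (f y) (f x) < e"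
      using uc e unfolding uniformly_continuous_on_def by (elim allE[of _ e]) simp
    then show thesis using that by blast
  qed
  show thesis
  proof (rule that[of "min d 1"])
    fix x y :: complex assume xy: "dist x y < min d 1"
    have tri: "\<bar>cmod x - cmod y\<bar> < 1" using norm_triangle_ineq3[of x y] xy by (simp add: dist_norm)
    show "\<bar>f x - f y\<bar> < e"
    proof (cases "cmod x \<le> T + 1 \<and> cmod y \<le> T + 1")
      case True
      then have "dist (f x) (f y) < e" using xy by (intro d(2)) auto
      then show ?thesis by (simp add: dist_real_def)
    next
      case False
      then have "T \<le> cmod x" "T \<le> cmod y" using tri by linarith+
      then show ?thesis using T e by simp
    qed
  qed (use d in auto)
qed

context frostman_seq begin

text \<open>
  Where the excess vanishes, the zeros and \<open>M\<close> agree asymptotically on the disc means of the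
  kernel.
\<close>

lemma vanish_imp_log_ball_mean_limit:
  assumes a: "a > 0" and v: "vanish (ball w a)"
  shows "(\<lambda>k. \<Sum>x\<in>P.zeros k. P.wt k x * log_ball_mean a (w - x)) \<longlonglongrightarrow> (\<integral> t. log_ball_mean a (w - t) \<partial>M)"
proof -
  define D where "D = (\<lambda>k. LINT s:ball w a|lborel. - P.Lp k s - pot M s + P.eps k)"
  have "(\<lambda>k. ennreal (D k)) \<longlonglongrightarrow> 0"
    using v unfolding vanish_def D_def by (simp add: P.nn_integral_excess)
  moreover have D0: "D k \<ge> 0" for k
    unfolding D_def set_lebesgue_integral_def
    by (intro integral_nonneg_AE, use P.AE_not_zero[of k] in eventually_elim)
       (use P.bernstein_walsh[of _ k] in \<open>auto intro!: mult_nonneg_nonneg\<close>)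
  ultimately have D: "D \<longlonglongrightarrow> 0" by (simp add: ennreal_tendsto_0_iff)
  have eq: "(\<Sum>x\<in>P.zeros k. P.wt k x * log_ball_mean a (w - x)) = (\<integral> t. log_ball_mean a (w - t) \<partial>M) + P.eps k - D k / (pi * a\<^sup>2)" for k
    using P.ball_mean_difference(1)[OF a, where k=k and w=w] a by (simp add: D_def field_simps)
  have "(\<lambda>k. (\<integral> t. log_ball_mean a (w - t) \<partial>M) + P.eps k - D k / (pi * a\<^sup>2)) \<longlonglongrightarrow> (\<integral> t. log_ball_mean a (w - t) \<partial>M) + 0 - 0 / (pi * a\<^sup>2)"
    using a by (intro tendsto_intros eps_lim D) auto
  then show ?thesis unfolding eq by simp
qed

lemma vanish_imp_bump_limit:
  assumes a: "a > 0" and v: "vanish (ball w (2 * a))"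
  shows "(\<lambda>k. \<Sum>x\<in>P.zeros k. P.wt k x * bump a (w - x)) \<longlonglongrightarrow> (\<integral> t. bump a (w - t) \<partial>M)"
proof -
  have v1: "vanish (ball w a)" by (rule vanish_mono[OF v]) (use a in auto)
  have "(\<lambda>k. (\<Sum>x\<in>P.zeros k. P.wt k x * log_ball_mean (2 * a) (w - x)) - (\<Sum>x\<in>P.zeros k. P.wt k x * log_ball_mean a (w - x)))
     \<longlonglongrightarrow> (\<integral> t. log_ball_mean (2 * a) (w - t) \<partial>M) - (\<integral> t. log_ball_mean a (w - t) \<partial>M)"
    using a by (intro tendsto_diff vanish_imp_log_ball_mean_limit v v1) auto
  moreover have "(\<integral> t. log_ball_mean (2 * a) (w - t) \<partial>M) - (\<integral> t. log_ball_mean a (w - t) \<partial>M) = (\<integral> t. bump a (w - t) \<partial>M)"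
    unfolding bump_def using P.ball_mean_difference(2)[of a w] P.ball_mean_difference(2)[of "2 * a" w] a
    by (subst Bochner_Integration.integral_diff) auto
  ultimately show ?thesis
    by (simp add: bump_def right_diff_distrib sum_subtractf)
qed

text \<open>
  Up to the factor \<open>c = \<integral> bump a\<close>, the function \<open>f\<close> is uniformly close to its convolution \<open>F\<close> with
  the bump. Exchanging integrals, the sum of \<open>F\<close> over the zeros is the integral of \<open>f\<close> against the
  functions \<open>S k\<close>, which converge on the support of \<open>f\<close> and are bounded by \<open>ln 2\<close>; dominated
  convergence applies.
\<close>

theorem zeros_converge_where_vanish:
  fixes f :: "complex \<Rightarrow> real"
  assumes cont: "continuous_on UNIV f" and X: "compact X" "\<And>z. z \<notin> X \<Longrightarrow> f z = 0"
    and O': "open O'" "X \<subseteq> O'" and van: "\<And>Y. compact Y \<Longrightarrow> Y \<subseteq> O' \<Longrightarrow> vanish Y"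
  shows "(\<lambda>k. \<Sum>x\<in>P.zeros k. P.wt k x * f x) \<longlonglongrightarrow> (\<integral> t. f t \<partial>M)"
proof -
  have [measurable]: "f \<in> borel_measurable borel" by (rule borel_measurable_continuous_onI[OF cont])
  have "compact (f ` X)" by (intro compact_continuous_image X continuous_on_subset[OF cont]) auto
  then have "bounded (f ` X)" by (rule compact_imp_bounded)
  then obtain B0 where B0: "\<And>x. x \<in> X \<Longrightarrow> \<bar>f x\<bar> \<le> B0" unfolding bounded_iff real_norm_def by blast
  define B where "B = max 1 B0"
  have B: "B > 0" "\<And>x. \<bar>f x\<bar> \<le> B"
  proof -
    show "B > 0" by (simp add: B_def)
    show "\<bar>f x\<bar> \<le> B" for x using B0[of x] X(2)[of x] by (cases "x \<in> X") (auto simp: B_def)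
  qed
  obtain T where T: "T > 0" "X \<subseteq> ball 0 T" using compact_imp_bounded[OF X(1)] bounded_subset_ballD by metis
  have fT: "f z = 0" if "T \<le> cmod z" for z using that T X(2)[of z] by (cases "z \<in> X") auto
  have fB: "\<bar>f z\<bar> \<le> B * indicat_real (ball 0 T) z" for z using fT[of z] B(2)[of z] by (auto simp: indicator_def)
  have iB: "integrable lborel (\<lambda>z. B * indicat_real (ball (0::complex) T) z)"
    using emeasure_ball_finite by (intro integrable_mult_right integrable_real_indicator) auto
  have fi: "integrable lborel f"
    by (rule Bochner_Integration.integrable_bound[OF iB]) (use fB B(1) in \<open>auto simp: abs_mult\<close>)
  have fM: "integrable M f"
    by (rule integrable_const_bound[where B=B]) (use B in auto)
  show ?thesis
    unfolding LIMSEQ_iff real_norm_def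
  proof (intro allI impI)
    fix e :: real assume e: "e > 0"
    obtain d where d: "d > 0" "\<And>x y. dist x y < d \<Longrightarrow> \<bar>f x - f y\<bar> < e / 4"
    proof -
      have "e / 4 > 0" using e by simp
      from compact_support_uniformly_continuous[OF cont fT this] show thesis using that by blast
    qed
    obtain b where b: "b > 0" "\<And>x y. x \<in> X \<Longrightarrow> y \<notin> O' \<Longrightarrow> b \<le> dist x y"
    proof -
      have "\<exists>d>0. \<forall>x\<in>X. \<forall>y\<in>-O'. d \<le> dist x y"
        using O' by (intro separate_compact_closed X) (auto simp: closed_Compl)
      then show thesis using that by blast
    qed
    \<comment> \<open>discs of radius \<open>2 a\<close> about points of \<open>X\<close> stay in \<open>O'\<close>, and \<open>f\<close> varies little on them\<close>
    define a where "a = min (d / 2) (b / 4)"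
    have a: "a > 0" "2 * a \<le> d" "2 * a < b" using d b by (auto simp: a_def)
    define c where "c = (\<integral> z. bump a z \<partial>lborel)"
    have c: "c > 0" using bump_integral(2)[OF a(1)] by (simp add: c_def)
    \<comment> \<open>the convolution of \<open>f\<close> with the bump\<close>
    define F where "F = (\<lambda>t. \<integral> w. f w * bump a (w - t) \<partial>lborel)"
    have bump_t: "integrable lborel (\<lambda>w. bump a (w - t))" "(\<integral> w. bump a (w - t) \<partial>lborel) = c" for t
    proof -
      have "(\<integral> w. bump a (- t + w) \<partial>lborel) = c" unfolding c_def by (rule integral_translate) measurable
      then show 2: "(\<integral> w. bump a (w - t) \<partial>lborel) = c" by simp
      show "integrable lborel (\<lambda>w. bump a (w - t))"
        using not_integrable_integral_eq[of lborel "\<lambda>w. bump a (w - t)"] 2 c by fastforce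
    qed
    have fbump: "integrable lborel (\<lambda>w. f w * bump a (w - t))" for t
    proof (rule Bochner_Integration.integrable_bound[OF integrable_mult_right[OF bump_t(1)[of t], of B]])
      show "AE w in lborel. norm (f w * bump a (w - t)) \<le> norm (B * bump a (w - t))"
        using B bump_bounds(1)[OF a(1)] by (auto simp: abs_mult intro!: mult_right_mono)
    qed measurable
    have close: "\<bar>F t - c * f t\<bar> \<le> c * (e / 4)" for t
    proof -
      have "F t - c * f t = (\<integral> w. f w * bump a (w - t) \<partial>lborel) - (\<integral> w. f t * bump a (w - t) \<partial>lborel)"
        using bump_t[of t] by (simp add: F_def mult.commute)
      also have "\<dots> = (\<integral> w. f w * bump a (w - t) - f t * bump a (w - t) \<partial>lborel)"
        using fbump[of t] bump_t(1)[of t] by (subst Bochner_Integration.integral_diff) auto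
      finally have "\<bar>F t - c * f t\<bar> = \<bar>\<integral> w. (f w - f t) * bump a (w - t) \<partial>lborel\<bar>" by (simp add: left_diff_distrib)
      also have "\<dots> \<le> (\<integral> w. \<bar>(f w - f t) * bump a (w - t)\<bar> \<partial>lborel)" by (rule integral_abs_bound)
      also have "\<dots> \<le> (\<integral> w. e / 4 * bump a (w - t) \<partial>lborel)"
      proof (rule integral_mono)
        have "integrable lborel (\<lambda>w. f w * bump a (w - t) - f t * bump a (w - t))"
          using fbump[of t] bump_t(1)[of t] by auto
        then show "integrable lborel (\<lambda>w. \<bar>(f w - f t) * bump a (w - t)\<bar>)" by (simp add: left_diff_distrib)
        show "integrable lborel (\<lambda>w. e / 4 * bump a (w - t))" using bump_t(1)[of t] by auto
        fix w
        show "\<bar>(f w - f t) * bump a (w - t)\<bar> \<le> e / 4 * bump a (w - t)"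
        proof (cases "dist w t < d")
          case True
          then have "\<bar>f w - f t\<bar> \<le> e / 4" using d(2)[of w t] by simp
          then have "\<bar>f w - f t\<bar> * bump a (w - t) \<le> e / 4 * bump a (w - t)"
            by (rule mult_right_mono) (rule bump_bounds(1)[OF a(1)])
          then show ?thesis by (simp only: abs_mult abs_of_nonneg[OF bump_bounds(1)[OF a(1)]])
        next
          case False
          then have "bump a (w - t) = 0" using a by (intro bump_support) (auto simp: dist_norm)
          then show ?thesis by simp
        qed
      qed
      also have "\<dots> = c * (e / 4)" using bump_t[of t] by simp
      finally show ?thesis .
    qed
    have [measurable]: "F \<in> borel_measurable borel"
      unfolding F_def by measurable
    have FB: "\<bar>F t\<bar> \<le> c * (e / 4) + c * B" for t
    proof -
      have "\<bar>F t\<bar> \<le> \<bar>F t - c * f t\<bar> + \<bar>c * f t\<bar>" by arith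
      moreover have "\<bar>c * f t\<bar> \<le> c * B" using c B(2)[of t] by (simp add: abs_mult)
      ultimately show ?thesis using close[of t] by linarith
    qed
    have FM: "integrable M F"
      by (rule integrable_const_bound[where B="c * (e / 4) + c * B"]) (use FB in auto)
    define S where "S = (\<lambda>k w. \<Sum>x\<in>P.zeros k. P.wt k x * bump a (w - x))"
    define S0 where "S0 = (\<lambda>w. \<integral> t. bump a (w - t) \<partial>M)"
    have [measurable]: "S k \<in> borel_measurable borel" for k unfolding S_def by measurable
    have [measurable]: "S0 \<in> borel_measurable borel" unfolding S0_def by measurable
    have S_bd: "\<bar>S k w\<bar> \<le> ln 2" for k w
    proof -
      have "\<bar>S k w\<bar> \<le> (\<Sum>x\<in>P.zeros k. \<bar>P.wt k x * bump a (w - x)\<bar>)" unfolding S_def by (rule sum_abs)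
      also have "\<dots> \<le> (\<Sum>x\<in>P.zeros k. P.wt k x * ln 2)"
        using bump_bounds[OF a(1)] P.wt_nonneg[of k] by (intro sum_mono) (auto simp: abs_mult intro!: mult_left_mono)
      also have "\<dots> = ln 2" using P.sum_wt[of k] by (simp flip: sum_distrib_right)
      finally show ?thesis .
    qed
    have sumF: "(\<Sum>x\<in>P.zeros k. P.wt k x * F x) = (\<integral> w. f w * S k w \<partial>lborel)" for k
    proof -
      have "(\<integral> w. f w * S k w \<partial>lborel) = (\<integral> w. (\<Sum>x\<in>P.zeros k. P.wt k x * (f w * bump a (w - x))) \<partial>lborel)"
        by (simp add: S_def sum_distrib_left mult_ac)
      also have "\<dots> = (\<Sum>x\<in>P.zeros k. \<integral> w. P.wt k x * (f w * bump a (w - x)) \<partial>lborel)"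
        using fbump by (intro Bochner_Integration.integral_sum) auto
      finally show ?thesis by (simp add: F_def)
    qed
    have lim: "(\<lambda>k. \<integral> w. f w * S k w \<partial>lborel) \<longlonglongrightarrow> (\<integral> w. f w * S0 w \<partial>lborel)"
    proof (rule integral_dominated_convergence[where w="\<lambda>w. \<bar>f w\<bar> * ln 2"])
      show "integrable lborel (\<lambda>w. \<bar>f w\<bar> * ln 2)" using fi by auto
      show "AE w in lborel. norm (f w * S k w) \<le> \<bar>f w\<bar> * ln 2" for k
        using S_bd by (auto simp: abs_mult intro!: mult_left_mono)
      show "AE w in lborel. (\<lambda>k. f w * S k w) \<longlonglongrightarrow> f w * S0 w"
      proof (rule AE_I2)
        fix w
        show "(\<lambda>k. f w * S k w) \<longlonglongrightarrow> f w * S0 w"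
        proof (cases "w \<in> X")
          case True
          have "cball w (2 * a) \<subseteq> O'"
          proof
            fix y assume "y \<in> cball w (2 * a)"
            then show "y \<in> O'" using b(2)[OF True, of y] a by (cases "y \<in> O'") auto
          qed
          then have "vanish (cball w (2 * a))" by (intro van) auto
          then have "vanish (ball w (2 * a))" by (rule vanish_mono) auto
          then show ?thesis unfolding S_def S0_def
            by (intro tendsto_mult tendsto_const vanish_imp_bump_limit a)
        next
          case False
          then show ?thesis using X(2) by simp
        qed
      qed
    qed measurable
    have FubM: "(\<integral> w. f w * S0 w \<partial>lborel) = (\<integral> t. F t \<partial>M)"
    proof -
      define h where "h = (\<lambda>w t. f w * bump a (w - t))"
      have [measurable]: "case_prod h \<in> borel_measurable (lborel \<Otimes>\<^sub>M M)" unfolding h_def by measurable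
      have fst: "(\<integral>\<^sup>+ w. (\<integral>\<^sup>+ t. ennreal (norm (case_prod h (w, t))) \<partial>M) \<partial>lborel)
          = (\<integral>\<^sup>+ x. ennreal (norm (case_prod h x)) \<partial>(lborel \<Otimes>\<^sub>M M))"
        by (rule nn_integral_fst) measurable
      interpret pair_sigma_finite lborel M by (intro pair_sigma_finite.intro) unfold_locales
      have "integrable (lborel \<Otimes>\<^sub>M M) (case_prod h)"
      proof (rule integrableI_bounded)
        have "(\<integral>\<^sup>+ x. ennreal (norm (case_prod h x)) \<partial>(lborel \<Otimes>\<^sub>M M)) = (\<integral>\<^sup>+ w. (\<integral>\<^sup>+ t. ennreal (norm (h w t)) \<partial>M) \<partial>lborel)"
          using fst by simp
        also have "\<dots> \<le> (\<integral>\<^sup>+ w. (\<integral>\<^sup>+ t. ennreal (\<bar>f w\<bar> * ln 2) \<partial>M) \<partial>lborel)"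
          using bump_bounds[OF a(1)] by (intro nn_integral_mono ennreal_leI) (auto simp: h_def abs_mult intro!: mult_left_mono)
        also have "\<dots> = (\<integral>\<^sup>+ w. ennreal (\<bar>f w\<bar> * ln 2) \<partial>lborel)" by (simp add: emeasure_space_1)
        also have "\<dots> = ennreal (\<integral> w. \<bar>f w\<bar> * ln 2 \<partial>lborel)"
          using fi by (intro nn_integral_eq_integral) auto
        finally show "(\<integral>\<^sup>+ x. ennreal (norm (case_prod h x)) \<partial>(lborel \<Otimes>\<^sub>M M)) < \<infinity>" by (simp add: le_less_trans)
      qed measurable
      from Fubini_integral[OF this] show ?thesis
        by (simp add: h_def S0_def F_def)
    qed
    have "(\<lambda>k. \<Sum>x\<in>P.zeros k. P.wt k x * F x) \<longlonglongrightarrow> (\<integral> t. F t \<partial>M)"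
      using lim unfolding sumF FubM .
    then obtain k0 where k0: "\<And>k. k \<ge> k0 \<Longrightarrow> \<bar>(\<Sum>x\<in>P.zeros k. P.wt k x * F x) - (\<integral> t. F t \<partial>M)\<bar> < c * (e / 4)"
      using c e unfolding LIMSEQ_iff real_norm_def by (metis divide_pos_pos mult_pos_pos zero_less_numeral)
    have "\<bar>(\<Sum>x\<in>P.zeros k. P.wt k x * f x) - (\<integral> t. f t \<partial>M)\<bar> < e" if k: "k \<ge> k0" for k
    proof -
      have 1: "\<bar>(\<Sum>x\<in>P.zeros k. P.wt k x * F x) - c * (\<Sum>x\<in>P.zeros k. P.wt k x * f x)\<bar> \<le> c * (e / 4)"
      proof -
        have "(\<Sum>x\<in>P.zeros k. P.wt k x * F x) - c * (\<Sum>x\<in>P.zeros k. P.wt k x * f x) = (\<Sum>x\<in>P.zeros k. P.wt k x * (F x - c * f x))"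
          by (simp add: right_diff_distrib sum_subtractf sum_distrib_left mult_ac)
        also have "\<bar>\<dots>\<bar> \<le> (\<Sum>x\<in>P.zeros k. \<bar>P.wt k x * (F x - c * f x)\<bar>)" by (rule sum_abs)
        also have "\<dots> \<le> (\<Sum>x\<in>P.zeros k. P.wt k x * (c * (e / 4)))"
        proof (intro sum_mono)
          show "\<bar>P.wt k x * (F x - c * f x)\<bar> \<le> P.wt k x * (c * (e / 4))" for x
            unfolding abs_mult abs_of_nonneg[OF P.wt_nonneg] by (intro mult_left_mono close P.wt_nonneg)
        qed
        also have "\<dots> = c * (e / 4)" unfolding sum_distrib_right[symmetric] P.sum_wt by simp
        finally show ?thesis .
      qed
      have 2: "\<bar>(\<integral> t. F t \<partial>M) - c * (\<integral> t. f t \<partial>M)\<bar> \<le> c * (e / 4)"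
      proof -
        have "(\<integral> t. F t \<partial>M) - c * (\<integral> t. f t \<partial>M) = (\<integral> t. F t - c * f t \<partial>M)"
          using FM fM by (subst Bochner_Integration.integral_diff) auto
        also have "\<bar>\<dots>\<bar> \<le> (\<integral> t. \<bar>F t - c * f t\<bar> \<partial>M)" by (rule integral_abs_bound)
        also have "\<dots> \<le> (\<integral> t. c * (e / 4) \<partial>M)"
          using FM fM close by (intro integral_mono) auto
        also have "\<dots> = c * (e / 4)" using prob_space by simp
        finally show ?thesis .
      qed
      have "c * \<bar>(\<Sum>x\<in>P.zeros k. P.wt k x * f x) - (\<integral> t. f t \<partial>M)\<bar>
          = \<bar>c * (\<Sum>x\<in>P.zeros k. P.wt k x * f x) - c * (\<integral> t. f t \<partial>M)\<bar>"
        using c by (simp add: right_diff_distrib[symmetric] abs_mult)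
      also have "\<dots> < c * e" using 1 2 k0[OF k] c e by (simp add: field_simps) (smt (verit) distrib_left)
      finally show ?thesis using c by simp
    qed
    then show "\<exists>no. \<forall>n\<ge>no. \<bar>(\<Sum>x\<in>P.zeros n. P.wt n x * f x) - (\<integral> t. f t \<partial>M)\<bar> < e" by blast
  qed
qed

end

section \<open>Zeros away from the hull, and restriction to a neighbourhood\<close>

context frostman_measure begin

text \<open>
  At a zero of \<open>g\<close> the chain inequality would force \<open>g\<close> to vanish almost everywhere on a disc far
  out, but \<open>g\<close> grows like the logarithm at infinity.
\<close>

lemma g_positive_Out:
  assumes z: "z \<in> Out" shows "g z > 0"
proof (rule ccontr)
  assume "\<not> ?thesis"
  then have gz: "g z = 0" using g_nonneg[of z] by simp
  obtain R0 where R0: "R0 > 0" "E \<subseteq> ball 0 R0" by (rule K_radius)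
  define L where "L = R0 + exp (1 - rob)"
  have far: "1 \<le> g y" if "L \<le> cmod y" for y
  proof -
    have gt: "exp (1 - rob) \<le> cmod y - R0" using that by (simp add: L_def)
    have pos: "0 < cmod y - R0" by (rule less_le_trans[OF _ gt]) simp
    have "pot M y \<le> - ln (cmod y - R0)" using R0 pos by (intro pot_far(2)) auto
    moreover have "ln (exp (1 - rob)) \<le> ln (cmod y - R0)" using gt by (intro ln_mono) auto
    ultimately show ?thesis by (simp add: g_def)
  qed
  define b where "b = complex_of_real (L + 1)"
  have L: "L > 0" using R0 by (simp add: L_def add_pos_pos)
  have nb: "cmod b = L + 1" using L unfolding b_def norm_of_real by simp
  have bO: "b \<in> Out" by (rule far_in_Out[OF R0(2)]) (simp add: nb L_def add_nonneg_nonneg)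
  obtain s r C where c: "s > 0" "r > 0" "C > 0" "cball b r \<subseteq> Out"
    and chain: "\<And>e y. superharmonic_ball Out e \<Longrightarrow> y \<in> ball z s \<Longrightarrow> (\<integral>\<^sup>+ x\<in>ball b r. e x \<partial>lborel) \<le> ennreal C * e y"
    by (rule superharmonic_chain[OF open_Out connected_Out z bO], rule that, assumption+)
  have "superharmonic_ball Out (\<lambda>y. ennreal (g y))"
    unfolding superharmonic_ball_def
  proof (intro conjI allI impI)
    fix y t assume t: "(t::real) > 0" "cball y t \<subseteq> Out"
    have tE: "t \<le> cmod (y - x)" if "x \<in> E" for x
    proof (rule ccontr)
      assume "\<not> ?thesis"
      then have "x \<in> Out" using t by (auto simp: dist_norm subset_iff)
      then show False using that Out_E by auto
    qed
    have ip: "set_integrable lborel (ball y t) (pot M)" by (rule pot_Fubini) auto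
    have "(LINT x:ball y t|lborel. g x) = pi * t\<^sup>2 * rob - (LINT x:ball y t|lborel. pot M x)"
      unfolding g_def using set_integral_diff(2)[OF set_integral_const_ball(2) ip] set_integral_const_ball(1) t by simp
    also have "\<dots> = pi * t\<^sup>2 * g y" using pot_ball_eq[of t y] tE t by (simp add: g_def algebra_simps)
    finally show "(\<integral>\<^sup>+ x\<in>ball y t. ennreal (g x) \<partial>lborel) \<le> ennreal (pi * t\<^sup>2) * ennreal (g y)"
      using g_nonneg[of y] by (simp add: nn_integral_g ennreal_mult)
  qed measurable
  from chain[OF this, of z] have z0: "(\<integral>\<^sup>+ x\<in>ball b r. ennreal (g x) \<partial>lborel) = 0" using c gz by simp
  define t where "t = min r 1"
  have t: "t > 0" "t \<le> r" "t \<le> 1" using c by (auto simp: t_def)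
  have "ennreal (pi * t\<^sup>2) = (\<integral>\<^sup>+ x. indicator (ball b t) x \<partial>lborel)"
    using t by (simp add: emeasure_ball_complex)
  also have "\<dots> \<le> (\<integral>\<^sup>+ x\<in>ball b r. ennreal (g x) \<partial>lborel)"
  proof (intro nn_integral_mono)
    fix x
    show "indicator (ball b t) x \<le> ennreal (g x) * indicator (ball b r) x"
    proof (cases "x \<in> ball b t")
      case True
      then have "cmod (b - x) < 1" using t by (simp add: dist_norm)
      then have "L \<le> cmod x" using nb norm_triangle_ineq2[of b x] by linarith
      then have "ennreal 1 \<le> ennreal (g x)" by (intro ennreal_leI far)
      then show ?thesis using True t by simp
    qed simp
  qed
  finally show False using z0 t by simp
qed

text \<open>
  Far out \<open>g \<ge> 1\<close>; the remaining points form a compact subset of the outer domain.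
\<close>

lemma g_lower_away:
  assumes \<delta>: "\<delta> > 0"
  obtains c where "c > 0" "\<And>z. \<delta> \<le> infdist z H \<Longrightarrow> c \<le> g z"
proof -
  obtain R0 where R0: "R0 > 0" "E \<subseteq> ball 0 R0" by (rule K_radius)
  define L where "L = R0 + exp (1 - rob)"
  have far: "1 \<le> g y" if "L \<le> cmod y" for y
  proof -
    have gt: "exp (1 - rob) \<le> cmod y - R0" using that by (simp add: L_def)
    have pos: "0 < cmod y - R0" by (rule less_le_trans[OF _ gt]) simp
    have "pot M y \<le> - ln (cmod y - R0)" using R0 pos by (intro pot_far(2)) auto
    moreover have "ln (exp (1 - rob)) \<le> ln (cmod y - R0)" using gt by (intro ln_mono) auto
    ultimately show ?thesis by (simp add: g_def)
  qed
  define A where "A = {z. \<delta> \<le> infdist z H} \<inter> cball 0 L"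
  have cl: "closed {z. \<delta> \<le> infdist z H}" by (intro closed_Collect_le continuous_intros)
  have cA: "compact A" unfolding A_def by (intro closed_Int_compact cl compact_cball)
  have AO: "A \<subseteq> Out"
  proof
    fix z assume "z \<in> A"
    then have "z \<notin> H" using \<delta> by (auto simp: A_def)
    then show "z \<in> Out" by (simp add: H_eq)
  qed
  have cg: "continuous_on A g"
    unfolding g_def using AO Out_E by (intro continuous_intros continuous_on_subset[OF continuous_pot_off]) auto
  show thesis
  proof (cases "A = {}")
    case True
    have "1 \<le> g z" if "\<delta> \<le> infdist z H" for z
    proof (rule far, rule ccontr)
      assume "\<not> L \<le> cmod z"
      then have "z \<in> A" using that by (simp add: A_def)
      then show False using True by simp
    qed
    then show thesis by (intro that[of 1]) auto
  next
    case False
    obtain z0 where z0: "z0 \<in> A" "\<And>z. z \<in> A \<Longrightarrow> g z0 \<le> g z"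
      using continuous_attains_inf[OF cA False cg] by blast
    have p: "g z0 > 0" using z0(1) AO by (intro g_positive_Out) auto
    have "min 1 (g z0) \<le> g z" if z: "\<delta> \<le> infdist z H" for z
    proof (cases "L \<le> cmod z")
      case True then show ?thesis using far[of z] by simp
    next
      case False
      then have "z \<in> A" using z by (simp add: A_def)
      then show ?thesis using z0(2)[of z] by simp
    qed
    then show thesis using p by (intro that[of "min 1 (g z0)"]) auto
  qed
qed

end

context frostman_seq begin

lemma zeros_away_from_hull:
  assumes \<delta>: "\<delta> > 0"
  shows "(\<lambda>k. \<Sum>x\<in>P.zeros k. P.wt k x * indicat_real {z. \<delta> \<le> infdist z H} x) \<longlonglongrightarrow> 0"
proof -
  obtain c where c: "c > 0" "\<And>z. \<delta> \<le> infdist z H \<Longrightarrow> c \<le> g z" using g_lower_away[OF \<delta>] by blast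
  have up: "(\<Sum>x\<in>P.zeros k. P.wt k x * indicat_real {z. \<delta> \<le> infdist z H} x) \<le> P.eps k / c" for k
  proof -
    have "c * (\<Sum>x\<in>P.zeros k. P.wt k x * indicat_real {z. \<delta> \<le> infdist z H} x)
        = (\<Sum>x\<in>P.zeros k. P.wt k x * (c * indicat_real {z. \<delta> \<le> infdist z H} x))"
      by (simp add: sum_distrib_left mult_ac)
    also have "\<dots> \<le> (\<Sum>x\<in>P.zeros k. P.wt k x * g x)"
      using c(2) g_nonneg by (intro sum_mono mult_left_mono P.wt_nonneg) (auto simp: indicator_def)
    also have "\<dots> \<le> P.eps k" by (rule P.sum_green_le)
    finally show ?thesis using c(1) by (simp add: field_simps)
  qed
  have lo: "0 \<le> (\<Sum>x\<in>P.zeros k. P.wt k x * indicat_real {z. \<delta> \<le> infdist z H} x)" for k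
    by (intro sum_nonneg mult_nonneg_nonneg P.wt_nonneg) auto
  have "(\<lambda>k. P.eps k / c) \<longlonglongrightarrow> 0 / c" using c by (intro tendsto_intros eps_lim) auto
  then have "(\<lambda>k. P.eps k / c) \<longlonglongrightarrow> 0" by simp
  from tendsto_sandwich[OF _ _ tendsto_const this] show ?thesis
    using up lo by simp
qed

text \<open>
  Cut the test function off near \<open>E0\<close>. The cut-off part is supported in \<open>- (H - E0)\<close>, where the
  excess vanishes; the part that was removed only sees zeros in \<open>V\<close> at a positive distance from
  the hull.
\<close>

theorem zeros_weak_star:
  assumes E0: "closed E0" "E0 \<subseteq> H" "E0 \<noteq> {}"
    and gap: "E0 = H \<or> setdist E0 (H - E0) > 0"
    and ncs: "interior E0 = {} \<or> (\<forall>C \<in> components (interior E0). \<exists>z0 \<in> frontier C. ncs_point C z0)"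
    and V: "open V" "E0 \<subseteq> V" "E0 \<noteq> H \<longrightarrow> setdist V (H - E0) > 0"
  shows "weak_star_conv (\<lambda>k. measure_restriction (zero_measure (p k)) V) (measure_restriction M E0)"
proof -
  have cE0: "compact E0" using E0 compact_H by (metis Int_absorb1 compact_Int_closed inf_commute)
  have sep: "\<exists>s>0. \<forall>x\<in>E0. \<forall>y\<in>H-E0. s \<le> dist x y"
  proof (cases "E0 = H")
    case False
    then have "setdist E0 (H - E0) > 0" using gap by simp
    then show ?thesis by (intro exI[of _ "setdist E0 (H - E0)"] conjI ballI setdist_le_dist) auto
  qed (auto intro: exI[of _ 1])
  have sepV: "\<exists>s>0. \<forall>x\<in>V. \<forall>y\<in>H-E0. s \<le> dist x y"
  proof (cases "E0 = H")
    case False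
    then have "setdist V (H - E0) > 0" using V(3) by simp
    then show ?thesis by (intro exI[of _ "setdist V (H - E0)"] conjI ballI setdist_le_dist) auto
  qed (auto intro: exI[of _ 1])
  obtain s where s: "s > 0" "\<And>x y. x \<in> E0 \<Longrightarrow> y \<in> H - E0 \<Longrightarrow> s \<le> dist x y" using sep by blast
  obtain sV where sV: "sV > 0" "\<And>x y. x \<in> V \<Longrightarrow> y \<in> H - E0 \<Longrightarrow> sV \<le> dist x y" using sepV by blast
  define O' where "O' = - (H - E0)"
  have "closed (H - E0)"
    unfolding closed_limpt
  proof (intro allI impI)
    fix x assume "x islimpt (H - E0)"
    then have xl: "x \<in> closure (H - E0)" by (simp add: closure_def)
    then have "x \<in> H" using closed_H closure_minimal[of "H - E0" H] by auto
    moreover have "x \<notin> E0"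
    proof
      assume x: "x \<in> E0"
      obtain y where "y \<in> H - E0" "dist y x < s" using xl s(1) by (meson closure_approachable)
      then show False using s(2)[OF x, of y] by (simp add: dist_commute)
    qed
    ultimately show "x \<in> H - E0" by simp
  qed
  then have oO: "open O'" unfolding O'_def by (rule open_Compl)
  have VO: "V \<subseteq> O'"
  proof
    fix x assume x: "x \<in> V"
    show "x \<in> O'" using sV(2)[OF x, of x] sV(1) by (auto simp: O'_def)
  qed
  have intE0: "w \<in> interior E0" if w: "w \<in> O'" "w \<notin> closure Out" for w
  proof -
    have "open (O' - closure Out)" using oO by (intro open_Diff) auto
    moreover have "O' - closure Out \<subseteq> E0" using closure_subset[of Out] by (auto simp: O'_def H_eq)
    ultimately show ?thesis using w interior_maximal by blast
  qed
  have van: "vanish Y" if Y: "compact Y" "Y \<subseteq> O'" for Y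
  proof (rule vanish_of_local[OF Y(1) oO Y(2)])
    fix w assume w: "w \<in> O'" "w \<notin> closure Out"
    have wi: "w \<in> interior E0" by (rule intE0[OF w])
    define C where "C = connected_component_set (interior E0) w"
    have C: "C \<in> components (interior E0)" using wi by (auto simp: C_def components_def)
    then obtain z0 where z0: "z0 \<in> frontier C" "ncs_point C z0" using ncs wi by auto
    have oC: "open C" using C by (rule open_components[OF open_interior])
    have CE: "C \<subseteq> interior E0" using C by (rule in_components_subset)
    have CH: "C \<subseteq> H" using CE interior_subset E0 by blast
    have wC: "w \<in> C" using wi by (simp add: C_def connected_component_refl)
    have cC: "connected C" by (rule in_components_connected[OF C])
    \<comment> \<open>A boundary point of the component outside the closure of the outer domain would be interior
      to \<open>E0\<close>, hence belong to the open component.\<close>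
    have "z0 \<in> closure Out"
    proof (rule ccontr)
      assume no: "z0 \<notin> closure Out"
      have zc: "z0 \<in> closure C" using z0(1) by (simp add: frontier_def)
      have "closure C \<subseteq> E0" using CE interior_subset E0(1) by (meson closure_minimal order_trans)
      then have "z0 \<in> E0" using zc by blast
      then have "z0 \<in> interior E0" using intE0[OF _ no] by (simp add: O'_def)
      then obtain t where t: "t > 0" "ball z0 t \<subseteq> interior E0" using open_interior openE by blast
      obtain y where y: "y \<in> C" "dist y z0 < t" using zc t(1) by (meson closure_approachable)
      have "ball z0 t \<subseteq> C"
        by (rule components_maximal[OF C connected_ball t(2)]) (use y in \<open>auto simp: dist_commute\<close>)
      then have "z0 \<in> C" using t by auto
      then show False using z0(1) oC by (simp add: frontier_def interior_open)
    qed
    then show "\<exists>r>0. vanish (ball w r)" by (rule ncs_vanish[OF oC cC CH z0(2) _ wC])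
  qed
  obtain \<delta>0 where \<delta>0: "\<delta>0 > 0" "\<And>x y. x \<in> E0 \<Longrightarrow> y \<notin> V \<Longrightarrow> \<delta>0 \<le> dist x y"
  proof -
    have "\<exists>d>0. \<forall>x\<in>E0. \<forall>y\<in>-V. d \<le> dist x y"
      using V by (intro separate_compact_closed cE0) (auto simp: closed_Compl)
    then show thesis using that by blast
  qed
  define \<delta> where "\<delta> = \<delta>0 / 4"
  have \<delta>: "\<delta> > 0" using \<delta>0 by (simp add: \<delta>_def)
  have inV: "z \<in> V" if "infdist z E0 \<le> 2 * \<delta>" for z
  proof -
    obtain x where x: "x \<in> E0" "infdist z E0 = dist z x" using infdist_attains_inf[OF E0(1,3)] by blast
    then have "dist x z < \<delta>0" using that \<delta>0(1) by (simp add: \<delta>_def dist_commute)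
    then show ?thesis using \<delta>0(2)[OF x(1), of z] by (cases "z \<in> V") auto
  qed
  \<comment> \<open>equal to 1 within distance \<open>\<delta>\<close> of \<open>E0\<close>, and 0 beyond distance \<open>2 \<delta>\<close>\<close>
  define cut where "cut = (\<lambda>z. max 0 (min 1 (2 - infdist z E0 / \<delta>)))"
  have cut_cont: "continuous_on UNIV cut" unfolding cut_def using \<delta> by (intro continuous_intros) auto
  have cut01: "0 \<le> cut z" "cut z \<le> 1" for z by (auto simp: cut_def)
  have cut1: "cut z = 1" if "infdist z E0 \<le> \<delta>" for z using that \<delta> by (simp add: cut_def field_simps)
  have cut0: "cut z = 0" if "2 * \<delta> \<le> infdist z E0" for z using that \<delta> by (simp add: cut_def field_simps)
  define \<delta>' where "\<delta>' = min \<delta> sV"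
  have \<delta>': "\<delta>' > 0" using \<delta> sV by (simp add: \<delta>'_def)
  have Hne: "H \<noteq> {}" using E0 by auto
  \<comment> \<open>points of \<open>V\<close> away from \<open>E0\<close> are away from the whole hull, by the gap between \<open>V\<close> and \<open>H - E0\<close>\<close>
  have away: "\<delta>' \<le> infdist z H" if z: "z \<in> V" "\<delta> < infdist z E0" for z
  proof -
    obtain y where y: "y \<in> H" "infdist z H = dist z y" using infdist_attains_inf[OF closed_H Hne] by blast
    show ?thesis
    proof (cases "y \<in> E0")
      case True
      then show ?thesis using z(2) infdist_le[OF True, of z] y by (simp add: \<delta>'_def)
    next
      case False
      then show ?thesis using sV(2)[OF z(1), of y] y by (simp add: \<delta>'_def)
    qed
  qed
  show ?thesis
    unfolding weak_star_conv_def
  proof (intro allI impI)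
    fix f :: "complex \<Rightarrow> real"
    assume cf: "continuous_on UNIV f" and supp: "compact (closure {z. f z \<noteq> 0})"
    define X0 where "X0 = closure {z. f z \<noteq> 0}"
    have X0: "compact X0" "\<And>z. z \<notin> X0 \<Longrightarrow> f z = 0"
      using supp closure_subset[of "{z. f z \<noteq> 0}"] by (auto simp: X0_def)
    have [measurable]: "f \<in> borel_measurable borel" by (rule borel_measurable_continuous_onI[OF cf])
    have [measurable]: "V \<in> sets borel" "E0 \<in> sets borel" using V E0 by auto
    obtain Bf where Bf: "Bf \<ge> 0" "\<And>z. \<bar>f z\<bar> \<le> Bf"
    proof -
      have "compact (f ` X0)" by (intro compact_continuous_image X0 continuous_on_subset[OF cf]) auto
      then have "bounded (f ` X0)" by (rule compact_imp_bounded)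
      then obtain b where b: "\<And>z. z \<in> X0 \<Longrightarrow> \<bar>f z\<bar> \<le> b" unfolding bounded_iff real_norm_def by blast
      have "\<bar>f z\<bar> \<le> max 0 b" for z using b[of z] X0(2)[of z] by (cases "z \<in> X0") auto
      then show thesis by (intro that[of "max 0 b"]) auto
    qed
    define f' where "f' = (\<lambda>z. f z * cut z)"
    define X where "X = X0 \<inter> {z. infdist z E0 \<le> 2 * \<delta>}"
    have "closed {z. infdist z E0 \<le> 2 * \<delta>}" by (intro closed_Collect_le continuous_intros)
    then have cX: "compact X" unfolding X_def using X0(1) by (simp add: compact_Int_closed)
    have XO: "X \<subseteq> O'" using inV VO by (auto simp: X_def)
    have f'X: "f' z = 0" if "z \<notin> X" for z using that X0(2)[of z] cut0[of z] by (auto simp: X_def f'_def)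
    have cf': "continuous_on UNIV f'" unfolding f'_def by (intro continuous_intros cf cut_cont)
    have lim1: "(\<lambda>k. \<Sum>x\<in>P.zeros k. P.wt k x * f' x) \<longlonglongrightarrow> (\<integral> t. f' t \<partial>M)"
      by (rule zeros_converge_where_vanish[OF cf' cX f'X oO XO van])
    have lim2: "(\<lambda>k. \<Sum>x\<in>P.zeros k. P.wt k x * (indicator V x * f x - f' x)) \<longlonglongrightarrow> 0"
    proof (rule Lim_null_comparison)
      show "\<forall>\<^sub>F k in sequentially. norm (\<Sum>x\<in>P.zeros k. P.wt k x * (indicator V x * f x - f' x))
          \<le> Bf * (\<Sum>x\<in>P.zeros k. P.wt k x * indicat_real {z. \<delta>' \<le> infdist z H} x)"
      proof (intro always_eventually allI)
        fix k
        have bnd: "\<bar>indicator V x * f x - f' x\<bar> \<le> Bf * indicat_real {z. \<delta>' \<le> infdist z H} x" for x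
        proof (cases "infdist x E0 \<le> \<delta>")
          case True
          then have "x \<in> V" using inV[of x] \<delta> by simp
          then show ?thesis using cut1[OF True] Bf(1) by (simp add: f'_def)
        next
          case False
          show ?thesis
          proof (cases "x \<in> V")
            case True
            have "\<bar>indicator V x * f x - f' x\<bar> = \<bar>f x\<bar> * (1 - cut x)"
              using True cut01[of x] by (simp add: f'_def abs_mult[symmetric] right_diff_distrib[symmetric])
                 (metis abs_of_nonneg abs_mult diff_ge_0_iff_ge mult.right_neutral right_diff_distrib)
            also have "\<dots> \<le> Bf * 1" using Bf(2)[of x] cut01[of x] by (intro mult_mono) auto
            finally show ?thesis using away[OF True] False by simp
          next
            case nV: False
            then have "2 * \<delta> \<le> infdist x E0" using inV[of x] by linarith
            then show ?thesis using nV cut0[of x] Bf(1) by (simp add: f'_def)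
          qed
        qed
        have "\<bar>\<Sum>x\<in>P.zeros k. P.wt k x * (indicator V x * f x - f' x)\<bar>
            \<le> (\<Sum>x\<in>P.zeros k. \<bar>P.wt k x * (indicator V x * f x - f' x)\<bar>)" by (rule sum_abs)
        also have "\<dots> \<le> (\<Sum>x\<in>P.zeros k. P.wt k x * (Bf * indicat_real {z. \<delta>' \<le> infdist z H} x))"
        proof (intro sum_mono)
          show "\<bar>P.wt k x * (indicator V x * f x - f' x)\<bar> \<le> P.wt k x * (Bf * indicat_real {z. \<delta>' \<le> infdist z H} x)" for x
            unfolding abs_mult[of "P.wt k x"] abs_of_nonneg[OF P.wt_nonneg] by (intro mult_left_mono bnd P.wt_nonneg)
        qed
        also have "\<dots> = Bf * (\<Sum>x\<in>P.zeros k. P.wt k x * indicat_real {z. \<delta>' \<le> infdist z H} x)"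
          by (simp add: sum_distrib_left mult_ac)
        finally show "norm (\<Sum>x\<in>P.zeros k. P.wt k x * (indicator V x * f x - f' x))
          \<le> Bf * (\<Sum>x\<in>P.zeros k. P.wt k x * indicat_real {z. \<delta>' \<le> infdist z H} x)" by simp
      qed
      have "(\<lambda>k. Bf * (\<Sum>x\<in>P.zeros k. P.wt k x * indicat_real {z. \<delta>' \<le> infdist z H} x)) \<longlonglongrightarrow> Bf * 0"
        by (intro tendsto_intros zeros_away_from_hull \<delta>')
      then show "(\<lambda>k. Bf * (\<Sum>x\<in>P.zeros k. P.wt k x * indicat_real {z. \<delta>' \<le> infdist z H} x)) \<longlonglongrightarrow> 0" by simp
    qed
    have lhs: "integral\<^sup>L (measure_restriction (zero_measure (p k)) V) f
        = (\<Sum>x\<in>P.zeros k. P.wt k x * f' x) + (\<Sum>x\<in>P.zeros k. P.wt k x * (indicator V x * f x - f' x))" for k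
      by (simp add: P.integral_zero_measure right_diff_distrib sum_subtractf)
    have rhs: "integral\<^sup>L (measure_restriction M E0) f = (\<integral> t. f' t \<partial>M)"
    proof -
      have "integral\<^sup>L (measure_restriction M E0) f = (\<integral> t. indicator E0 t *\<^sub>R f t \<partial>M)"
        unfolding measure_restriction_def ennreal_indicator[symmetric] by (rule integral_density) auto
      also have "\<dots> = (\<integral> t. f' t \<partial>M)"
      proof (rule integral_cong_AE)
        show "AE t in M. indicator E0 t *\<^sub>R f t = f' t"
          using AE_K
        proof eventually_elim
          fix t assume "t \<in> E"
          then have tH: "t \<in> H" using E_sub_H by auto
          show "indicator E0 t *\<^sub>R f t = f' t"
          proof (cases "t \<in> E0")
            case True
            then show ?thesis using cut1[of t] \<delta> by (simp add: f'_def)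
          next
            case False
            have "t \<notin> V" using VO tH False by (auto simp: O'_def)
            then have "2 * \<delta> \<le> infdist t E0" using inV[of t] by linarith
            then show ?thesis using False cut0[of t] by (simp add: f'_def)
          qed
        qed
        have "f' \<in> borel_measurable borel" by (rule borel_measurable_continuous_onI[OF cf'])
        then show "f' \<in> borel_measurable M" by measurable
      qed measurable
      finally show ?thesis .
    qed
    show "(\<lambda>k. integral\<^sup>L (measure_restriction (zero_measure (p k)) V) f) \<longlonglongrightarrow> integral\<^sup>L (measure_restriction M E0) f"
      unfolding lhs rhs using tendsto_add[OF lim1 lim2] by simp
  qed
qed

end

section \<open>The equilibrium measure and the theorem\<close>

lemma robin_constant_equilibrium:
  assumes "is_equilibrium_measure E \<mu>" shows "robin_constant E = log_energy \<mu>"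
  unfolding robin_constant_def
  using assms by (intro antisym INF_lower INF_greatest) (auto simp: is_equilibrium_measure_def)

lemma log_capacity_empty: "log_capacity {} = 0"
proof -
  have "prob_measures_on {} = {}" by (auto simp: prob_measures_on_def)
  then show ?thesis by (simp add: log_capacity_def robin_constant_def top_ereal_def)
qed

lemma equilibrium_finite_energy:
  assumes E: "compact E" "log_capacity E > 0" and eq: "is_equilibrium_measure E \<mu>"
    and R: "R \<ge> 1" "E \<subseteq> ball 0 (R/2)"
  obtains W where "W \<ge> 0" "energy R \<mu> = ennreal W" "log_capacity E = exp (- (W - ln R))"
    "\<And>T. T \<in> prob_measures_on E \<Longrightarrow> energy R \<mu> \<le> energy R T"
proof -
  have le: "log_energy T = enn2ereal (energy R T) - ereal (ln R)" if "T \<in> prob_measures_on E" for T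
    by (rule compact_prob.log_energy_eq[OF prob_measures_onD[OF that E(1)] R])
  have mu: "\<mu> \<in> prob_measures_on E" using eq by (simp add: is_equilibrium_measure_def)
  have ninf: "robin_constant E \<noteq> \<infinity>" using E(2) by (auto simp: log_capacity_def)
  have fin: "energy R \<mu> \<noteq> \<top>"
  proof
    assume "energy R \<mu> = \<top>"
    then have "log_energy \<mu> = \<infinity>" using le[OF mu] by simp
    then show False using ninf robin_constant_equilibrium[OF eq] by simp
  qed
  then obtain W where W: "energy R \<mu> = ennreal W" "W \<ge> 0" by (cases "energy R \<mu>") auto
  have lm: "log_energy \<mu> = ereal (W - ln R)" using le[OF mu] W by simp
  have cap: "log_capacity E = exp (- (W - ln R))"
    using ninf by (simp add: log_capacity_def robin_constant_equilibrium[OF eq] lm)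
  have min: "energy R \<mu> \<le> energy R T" if T: "T \<in> prob_measures_on E" for T
  proof (cases "energy R T")
    case (real r)
    have "log_energy \<mu> \<le> log_energy T" using eq T by (simp add: is_equilibrium_measure_def)
    then have "W \<le> r" using lm le[OF T] real by simp
    then show ?thesis using W real by (simp add: ennreal_leI)
  qed simp
  show thesis by (rule that[OF W(2,1) cap min])
qed

context frostman_measure begin

lemma eps_tendsto_0:
  fixes N :: "nat \<Rightarrow> nat" and P :: "nat \<Rightarrow> complex poly"
  assumes ae: "asymptotically_extremal E N P" and cap: "log_capacity E = exp (- rob)"
  shows "(\<lambda>k. frostman_poly.eps E rob (P (N k))) \<longlonglongrightarrow> 0"
proof (rule tendstoI)
  fix \<eta> :: real assume \<eta>: "\<eta> > 0"
  have "limsup (\<lambda>k. ereal (root (N k) (SUP z\<in>E. cmod (poly (P (N k)) z)))) \<le> ereal (exp (- rob))"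
    using ae cap by (simp add: asymptotically_extremal_def)
  also have "\<dots> < ereal (exp (- rob + \<eta>))" using \<eta> by simp
  finally have "\<forall>\<^sub>F k in sequentially. ereal (root (N k) (SUP z\<in>E. cmod (poly (P (N k)) z))) < ereal (exp (- rob + \<eta>))"
    by (rule Limsup_lessD)
  then show "\<forall>\<^sub>F k in sequentially. dist (frostman_poly.eps E rob (P (N k))) 0 < \<eta>"
  proof eventually_elim
    fix k
    assume less: "ereal (root (N k) (SUP z\<in>E. cmod (poly (P (N k)) z))) < ereal (exp (- rob + \<eta>))"
    have N: "N k > 0" "degree (P (N k)) = N k" "lead_coeff (P (N k)) = 1"
      using ae unfolding asymptotically_extremal_def by blast+
    interpret q: frostman_poly M E rob "P (N k)"
      using N(1,3) by unfold_locales (simp_all only: N(2))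
    have "root (N k) q.nrm < exp (- rob + \<eta>)" using less by (simp add: q.nrm_def)
    then have "ln (root (N k) q.nrm) < ln (exp (- rob + \<eta>))"
      using q.nrm_pos N by (subst ln_less_cancel_iff) auto
    then have "q.eps < \<eta>" using q.nrm_pos N by (simp add: q.eps_def ln_root)
    then show "dist q.eps 0 < \<eta>" using q.eps_nonneg by simp
  qed
qed

text \<open>
  The equilibrium measure of \<open>E\<close> also minimizes the energy on the hull: a measure on \<open>H\<close> whose
  potential is bounded by \<open>c - ln R\<close> forces \<open>eps \<ge> rob - (c - ln R)\<close> for every polynomial, and
  \<open>eps\<close> tends to 0.
\<close>

lemma hull_energy_minimal:
  fixes p :: "nat \<Rightarrow> complex poly"
  assumes mp: "\<And>k. monic_poly (p k)" and lim: "(\<lambda>k. frostman_poly.eps E rob (p k)) \<longlonglongrightarrow> 0"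
    and R: "R > 0" "H \<subseteq> ball 0 (R/2)" and W: "W \<ge> 0" "rob = W - ln R"
    and T: "T \<in> prob_measures_on H"
  shows "ennreal W \<le> energy R T"
proof (rule energy_lower_bound[OF compact_H R W(1) _ T])
  fix L K and c :: real
  assume L: "compact_prob L K" "K \<subseteq> H" "\<And>z. integrable L (\<lambda>t. ln (cmod (z - t)))"
    "\<And>z. AE t in L. t \<noteq> z" "\<And>z. pot L z \<le> c - ln R"
  have "- (c - ln R) + rob \<le> frostman_poly.eps E rob (p k)" for k
  proof -
    interpret q: frostman_poly M E rob "p k"
      using mp[of k] by (simp add: frostman_poly_def frostman_measure_axioms)
    show ?thesis using q.nrm_lower(1)[OF L] by (simp add: q.eps_def)
  qed
  then have "- (c - ln R) + rob \<le> 0"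
    by (intro tendsto_lowerbound[OF lim]) auto
  then show "W \<le> c" using W by simp
qed

end

theorem theorem2p1:
  fixes E E0 V :: "complex set" and \<mu> :: "complex measure"
    and N :: "nat \<Rightarrow> nat" and P :: "nat \<Rightarrow> complex poly"
  assumes "compact E" and "log_capacity E > 0"
    and "is_equilibrium_measure E \<mu>"
    and "closed E0" and "E0 \<subseteq> poly_convex_hull E"
    and "log_capacity E0 > 0"
    and "E0 = poly_convex_hull E \<or> setdist E0 (poly_convex_hull E - E0) > 0"
    and "interior E0 = {} \<or>
         (\<forall>C \<in> components (interior E0). \<exists>z0 \<in> frontier C. ncs_point C z0)"
    and "open V" and "E0 \<subseteq> V"
    and "E0 \<noteq> poly_convex_hull E \<longrightarrow> setdist V (poly_convex_hull E - E0) > 0"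
    and "asymptotically_extremal E N P"
  shows "weak_star_conv (\<lambda>k. measure_restriction (zero_measure (P (N k))) V)
           (measure_restriction \<mu> E0)"
proof -
  have mu: "\<mu> \<in> prob_measures_on E" using assms(3) by (simp add: is_equilibrium_measure_def)
  have "bounded (poly_convex_hull E)"
    unfolding poly_convex_hull_def by (intro cobounded_outside compact_imp_bounded assms(1))
  then obtain r where r: "r > 0" "poly_convex_hull E \<subseteq> ball 0 r" using bounded_subset_ballD by blast
  define R where "R = max 1 (2 * r)"
  have R: "R \<ge> 1" "R > 0" "poly_convex_hull E \<subseteq> ball 0 (R/2)"
    using r(2) by (auto simp: R_def subset_iff less_max_iff_disj field_simps dest!: r(2)[THEN subsetD])
  have "E \<subseteq> poly_convex_hull E" unfolding poly_convex_hull_def using outside_no_overlap[of E] by blast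
  then have RE: "E \<subseteq> ball 0 (R/2)" using R(3) by (rule order_trans)
  obtain W where W: "W \<ge> 0" "energy R \<mu> = ennreal W" "log_capacity E = exp (- (W - ln R))"
    and min: "\<And>T. T \<in> prob_measures_on E \<Longrightarrow> energy R \<mu> \<le> energy R T"
    by (rule equilibrium_finite_energy[OF assms(1-3) R(1) RE]) (rule that, assumption+)
  interpret compact_prob \<mu> E by (rule prob_measures_onD[OF mu assms(1)])
  have fu: "integrable \<mu> (\<lambda>t. ln (cmod (z - t)))" "AE t in \<mu>. t \<noteq> z" "pot \<mu> z \<le> W - ln R" for z
    by (rule frostman_upper[OF mu assms(1) R(2) RE _ W(2,1)]; rule min; assumption)+
  interpret frostman_measure \<mu> E "W - ln R"
    by unfold_locales (rule fu)+
  have mp: "monic_poly (P (N k))" for k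
  proof
    show "lead_coeff (P (N k)) = 1" "degree (P (N k)) > 0"
      using assms(12) unfolding asymptotically_extremal_def by (blast, metis)
  qed
  have lim: "(\<lambda>k. frostman_poly.eps E (W - ln R) (P (N k))) \<longlonglongrightarrow> 0"
    by (rule eps_tendsto_0[OF assms(12) W(3)])
  have RH: "H \<subseteq> ball 0 (R/2)" using R(3) by (simp add: H_def)
  have muH: "\<mu> \<in> prob_measures_on H"
  proof -
    have "emeasure \<mu> E \<le> emeasure \<mu> H"
      using E_sub_H compact_H setsM by (intro emeasure_mono) (auto simp: compact_imp_closed)
    then have "emeasure \<mu> H = 1" using M_K emeasure_le_1[of H] by simp
    then show ?thesis using setsM prob_space_axioms by (simp add: prob_measures_on_def)
  qed
  have "AE z in lborel. z \<in> H \<longrightarrow> pot \<mu> z = W - ln R"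
  proof (rule frostman_ae[OF muH compact_H R(1) RH _ W(2,1)])
    show "energy R \<mu> \<le> energy R T" if "T \<in> prob_measures_on H" for T
      unfolding W(2) by (rule hull_energy_minimal[OF mp lim R(2) RH W(1) refl that])
  qed
  then interpret frostman_seq \<mu> E "W - ln R" "\<lambda>k. P (N k)"
    by unfold_locales (use mp lim in \<open>auto simp: monic_poly_def\<close>)
  have "E0 \<noteq> {}" using assms(6) log_capacity_empty by auto
  then show ?thesis
    using assms(4,5,7-11) unfolding H_def[symmetric] by (intro zeros_weak_star) auto
qed

end
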